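(* Let $G=(V,E)$ be a connected, locally finite, transitive graph with $\nabla_{p_c}<\infty$. For each $\ell\geq 2$ there exists a finite constant $K(\ell)$ such that $$\mathbf P_{p_c}\bigl(K_{v_1},\ldots,K_{v_\ell}\text{ are disjoint and } |K_{v_i}|\geq n_i\text{ for every }1\leq i\leq\ell\bigr)\asymp_\ell\prod_{i=1}^\ell n_i^{-1/2}$$ for every $n_1,\ldots,n_\ell\geq 1$ and every $v_1,v_2,\ldots,v_\ell\in V$ such that $d(v_i,v_j)\geq K(\ell)$ for every $1\leq i<j\leq\ell$.
   Context: $G$ is transitive if $\operatorname{Aut}(G)$ acts transitively on $V$. $d$ is the graph distance on $G$. Bernoulli-$p$ bond percolation on $G$: each edge is independently open with probability $p$ and closed otherwise; $G[p]$ is the subgraph of open edges, its connected components are called clusters, its law is $\mathbf P_p$, $K_v$ is the cluster of $v$ and $|K_v|$ its number of vertices; $u\leftrightarrow v$ means $u,v$ are in the same cluster. $p_c=p_c(G)=\inf\{p\in[0,1]: G[p]\text{ has an infinite cluster a.s.}\}$. $\nabla_p=\nabla_p(v)=\sum_{u,w\in V}\mathbf P_p(v\leftrightarrow u)\mathbf P_p(u\leftrightarrow w)\mathbf P_p(w\leftrightarrow v)$, which does not depend on $v$ by transitivity. $A\asymp_\ell B$ means $c_\ell B\le A\le C_\ell B$ for constants $0<c_\ell\le C_\ell<\infty$ that may depend on $\ell$ (and the graph $G$) but not on the other parameters ($n_1,\dots,n_\ell$, $v_1,\dots,v_\ell$). *)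

theory Defs
  imports "HOL-Probability.Probability" "HOL-Library.Extended_Nat"
begin

definition simple_graph :: "'a set \<Rightarrow> 'a set set \<Rightarrow> bool" where
  "simple_graph V E \<longleftrightarrow> (\<forall>e\<in>E. e \<subseteq> V \<and> card e = 2)"

definition adj :: "'a set set \<Rightarrow> ('a \<times> 'a) set" where
  "adj E = {(u, v). {u, v} \<in> E}"

definition connected_graph :: "'a set \<Rightarrow> 'a set set \<Rightarrow> bool" where
  "connected_graph V E \<longleftrightarrow> (\<forall>u\<in>V. \<forall>v\<in>V. (u, v) \<in> (adj E)\<^sup>*)"

definition locally_finite_graph :: "'a set \<Rightarrow> 'a set set \<Rightarrow> bool" where
  "locally_finite_graph V E \<longleftrightarrow> (\<forall>v\<in>V. finite {e \<in> E. v \<in> e})"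

definition graph_aut :: "'a set \<Rightarrow> 'a set set \<Rightarrow> ('a \<Rightarrow> 'a) set" where
  "graph_aut V E =
     {f. bij_betw f V V \<and> (\<forall>u\<in>V. \<forall>v\<in>V. {u, v} \<in> E \<longleftrightarrow> {f u, f v} \<in> E)}"

definition transitive_graph :: "'a set \<Rightarrow> 'a set set \<Rightarrow> bool" where
  "transitive_graph V E \<longleftrightarrow> (\<forall>u\<in>V. \<forall>v\<in>V. \<exists>f\<in>graph_aut V E. f u = v)"

(* Meaningful only when some path joins u and v, as is always the case in a connected graph. *)
definition graph_dist :: "'a set set \<Rightarrow> 'a \<Rightarrow> 'a \<Rightarrow> nat" where
  "graph_dist E u v = (LEAST n. (u, v) \<in> adj E ^^ n)"

definition percolation :: "'a set set \<Rightarrow> real \<Rightarrow> ('a set \<Rightarrow> bool) measure" where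
  "percolation E p = (\<Pi>\<^sub>M e\<in>E. measure_pmf (bernoulli_pmf p))"

definition open_edges :: "'a set set \<Rightarrow> ('a set \<Rightarrow> bool) \<Rightarrow> 'a set set" where
  "open_edges E \<omega> = {e \<in> E. \<omega> e}"

definition cluster :: "'a set set \<Rightarrow> ('a set \<Rightarrow> bool) \<Rightarrow> 'a \<Rightarrow> 'a set" where
  "cluster E \<omega> v = {u. (v, u) \<in> (adj (open_edges E \<omega>))\<^sup>*}"

(* The cardinality is infinity, not 0, on an infinite cluster. *)
definition cluster_size :: "'a set set \<Rightarrow> ('a set \<Rightarrow> bool) \<Rightarrow> 'a \<Rightarrow> enat" where
  "cluster_size E \<omega> v =
     (if finite (cluster E \<omega> v) then enat (card (cluster E \<omega> v)) else \<infinity>)"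

definition conn_prob :: "'a set set \<Rightarrow> real \<Rightarrow> 'a \<Rightarrow> 'a \<Rightarrow> real" where
  "conn_prob E p u v =
     measure (percolation E p) {\<omega> \<in> space (percolation E p). u \<in> cluster E \<omega> v}"

(* For an infinite connected graph the set contains 1, so this is a genuine infimum.
   For a finite graph the set is empty and the value is unspecified. *)
definition p_crit :: "'a set \<Rightarrow> 'a set set \<Rightarrow> real" where
  "p_crit V E =
     Inf {p \<in> {0..1}. AE \<omega> in percolation E p. \<exists>v\<in>V. infinite (cluster E \<omega> v)}"

definition nabla :: "'a set \<Rightarrow> 'a set set \<Rightarrow> real \<Rightarrow> 'a \<Rightarrow> ennreal" where
  "nabla V E p v =
     (\<Sum>\<^sub>\<infinity>(u, w)\<in>V \<times> V.
        ennreal (conn_prob E p v u * conn_prob E p u w * conn_prob E p w v))"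

end

theory Submission
  imports Defs
begin

text \<open>Colour every vertex green independently with probability \<open>q\<close>; let \<open>M(q)\<close> be the probability that
  the cluster of a vertex contains a green vertex and \<open>\<chi>(q)\<close> the expected size of the cluster on the
  event that it contains none. The critical tail exponent follows once \<open>M(q)\<close> is of order \<open>q^(1/2)\<close>.

  Upper bound. Explore the green-free cluster of \<open>v\<close> and let a path from one of its vertices \<open>x\<close> to a
  green vertex leave it for the last time at \<open>s\<close>. The triangle condition makes the contribution of
  \<open>s\<close> far from \<open>x\<close> negligible, so \<open>M \<chi>\<close> is controlled by the expected number of places at which a
  green cluster comes close to that of \<open>v\<close>. Repeating the argument at such a place gives
  \<open>M\<^sup>2 \<chi>\<close> in terms of places where two distinct green clusters come close to the
  cluster of \<open>v\<close>. Opening all edges nearby turns such a place into a branch point between \<open>v\<close> and the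
  green vertices beyond which nothing else is green; there is essentially at most one, and it forces the
  cluster of \<open>v\<close> to be green. Hence \<open>M\<^sup>2 \<chi> \<le> C M\<close>, so
  \<open>M(2q)\<^sup>2 - M(q)\<^sup>2 \<le> C q\<close>, and \<open>M(q) \<le> C q^(1/2)\<close>.

  Lower bound. In a finite graph whose largest susceptibility is \<open>m\<close>, the tree graph inequality bounds
  the second moment of a cluster size by \<open>m\<^sup>3\<close>, and with the upper bound on the tail the second moment
  method yields the lower bound at sizes of order \<open>m\<^sup>2\<close>. At criticality \<open>m\<close> is unbounded as
  the graph grows, and one extra edge multiplies it by at most 3, so all scales are reached.

  Several clusters. The upper bound is the BK inequality. For the lower bound the clusters are explored
  one after another; the price of keeping them disjoint is an open triangle between far away vertices,
  which is small because the two-point function is positive semidefinite.\<close>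

section \<open>Bernoulli configurations on finite sets\<close>

text \<open>Every estimate is made for a finite edge set \<open>F\<close>, where expectations are
  finite sums, with constants independent of \<open>F\<close>; suprema and limits carry it to the
  graph. A finite \<open>F\<close> has no symmetry, so the infinite-volume value \<open>magn\<close>
  serves as an upper bound at every vertex, and \<open>F\<close> is taken so large that all vertices
  of a fixed finite window nearly attain it.

  Summed over \<open>q / 2^j\<close>, the doubling inequality only bounds M(q)^2 by the limit of M(q
  / 2^j)^2 plus a multiple of \<open>q\<close>. That limit vanishes only if there is no infinite
  cluster. Below \<open>pc\<close> this takes an argument: \<open>p_crit\<close> is an infimum over
  those \<open>p\<close> that percolate almost surely, so percolation with positive probability has
  to be upgraded to almost sure percolation. At \<open>pc\<close> it is not known beforehand. Hence
  the bound is shown for \<open>p < pc\<close> and carried to \<open>pc\<close> by continuity in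
  \<open>p\<close> for fixed \<open>F\<close>. This requires constants uniform in \<open>p\<close>:
  triangle tails are monotone in \<open>p\<close>, and opening a ball costs a power of
  \<open>p\<close>, which is harmless for \<open>p \<ge> pc / 2\<close> because
  \<open>pc > 0\<close>.\<close>

definition bern_weight :: "'c set \<Rightarrow> ('c \<Rightarrow> real) \<Rightarrow> 'c set \<Rightarrow> real" where
  "bern_weight F r \<omega> = (\<Prod>c\<in>F. if c \<in> \<omega> then r c else 1 - r c)"

text \<open>Random variables are functions on all sets of coordinates, not only on subsets of
  \<open>F\<close>, so that one \<open>X\<close> can be evaluated in different volumes.\<close>

definition fexp :: "'c set \<Rightarrow> ('c \<Rightarrow> real) \<Rightarrow> ('c set \<Rightarrow> real) \<Rightarrow> real" where
  "fexp F r X = (\<Sum>\<omega>\<in>Pow F. bern_weight F r \<omega> * X \<omega>)"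

definition fprob :: "'c set \<Rightarrow> ('c \<Rightarrow> real) \<Rightarrow> ('c set \<Rightarrow> bool) \<Rightarrow> real" where
  "fprob F r A = fexp F r (\<lambda>\<omega>. of_bool (A \<omega>))"

definition probs :: "('c \<Rightarrow> real) \<Rightarrow> bool" where
  "probs r \<longleftrightarrow> (\<forall>c. 0 \<le> r c \<and> r c \<le> 1)"

lemma fexp_empty [simp]: "fexp {} r X = X {}"
  by (simp add: fexp_def bern_weight_def)

text \<open>Conditioning on one coordinate; this is the recursion behind the inductions over
  \<open>F\<close>.\<close>

lemma fexp_insert:
  assumes "finite F" "c \<notin> F"
  shows "fexp (insert c F) r X = r c * fexp F r (\<lambda>\<omega>. X (insert c \<omega>)) + (1 - r c) * fexp F r X"
proof -
  have w1: "bern_weight (insert c F) r (insert c \<omega>) = r c * bern_weight F r \<omega>" if "\<omega> \<subseteq> F" for \<omega>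
  proof -
    have "(\<Prod>d\<in>F. if d \<in> insert c \<omega> then r d else 1 - r d) = (\<Prod>d\<in>F. if d \<in> \<omega> then r d else 1 - r d)"
      using assms by (intro prod.cong) auto
    then show ?thesis using assms by (simp add: bern_weight_def)
  qed
  have w0: "bern_weight (insert c F) r \<omega> = (1 - r c) * bern_weight F r \<omega>" if "\<omega> \<subseteq> F" for \<omega>
    using assms that by (auto simp: bern_weight_def)
  have "fexp (insert c F) r X = (\<Sum>\<omega>\<in>Pow F. bern_weight (insert c F) r \<omega> * X \<omega>)
      + (\<Sum>\<omega>\<in>insert c ` Pow F. bern_weight (insert c F) r \<omega> * X \<omega>)"
    unfolding fexp_def Pow_insert using assms by (subst sum.union_disjoint) auto
  also have "(\<Sum>\<omega>\<in>insert c ` Pow F. bern_weight (insert c F) r \<omega> * X \<omega>)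
      = (\<Sum>\<omega>\<in>Pow F. bern_weight (insert c F) r (insert c \<omega>) * X (insert c \<omega>))"
  proof (subst sum.reindex)
    show "inj_on (insert c) (Pow F)"
      using assms by (auto simp: inj_on_def)
  qed simp
  finally show ?thesis
    using w0 w1 by (simp add: fexp_def sum_distrib_left mult.assoc)
qed

lemma fexp_const: "finite F \<Longrightarrow> fexp F r (\<lambda>_. k) = k"
  by (induction F rule: finite_induct) (auto simp: fexp_insert algebra_simps)

lemma fexp_add: "fexp F r (\<lambda>\<omega>. X \<omega> + Y \<omega>) = fexp F r X + fexp F r Y"
  by (simp add: fexp_def algebra_simps sum.distrib)

lemma fexp_diff: "fexp F r (\<lambda>\<omega>. X \<omega> - Y \<omega>) = fexp F r X - fexp F r Y"
  by (simp add: fexp_def algebra_simps sum_subtractf)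

lemma fexp_cmult: "fexp F r (\<lambda>\<omega>. k * X \<omega>) = k * fexp F r X"
  by (simp add: fexp_def sum_distrib_left mult.left_commute)

lemma fexp_cmult2: "fexp F r (\<lambda>\<omega>. X \<omega> * k) = fexp F r X * k"
  by (simp add: fexp_def sum_distrib_right mult.assoc)

lemma fexp_sum: "fexp F r (\<lambda>\<omega>. \<Sum>i\<in>I. X i \<omega>) = (\<Sum>i\<in>I. fexp F r (X i))"
  by (simp add: fexp_def sum_distrib_left) (rule sum.swap)

lemma bern_weight_nonneg: "probs r \<Longrightarrow> 0 \<le> bern_weight F r \<omega>"
  by (auto simp: bern_weight_def probs_def intro!: prod_nonneg)

lemma fexp_mono:
  assumes "probs r" "\<And>\<omega>. \<omega> \<subseteq> F \<Longrightarrow> X \<omega> \<le> Y \<omega>"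
  shows "fexp F r X \<le> fexp F r Y"
  unfolding fexp_def using assms by (intro sum_mono mult_left_mono bern_weight_nonneg) auto

lemma fexp_cong: "(\<And>\<omega>. \<omega> \<subseteq> F \<Longrightarrow> X \<omega> = Y \<omega>) \<Longrightarrow> fexp F r X = fexp F r Y"
  unfolding fexp_def by (intro sum.cong) auto

lemma fexp_nonneg: "probs r \<Longrightarrow> (\<And>\<omega>. \<omega> \<subseteq> F \<Longrightarrow> 0 \<le> X \<omega>) \<Longrightarrow> 0 \<le> fexp F r X"
  unfolding fexp_def by (intro sum_nonneg mult_nonneg_nonneg bern_weight_nonneg) auto

lemma fprob_mono:
  assumes "probs r" "\<And>\<omega>. \<omega> \<subseteq> F \<Longrightarrow> A \<omega> \<Longrightarrow> B \<omega>"
  shows "fprob F r A \<le> fprob F r B"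
  unfolding fprob_def using assms by (intro fexp_mono) auto

lemma fprob_cong: "(\<And>\<omega>. \<omega> \<subseteq> F \<Longrightarrow> A \<omega> = B \<omega>) \<Longrightarrow> fprob F r A = fprob F r B"
  unfolding fprob_def by (intro fexp_cong) auto

lemma fprob_nonneg: "probs r \<Longrightarrow> 0 \<le> fprob F r A"
  unfolding fprob_def by (intro fexp_nonneg) auto

lemma fprob_le_1: "finite F \<Longrightarrow> probs r \<Longrightarrow> fprob F r A \<le> 1"
  using fexp_mono[of r F "\<lambda>\<omega>. of_bool (A \<omega>)" "\<lambda>_. 1"] by (simp add: fprob_def fexp_const)

lemma fprob_True: "finite F \<Longrightarrow> fprob F r (\<lambda>_. True) = 1"
  by (simp add: fprob_def fexp_const)

lemma fprob_False [simp]: "fprob F r (\<lambda>_. False) = 0"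
  by (simp add: fprob_def fexp_def)

lemma fprob_union_bound:
  assumes "probs r" "finite I" "\<And>\<omega>. \<omega> \<subseteq> F \<Longrightarrow> A \<omega> \<Longrightarrow> \<exists>i\<in>I. B i \<omega>"
  shows "fprob F r A \<le> (\<Sum>i\<in>I. fprob F r (B i))"
proof -
  have "of_bool (A \<omega>) \<le> (\<Sum>i\<in>I. of_bool (B i \<omega>) :: real)" if sub: "\<omega> \<subseteq> F" for \<omega>
  proof (cases "A \<omega>")
    case True
    then obtain i where "i \<in> I" "B i \<omega>" using assms(3)[OF sub True] by blast
    then have "(1::real) \<le> (\<Sum>i\<in>{i}. of_bool (B i \<omega>))" by simp
    also have "\<dots> \<le> (\<Sum>i\<in>I. of_bool (B i \<omega>))"
      using assms(2) \<open>i \<in> I\<close> by (intro sum_mono2) auto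
    finally show ?thesis by simp
  qed (simp add: sum_nonneg)
  then show ?thesis
    unfolding fprob_def fexp_sum[symmetric] using assms(1) by (intro fexp_mono) auto
qed

lemma fprob_neg: "finite F \<Longrightarrow> fprob F r (\<lambda>\<omega>. \<not> A \<omega>) = 1 - fprob F r A"
  by (simp add: fprob_def of_bool_not_iff fexp_diff fexp_const)

text \<open>That \<open>X\<close> looks only inside \<open>Z\<close> and \<open>Y\<close> only
  outside is expressed through \<open>\<omega> \<inter> Z\<close> and \<open>\<omega> - Z\<close>. A
  new coordinate lies on one side, and the factor belonging to the other side does not change when
  it is switched on.\<close>

lemma fexp_indep:
  assumes "finite F" "\<And>\<omega>. X \<omega> = X (\<omega> \<inter> Z)" "\<And>\<omega>. Y \<omega> = Y (\<omega> - Z)"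
  shows "fexp F r (\<lambda>\<omega>. X \<omega> * Y \<omega>) = fexp F r X * fexp F r Y"
  using assms
proof (induction F arbitrary: X Y rule: finite_induct)
  case (insert c F)
  note IH = insert.IH and fi = fexp_insert[OF insert.hyps]
  show ?case
  proof (cases "c \<in> Z")
    case True
    have Y: "Y (insert c \<omega>) = Y \<omega>" for \<omega>
      by (rule trans[OF insert.prems(2) trans[OF _ insert.prems(2)[symmetric]]], rule arg_cong[of _ _ Y]) (use True in auto)
    have X: "X (insert c \<omega>) = X (insert c (\<omega> \<inter> Z))" for \<omega>
      by (rule trans[OF insert.prems(1) trans[OF _ insert.prems(1)[symmetric]]], rule arg_cong[of _ _ X]) (use True in auto)
    have "fexp F r (\<lambda>\<omega>. X (insert c \<omega>) * Y \<omega>) = fexp F r (\<lambda>\<omega>. X (insert c \<omega>)) * fexp F r Y"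
      by (rule IH[of "\<lambda>\<omega>. X (insert c \<omega>)"]) (fact X, fact insert.prems(2))
    then show ?thesis
      using IH[of X Y, OF insert.prems] by (simp add: fi Y algebra_simps)
  next
    case False
    have X: "X (insert c \<omega>) = X \<omega>" for \<omega>
      by (rule trans[OF insert.prems(1) trans[OF _ insert.prems(1)[symmetric]]], rule arg_cong[of _ _ X]) (use False in auto)
    have Y: "Y (insert c \<omega>) = Y (insert c (\<omega> - Z))" for \<omega>
      by (rule trans[OF insert.prems(2) trans[OF _ insert.prems(2)[symmetric]]], rule arg_cong[of _ _ Y]) (use False in auto)
    have "fexp F r (\<lambda>\<omega>. X \<omega> * Y (insert c \<omega>)) = fexp F r X * fexp F r (\<lambda>\<omega>. Y (insert c \<omega>))"
      by (rule IH[of _ "\<lambda>\<omega>. Y (insert c \<omega>)"]) (fact insert.prems(1), fact Y)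
    then show ?thesis
      using IH[of X Y, OF insert.prems] by (simp add: fi X algebra_simps)
  qed
qed simp

lemma fprob_indep:
  assumes "finite F" "\<And>\<omega>. A \<omega> = A (\<omega> \<inter> Z)" "\<And>\<omega>. B \<omega> = B (\<omega> - Z)"
  shows "fprob F r (\<lambda>\<omega>. A \<omega> \<and> B \<omega>) = fprob F r A * fprob F r B"
  unfolding fprob_def of_bool_conj
  by (rule fexp_indep[OF assms(1), of _ Z]; rule arg_cong[where f = of_bool], rule assms)

lemma fexp_restrict:
  assumes "finite F" "H \<subseteq> F" "\<And>\<omega>. X \<omega> = X (\<omega> \<inter> H)"
  shows "fexp F r X = fexp H r X"
proof -
  have "finite G \<Longrightarrow> G \<inter> H = {} \<Longrightarrow> fexp (H \<union> G) r X = fexp H r X" for G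
  proof (induction G rule: finite_induct)
    case (insert c G)
    have "X (insert c \<omega>) = X \<omega>" for \<omega>
      by (rule trans[OF assms(3) trans[OF _ assms(3)[symmetric]]], rule arg_cong[of _ _ X])
        (use insert.prems in auto)
    then show ?case
      using insert finite_subset[OF assms(2,1)]
      by (simp add: fexp_insert algebra_simps)
  qed simp
  from this[of "F - H"] assms show ?thesis
    by (simp add: Un_absorb1 Int_commute Diff_disjoint)
qed

lemma fprob_restrict:
  assumes "finite F" "H \<subseteq> F" "\<And>\<omega>. A \<omega> = A (\<omega> \<inter> H)"
  shows "fprob F r A = fprob H r A"
  unfolding fprob_def 
  by (rule fexp_restrict[OF assms(1,2)], rule arg_cong[where f = of_bool], rule assms)

text \<open>An increasing \<open>X\<close> drops when its argument is cut down to \<open>H\<close>,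
  and after the cut the coordinates outside \<open>H\<close> integrate out.\<close>

lemma fexp_mono_set:
  assumes "finite F" "H \<subseteq> F" "probs r" "\<And>\<omega> \<omega>'. \<omega> \<subseteq> \<omega>' \<Longrightarrow> \<omega>' \<subseteq> F \<Longrightarrow> X \<omega> \<le> X \<omega>'"
  shows "fexp H r X \<le> fexp F r X"
proof -
  have "fexp H r X = fexp H r (\<lambda>\<omega>. X (\<omega> \<inter> H))"
    by (intro fexp_cong) (simp add: Int_absorb2)
  also have "\<dots> = fexp F r (\<lambda>\<omega>. X (\<omega> \<inter> H))"
    using assms by (intro fexp_restrict[symmetric]) auto
  also have "\<dots> \<le> fexp F r X"
    using assms by (intro fexp_mono) auto
  finally show ?thesis .
qed

lemma fprob_mono_set:
  assumes "finite F" "H \<subseteq> F" "probs r" "\<And>\<omega> \<omega>'. \<omega> \<subseteq> \<omega>' \<Longrightarrow> \<omega>' \<subseteq> F \<Longrightarrow> A \<omega> \<Longrightarrow> A \<omega>'"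
  shows "fprob H r A \<le> fprob F r A"
  unfolding fprob_def using assms(1-3) by (rule fexp_mono_set) (use assms(4) in auto)

text \<open>Raising \<open>r c\<close> moves mass from the configurations without \<open>c\<close>
  to those with \<open>c\<close>, where an increasing \<open>X\<close> is larger.\<close>

lemma fexp_mono_param:
  assumes "finite F" "probs r" "probs s" "\<And>c. r c \<le> s c"
    and "\<And>\<omega> \<omega>'. \<omega> \<subseteq> \<omega>' \<Longrightarrow> \<omega>' \<subseteq> F \<Longrightarrow> X \<omega> \<le> X \<omega>'"
  shows "fexp F r X \<le> fexp F s X"
  using assms(1,5)
proof (induction F arbitrary: X rule: finite_induct)
  case (insert c F)
  let ?X = "\<lambda>\<omega>. X (insert c \<omega>)"
  have IH: "fexp F r X \<le> fexp F s X" "fexp F r ?X \<le> fexp F s ?X"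
    by (auto intro!: insert.IH insert.prems)
  have m: "fexp F s X \<le> fexp F s ?X"
    by (intro fexp_mono insert.prems assms(3)) auto
  have r: "0 \<le> r c" "r c \<le> 1" "r c \<le> s c" using assms(2,4) by (auto simp: probs_def)
  have "fexp (insert c F) r X = r c * fexp F r ?X + (1 - r c) * fexp F r X"
    using insert by (simp add: fexp_insert)
  also have "\<dots> \<le> r c * fexp F s ?X + (1 - r c) * fexp F s X"
    using IH r by (intro add_mono mult_left_mono) auto
  also have "\<dots> = fexp F s X + r c * (fexp F s ?X - fexp F s X)"
    by (simp add: algebra_simps)
  also have "\<dots> \<le> fexp F s X + s c * (fexp F s ?X - fexp F s X)"
    using m r by (intro add_left_mono mult_right_mono) auto
  also have "\<dots> = fexp (insert c F) s X"
    using insert by (simp add: fexp_insert algebra_simps)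
  finally show ?case .
qed simp

lemma fexp_image:
  assumes "finite F" "inj_on h F"
  shows "fexp (h ` F) r X = fexp F (r \<circ> h) (\<lambda>\<omega>. X (h ` \<omega>))"
  using assms
proof (induction F arbitrary: X rule: finite_induct)
  case (insert c F)
  then have "h c \<notin> h ` F" by auto
  then show ?case using insert by (simp add: fexp_insert)
qed simp

text \<open>For finite \<open>F\<close> this is a polynomial in \<open>p\<close>. Its continuity is
  used for the openness of the subcritical condition and for the passage from \<open>p < pc\<close>
  to \<open>pc\<close>.\<close>

lemma continuous_on_fexp: "continuous_on S (\<lambda>p. fexp F (\<lambda>_. p) X)"
  unfolding fexp_def bern_weight_def
proof (intro continuous_intros)
  fix \<omega> c show "continuous_on S (\<lambda>p. if c \<in> \<omega> then p else 1 - p)"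
    by (cases "c \<in> \<omega>") (auto intro!: continuous_intros)
qed

section \<open>The BK inequality\<close>

definition inc :: "('c set \<Rightarrow> bool) \<Rightarrow> bool" where
  "inc A \<longleftrightarrow> (\<forall>\<omega> \<omega>'. \<omega> \<subseteq> \<omega>' \<longrightarrow> A \<omega> \<longrightarrow> A \<omega>')"

definition dec :: "('c set \<Rightarrow> bool) \<Rightarrow> bool" where
  "dec A \<longleftrightarrow> (\<forall>\<omega> \<omega>'. \<omega> \<subseteq> \<omega>' \<longrightarrow> A \<omega>' \<longrightarrow> A \<omega>)"

lemma incD: "inc A \<Longrightarrow> A \<omega> \<Longrightarrow> A (insert c \<omega>)"
  unfolding inc_def by (metis subset_insertI)

lemma decD: "dec A \<Longrightarrow> A (insert c \<omega>) \<Longrightarrow> A \<omega>"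
  unfolding dec_def by (metis subset_insertI)

lemma inc_insert: "inc A \<Longrightarrow> inc (\<lambda>\<omega>. A (insert c \<omega>))"
  unfolding inc_def by (metis Set.insert_mono)

lemma dec_insert: "dec A \<Longrightarrow> dec (\<lambda>\<omega>. A (insert c \<omega>))"
  unfolding dec_def by (metis Set.insert_mono)

text \<open>For increasing events, \<open>A I\<close> says that the open coordinates in
  \<open>I\<close> alone force \<open>A\<close>; this is then the disjoint occurrence of van den
  Berg and Kesten.\<close>

definition circ :: "('c set \<Rightarrow> bool) \<Rightarrow> ('c set \<Rightarrow> bool) \<Rightarrow> 'c set \<Rightarrow> bool" where
  "circ A B \<omega> \<longleftrightarrow> (\<exists>I J. I \<subseteq> \<omega> \<and> J \<subseteq> \<omega> \<and> I \<inter> J = {} \<and> A I \<and> B J)"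

lemma circI: "I \<subseteq> \<omega> \<Longrightarrow> J \<subseteq> \<omega> \<Longrightarrow> I \<inter> J = {} \<Longrightarrow> A I \<Longrightarrow> B J \<Longrightarrow> circ A B \<omega>"
  unfolding circ_def by blast

lemma inc_circ: "inc (circ A B)"
  unfolding inc_def circ_def by (meson subset_trans)

lemma circ_mono: "(\<And>\<omega>. A \<omega> \<Longrightarrow> A' \<omega>) \<Longrightarrow> (\<And>\<omega>. B \<omega> \<Longrightarrow> B' \<omega>) \<Longrightarrow> circ A B \<omega> \<Longrightarrow> circ A' B' \<omega>"
  unfolding circ_def by blast

text \<open>The coordinate \<open>c\<close> can serve only one of the two disjoint witnesses. When
  neither uses it, it is given to \<open>A\<close>, which is increasing.\<close>

lemma circ_insert:
  assumes "inc A" "inc B" "c \<notin> \<omega>"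
  shows "circ A B (insert c \<omega>) \<longleftrightarrow>
    circ (\<lambda>\<omega>. A (insert c \<omega>)) B \<omega> \<or> circ A (\<lambda>\<omega>. B (insert c \<omega>)) \<omega>"
proof
  assume "circ A B (insert c \<omega>)"
  then obtain I J where IJ: "I \<subseteq> insert c \<omega>" "J \<subseteq> insert c \<omega>" "I \<inter> J = {}" "A I" "B J"
    unfolding circ_def by blast
  show "circ (\<lambda>\<omega>. A (insert c \<omega>)) B \<omega> \<or> circ A (\<lambda>\<omega>. B (insert c \<omega>)) \<omega>"
  proof (cases "c \<in> J")
    case True
    then have "insert c (J - {c}) = J" by auto
    then have "circ A (\<lambda>\<omega>. B (insert c \<omega>)) \<omega>"
      using IJ True by (intro circI[of I \<omega> "J - {c}"]) auto
    then show ?thesis ..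
  next
    case False
    have "A (insert c (I - {c}))" 
      using assms(1)[unfolded inc_def, rule_format, of I "insert c (I - {c})"] IJ(4) by auto
    then have "circ (\<lambda>\<omega>. A (insert c \<omega>)) B \<omega>"
      using IJ False by (intro circI[of "I - {c}" \<omega> J]) auto
    then show ?thesis ..
  qed
next
  assume "circ (\<lambda>\<omega>. A (insert c \<omega>)) B \<omega> \<or> circ A (\<lambda>\<omega>. B (insert c \<omega>)) \<omega>"
  then show "circ A B (insert c \<omega>)"
  proof
    assume "circ (\<lambda>\<omega>. A (insert c \<omega>)) B \<omega>"
    then obtain I J where "I \<subseteq> \<omega>" "J \<subseteq> \<omega>" "I \<inter> J = {}" "A (insert c I)" "B J"
      unfolding circ_def by blast
    then show ?thesis using assms(3) by (intro circI[of "insert c I" _ J]) auto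
  next
    assume "circ A (\<lambda>\<omega>. B (insert c \<omega>)) \<omega>"
    then obtain I J where "I \<subseteq> \<omega>" "J \<subseteq> \<omega>" "I \<inter> J = {}" "A I" "B (insert c J)"
      unfolding circ_def by blast
    then show ?thesis using assms(3) by (intro circI[of I _ "insert c J"]) auto
  qed
qed

text \<open>A decreasing event can be attached to one of the two disjointly occurring increasing events; it will
  say that an explored cluster contains no green vertex.\<close>
theorem bk_inequality:
  assumes "finite F" "probs r" "inc U" "inc B" "dec D"
  shows "fprob F r (\<lambda>\<omega>. circ U B \<omega> \<and> D \<omega>) \<le> fprob F r (\<lambda>\<omega>. U \<omega> \<and> D \<omega>) * fprob F r B"
  using assms(1,3,4,5)
proof (induction F arbitrary: U B D rule: finite_induct)
  case empty
  have "circ U B {} \<Longrightarrow> U {} \<and> B {}" unfolding circ_def by auto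
  then show ?case by (auto simp: fprob_def of_bool_def)
next
  case (insert c F)
  define U1 B1 D1 where "U1 = (\<lambda>\<omega>. U (insert c \<omega>))" and "B1 = (\<lambda>\<omega>. B (insert c \<omega>))"
    and "D1 = (\<lambda>\<omega>. D (insert c \<omega>))"
  have inc1: "inc U1" "inc B1" "dec D1"
    using insert.prems unfolding U1_def B1_def D1_def by (auto intro: inc_insert dec_insert)
  have UU: "U \<omega> \<Longrightarrow> U1 \<omega>" and BB: "B \<omega> \<Longrightarrow> B1 \<omega>" and DD: "D1 \<omega> \<Longrightarrow> D \<omega>" for \<omega>
    using insert.prems unfolding U1_def B1_def D1_def by (auto intro: incD decD)
  define p where "p = r c"
  have p: "0 \<le> p" "0 \<le> 1 - p" using assms(2) by (auto simp: probs_def p_def)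
  define P where "P = (\<lambda>A. fprob F r A)"
  have split: "fprob (insert c F) r A = p * P (\<lambda>\<omega>. A (insert c \<omega>)) + (1 - p) * P A" for A
    using insert.hyps by (simp add: fprob_def fexp_insert p_def P_def)
  note IH = insert.IH[folded P_def]
  let ?s = "\<lambda>\<omega>. (circ U1 B \<omega> \<or> circ U B1 \<omega>) \<and> D1 \<omega>"
  have c1: "P (\<lambda>\<omega>. circ U B (insert c \<omega>) \<and> D (insert c \<omega>)) = P ?s"
    unfolding P_def
  proof (rule fprob_cong)
    fix \<omega> assume "\<omega> \<subseteq> F"
    then have "c \<notin> \<omega>" using insert.hyps by auto
    then show "(circ U B (insert c \<omega>) \<and> D (insert c \<omega>)) = ?s \<omega>"
      using circ_insert[OF insert.prems(1,2)] by (simp add: U1_def B1_def D1_def)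
  qed
  \<comment> \<open>Inclusion-exclusion, with \<open>circ U B\<close> contained in both
    alternatives.\<close>
  have e1: "P ?s \<le> P (\<lambda>\<omega>. circ U1 B \<omega> \<and> D1 \<omega>) + P (\<lambda>\<omega>. circ U B1 \<omega> \<and> D1 \<omega>)
      - P (\<lambda>\<omega>. circ U B \<omega> \<and> D1 \<omega>)"
    unfolding P_def fprob_def fexp_add[symmetric] fexp_diff[symmetric]
  proof (rule fexp_mono[OF assms(2)])
    fix \<omega>
    have "circ U B \<omega> \<Longrightarrow> circ U1 B \<omega>" "circ U B \<omega> \<Longrightarrow> circ U B1 \<omega>"
      using UU BB by (auto elim!: circ_mono[rotated 2])
    then show "of_bool (?s \<omega>) \<le> of_bool (circ U1 B \<omega> \<and> D1 \<omega>) + of_bool (circ U B1 \<omega> \<and> D1 \<omega>)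
      - (of_bool (circ U B \<omega> \<and> D1 \<omega>) :: real)" by (auto simp: of_bool_def)
  qed
  have e2: "P ?s \<le> P (\<lambda>\<omega>. circ U1 B1 \<omega> \<and> D1 \<omega>)"
    unfolding P_def using UU BB by (intro fprob_mono assms(2)) (auto elim!: circ_mono[rotated 2])
  \<comment> \<open>The increment from \<open>B\<close> to \<open>B1\<close> is nonnegative, so
    replacing \<open>D1\<close> by the larger \<open>D\<close> can only raise it.\<close>
  have e3: "P (\<lambda>\<omega>. circ U B1 \<omega> \<and> D1 \<omega>) - P (\<lambda>\<omega>. circ U B \<omega> \<and> D1 \<omega>)
      \<le> P (\<lambda>\<omega>. circ U B1 \<omega> \<and> D \<omega>) - P (\<lambda>\<omega>. circ U B \<omega> \<and> D \<omega>)"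
    unfolding P_def fprob_def fexp_add[symmetric] fexp_diff[symmetric]
  proof (rule fexp_mono[OF assms(2)])
    fix \<omega>
    have "circ U B \<omega> \<Longrightarrow> circ U B1 \<omega>"
      using BB by (auto elim!: circ_mono[rotated 2])
    then show "of_bool (circ U B1 \<omega> \<and> D1 \<omega>) - of_bool (circ U B \<omega> \<and> D1 \<omega>)
      \<le> of_bool (circ U B1 \<omega> \<and> D \<omega>) - (of_bool (circ U B \<omega> \<and> D \<omega>) :: real)"
      using DD[of \<omega>] by (auto simp: of_bool_def)
  qed
  let ?u0 = "P (\<lambda>\<omega>. U \<omega> \<and> D \<omega>)" and ?u1 = "P (\<lambda>\<omega>. U1 \<omega> \<and> D1 \<omega>)"
  let ?c00 = "P (\<lambda>\<omega>. circ U B \<omega> \<and> D \<omega>)" and ?c01 = "P (\<lambda>\<omega>. circ U B1 \<omega> \<and> D \<omega>)"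
  let ?c10 = "P (\<lambda>\<omega>. circ U1 B \<omega> \<and> D1 \<omega>)" and ?c11 = "P (\<lambda>\<omega>. circ U1 B1 \<omega> \<and> D1 \<omega>)"
  \<comment> \<open>\<open>e1\<close> and \<open>e3\<close> are used with weight
    \<open>1 - p\<close> and \<open>e2\<close> with weight \<open>p\<close>; then the four terms
    below carry exactly the weights of the product on the right.\<close>
  have e4: "P ?s \<le> (1 - p) * (?c10 + ?c01 - ?c00) + p * ?c11"
  proof -
    have "P ?s = (1 - p) * P ?s + p * P ?s" by (simp add: algebra_simps)
    also have "\<dots> \<le> (1 - p) * (?c10 + ?c01 - ?c00) + p * ?c11"
      using e1 e2 e3 p by (intro add_mono mult_left_mono) auto
    finally show ?thesis .
  qed
  have I: "?c00 \<le> ?u0 * P B" "?c01 \<le> ?u0 * P B1" "?c10 \<le> ?u1 * P B" "?c11 \<le> ?u1 * P B1"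
    using IH[of U B D] IH[of U B1 D] IH[of U1 B D1] IH[of U1 B1 D1] insert.prems inc1 by auto
  have "fprob (insert c F) r (\<lambda>\<omega>. circ U B \<omega> \<and> D \<omega>) = p * P ?s + (1 - p) * ?c00"
    unfolding split c1 ..
  also have "\<dots> \<le> p * ((1 - p) * (?c10 + ?c01 - ?c00) + p * ?c11) + (1 - p) * ?c00"
    using e4 p by (intro add_right_mono mult_left_mono) auto
  also have "\<dots> = p * (1 - p) * ?c10 + p * (1 - p) * ?c01 + p * p * ?c11 + (1 - p) * (1 - p) * ?c00"
    by (simp add: algebra_simps)
  also have "\<dots> \<le> p * (1 - p) * (?u1 * P B) + p * (1 - p) * (?u0 * P B1)
      + p * p * (?u1 * P B1) + (1 - p) * (1 - p) * (?u0 * P B)"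
    using I p by (intro add_mono mult_left_mono) auto
  also have "\<dots> = (p * ?u1 + (1 - p) * ?u0) * (p * P B1 + (1 - p) * P B)"
    by (simp add: algebra_simps)
  also have "\<dots> = fprob (insert c F) r (\<lambda>\<omega>. U \<omega> \<and> D \<omega>) * fprob (insert c F) r B"
    unfolding split by (simp add: U1_def B1_def D1_def)
  finally show ?case .
qed

lemma bk_simple:
  assumes "finite F" "probs r" "inc U" "inc B"
  shows "fprob F r (circ U B) \<le> fprob F r U * fprob F r B"
  using bk_inequality[OF assms, of "\<lambda>_. True"] by (simp add: dec_def)

section \<open>Open paths and clusters\<close>

definition conn :: "'a set set \<Rightarrow> 'a \<Rightarrow> 'a \<Rightarrow> bool" where
  "conn \<eta> u w \<longleftrightarrow> (u, w) \<in> (adj \<eta>)\<^sup>*"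

definition clus :: "'a set set \<Rightarrow> 'a \<Rightarrow> 'a set" where
  "clus \<eta> v = {u. conn \<eta> v u}"

text \<open>After a cluster with vertex set \<open>S\<close> has been explored, this is the
  unexplored part of \<open>\<eta>\<close>.\<close>

definition off :: "'a set set \<Rightarrow> 'a set \<Rightarrow> 'a set set" where
  "off \<eta> S = {e \<in> \<eta>. e \<inter> S = {}}"

lemma adj_iff [simp]: "(u, w) \<in> adj \<eta> \<longleftrightarrow> {u, w} \<in> \<eta>"
  by (simp add: adj_def)

lemma sym_adj: "sym (adj \<eta>)"
  by (simp add: sym_def insert_commute)

lemma conn_refl [simp]: "conn \<eta> x x"
  by (simp add: conn_def)

lemma conn_sym: "conn \<eta> x y \<Longrightarrow> conn \<eta> y x"
  unfolding conn_def using sym_rtrancl[OF sym_adj] by (meson symD)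

lemma conn_trans: "conn \<eta> x y \<Longrightarrow> conn \<eta> y z \<Longrightarrow> conn \<eta> x z"
  unfolding conn_def by (rule rtrancl_trans)

lemma conn_edge: "{x, y} \<in> \<eta> \<Longrightarrow> conn \<eta> x y"
  unfolding conn_def by auto

lemma conn_mono: "\<eta> \<subseteq> \<eta>' \<Longrightarrow> conn \<eta> x y \<Longrightarrow> conn \<eta>' x y"
  unfolding conn_def by (rule rtrancl_mono[THEN subsetD]) auto

lemma conn_induct [consumes 1, case_names refl step]:
  assumes "conn \<eta> x y" "P x" "\<And>y z. conn \<eta> x y \<Longrightarrow> {y, z} \<in> \<eta> \<Longrightarrow> P y \<Longrightarrow> P z"
  shows "P y"
  using assms(1) unfolding conn_def
  by (induction rule: rtrancl_induct) (use assms(2,3) in \<open>auto simp: conn_def\<close>)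

lemma cluster_eq: "cluster E \<omega> v = clus (open_edges E \<omega>) v"
  by (simp add: cluster_def clus_def conn_def)

lemma self_in_clus [simp]: "v \<in> clus \<eta> v"
  by (simp add: clus_def)

lemma clus_mono: "\<eta> \<subseteq> \<eta>' \<Longrightarrow> clus \<eta> v \<subseteq> clus \<eta>' v"
  by (auto simp: clus_def intro: conn_mono)

lemma clus_eq: "conn \<eta> u v \<Longrightarrow> clus \<eta> u = clus \<eta> v"
  unfolding clus_def using conn_sym conn_trans by fast

lemma clus_disjoint_iff: "clus \<eta> u \<inter> clus \<eta> v = {} \<longleftrightarrow> v \<notin> clus \<eta> u"
  unfolding clus_def using conn_sym conn_trans by fast

lemma clus_subset: "clus \<eta> v \<subseteq> insert v (\<Union>\<eta>)"
proof
  fix u assume "u \<in> clus \<eta> v"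
  then have "conn \<eta> v u" by (simp add: clus_def)
  then show "u \<in> insert v (\<Union>\<eta>)" by (induction rule: conn_induct) auto
qed

lemma conn_fun:
  assumes "f 0 = x" "f n = y" "\<And>i. i < n \<Longrightarrow> {f i, f (Suc i)} \<in> \<eta>"
  shows "conn \<eta> x y"
  unfolding conn_def using assms
  by (intro relpow_imp_rtrancl[of _ n]) (auto simp: relpow_fun_conv)

text \<open>In a walk of least length no vertex is visited twice, since the piece between two visits
  could be cut out. Injectivity makes different stretches of the path edge disjoint, as BK
  requires.\<close>

lemma simple_path:
  assumes "conn \<eta> x g"
  obtains f n where "f 0 = x" "f n = g" "inj_on f {..n::nat}" "\<And>i. i < n \<Longrightarrow> {f i, f (Suc i)} \<in> \<eta>"
proof -
  define n where "n = (LEAST n. (x, g) \<in> adj \<eta> ^^ n)"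
  have "\<exists>n. (x, g) \<in> adj \<eta> ^^ n"
    using assms unfolding conn_def by (simp add: rtrancl_power)
  then have n: "(x, g) \<in> adj \<eta> ^^ n" unfolding n_def by (rule LeastI_ex)
  have least: "n \<le> m" if "(x, g) \<in> adj \<eta> ^^ m" for m
    unfolding n_def using that by (rule Least_le)
  obtain f where f: "f 0 = x" "f n = g" "\<forall>i<n. {f i, f (Suc i)} \<in> \<eta>"
    using n by (auto simp: relpow_fun_conv)
  have seg: "(f i, f j) \<in> adj \<eta> ^^ (j - i)" if "i \<le> j" "j \<le> n" for i j
    unfolding relpow_fun_conv using f that by (intro exI[of _ "\<lambda>k. f (i + k)"]) auto
  have ne: "f i \<noteq> f j" if "i < j" "j \<le> n" for i j
  proof
    assume "f i = f j"
    then have "(x, f j) \<in> adj \<eta> ^^ i" "(f j, g) \<in> adj \<eta> ^^ (n - j)"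
      using seg[of 0 i] seg[of j n] f that by auto
    then have "(x, g) \<in> adj \<eta> ^^ (i + (n - j))"
      unfolding relpow_add by blast
    then show False using least[of "i + (n - j)"] that by simp
  qed
  have "inj_on f {..n}"
    by (rule linorder_inj_onI) (use ne in auto)
  with f that show ?thesis by blast
qed

definition seg :: "(nat \<Rightarrow> 'a) \<Rightarrow> nat \<Rightarrow> nat \<Rightarrow> 'a set set" where
  "seg f a b = (\<lambda>i. {f i, f (Suc i)}) ` {a..<b}"

lemma conn_seg: "a \<le> b \<Longrightarrow> conn (seg f a b) (f a) (f b)"
  by (rule conn_fun[of "\<lambda>i. f (a + i)" _ "b - a"]) (auto simp: seg_def)

lemma seg_disjoint:
  assumes "inj_on f {..n}" "b \<le> a'" "b' \<le> n"
  shows "seg f a b \<inter> seg f a' b' = {}"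
proof -
  have "{f i, f (Suc i)} \<noteq> {f j, f (Suc j)}" if "i < j" "Suc j \<le> n" for i j
  proof
    assume "{f i, f (Suc i)} = {f j, f (Suc j)}"
    then have "f i = f j \<or> f i = f (Suc j)" by (auto simp: doubleton_eq_iff)
    then show False
      using inj_onD[OF assms(1), of i j] inj_onD[OF assms(1), of i "Suc j"] that by auto
  qed
  moreover have "i < j \<and> Suc j \<le> n" if "i \<in> {a..<b}" "j \<in> {a'..<b'}" for i j
    using that assms(2,3) by auto
  ultimately show ?thesis unfolding seg_def by blast
qed

text \<open>The point \<open>s\<close> is the last visit of a simple path to \<open>S\<close>.
  Beyond it the path touches no other vertex of \<open>S\<close>, and the pieces before and after it
  share no edge. The first alternative is a path that misses \<open>S\<close>.\<close>

lemma last_exit: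
  assumes "conn \<eta> x g"
  shows "(conn (off \<eta> S) x g \<and> x \<notin> S) \<or>
    (\<exists>s\<in>S. \<exists>I J. I \<subseteq> \<eta> \<and> J \<subseteq> \<eta> \<and> I \<inter> J = {} \<and> conn I x s \<and> conn (off J (S - {s})) s g)"
proof -
  obtain f n where f: "f 0 = x" "f n = g" "inj_on f {..n::nat}" "\<And>i. i < n \<Longrightarrow> {f i, f (Suc i)} \<in> \<eta>"
    using simple_path[OF assms] by metis
  show ?thesis
  proof (cases "\<exists>i\<le>n. f i \<in> S")
    case True
    define k where "k = Max {i. i \<le> n \<and> f i \<in> S}"
    have fin: "finite {i. i \<le> n \<and> f i \<in> S}" by simp
    have k: "k \<le> n" "f k \<in> S" using Max_in[OF fin] True by (auto simp: k_def)
    have k2: "f i \<notin> S" if "k < i" "i \<le> n" for i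
    proof
      assume "f i \<in> S"
      then have "i \<le> k" using Max_ge[OF fin, of i] that by (simp add: k_def)
      then show False using that by simp
    qed
    have "off (seg f k n) (S - {f k}) = seg f k n"
      using k k2 by (auto simp: off_def seg_def) (metis Suc_leI le_SucI le_neq_implies_less less_Suc_eq_le order_less_le)+
    then have "conn (off (seg f k n) (S - {f k})) (f k) g"
      using conn_seg[OF k(1), of f] f by simp
    moreover have "conn (seg f 0 k) x (f k)" using conn_seg[of 0 k f] f by simp
    moreover have "seg f 0 k \<subseteq> \<eta>" "seg f k n \<subseteq> \<eta>" using f k by (auto simp: seg_def)
    moreover have "seg f 0 k \<inter> seg f k n = {}" by (rule seg_disjoint[OF f(3)]) auto
    ultimately show ?thesis using k(2) by blast
  next
    case False
    then have "seg f 0 n \<subseteq> off \<eta> S" using f(4) by (auto simp: off_def seg_def)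
    then have "conn (off \<eta> S) x g" using conn_mono[OF _ conn_seg[of 0 n f]] f(1,2) by simp
    then show ?thesis using False f(1) by auto
  qed
qed

text \<open>The branch point is where a path to \<open>y\<close> leaves a simple path to
  \<open>x\<close> for the last time. Every edge of the latter has an end in \<open>S\<close> other
  than \<open>s\<close>, so none of them belongs to \<open>off J (S - {s})\<close>.\<close>

lemma tree_split:
  assumes "conn \<eta> v x" "conn \<eta> v y"
  obtains w I1 I2 I3 where "I1 \<subseteq> \<eta>" "I2 \<subseteq> \<eta>" "I3 \<subseteq> \<eta>" "I1 \<inter> I2 = {}" "I1 \<inter> I3 = {}" "I2 \<inter> I3 = {}"
    "conn I1 v w" "conn I2 w x" "conn I3 w y"
proof -
  obtain f n where f: "f 0 = v" "f n = x" "inj_on f {..n::nat}" "\<And>i. i < n \<Longrightarrow> {f i, f (Suc i)} \<in> \<eta>"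
    using simple_path[OF assms(1)] by metis
  define S where "S = f ` {..n}"
  have "v \<in> S" using f(1) by (force simp: S_def)
  then obtain s J where s: "s \<in> S" "J \<subseteq> \<eta>" "conn (off J (S - {s})) s y"
    using last_exit[OF assms(2), of S] by blast
  then obtain k where k: "k \<le> n" "s = f k" by (auto simp: S_def)
  let ?J = "off J (S - {s})"
  have dj: "e \<notin> ?J" if "e \<in> seg f 0 n" for e
  proof -
    obtain i where i: "i < n" "e = {f i, f (Suc i)}" using \<open>e \<in> seg f 0 n\<close> by (auto simp: seg_def)
    have "f i \<in> S" "f (Suc i) \<in> S" "f i \<noteq> f (Suc i)"
      using i inj_onD[OF f(3), of i "Suc i"] by (auto simp: S_def)
    then have "e \<inter> (S - {s}) \<noteq> {}" using i by auto
    then show ?thesis by (simp add: off_def)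
  qed
  have sub: "seg f 0 k \<subseteq> seg f 0 n" "seg f k n \<subseteq> seg f 0 n" "seg f 0 n \<subseteq> \<eta>"
    using k f(4) by (auto simp: seg_def)
  show ?thesis
  proof (rule that[of "seg f 0 k" "seg f k n" ?J s])
    show "seg f 0 k \<inter> seg f k n = {}" by (rule seg_disjoint[OF f(3)]) auto
    show "conn (seg f 0 k) v s" using conn_seg[of 0 k f] f k by simp
    show "conn (seg f k n) s x" using conn_seg[of k n f] f k by simp
    show "?J \<subseteq> \<eta>" using s(2) by (auto simp: off_def)
    show "conn ?J s y" by (rule s)
  qed (use sub dj in blast)+
qed

text \<open>Exploring a cluster looks only at edges that touch it, so a configuration that agrees on
  these has the same cluster.\<close>

lemma clus_local:
  assumes "clus \<eta> v \<subseteq> A" "\<And>e. e \<inter> A \<noteq> {} \<Longrightarrow> e \<in> \<eta> \<longleftrightarrow> e \<in> \<eta>'"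
  shows "clus \<eta>' v = clus \<eta> v"
proof (intro equalityI subsetI)
  fix u assume "u \<in> clus \<eta>' v"
  then have "conn \<eta>' v u" by (simp add: clus_def)
  then show "u \<in> clus \<eta> v"
  proof (induction rule: conn_induct)
    case (step y z)
    then have "{y, z} \<inter> A \<noteq> {}" using assms(1) by auto
    then have "{y, z} \<in> \<eta>" using assms(2)[of "{y, z}"] step by blast
    then show ?case using step conn_edge conn_trans unfolding clus_def by fast
  qed simp
next
  fix u assume "u \<in> clus \<eta> v"
  then have "conn \<eta> v u" by (simp add: clus_def)
  then have "conn \<eta>' v u"
  proof (induction rule: conn_induct)
    case (step y z)
    then have "y \<in> A" using assms(1) by (auto simp: clus_def)
    then have "{y, z} \<in> \<eta>'" using assms(2)[of "{y, z}"] step by blast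
    then show ?case using step conn_edge conn_trans by fast
  qed simp
  then show "u \<in> clus \<eta>' v" by (simp add: clus_def)
qed

lemma conn_off_notin: "conn (off \<eta> A) x g \<Longrightarrow> x \<notin> A \<Longrightarrow> g \<notin> A"
  by (induction rule: conn_induct) (auto simp: off_def)

lemma off_mono: "\<eta> \<subseteq> \<eta>' \<Longrightarrow> off \<eta> S \<subseteq> off \<eta>' S"
  by (auto simp: off_def)

lemma off_subset: "off \<eta> S \<subseteq> \<eta>"
  by (auto simp: off_def)

section \<open>The ghost field\<close>

text \<open>Besides the edges, a configuration records which vertices are green: the coordinate
  \<^term>\<open>Inr (i, x)\<close> says that \<^term>\<open>x\<close> carries colour \<^term>\<open>i\<close> (Aizenman and Barsky's ghost field).\<close>

type_synonym 'a coord = "'a set + nat \<times> 'a"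

definition eds :: "'a coord set \<Rightarrow> 'a set set" where
  "eds \<omega> = {e. Inl e \<in> \<omega>}"

text \<open>Several colours are kept because each of the \<open>\<ell>\<close> clusters has its own
  size threshold and hence its own intensity.\<close>

definition grn :: "nat \<Rightarrow> 'a coord set \<Rightarrow> 'a set" where
  "grn i \<omega> = {x. Inr (i, x) \<in> \<omega>}"

definition hit :: "nat \<Rightarrow> 'a \<Rightarrow> 'a coord set \<Rightarrow> bool" where
  "hit i x \<omega> \<longleftrightarrow> (\<exists>g\<in>grn i \<omega>. conn (eds \<omega>) x g)"

definition cn :: "'a \<Rightarrow> 'a \<Rightarrow> 'a coord set \<Rightarrow> bool" where
  "cn x y \<omega> \<longleftrightarrow> conn (eds \<omega>) x y"

text \<open>The coordinates that are revealed when a cluster with vertex set \<open>A\<close> is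
  explored.\<close>

definition tch :: "'a set \<Rightarrow> 'a coord set" where
  "tch A = Inl ` {e. e \<inter> A \<noteq> {}} \<union> Inr ` (UNIV \<times> A)"

text \<open>This is what remains of a path to a green vertex after its last exit \<open>s\<close>
  from \<open>S\<close>.\<close>

definition qhit :: "nat \<Rightarrow> 'a set \<Rightarrow> 'a \<Rightarrow> 'a coord set \<Rightarrow> bool" where
  "qhit i S s \<omega> \<longleftrightarrow> (\<exists>g\<in>grn i \<omega>. conn (off (eds \<omega>) (S - {s})) s g)"

lemma eds_mono: "\<omega> \<subseteq> \<omega>' \<Longrightarrow> eds \<omega> \<subseteq> eds \<omega>'" and grn_mono: "\<omega> \<subseteq> \<omega>' \<Longrightarrow> grn i \<omega> \<subseteq> grn i \<omega>'"
  by (auto simp: eds_def grn_def)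

lemma eds_Inl [simp]: "eds (Inl ` I) = I" "eds (insert (Inr z) \<omega>) = eds \<omega>" "eds (insert (Inl e) \<omega>) = insert e (eds \<omega>)"
  by (auto simp: eds_def)

lemma grn_insert [simp]: "grn i (Inl ` I) = {}" "grn i (insert (Inr (i, x)) \<omega>) = insert x (grn i \<omega>)"
   "grn i (insert (Inl e) \<omega>) = grn i \<omega>"
  by (auto simp: grn_def)

lemma eds_tch [simp]: "eds (\<omega> - tch A) = off (eds \<omega>) A" "eds (\<omega> \<inter> tch A) = {e \<in> eds \<omega>. e \<inter> A \<noteq> {}}"
  by (auto simp: eds_def tch_def off_def)

lemma grn_tch [simp]: "grn i (\<omega> - tch A) = grn i \<omega> - A" "grn i (\<omega> \<inter> tch A) = grn i \<omega> \<inter> A"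
  by (auto simp: grn_def tch_def)

lemma Inl_subset_iff: "Inl ` I \<subseteq> \<omega> \<longleftrightarrow> I \<subseteq> eds \<omega>" and Inr_mem_iff: "Inr (i, x) \<in> \<omega> \<longleftrightarrow> x \<in> grn i \<omega>"
  by (auto simp: eds_def grn_def)

lemma inc_cn: "inc (cn x y)"
  unfolding inc_def cn_def using conn_mono eds_mono by metis

lemma inc_hit: "inc (hit i x)"
  unfolding inc_def hit_def by (meson conn_mono eds_mono grn_mono subsetD)

lemma inc_qhit: "inc (qhit i S s)"
  unfolding inc_def qhit_def by (meson conn_mono eds_mono grn_mono off_mono subsetD)

lemma qhit_imp_hit: "qhit i S s \<omega> \<Longrightarrow> hit i s \<omega>"
  unfolding qhit_def hit_def using conn_mono[OF off_subset] by metis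

lemma hit_iff: "hit i x \<omega> \<longleftrightarrow> clus (eds \<omega>) x \<inter> grn i \<omega> \<noteq> {}"
  by (auto simp: hit_def clus_def)

lemma circ_conn_hit:
  assumes "I \<subseteq> eds \<omega>" "J \<subseteq> eds \<omega>" "I \<inter> J = {}" "conn I x s" "conn J s g" "g \<in> grn i \<omega>"
  shows "circ (cn x s) (hit i s) \<omega>"
  using assms
  by (intro circI[of "Inl ` I" _ "insert (Inr (i, g)) (Inl ` J)"]) (auto simp: cn_def hit_def Inl_subset_iff Inr_mem_iff)

lemma hit_last_exit:
  assumes "hit i x \<omega>" "x \<in> S"
  shows "\<exists>s\<in>S. circ (cn x s) (qhit i S s) \<omega>"
proof -
  obtain g where g: "g \<in> grn i \<omega>" "conn (eds \<omega>) x g" using assms by (auto simp: hit_def)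
  then obtain s I J where "s \<in> S" and *: "I \<subseteq> eds \<omega>" "J \<subseteq> eds \<omega>" "I \<inter> J = {}" "conn I x s"
    "conn (off J (S - {s})) s g"
    using last_exit[OF g(2), of S] assms(2) by blast
  have "circ (cn x s) (qhit i S s) \<omega>"
    using * g(1)
    by (intro circI[of "Inl ` I" _ "insert (Inr (i, g)) (Inl ` J)"]) (auto simp: cn_def qhit_def Inl_subset_iff Inr_mem_iff)
  then show ?thesis using \<open>s \<in> S\<close> by blast
qed

text \<open>A path to a green vertex either survives the removal of everything that touches
  \<open>A\<close>, or it can be split at a vertex of \<open>A\<close> into two edge disjoint
  pieces.\<close>

lemma hit_through:
  assumes "hit i x \<omega>" "\<not> (x \<notin> A \<and> hit i x (\<omega> - tch A))"
  shows "\<exists>s\<in>A. circ (cn x s) (hit i s) \<omega>"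
proof -
  obtain g where g: "g \<in> grn i \<omega>" "conn (eds \<omega>) x g" using assms by (auto simp: hit_def)
  have "\<not> (conn (off (eds \<omega>) A) x g \<and> x \<notin> A)"
  proof
    assume *: "conn (off (eds \<omega>) A) x g \<and> x \<notin> A"
    then have "g \<notin> A" using conn_off_notin by metis
    then show False using assms(2) g(1) * by (auto simp: hit_def)
  qed
  then obtain s I J where "s \<in> A" and *: "I \<subseteq> eds \<omega>" "J \<subseteq> eds \<omega>" "I \<inter> J = {}" "conn I x s"
    "conn (off J (A - {s})) s g"
    using last_exit[OF g(2), of A] by blast
  then have "conn J s g" using conn_mono[OF off_subset] by metis
  then show ?thesis using circ_conn_hit[OF *(1-4) _ g(1)] \<open>s \<in> A\<close> by blast
qed

text \<open>After its first edge a simple path from \<open>s\<close> that avoids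
  \<open>S - {s}\<close> stays away from all of \<open>S\<close>. A path without edges means that
  \<open>s\<close> itself is green.\<close>

lemma qhit_split:
  assumes "qhit i S s \<omega>" "s \<in> S"
  shows "s \<in> grn i \<omega> \<or> (\<exists>b. {s, b} \<in> eds \<omega> \<and> b \<notin> S \<and> hit i b (\<omega> - tch S))"
proof -
  obtain g where g: "g \<in> grn i \<omega>" "conn (off (eds \<omega>) (S - {s})) s g"
    using assms by (auto simp: qhit_def)
  obtain f n where f: "f 0 = s" "f n = g" "inj_on f {..n::nat}"
    "\<And>k. k < n \<Longrightarrow> {f k, f (Suc k)} \<in> off (eds \<omega>) (S - {s})"
    using simple_path[OF g(2)] by metis
  show ?thesis
  proof (cases "n = 0")
    case True
    then show ?thesis using f g by auto
  next
    case False
    have ns: "f k \<notin> S" if "1 \<le> k" "k \<le> n" for k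
    proof -
      have "f k \<noteq> s" using f(1,3) that by (auto simp: inj_on_def)
      moreover have "f k \<notin> S - {s}"
        using f(4)[of "k - 1"] that by (auto simp: off_def)
      ultimately show ?thesis by auto
    qed
    have "conn (off (eds \<omega>) S) (f 1) g"
    proof (rule conn_fun[of "\<lambda>k. f (Suc k)" _ "n - 1"])
      fix k assume "k < n - 1"
      then show "{f (Suc k), f (Suc (Suc k))} \<in> off (eds \<omega>) S"
        using f(4)[of "Suc k"] ns[of "Suc k"] ns[of "Suc (Suc k)"] by (auto simp: off_def)
    qed (use f False in auto)
    then have "hit i (f 1) (\<omega> - tch S)"
      using g(1) f(2) ns[of n] False by (auto simp: hit_def)
    moreover have "{s, f 1} \<in> eds \<omega>" using f(4)[of 0] f(1) False by (auto simp: off_def)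
    ultimately show ?thesis using ns[of 1] False by auto
  qed
qed

text \<open>The nested \<open>circ\<close> encodes three disjoint witnesses, one per branch, so that
  BK can be applied twice.\<close>

lemma tree_circ:
  assumes "cn v x \<omega>" "cn v y \<omega>"
  shows "\<exists>w\<in>clus (eds \<omega>) v. circ (circ (cn v w) (cn w x)) (cn w y) \<omega>"
proof -
  obtain w I1 I2 I3 where *: "I1 \<subseteq> eds \<omega>" "I2 \<subseteq> eds \<omega>" "I3 \<subseteq> eds \<omega>" "I1 \<inter> I2 = {}" "I1 \<inter> I3 = {}" "I2 \<inter> I3 = {}"
    "conn I1 v w" "conn I2 w x" "conn I3 w y"
    using tree_split[OF assms[unfolded cn_def]] by metis
  have "circ (cn v w) (cn w x) (Inl ` (I1 \<union> I2))"
    using * by (intro circI[of "Inl ` I1" _ "Inl ` I2"]) (auto simp: cn_def)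
  then have "circ (circ (cn v w) (cn w x)) (cn w y) \<omega>"
  proof (rule circI[rotated 3])
    show "Inl ` (I1 \<union> I2) \<subseteq> \<omega>" using *(1,2) by (auto simp: eds_def)
    show "Inl ` I3 \<subseteq> \<omega>" using *(3) by (auto simp: eds_def)
    show "Inl ` (I1 \<union> I2) \<inter> Inl ` I3 = {}" using *(5,6) by blast
    show "cn w y (Inl ` I3)" using *(9) by (simp add: cn_def)
  qed
  moreover have "w \<in> clus (eds \<omega>) v" using conn_mono[OF *(1,7)] by (simp add: clus_def)
  ultimately show ?thesis by blast
qed

lemma tree_circ_hit:
  assumes "cn v x \<omega>" "hit i v \<omega>"
  shows "\<exists>w\<in>clus (eds \<omega>) v. circ (circ (cn v w) (cn w x)) (hit i w) \<omega>"
proof -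
  obtain y where y: "y \<in> grn i \<omega>" "conn (eds \<omega>) v y" using assms by (auto simp: hit_def)
  obtain w I1 I2 I3 where *: "I1 \<subseteq> eds \<omega>" "I2 \<subseteq> eds \<omega>" "I3 \<subseteq> eds \<omega>" "I1 \<inter> I2 = {}" "I1 \<inter> I3 = {}" "I2 \<inter> I3 = {}"
    "conn I1 v w" "conn I2 w x" "conn I3 w y"
    using tree_split[OF assms(1)[unfolded cn_def] y(2)] by metis
  have "circ (cn v w) (cn w x) (Inl ` (I1 \<union> I2))"
    using * by (intro circI[of "Inl ` I1" _ "Inl ` I2"]) (auto simp: cn_def)
  then have "circ (circ (cn v w) (cn w x)) (hit i w) \<omega>"
  proof (rule circI[rotated 3])
    show "Inl ` (I1 \<union> I2) \<subseteq> \<omega>" using *(1,2) by (auto simp: eds_def)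
    show "insert (Inr (i, y)) (Inl ` I3) \<subseteq> \<omega>" using *(3) y(1) by (auto simp: eds_def grn_def)
    show "Inl ` (I1 \<union> I2) \<inter> insert (Inr (i, y)) (Inl ` I3) = {}" using *(5,6) by blast
    show "hit i w (insert (Inr (i, y)) (Inl ` I3))" using *(9) by (auto simp: hit_def)
  qed
  moreover have "w \<in> clus (eds \<omega>) v" using conn_mono[OF *(1,7)] by (simp add: clus_def)
  ultimately show ?thesis by blast
qed

text \<open>Everything a cluster with vertex set \<open>A\<close> consists of. Disjoint vertex sets
  give disjoint restrictions, and this is how disjoint clusters become disjoint witnesses; the empty
  edge is excluded because it would lie in all of them.\<close>

definition res :: "'a set \<Rightarrow> 'a coord set \<Rightarrow> 'a coord set" where
  "res A \<omega> = \<omega> \<inter> (Inl ` {e. e \<subseteq> A \<and> e \<noteq> {}} \<union> Inr ` (UNIV \<times> A))"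

lemma res_subset: "res A \<omega> \<subseteq> \<omega>"
  by (auto simp: res_def)

lemma res_disjoint: "A \<inter> B = {} \<Longrightarrow> res A \<omega> \<inter> res B \<omega> = {}"
  by (auto simp: res_def)

lemma clus_res: "clus (eds (res (clus (eds \<omega>) v) \<omega>)) v = clus (eds \<omega>) v"
proof (intro equalityI subsetI)
  fix u assume "u \<in> clus (eds (res (clus (eds \<omega>) v) \<omega>)) v"
  then show "u \<in> clus (eds \<omega>) v"
    using clus_mono[OF eds_mono[OF res_subset]] by fast
next
  fix u assume "u \<in> clus (eds \<omega>) v"
  then have "conn (eds \<omega>) v u" by (simp add: clus_def)
  then show "u \<in> clus (eds (res (clus (eds \<omega>) v) \<omega>)) v"
  proof (induction rule: conn_induct)
    case (step y z)
    then have "conn (eds \<omega>) v z" using conn_edge conn_trans by fast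
    then have "{y, z} \<in> eds (res (clus (eds \<omega>) v) \<omega>)"
      using step by (auto simp: res_def eds_def clus_def)
    then show ?case using step conn_edge conn_trans unfolding clus_def by fast
  qed simp
qed

lemma hit_res: "hit i v (res (clus (eds \<omega>) v) \<omega>) \<longleftrightarrow> hit i v \<omega>"
  unfolding hit_iff clus_res by (auto simp: res_def grn_def)

lemma fprob_superset:
  assumes "finite F" "Z \<subseteq> F"
  shows "fprob F r (\<lambda>\<omega>. Z \<subseteq> \<omega>) = (\<Prod>c\<in>Z. r c)"
proof -
  have fZ: "finite Z" using assms finite_subset by blast
  have "fprob F r (\<lambda>\<omega>. Z \<subseteq> \<omega>) = fprob Z r (\<lambda>\<omega>. Z \<subseteq> \<omega>)"
    using assms by (intro fprob_restrict) auto
  also have "\<dots> = (\<Sum>\<omega>\<in>Pow Z. if \<omega> = Z then bern_weight Z r \<omega> else 0)"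
    unfolding fprob_def fexp_def by (intro sum.cong) auto
  also have "\<dots> = (\<Prod>c\<in>Z. r c)"
    using fZ by (simp add: bern_weight_def)
  finally show ?thesis .
qed

lemma fprob_mem_le:
  assumes "finite F" "probs r"
  shows "fprob F r (\<lambda>\<omega>. c \<in> \<omega>) \<le> r c"
proof (cases "c \<in> F")
  case True
  then show ?thesis using fprob_superset[of F "{c}" r] assms by simp
next
  case False
  then have "fprob F r (\<lambda>\<omega>. c \<in> \<omega>) = fprob F r (\<lambda>\<omega>. False)"
    by (intro fprob_cong) auto
  then show ?thesis using assms by (simp add: probs_def)
qed

lemma agree_tch:
  assumes "\<omega> \<inter> tch A = \<omega>' \<inter> tch A"
  shows "e \<inter> A \<noteq> {} \<Longrightarrow> e \<in> eds \<omega> \<longleftrightarrow> e \<in> eds \<omega>'" "x \<in> A \<Longrightarrow> x \<in> grn i \<omega> \<longleftrightarrow> x \<in> grn i \<omega>'"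
proof -
  show "e \<in> eds \<omega> \<longleftrightarrow> e \<in> eds \<omega>'" if "e \<inter> A \<noteq> {}"
  proof -
    have "Inl e \<in> tch A" using that by (auto simp: tch_def)
    then show ?thesis using assms unfolding eds_def by blast
  qed
  show "x \<in> grn i \<omega> \<longleftrightarrow> x \<in> grn i \<omega>'" if "x \<in> A"
  proof -
    have "Inr (i, x) \<in> tch A" using that by (auto simp: tch_def)
    then show ?thesis using assms unfolding grn_def by blast
  qed
qed

lemma clus_tch:
  assumes "\<omega> \<inter> tch A = \<omega>' \<inter> tch A" "clus (eds \<omega>) v \<subseteq> A"
  shows "clus (eds \<omega>') v = clus (eds \<omega>) v" "hit i v \<omega>' = hit i v \<omega>"
proof -
  show *: "clus (eds \<omega>') v = clus (eds \<omega>) v"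
    using assms(2) agree_tch(1)[OF assms(1)] by (rule clus_local)
  show "hit i v \<omega>' = hit i v \<omega>"
    unfolding hit_iff * using agree_tch(2)[OF assms(1)] assms(2) by blast
qed

section \<open>Disjoint occurrence of several events\<close>

definition disj_occ :: "('i \<Rightarrow> 'c set \<Rightarrow> bool) \<Rightarrow> 'i set \<Rightarrow> 'c set \<Rightarrow> bool" where
  "disj_occ U I \<omega> \<longleftrightarrow> (\<exists>J. (\<forall>i\<in>I. J i \<subseteq> \<omega> \<and> U i (J i)) \<and> disjoint_family_on J I)"

lemma inc_disj_occ: "inc (disj_occ U I)"
  unfolding inc_def disj_occ_def by (meson subset_trans)

lemma disj_occ_insert:
  assumes "disj_occ U (insert j I) \<omega>" "j \<notin> I"
  shows "circ (U j) (disj_occ U I) \<omega>"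
proof -
  obtain J where J: "\<forall>i\<in>insert j I. J i \<subseteq> \<omega> \<and> U i (J i)" "disjoint_family_on J (insert j I)"
    using assms(1) unfolding disj_occ_def by blast
  show ?thesis
  proof (rule circI[of "J j" _ "\<Union>i\<in>I. J i"])
    show "J j \<inter> (\<Union>i\<in>I. J i) = {}"
      using J(2) assms(2) by (force simp: disjoint_family_on_def)
    have "disjoint_family_on J I" using J(2) by (rule disjoint_family_on_mono[rotated]) auto
    then show "disj_occ U I (\<Union>i\<in>I. J i)"
      unfolding disj_occ_def using J(1) by (intro exI[of _ J]) auto
  qed (use J(1) in auto)
qed

lemma bk_family:
  assumes "finite F" "probs r" "finite I" "\<And>i. i \<in> I \<Longrightarrow> inc (U i)"
  shows "fprob F r (disj_occ U I) \<le> (\<Prod>i\<in>I. fprob F r (U i))"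
  using assms(3,4)
proof (induction I rule: finite_induct)
  case empty
  then show ?case using fprob_le_1[OF assms(1,2)] by simp
next
  case (insert j I)
  have "fprob F r (disj_occ U (insert j I)) \<le> fprob F r (circ (U j) (disj_occ U I))"
    using insert.hyps(2) by (intro fprob_mono assms(2) disj_occ_insert)
  also have "\<dots> \<le> fprob F r (U j) * fprob F r (disj_occ U I)"
    by (intro bk_simple assms(1,2) inc_disj_occ insert.prems) simp
  also have "\<dots> \<le> fprob F r (U j) * (\<Prod>i\<in>I. fprob F r (U i))"
    using insert by (intro mult_left_mono fprob_nonneg assms) auto
  finally show ?case using insert by simp
qed

text \<open>The decreasing event stays with the factor \<open>U j\<close>, which will be the cluster
  that it concerns.\<close>

lemma bk_family_dec:
  assumes "finite F" "probs r" "finite I" "\<And>i. i \<in> I \<Longrightarrow> inc (U i)" "j \<in> I" "dec D"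
  shows "fprob F r (\<lambda>\<omega>. disj_occ U I \<omega> \<and> D \<omega>) \<le> fprob F r (\<lambda>\<omega>. U j \<omega> \<and> D \<omega>) * (\<Prod>i\<in>I-{j}. fprob F r (U i))"
proof -
  have I: "I = insert j (I - {j})" using assms by auto
  have "fprob F r (\<lambda>\<omega>. disj_occ U I \<omega> \<and> D \<omega>) \<le> fprob F r (\<lambda>\<omega>. circ (U j) (disj_occ U (I - {j})) \<omega> \<and> D \<omega>)"
    using I disj_occ_insert[of U j "I - {j}"] by (intro fprob_mono assms) auto
  also have "\<dots> \<le> fprob F r (\<lambda>\<omega>. U j \<omega> \<and> D \<omega>) * fprob F r (disj_occ U (I - {j}))"
    using assms by (intro bk_inequality inc_disj_occ) auto
  also have "\<dots> \<le> fprob F r (\<lambda>\<omega>. U j \<omega> \<and> D \<omega>) * (\<Prod>i\<in>I-{j}. fprob F r (U i))"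
    using assms by (intro mult_left_mono bk_family fprob_nonneg) auto
  finally show ?thesis .
qed

text \<open>Each event is read off the configuration inside its own cluster, and these parts of the
  configuration are disjoint.\<close>

lemma disj_occ_clusters:
  assumes "disjoint_family_on (\<lambda>i. clus (eds \<omega>) (v i)) I"
    and "\<And>i. i \<in> I \<Longrightarrow> U i (res (clus (eds \<omega>) (v i)) \<omega>)"
  shows "disj_occ U I \<omega>"
  unfolding disj_occ_def using assms
  by (intro exI[of _ "\<lambda>i. res (clus (eds \<omega>) (v i)) \<omega>"])
    (auto simp: res_subset disjoint_family_on_def res_disjoint)

section \<open>Exploration and tree graph bounds in a finite volume\<close>

locale ghost_volume =
  fixes \<Omega> :: "'a coord set" and r :: "'a coord \<Rightarrow> real" and X :: "'a set"
  assumes fin: "finite \<Omega>" and pr: "probs r" and finX: "finite X"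
    and edX: "e \<in> eds \<Omega> \<Longrightarrow> e \<subseteq> X"
begin

abbreviation "P \<equiv> fprob \<Omega> r"
abbreviation "EE \<equiv> fexp \<Omega> r"

definition T where "T x y = P (cn x y)"
definition M where "M i x = P (hit i x)"
definition Q where "Q i S s = P (qhit i S s)"

lemma T_nonneg: "0 \<le> T x y" and M_nonneg: "0 \<le> M i x" and Q_nonneg: "0 \<le> Q i S s"
  by (simp_all add: T_def M_def Q_def fprob_nonneg pr)

lemma T_le_1: "T x y \<le> 1" and M_le_1: "M i x \<le> 1"
  by (simp_all add: T_def M_def fprob_le_1 fin pr)

lemma T_sym: "T x y = T y x"
  unfolding T_def cn_def by (intro fprob_cong) (auto intro: conn_sym)

lemma clus_in_X: "\<omega> \<subseteq> \<Omega> \<Longrightarrow> v \<in> X \<Longrightarrow> clus (eds \<omega>) v \<subseteq> X"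
  using clus_subset[of "eds \<omega>" v] edX eds_mono[of \<omega> \<Omega>] by blast

text \<open>Markov property of an exploration. By \<open>loc\<close>, the event
  \<open>\<Phi>\<close> and the set \<open>S\<close> that the exploration finds are decided by the
  coordinates touching \<open>S\<close>; the variable \<open>R A\<close> sees only the other
  coordinates, so it is independent of the event that \<open>A\<close> is found.\<close>

lemma explore:
  fixes S :: "'a coord set \<Rightarrow> 'a set" and R :: "'a set \<Rightarrow> 'a coord set \<Rightarrow> real"
  assumes loc: "\<And>\<omega> \<omega>'. \<Phi> \<omega> \<Longrightarrow> \<omega> \<inter> tch (S \<omega>) = \<omega>' \<inter> tch (S \<omega>) \<Longrightarrow> \<Phi> \<omega>' \<and> S \<omega>' = S \<omega>"
    and R: "\<And>A \<omega>. R A \<omega> = R A (\<omega> - tch A)"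
  shows "EE (\<lambda>\<omega>. of_bool (\<Phi> \<omega>) * R (S \<omega>) \<omega>) = EE (\<lambda>\<omega>. of_bool (\<Phi> \<omega>) * EE (R (S \<omega>)))"
proof -
  define SS where "SS = S ` Pow \<Omega>"
  have finSS: "finite SS" using fin by (simp add: SS_def)
  have split: "of_bool (\<Phi> \<omega>) * f (S \<omega>) = (\<Sum>A\<in>SS. of_bool (\<Phi> \<omega> \<and> S \<omega> = A) * f A)"
    if "\<omega> \<subseteq> \<Omega>" for \<omega> and f :: "'a set \<Rightarrow> real"
  proof -
    have "(\<Sum>A\<in>SS. of_bool (\<Phi> \<omega> \<and> S \<omega> = A) * f A) = (\<Sum>A\<in>SS. if A = S \<omega> then of_bool (\<Phi> \<omega>) * f A else 0)"
      by (intro sum.cong) auto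
    also have "\<dots> = of_bool (\<Phi> \<omega>) * f (S \<omega>)"
      using that finSS by (simp add: SS_def)
    finally show ?thesis ..
  qed
  \<comment> \<open>Both directions of \<open>loc\<close> are needed: a configuration and its
    restriction to \<open>tch A\<close> find \<open>A\<close> together.\<close>
  have dep: "(\<Phi> \<omega> \<and> S \<omega> = A) = (\<Phi> (\<omega> \<inter> tch A) \<and> S (\<omega> \<inter> tch A) = A)" for \<omega> A
    using loc[of \<omega> "\<omega> \<inter> tch A"] loc[of "\<omega> \<inter> tch A" \<omega>] by (metis Int_assoc Int_absorb)
  have "EE (\<lambda>\<omega>. of_bool (\<Phi> \<omega>) * R (S \<omega>) \<omega>) = EE (\<lambda>\<omega>. \<Sum>A\<in>SS. of_bool (\<Phi> \<omega> \<and> S \<omega> = A) * R A \<omega>)"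
    by (intro fexp_cong split[of _ "\<lambda>A. R A _"])
  also have "\<dots> = (\<Sum>A\<in>SS. EE (\<lambda>\<omega>. of_bool (\<Phi> \<omega> \<and> S \<omega> = A) * R A \<omega>))"
    by (rule fexp_sum)
  also have "\<dots> = (\<Sum>A\<in>SS. EE (\<lambda>\<omega>. of_bool (\<Phi> \<omega> \<and> S \<omega> = A)) * EE (R A))"
  proof (intro sum.cong refl fexp_indep[OF fin])
    fix A \<omega>
    show "of_bool (\<Phi> \<omega> \<and> S \<omega> = A) = (of_bool (\<Phi> (\<omega> \<inter> tch A) \<and> S (\<omega> \<inter> tch A) = A) :: real)"
      using dep[of \<omega> A] by simp
    show "R A \<omega> = R A (\<omega> - tch A)" by (rule R)
  qed
  also have "\<dots> = (\<Sum>A\<in>SS. EE (\<lambda>\<omega>. of_bool (\<Phi> \<omega> \<and> S \<omega> = A) * EE (R A)))"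
    by (simp add: fexp_cmult2)
  also have "\<dots> = EE (\<lambda>\<omega>. \<Sum>A\<in>SS. of_bool (\<Phi> \<omega> \<and> S \<omega> = A) * EE (R A))"
    by (rule fexp_sum[symmetric])
  also have "\<dots> = EE (\<lambda>\<omega>. of_bool (\<Phi> \<omega>) * EE (R (S \<omega>)))"
    by (intro fexp_cong split[symmetric, of _ "\<lambda>A. EE (R A)"])
  finally show ?thesis .
qed

lemma explore_prob:
  assumes loc: "\<And>\<omega> \<omega>'. \<Phi> \<omega> \<Longrightarrow> \<omega> \<inter> tch (S \<omega>) = \<omega>' \<inter> tch (S \<omega>) \<Longrightarrow> \<Phi> \<omega>' \<and> S \<omega>' = S \<omega>"
    and R: "\<And>A \<omega>. R A \<omega> = R A (\<omega> - tch A)"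
  shows "P (\<lambda>\<omega>. \<Phi> \<omega> \<and> R (S \<omega>) \<omega>) = EE (\<lambda>\<omega>. of_bool (\<Phi> \<omega>) * P (R (S \<omega>)))"
proof -
  have "P (\<lambda>\<omega>. \<Phi> \<omega> \<and> R (S \<omega>) \<omega>) = EE (\<lambda>\<omega>. of_bool (\<Phi> \<omega>) * of_bool (R (S \<omega>) \<omega>))"
    unfolding fprob_def by (intro fexp_cong) auto
  also have "\<dots> = EE (\<lambda>\<omega>. of_bool (\<Phi> \<omega>) * EE (\<lambda>\<omega>'. of_bool (R (S \<omega>) \<omega>')))"
    using assms(1) by (rule explore[of \<Phi> S "\<lambda>A \<omega>. of_bool (R A \<omega>)"]) (use R in auto)
  finally show ?thesis by (simp add: fprob_def)
qed

text \<open>The decreasing event is carried by the innermost branch, from \<open>v\<close> to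
  \<open>w\<close>; it will say that the cluster of \<open>v\<close> is not green.\<close>

lemma tree_dec:
  assumes "v \<in> X" "dec D"
  shows "P (\<lambda>\<omega>. cn v x \<omega> \<and> cn v y \<omega> \<and> D \<omega>) \<le> (\<Sum>w\<in>X. P (\<lambda>\<omega>. cn v w \<omega> \<and> D \<omega>) * T w x * T w y)"
proof -
  have "P (\<lambda>\<omega>. cn v x \<omega> \<and> cn v y \<omega> \<and> D \<omega>)
      \<le> (\<Sum>w\<in>X. P (\<lambda>\<omega>. circ (circ (cn v w) (cn w x)) (cn w y) \<omega> \<and> D \<omega>))"
  proof (intro fprob_union_bound pr finX)
    fix \<omega> assume \<omega>: "\<omega> \<subseteq> \<Omega>" and *: "cn v x \<omega> \<and> cn v y \<omega> \<and> D \<omega>"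
    then obtain w where "w \<in> clus (eds \<omega>) v" "circ (circ (cn v w) (cn w x)) (cn w y) \<omega>"
      using tree_circ[of v x \<omega> y] by auto
    then show "\<exists>w\<in>X. circ (circ (cn v w) (cn w x)) (cn w y) \<omega> \<and> D \<omega>"
      using clus_in_X[OF \<omega> assms(1)] * by auto
  qed
  also have "\<dots> \<le> (\<Sum>w\<in>X. P (\<lambda>\<omega>. cn v w \<omega> \<and> D \<omega>) * T w x * T w y)"
  proof (rule sum_mono)
    fix w
    have "P (\<lambda>\<omega>. circ (circ (cn v w) (cn w x)) (cn w y) \<omega> \<and> D \<omega>)
        \<le> P (\<lambda>\<omega>. circ (cn v w) (cn w x) \<omega> \<and> D \<omega>) * P (cn w y)"
      by (intro bk_inequality fin pr inc_circ inc_cn assms)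
    also have "\<dots> \<le> P (\<lambda>\<omega>. cn v w \<omega> \<and> D \<omega>) * P (cn w x) * P (cn w y)"
      by (intro mult_right_mono bk_inequality fin pr inc_cn assms fprob_nonneg)
    finally show "P (\<lambda>\<omega>. circ (circ (cn v w) (cn w x)) (cn w y) \<omega> \<and> D \<omega>)
      \<le> P (\<lambda>\<omega>. cn v w \<omega> \<and> D \<omega>) * T w x * T w y" by (simp add: T_def)
  qed
  finally show ?thesis .
qed

lemma tree_hit:
  assumes "v \<in> X"
  shows "P (\<lambda>\<omega>. cn v x \<omega> \<and> hit i v \<omega>) \<le> (\<Sum>w\<in>X. T v w * T w x * M i w)"
proof -
  have "P (\<lambda>\<omega>. cn v x \<omega> \<and> hit i v \<omega>)
      \<le> (\<Sum>w\<in>X. P (circ (circ (cn v w) (cn w x)) (hit i w)))"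
  proof (intro fprob_union_bound pr finX)
    fix \<omega> assume \<omega>: "\<omega> \<subseteq> \<Omega>" and *: "cn v x \<omega> \<and> hit i v \<omega>"
    then obtain w where "w \<in> clus (eds \<omega>) v" "circ (circ (cn v w) (cn w x)) (hit i w) \<omega>"
      using tree_circ_hit[of v x \<omega> i] by auto
    then show "\<exists>w\<in>X. circ (circ (cn v w) (cn w x)) (hit i w) \<omega>"
      using clus_in_X[OF \<omega> assms(1)] by auto
  qed
  also have "\<dots> \<le> (\<Sum>w\<in>X. T v w * T w x * M i w)"
  proof (rule sum_mono)
    fix w
    have "P (circ (circ (cn v w) (cn w x)) (hit i w)) \<le> P (circ (cn v w) (cn w x)) * P (hit i w)"
      by (intro bk_simple fin pr inc_circ inc_hit)
    also have "\<dots> \<le> P (cn v w) * P (cn w x) * P (hit i w)"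
      by (intro mult_right_mono bk_simple fin pr inc_cn fprob_nonneg)
    finally show "P (circ (circ (cn v w) (cn w x)) (hit i w)) \<le> T v w * T w x * M i w"
      by (simp add: T_def M_def)
  qed
  finally show ?thesis .
qed

text \<open>\<open>S\<close> will be an explored cluster. As \<open>M i x\<close> on the left is
  unconditioned, the inequality says that the unexplored region still offers enough green arms
  starting from \<open>S\<close>.\<close>

lemma hit_le_sum:
  assumes "x \<in> S" "finite S"
  shows "M i x \<le> (\<Sum>s\<in>S. T x s * Q i S s)"
proof -
  have "M i x \<le> (\<Sum>s\<in>S. P (circ (cn x s) (qhit i S s)))"
    unfolding M_def
    by (intro fprob_union_bound pr assms(2)) (rule hit_last_exit[OF _ assms(1)])
  also have "\<dots> \<le> (\<Sum>s\<in>S. T x s * Q i S s)"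
    unfolding T_def Q_def by (intro sum_mono bk_simple fin pr inc_cn inc_qhit)
  finally show ?thesis .
qed

lemma Q_le_M: "Q i S s \<le> M i s"
  unfolding Q_def M_def by (intro fprob_mono pr qhit_imp_hit)

lemma Q_le_sum:
  assumes "s \<in> S" "s \<in> X"
  shows "Q i S s \<le> r (Inr (i, s)) + (\<Sum>b\<in>{b. {s, b} \<in> eds \<Omega>} - S. P (\<lambda>\<omega>. hit i b (\<omega> - tch S)))"
proof -
  let ?N = "{b. {s, b} \<in> eds \<Omega>} - S"
  have finN: "finite ?N"
    by (rule finite_subset[OF _ finX]) (use edX in auto)
  have "Q i S s \<le> (\<Sum>c\<in>insert None (Some ` ?N). P (case c of None \<Rightarrow> (\<lambda>\<omega>. s \<in> grn i \<omega>)
      | Some b \<Rightarrow> (\<lambda>\<omega>. hit i b (\<omega> - tch S))))"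
    unfolding Q_def
  proof (intro fprob_union_bound pr)
    fix \<omega> assume "\<omega> \<subseteq> \<Omega>" "qhit i S s \<omega>"
    then show "\<exists>c\<in>insert None (Some ` ?N). (case c of None \<Rightarrow> (\<lambda>\<omega>. s \<in> grn i \<omega>)
      | Some b \<Rightarrow> (\<lambda>\<omega>. hit i b (\<omega> - tch S))) \<omega>"
      using qhit_split[of i S s \<omega>] assms(1) eds_mono[of \<omega> \<Omega>] by (auto; blast)
  qed (use finN in auto)
  also have "\<dots> = P (\<lambda>\<omega>. s \<in> grn i \<omega>) + (\<Sum>b\<in>?N. P (\<lambda>\<omega>. hit i b (\<omega> - tch S)))"
    using finN by (subst sum.insert) (auto simp: sum.reindex)
  also have "P (\<lambda>\<omega>. s \<in> grn i \<omega>) \<le> r (Inr (i, s))"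
    unfolding grn_def using fprob_mem_le[OF fin pr] by simp
  finally show ?thesis by simp
qed

text \<open>Read as a lower bound for reaching colour \<open>i\<close> while avoiding
  \<open>A\<close>: what is lost passes through a vertex of \<open>A\<close>.\<close>

lemma hit_through_bound:
  assumes "finite A"
  shows "M i x \<le> P (\<lambda>\<omega>. x \<notin> A \<and> hit i x (\<omega> - tch A)) + (\<Sum>a\<in>A. T x a * M i a)"
proof -
  have "M i x \<le> (\<Sum>c\<in>insert None (Some ` A). P (case c of None \<Rightarrow> (\<lambda>\<omega>. x \<notin> A \<and> hit i x (\<omega> - tch A))
      | Some a \<Rightarrow> circ (cn x a) (hit i a)))"
    unfolding M_def
  proof (intro fprob_union_bound pr)
    fix \<omega> assume "\<omega> \<subseteq> \<Omega>" "hit i x \<omega>"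
    then show "\<exists>c\<in>insert None (Some ` A). (case c of None \<Rightarrow> (\<lambda>\<omega>. x \<notin> A \<and> hit i x (\<omega> - tch A))
      | Some a \<Rightarrow> circ (cn x a) (hit i a)) \<omega>"
      using hit_through[of i x \<omega> A] by auto
  qed (use assms in auto)
  also have "\<dots> = P (\<lambda>\<omega>. x \<notin> A \<and> hit i x (\<omega> - tch A)) + (\<Sum>a\<in>A. P (circ (cn x a) (hit i a)))"
    using assms by (subst sum.insert) (auto simp: sum.reindex)
  also have "(\<Sum>a\<in>A. P (circ (cn x a) (hit i a))) \<le> (\<Sum>a\<in>A. T x a * M i a)"
    unfolding T_def M_def by (intro sum_mono bk_simple fin pr inc_cn inc_hit)
  finally show ?thesis by simp
qed

end

section \<open>Transitive graphs\<close>

locale pgraph =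
  fixes V :: "'a set" and E :: "'a set set" and v0 :: 'a
  assumes simple: "simple_graph V E" and connected: "connected_graph V E"
    and locfin: "locally_finite_graph V E" and trans: "transitive_graph V E" and v0: "v0 \<in> V"
begin

abbreviation "d \<equiv> graph_dist E"

definition ball :: "'a \<Rightarrow> nat \<Rightarrow> 'a set" where "ball x R = {y \<in> V. d x y \<le> R}"

definition N :: "nat \<Rightarrow> nat" where "N R = card (ball v0 R)"

definition nb :: "'a \<Rightarrow> 'a set" where "nb x = {y. {x, y} \<in> E}"

text \<open>The edges that the surgery opens; open, they make the ball connected.\<close>

definition U :: "'a \<Rightarrow> nat \<Rightarrow> 'a set set" where "U a R = {e \<in> E. e \<subseteq> ball a R}"

lemma edge_sub: "e \<in> E \<Longrightarrow> e \<subseteq> V" and edge_card: "e \<in> E \<Longrightarrow> card e = 2"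
  using simple unfolding simple_graph_def by blast+

lemma edge_V: "{x, y} \<in> E \<Longrightarrow> x \<in> V" "{x, y} \<in> E \<Longrightarrow> y \<in> V"
  using edge_sub[of "{x, y}"] by auto

lemma edge_finite: "e \<in> E \<Longrightarrow> finite e"
  using edge_card[of e] by (intro card_ge_0_finite) simp

lemma dist_relpow: "x \<in> V \<Longrightarrow> y \<in> V \<Longrightarrow> (x, y) \<in> adj E ^^ d x y"
  unfolding graph_dist_def
  by (rule LeastI_ex) (use connected in \<open>simp add: connected_graph_def rtrancl_power\<close>)

lemma dist_le: "(x, y) \<in> adj E ^^ n \<Longrightarrow> d x y \<le> n"
  unfolding graph_dist_def by (rule Least_le)

lemma dist_self [simp]: "d x x = 0"
  using dist_le[of x x 0] by simp

lemma dist_sym: "x \<in> V \<Longrightarrow> y \<in> V \<Longrightarrow> d x y = d y x"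
proof -
  have "d y x \<le> d x y" if "x \<in> V" "y \<in> V" for x y
  proof (rule dist_le)
    have "(x, z) \<in> adj E ^^ n \<Longrightarrow> (z, x) \<in> adj E ^^ n" for n z
    proof (induction n arbitrary: z)
      case (Suc n)
      then obtain u where "(x, u) \<in> adj E ^^ n" "{u, z} \<in> E" by auto
      then have "(z, u) \<in> adj E" "(u, x) \<in> adj E ^^ n" using Suc.IH by (auto simp: insert_commute)
      then show ?case by (rule relpow_Suc_I2)
    qed simp
    then show "(y, x) \<in> adj E ^^ d x y" using dist_relpow[OF that] by metis
  qed
  then show "x \<in> V \<Longrightarrow> y \<in> V \<Longrightarrow> d x y = d y x" by (simp add: le_antisym)
qed

lemma dist_triangle: "x \<in> V \<Longrightarrow> y \<in> V \<Longrightarrow> z \<in> V \<Longrightarrow> d x z \<le> d x y + d y z"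
  using dist_relpow[of x y] dist_relpow[of y z] by (intro dist_le) (auto simp: relpow_add)

lemma dist_edge: "{x, y} \<in> E \<Longrightarrow> d x y \<le> 1"
  by (rule dist_le) simp

lemma ball_self: "x \<in> V \<Longrightarrow> x \<in> ball x R"
  by (simp add: ball_def)

lemma ball_sub: "ball x R \<subseteq> V"
  by (auto simp: ball_def)

lemma ball_mono: "R \<le> R' \<Longrightarrow> ball x R \<subseteq> ball x R'"
  by (auto simp: ball_def)

lemma ball_subset: "x \<in> V \<Longrightarrow> y \<in> V \<Longrightarrow> d x y + r \<le> R \<Longrightarrow> ball y r \<subseteq> ball x R"
  using dist_triangle by (fastforce simp: ball_def)

lemma finite_nb: "x \<in> V \<Longrightarrow> finite (nb x)"
proof -
  assume "x \<in> V"
  then have "finite (\<Union>{e \<in> E. x \<in> e})"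
    using locfin edge_finite unfolding locally_finite_graph_def by blast
  then show ?thesis by (rule finite_subset[rotated]) (auto simp: nb_def)
qed

lemma nb_ball: "x \<in> V \<Longrightarrow> nb x \<subseteq> ball x 1"
  using dist_edge edge_V by (fastforce simp: nb_def ball_def)

lemma finite_ball: assumes "x \<in> V" shows "finite (ball x R)"
proof (induction R)
  case 0
  have "ball x 0 \<subseteq> {x}" using dist_relpow[OF assms] by (fastforce simp: ball_def)
  then show ?case by (rule finite_subset) simp
next
  case (Suc R)
  have "ball x (Suc R) \<subseteq> ball x R \<union> (\<Union>y\<in>ball x R. nb y)"
  proof
    fix z assume z: "z \<in> ball x (Suc R)"
    show "z \<in> ball x R \<union> (\<Union>y\<in>ball x R. nb y)"
    proof (cases "d x z \<le> R")
      case False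
      then have "d x z = Suc R" using z by (simp add: ball_def)
      then have "(x, z) \<in> adj E ^^ Suc R" using dist_relpow[of x z] assms z by (simp add: ball_def)
      then obtain y where y: "(x, y) \<in> adj E ^^ R" "{y, z} \<in> E" by auto
      then have "y \<in> ball x R" using edge_V by (auto simp: ball_def dist_le)
      then show ?thesis using y by (auto simp: nb_def)
    qed (use z in \<open>simp add: ball_def\<close>)
  qed
  moreover have "finite (ball x R \<union> (\<Union>y\<in>ball x R. nb y))"
    using Suc finite_nb by (auto simp: ball_def)
  ultimately show ?case by (rule finite_subset)
qed

lemma finite_U: "a \<in> V \<Longrightarrow> finite (U a R)"
  by (rule finite_subset[of _ "Pow (ball a R)"]) (auto simp: U_def finite_ball)

lemma U_sub: "U a R \<subseteq> E" by (auto simp: U_def)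

lemma U_mono: "R \<le> R' \<Longrightarrow> U a R \<subseteq> U a R'"
  using ball_mono unfolding U_def by blast

text \<open>A geodesic from the centre stays in the ball.\<close>

lemma conn_U:
  assumes "a \<in> V" "y \<in> ball a R" shows "conn (U a R) a y"
proof -
  have "(a, y) \<in> adj E ^^ n \<Longrightarrow> n \<le> R \<Longrightarrow> conn (U a R) a y" for n
  proof (induction n arbitrary: y)
    case (Suc n)
    then obtain z where z: "(a, z) \<in> adj E ^^ n" "{z, y} \<in> E" by auto
    have "{z, y} \<in> U a R"
      using z Suc.prems dist_le[OF z(1)] dist_le[OF Suc.prems(1)] edge_V[of z y] by (auto simp: U_def ball_def)
    then show ?case using Suc.IH[OF z(1)] Suc.prems(2) conn_edge conn_trans by fastforce
  qed simp
  then show ?thesis using dist_relpow[of a y] assms by (auto simp: ball_def)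
qed

lemma aut_ex: "x \<in> V \<Longrightarrow> y \<in> V \<Longrightarrow> \<exists>h\<in>graph_aut V E. h x = y"
  using trans by (auto simp: transitive_graph_def)

lemma aut_props:
  assumes "h \<in> graph_aut V E"
  shows "inj_on h V" "h ` V = V" "x \<in> V \<Longrightarrow> y \<in> V \<Longrightarrow> {h x, h y} \<in> E \<longleftrightarrow> {x, y} \<in> E"
  using assms by (auto simp: graph_aut_def bij_betw_def)

lemma aut_edge: assumes "h \<in> graph_aut V E" "e \<in> E" shows "h ` e \<in> E"
proof -
  obtain x y where "e = {x, y}" using edge_card[OF assms(2)] by (auto simp: card_2_iff)
  then show ?thesis using aut_props(3)[OF assms(1), of x y] assms(2) edge_V by auto
qed

lemma aut_inv:
  assumes "h \<in> graph_aut V E" shows "inv_into V h \<in> graph_aut V E"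
proof -
  note p = aut_props[OF assms]
  have b: "bij_betw (inv_into V h) V V"
    using assms by (auto simp: graph_aut_def intro: bij_betw_inv_into)
  have "{u, w} \<in> E \<longleftrightarrow> {inv_into V h u, inv_into V h w} \<in> E" if "u \<in> V" "w \<in> V" for u w
    using p(3)[of "inv_into V h u" "inv_into V h w"] that p(2)
    by (simp add: inv_into_into f_inv_into_f)
  then show ?thesis using b by (simp add: graph_aut_def)
qed

lemma aut_dist:
  assumes h: "h \<in> graph_aut V E" and xy: "x \<in> V" "y \<in> V"
  shows "d (h x) (h y) = d x y"
proof -
  have le: "d (h x) (h y) \<le> d x y" if "h \<in> graph_aut V E" "x \<in> V" "y \<in> V" for h x y
  proof (rule dist_le)
    have "(x, z) \<in> adj E ^^ n \<Longrightarrow> (h x, h z) \<in> adj E ^^ n" for n z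
    proof (induction n arbitrary: z)
      case (Suc n)
      then obtain u where "(x, u) \<in> adj E ^^ n" "{u, z} \<in> E" by auto
      then have "(h x, h u) \<in> adj E ^^ n" "{h u, h z} \<in> E"
        using Suc.IH aut_edge[OF that(1), of "{u, z}"] by auto
      then show ?case by auto
    qed auto
    then show "(h x, h y) \<in> adj E ^^ d x y" using dist_relpow that by blast
  qed
  have "d (inv_into V h (h x)) (inv_into V h (h y)) \<le> d (h x) (h y)"
    using le[OF aut_inv[OF h], of "h x" "h y"] aut_props(2)[OF h] xy by auto
  then show ?thesis
    using le[OF h xy] xy aut_props(1)[OF h] by simp
qed

lemma card_ball: assumes "x \<in> V" shows "card (ball x R) = N R"
proof -
  obtain h where h: "h \<in> graph_aut V E" "h v0 = x" using aut_ex[OF v0 assms] by auto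
  have "ball x R = h ` ball v0 R"
  proof (intro equalityI subsetI)
    fix y assume y: "y \<in> ball x R"
    then have "y \<in> h ` V" using aut_props(2)[OF h(1)] by (auto simp: ball_def)
    then obtain z where "z \<in> V" "y = h z" by auto
    then show "y \<in> h ` ball v0 R" using y aut_dist[OF h(1) v0] h(2) by (auto simp: ball_def)
  next
    fix y assume "y \<in> h ` ball v0 R"
    then show "y \<in> ball x R"
      using aut_dist[OF h(1) v0] aut_props(2)[OF h(1)] h(2) by (auto simp: ball_def)
  qed
  moreover have "inj_on h (ball v0 R)"
    using aut_props(1)[OF h(1)] ball_sub by (rule inj_on_subset)
  ultimately show ?thesis by (simp add: N_def card_image)
qed

lemma N_pos: "1 \<le> N R"
  using finite_ball[OF v0, of R] ball_self[OF v0, of R] unfolding N_def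
  by (metis One_nat_def Suc_leI card_gt_0_iff empty_iff)

lemma card_nb: "x \<in> V \<Longrightarrow> card (nb x) \<le> N 1"
  using card_mono[OF finite_ball nb_ball] card_ball by simp

text \<open>Edges are counted as subsets of the ball. The bound is crude, but it only has to be
  independent of \<open>a\<close>.\<close>

lemma card_U: "a \<in> V \<Longrightarrow> card (U a R) \<le> 2 ^ N R"
  using card_mono[of "Pow (ball a R)" "U a R"] finite_ball[of a R] card_ball[of a R]
  by (auto simp: U_def card_Pow)

lemma far_vertex:
  assumes "infinite V" "finite W" "W \<subseteq> V"
  shows "\<exists>y\<in>V. \<forall>w\<in>W. d w y \<ge> K"
proof -
  have "finite (\<Union>w\<in>W. ball w K)" using assms finite_ball by auto
  then obtain y where "y \<in> V" "y \<notin> (\<Union>w\<in>W. ball w K)"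
    using assms(1) by (meson finite_subset subsetI)
  then show ?thesis by (force simp: ball_def)
qed

section \<open>Finite edge sets and automorphisms\<close>

definition fins :: "'a set set set" where "fins = {F. finite F \<and> F \<subseteq> E}"

lemma fins_empty: "{} \<in> fins" and fins_Un: "F \<in> fins \<Longrightarrow> G \<in> fins \<Longrightarrow> F \<union> G \<in> fins"
  and fins_sub: "F \<in> fins \<Longrightarrow> G \<subseteq> F \<Longrightarrow> G \<in> fins"
  by (auto simp: fins_def finite_subset)

lemma fins_U: "a \<in> V \<Longrightarrow> U a R \<in> fins"
  by (simp add: fins_def finite_U U_sub)

lemma fins_finite_UN: "F \<in> fins \<Longrightarrow> finite (\<Union>F)"
  using edge_finite unfolding fins_def by blast

lemma finite_clus: "F \<in> fins \<Longrightarrow> finite (clus F x)"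
  using clus_subset[of F x] fins_finite_UN[of F] by (metis finite_insert finite_subset)

lemma clus_sub_V: "F \<subseteq> E \<Longrightarrow> x \<in> V \<Longrightarrow> clus F x \<subseteq> V"
  using clus_subset[of F x] edge_sub by blast

lemma card_clus_mono: "F \<in> fins \<Longrightarrow> G \<subseteq> F \<Longrightarrow> card (clus G x) \<le> card (clus F x)"
  by (intro card_mono finite_clus clus_mono)

lemma aut_conn:
  assumes h: "h \<in> graph_aut V E" and F: "F \<subseteq> E" and xy: "x \<in> V" "y \<in> V"
  shows "conn ((`) h ` F) (h x) (h y) \<longleftrightarrow> conn F x y"
proof
  assume "conn F x y"
  then show "conn ((`) h ` F) (h x) (h y)"
  proof (induction rule: conn_induct)
    case (step y z)
    then have "{h y, h z} \<in> (`) h ` F" using step(2) by (intro image_eqI[of _ _ "{y, z}"]) auto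
    then show ?case by (rule conn_trans[OF step(3) conn_edge])
  qed simp
next
  assume "conn ((`) h ` F) (h x) (h y)"
  moreover have "conn ((`) h ` F) (h x) u \<Longrightarrow> \<exists>z\<in>V. u = h z \<and> conn F x z" for u
  proof (induction rule: conn_induct)
    case (step u w)
    then obtain z e where z: "z \<in> V" "u = h z" "conn F x z" "e \<in> F" "{u, w} = h ` e" by auto
    obtain a b where ab: "e = {a, b}" using edge_card[of e] z F by (auto simp: card_2_iff)
    have abV: "a \<in> V" "b \<in> V" "{b, a} \<in> F" using ab z F edge_V[of a b] by (auto simp: insert_commute)
    have "{h z, w} = {h a, h b}" using z ab by auto
    then consider "h z = h a" "w = h b" | "h z = h b" "w = h a" by (auto simp: doubleton_eq_iff)
    then show ?case
    proof cases
      case 1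
      then have "z = a" using aut_props(1)[OF h] z(1) abV by (auto dest: inj_onD)
      then have "conn F x b" using conn_trans[OF z(3) conn_edge[of z b]] z(4) ab by simp
      then show ?thesis using 1 abV by auto
    next
      case 2
      then have "z = b" using aut_props(1)[OF h] z(1) abV by (auto dest: inj_onD)
      then have "conn F x a" using conn_trans[OF z(3) conn_edge[of z a]] abV(3) by simp
      then show ?thesis using 2 abV by auto
    qed
  qed (use xy in auto)
  ultimately obtain z where "z \<in> V" "h y = h z" "conn F x z" by blast
  then show "conn F x y" using aut_props(1)[OF h] xy by (auto dest: inj_onD)
qed

lemma aut_clus:
  assumes h: "h \<in> graph_aut V E" and F: "F \<subseteq> E" and x: "x \<in> V"
  shows "clus ((`) h ` F) (h x) = h ` clus F x"
proof -
  have sub: "(`) h ` F \<subseteq> E" using aut_edge[OF h] F by auto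
  have "h x \<in> V" using aut_props(2)[OF h] x by auto
  then have "clus ((`) h ` F) (h x) \<subseteq> h ` V"
    using clus_sub_V[OF sub] aut_props(2)[OF h] by simp
  then show ?thesis
    using aut_conn[OF h F x] clus_sub_V[OF F x] unfolding clus_def by auto
qed

lemma aut_card_clus:
  assumes h: "h \<in> graph_aut V E" and F: "F \<subseteq> E" and x: "x \<in> V"
  shows "card (clus ((`) h ` F) (h x)) = card (clus F x)"
  using aut_clus[OF assms] clus_sub_V[OF F x] aut_props(1)[OF h]
  by (simp add: card_image inj_on_subset)

lemma aut_fins: "h \<in> graph_aut V E \<Longrightarrow> F \<in> fins \<Longrightarrow> (`) h ` F \<in> fins"
  using aut_edge by (auto simp: fins_def)

lemma aut_fexp:
  assumes h: "h \<in> graph_aut V E" and F: "F \<in> fins"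
  shows "fexp ((`) h ` F) (\<lambda>_. p) Y = fexp F (\<lambda>_. p) (\<lambda>\<eta>. Y ((`) h ` \<eta>))"
proof -
  have "inj_on ((`) h) F"
    using aut_props(1)[OF h] F edge_sub unfolding fins_def
    by (intro inj_onI) (metis (no_types, lifting) inj_on_image_eq_iff mem_Collect_eq subsetD)
  then show ?thesis using F by (simp add: fexp_image fins_def comp_def)
qed

section \<open>Infinite volume limits\<close>

definition good :: "('a set set \<Rightarrow> real) \<Rightarrow> bool" where
  "good Y \<longleftrightarrow> (\<forall>F\<in>fins. 0 \<le> Y F \<and> Y F \<le> 1 \<and> (\<forall>G\<subseteq>F. Y G \<le> Y F))"

text \<open>For a variable that is monotone in the edge set this is its expectation on the whole
  graph, reached without integrating over infinite configurations.\<close>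

definition supf :: "real \<Rightarrow> ('a set set \<Rightarrow> real) \<Rightarrow> real" where
  "supf p Y = (SUP F\<in>fins. fexp F (\<lambda>_. p) Y)"

definition tau where "tau p x y = supf p (\<lambda>\<eta>. of_bool (conn \<eta> x y))"
text \<open>The colours are integrated out: given the edges, a cluster of \<open>k\<close> vertices
  contains no green vertex with probability \<open>(1 - q) ^ k\<close>. So no colouring of
  infinitely many vertices is needed.\<close>

definition magn where "magn p q x = supf p (\<lambda>\<eta>. 1 - (1 - q) ^ card (clus \<eta> x))"
definition tail where "tail p n x = supf p (\<lambda>\<eta>. of_bool (n \<le> card (clus \<eta> x)))"

lemma probs_const: "0 \<le> p \<Longrightarrow> p \<le> 1 \<Longrightarrow> probs (\<lambda>_. p)"
  by (simp add: probs_def)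

lemma good_conn: "good (\<lambda>\<eta>. of_bool (conn \<eta> x y))"
  unfolding good_def by (auto intro: conn_mono)

lemma good_magn: "0 \<le> q \<Longrightarrow> q \<le> 1 \<Longrightarrow> good (\<lambda>\<eta>. 1 - (1 - q) ^ card (clus \<eta> x))"
  unfolding good_def by (auto simp: power_le_one intro!: power_decreasing card_clus_mono)

lemma good_tail: "good (\<lambda>\<eta>. of_bool (n \<le> card (clus \<eta> x)))"
  unfolding good_def using card_clus_mono[of _ _ x] by (auto intro: order_trans)

context
  fixes p :: real assumes p: "0 \<le> p" "p \<le> 1"
begin

lemma fexp_good_bounds:
  assumes "good Y" "F \<in> fins"
  shows "0 \<le> fexp F (\<lambda>_. p) Y" "fexp F (\<lambda>_. p) Y \<le> 1"
proof -
  have Y: "0 \<le> Y \<omega>" "Y \<omega> \<le> 1" if "\<omega> \<subseteq> F" for \<omega>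
    using assms fins_sub[OF assms(2) that] by (auto simp: good_def)
  show "0 \<le> fexp F (\<lambda>_. p) Y" using Y by (intro fexp_nonneg probs_const p)
  have "fexp F (\<lambda>_. p) Y \<le> fexp F (\<lambda>_. p) (\<lambda>_. 1)" using Y by (intro fexp_mono probs_const p)
  then show "fexp F (\<lambda>_. p) Y \<le> 1" using assms(2) by (simp add: fexp_const fins_def)
qed

lemma bdd_fexp: "good Y \<Longrightarrow> bdd_above ((\<lambda>F. fexp F (\<lambda>_. p) Y) ` fins)"
  using fexp_good_bounds by (intro bdd_aboveI[of _ 1]) auto

lemma supf_upper: "good Y \<Longrightarrow> F \<in> fins \<Longrightarrow> fexp F (\<lambda>_. p) Y \<le> supf p Y"
  unfolding supf_def by (intro cSUP_upper bdd_fexp)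

lemma supf_le: "(\<And>F. F \<in> fins \<Longrightarrow> fexp F (\<lambda>_. p) Y \<le> B) \<Longrightarrow> supf p Y \<le> B"
  unfolding supf_def using fins_empty by (intro cSUP_least) auto

lemma supf_bounds: "good Y \<Longrightarrow> 0 \<le> supf p Y" "good Y \<Longrightarrow> supf p Y \<le> 1"
  using order_trans[OF fexp_good_bounds(1) supf_upper, of Y "{}"] fins_empty
  by (auto intro!: supf_le fexp_good_bounds)

lemma fexp_good_mono:
  assumes "good Y" "F \<in> fins" "G \<subseteq> F"
  shows "fexp G (\<lambda>_. p) Y \<le> fexp F (\<lambda>_. p) Y"
proof (rule fexp_mono_set)
  fix \<omega> \<omega>' assume "\<omega> \<subseteq> \<omega>'" "\<omega>' \<subseteq> F"
  then show "Y \<omega> \<le> Y \<omega>'" using assms fins_sub[OF assms(2)] by (auto simp: good_def)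
qed (use assms p in \<open>auto simp: fins_def probs_const\<close>)

text \<open>By monotonicity a nearly optimal \<open>F0\<close> may be enlarged freely. Hence a
  single \<open>F\<close> can be nearly optimal for finitely many variables at once.\<close>

lemma supf_approx:
  assumes "good Y" "\<delta> > 0"
  shows "\<exists>F0\<in>fins. \<forall>F\<in>fins. F0 \<subseteq> F \<longrightarrow> fexp F (\<lambda>_. p) Y \<ge> supf p Y - \<delta>"
proof -
  have "\<exists>F0\<in>fins. supf p Y - \<delta> < fexp F0 (\<lambda>_. p) Y"
    using assms(2) fins_empty bdd_fexp[OF assms(1)] unfolding supf_def
    by (subst less_cSUP_iff[symmetric]) auto
  then show ?thesis using fexp_good_mono[OF assms(1)] by (meson less_eq_real_def order_trans)
qed

lemma supf_aut:
  assumes h: "h \<in> graph_aut V E" and Y: "\<And>\<eta>. \<eta> \<in> fins \<Longrightarrow> Y ((`) h ` \<eta>) = Y' \<eta>" and g: "good Y"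
  shows "supf p Y' \<le> supf p Y"
proof (rule supf_le)
  fix F assume F: "F \<in> fins"
  have "fexp F (\<lambda>_. p) Y' = fexp F (\<lambda>_. p) (\<lambda>\<eta>. Y ((`) h ` \<eta>))"
    using Y F by (intro fexp_cong) (metis fins_sub)
  also have "\<dots> = fexp ((`) h ` F) (\<lambda>_. p) Y" using aut_fexp[OF h F] by simp
  also have "\<dots> \<le> supf p Y" by (intro supf_upper g aut_fins h F)
  finally show "fexp F (\<lambda>_. p) Y' \<le> supf p Y" .
qed

lemma magn_le_aux: assumes "0 \<le> q" "q \<le> 1" "x \<in> V" "y \<in> V" shows "magn p q x \<le> magn p q y"
proof -
  obtain h where h: "h \<in> graph_aut V E" "h x = y" using aut_ex[of x y] assms by auto
  show ?thesis unfolding magn_def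
    by (rule supf_aut[OF h(1) _ good_magn[OF assms(1,2)]])
      (use aut_card_clus[OF h(1) _ assms(3)] h(2) in \<open>auto simp: fins_def\<close>)
qed

lemma magn_eq: "0 \<le> q \<Longrightarrow> q \<le> 1 \<Longrightarrow> x \<in> V \<Longrightarrow> magn p q x = magn p q v0"
  by (intro antisym magn_le_aux v0)

lemma tail_le_aux: assumes "x \<in> V" "y \<in> V" shows "tail p n x \<le> tail p n y"
proof -
  obtain h where h: "h \<in> graph_aut V E" "h x = y" using aut_ex[of x y] assms by auto
  show ?thesis unfolding tail_def
    by (rule supf_aut[OF h(1) _ good_tail])
      (use aut_card_clus[OF h(1) _ assms(1)] h(2) in \<open>auto simp: fins_def\<close>)
qed

lemma tail_eq: "x \<in> V \<Longrightarrow> tail p n x = tail p n v0"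
  by (intro antisym tail_le_aux v0)

lemma tau_aut_le:
  assumes h: "h \<in> graph_aut V E" and xy: "x \<in> V" "y \<in> V"
  shows "tau p x y \<le> tau p (h x) (h y)"
  unfolding tau_def
  by (rule supf_aut[OF h _ good_conn]) (use aut_conn[OF h _ xy] in \<open>auto simp: fins_def\<close>)

lemma tau_aut:
  assumes h: "h \<in> graph_aut V E" and xy: "x \<in> V" "y \<in> V"
  shows "tau p (h x) (h y) = tau p x y"
proof -
  have "tau p (h x) (h y) \<le> tau p (inv_into V h (h x)) (inv_into V h (h y))"
    using aut_props(2)[OF h] xy by (intro tau_aut_le aut_inv h) auto
  then show ?thesis using tau_aut_le[OF h xy] aut_props(1)[OF h] xy by simp
qed

lemma tau_sym: "tau p x y = tau p y x"
proof -
  have "conn \<eta> x y = conn \<eta> y x" for \<eta> by (metis conn_sym)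
  then show ?thesis by (simp add: tau_def)
qed

lemma tau_bounds: "0 \<le> tau p x y" "tau p x y \<le> 1"
  unfolding tau_def by (intro supf_bounds good_conn)+

lemma tau_upper: "F \<in> fins \<Longrightarrow> fprob F (\<lambda>_. p) (\<lambda>\<eta>. conn \<eta> x y) \<le> tau p x y"
  unfolding tau_def fprob_def by (intro supf_upper good_conn)

lemma tau_self: "tau p x x = 1"
  using tau_upper[OF fins_empty, of x x] tau_bounds(2)[of x x] by (simp add: fprob_def)

lemma tail_upper: "F \<in> fins \<Longrightarrow> fprob F (\<lambda>_. p) (\<lambda>\<eta>. n \<le> card (clus \<eta> x)) \<le> tail p n x"
  unfolding tail_def fprob_def by (intro supf_upper good_tail)

lemma tail_bounds: "0 \<le> tail p n x" "tail p n x \<le> 1"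
  unfolding tail_def by (intro supf_bounds good_tail)+

lemma magn_upper: "0 \<le> q \<Longrightarrow> q \<le> 1 \<Longrightarrow> F \<in> fins \<Longrightarrow> fexp F (\<lambda>_. p) (\<lambda>\<eta>. 1 - (1 - q) ^ card (clus \<eta> x)) \<le> magn p q x"
  unfolding magn_def by (intro supf_upper good_magn)

lemma magn_bounds: "0 \<le> q \<Longrightarrow> q \<le> 1 \<Longrightarrow> 0 \<le> magn p q x" "0 \<le> q \<Longrightarrow> q \<le> 1 \<Longrightarrow> magn p q x \<le> 1"
  unfolding magn_def by (intro supf_bounds good_magn; simp)+

lemma magn_ge_q: assumes "0 \<le> q" "q \<le> 1" shows "q \<le> magn p q x"
proof -
  have "clus {} x = {x}" using clus_subset[of "{}" x] self_in_clus[of x "{}"] by auto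
  then show ?thesis using magn_upper[OF assms fins_empty, of x] by simp
qed

text \<open>An exhaustion by balls turns the supremum over a directed family into the limit of a
  sequence.\<close>

definition EB where "EB k = U v0 k"

lemma EB_fins: "EB k \<in> fins" and EB_mono: "k \<le> k' \<Longrightarrow> EB k \<subseteq> EB k'"
  by (simp_all add: EB_def fins_U v0 U_mono)

lemma EB_cover: assumes "F \<in> fins" shows "\<exists>k. F \<subseteq> EB k"
proof -
  have "finite (\<Union>F)" using fins_finite_UN[OF assms] .
  then obtain k where k: "\<forall>y\<in>\<Union>F. d v0 y \<le> k"
    using finite_nat_set_iff_bounded_le[of "d v0 ` \<Union>F"] by auto
  have "F \<subseteq> EB k"
    using k assms edge_sub by (fastforce simp: EB_def U_def ball_def fins_def)
  then show ?thesis ..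
qed

lemma supf_LIMSEQ:
  assumes "good Y" shows "(\<lambda>k. fexp (EB k) (\<lambda>_. p) Y) \<longlonglongrightarrow> supf p Y"
proof (rule LIMSEQ_I)
  fix e :: real assume e: "0 < e"
  obtain F0 where F0: "F0 \<in> fins" "\<forall>F\<in>fins. F0 \<subseteq> F \<longrightarrow> fexp F (\<lambda>_. p) Y \<ge> supf p Y - e/2"
    using supf_approx[OF assms, of "e/2"] e by auto
  obtain k where k: "F0 \<subseteq> EB k" using EB_cover[OF F0(1)] by auto
  have "norm (fexp (EB m) (\<lambda>_. p) Y - supf p Y) < e" if "m \<ge> k" for m
  proof -
    have "fexp (EB m) (\<lambda>_. p) Y \<ge> supf p Y - e/2"
      using F0(2) EB_fins k EB_mono[OF that] by (meson order_trans)
    moreover have "fexp (EB m) (\<lambda>_. p) Y \<le> supf p Y" by (intro supf_upper assms EB_fins)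
    ultimately show ?thesis using e by simp
  qed
  then show "\<exists>no. \<forall>n\<ge>no. norm (fexp (EB n) (\<lambda>_. p) Y - supf p Y) < e" by blast
qed

section \<open>Comparison with the percolation measure\<close>

lemma perc_prob_space: "prob_space (percolation E p)"
  unfolding percolation_def by (intro prob_space_PiM prob_space_measure_pmf)

text \<open>An event that depends on \<open>F\<close> is a finite disjoint union of patterns on
  \<open>F\<close>, and the product measure gives each pattern its weight.\<close>

lemma perc_cylinder:
  assumes F: "F \<in> fins"
  shows "{\<omega> \<in> space (percolation E p). A (open_edges F \<omega>)} \<in> sets (percolation E p)"
    and "measure (percolation E p) {\<omega> \<in> space (percolation E p). A (open_edges F \<omega>)} = fprob F (\<lambda>_. p) A"
proof -
  interpret product_prob_space "\<lambda>_. measure_pmf (bernoulli_pmf p)" E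
    by unfold_locales
  interpret PP: prob_space "percolation E p" by (rule perc_prob_space)
  have finF: "finite F" "F \<subseteq> E" using F by (auto simp: fins_def)
  let ?M = "percolation E p"
  let ?C = "\<lambda>\<eta>. {\<omega> \<in> space ?M. open_edges F \<omega> = \<eta>}"
  have C: "?C \<eta> = {\<omega> \<in> space ?M. \<forall>e\<in>F. \<omega> e \<in> {e \<in> \<eta>}}" if "\<eta> \<subseteq> F" for \<eta>
    using that by (auto simp: open_edges_def)
  have Cs: "?C \<eta> \<in> sets ?M" if "\<eta> \<subseteq> F" for \<eta>
  proof -
    have "{\<omega> \<in> space ?M. \<forall>e\<in>F. \<omega> e \<in> {e \<in> \<eta>}} = (\<Inter>e\<in>F. {\<omega> \<in> space ?M. \<omega> e \<in> {e \<in> \<eta>}}) \<inter> space ?M"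
      by auto
    moreover have "{\<omega> \<in> space ?M. \<omega> e \<in> {e \<in> \<eta>}} \<in> sets ?M" if "e \<in> F" for e
      unfolding percolation_def using that finF by (intro sets_Collect_single) auto
    ultimately show ?thesis
      unfolding C[OF that] using finF by (cases "F = {}") (auto intro!: sets.Int sets.finite_INT)
  qed
  have Cm: "measure ?M (?C \<eta>) = bern_weight F (\<lambda>_. p) \<eta>" if "\<eta> \<subseteq> F" for \<eta>
  proof -
    have "emeasure ?M (?C \<eta>) = (\<Prod>e\<in>F. emeasure (measure_pmf (bernoulli_pmf p)) {e \<in> \<eta>})"
      unfolding C[OF that] unfolding percolation_def by (rule emeasure_PiM_Collect) (use finF in auto)
    also have "\<dots> = (\<Prod>e\<in>F. ennreal (measure (measure_pmf (bernoulli_pmf p)) {e \<in> \<eta>}))"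
      by (simp only: measure_pmf.emeasure_eq_measure)
    also have "\<dots> = ennreal (\<Prod>e\<in>F. measure (measure_pmf (bernoulli_pmf p)) {e \<in> \<eta>})"
      by (rule prod_ennreal) simp
    finally have "measure ?M (?C \<eta>) = (\<Prod>e\<in>F. measure (measure_pmf (bernoulli_pmf p)) {e \<in> \<eta>})"
      by (simp add: measure_def prod_nonneg)
    also have "\<dots> = bern_weight F (\<lambda>_. p) \<eta>"
      unfolding bern_weight_def using p by (intro prod.cong) (auto simp: measure_pmf_single)
    finally show ?thesis .
  qed
  have eq: "{\<omega> \<in> space ?M. A (open_edges F \<omega>)} = (\<Union>\<eta>\<in>{\<eta>\<in>Pow F. A \<eta>}. ?C \<eta>)"
    by (auto simp: open_edges_def)
  show "{\<omega> \<in> space ?M. A (open_edges F \<omega>)} \<in> sets ?M"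
    unfolding eq using Cs finF by (intro sets.finite_UN) auto
  have "measure ?M {\<omega> \<in> space ?M. A (open_edges F \<omega>)} = (\<Sum>\<eta>\<in>{\<eta>\<in>Pow F. A \<eta>}. measure ?M (?C \<eta>))"
    unfolding eq using Cs finF
    by (intro PP.finite_measure_finite_Union) (auto simp: disjoint_family_on_def)
  also have "\<dots> = (\<Sum>\<eta>\<in>{\<eta>\<in>Pow F. A \<eta>}. bern_weight F (\<lambda>_. p) \<eta>)"
    using Cm by (intro sum.cong) auto
  also have "\<dots> = fprob F (\<lambda>_. p) A"
    unfolding fprob_def fexp_def using finF by (intro sum.mono_neutral_cong_left) auto
  finally show "measure ?M {\<omega> \<in> space ?M. A (open_edges F \<omega>)} = fprob F (\<lambda>_. p) A" .
qed

lemma open_edges_EB_mono: "k \<le> k' \<Longrightarrow> open_edges (EB k) \<omega> \<subseteq> open_edges (EB k') \<omega>"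
  using EB_mono by (auto simp: open_edges_def)

lemma open_edges_EB_sub: "open_edges (EB k) \<omega> \<subseteq> open_edges E \<omega>"
  using EB_fins by (auto simp: open_edges_def fins_def)

lemma open_edges_fins: "open_edges (EB k) \<omega> \<in> fins"
  using EB_fins fins_sub by (metis (no_types, lifting) mem_Collect_eq open_edges_def subsetI)

lemma conn_EB: "conn (open_edges E \<omega>) x y \<longleftrightarrow> (\<exists>k. conn (open_edges (EB k) \<omega>) x y)"
proof
  assume "conn (open_edges E \<omega>) x y"
  then obtain f n where f: "f 0 = x" "f n = y" "inj_on f {..n::nat}" "\<And>i. i < n \<Longrightarrow> {f i, f (Suc i)} \<in> open_edges E \<omega>"
    using simple_path by metis
  have "seg f 0 n \<in> fins" using f(4) by (auto simp: seg_def fins_def open_edges_def)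
  then obtain k where "seg f 0 n \<subseteq> EB k" using EB_cover by blast
  then have "seg f 0 n \<subseteq> open_edges (EB k) \<omega>" using f(4) by (auto simp: seg_def open_edges_def)
  then show "\<exists>k. conn (open_edges (EB k) \<omega>) x y"
    using conn_mono[OF _ conn_seg[of 0 n f]] f(1,2) by blast
qed (use conn_mono[OF open_edges_EB_sub] in blast)

lemma clus_EB_finite_sub:
  assumes "finite B" "B \<subseteq> clus (open_edges E \<omega>) x"
  shows "\<exists>k. B \<subseteq> clus (open_edges (EB k) \<omega>) x"
  using assms
proof (induction B rule: finite_induct)
  case (insert b B)
  then obtain k where k: "B \<subseteq> clus (open_edges (EB k) \<omega>) x" by auto
  obtain j where j: "conn (open_edges (EB j) \<omega>) x b"
    using insert.prems conn_EB by (auto simp: clus_def)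
  have "insert b B \<subseteq> clus (open_edges (EB (max j k)) \<omega>) x"
    using k clus_mono[OF open_edges_EB_mono, of k "max j k" \<omega> x] conn_mono[OF open_edges_EB_mono j]
    by (auto simp: clus_def)
  then show ?case ..
qed simp

text \<open>An infinite cluster has finite subsets of every size, so the equivalence covers it as
  well.\<close>

lemma size_EB: "cluster_size E \<omega> x \<ge> enat n \<longleftrightarrow> (\<exists>k. n \<le> card (clus (open_edges (EB k) \<omega>) x))"
proof
  assume L: "cluster_size E \<omega> x \<ge> enat n"
  have "\<exists>B. finite B \<and> card B = n \<and> B \<subseteq> clus (open_edges E \<omega>) x"
  proof (cases "finite (clus (open_edges E \<omega>) x)")
    case True
    then show ?thesis using L obtain_subset_with_card_n[of n "clus (open_edges E \<omega>) x"] finite_subset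
      by (simp add: cluster_size_def cluster_eq) blast
  next
    case False
    then show ?thesis using infinite_arbitrarily_large by blast
  qed
  then obtain B where B: "finite B" "card B = n" "B \<subseteq> clus (open_edges E \<omega>) x" by blast
  then obtain k where "B \<subseteq> clus (open_edges (EB k) \<omega>) x" using clus_EB_finite_sub by blast
  then show "\<exists>k. n \<le> card (clus (open_edges (EB k) \<omega>) x)"
    using card_mono[OF finite_clus[OF open_edges_fins]] B by blast
next
  assume "\<exists>k. n \<le> card (clus (open_edges (EB k) \<omega>) x)"
  then obtain k where k: "n \<le> card (clus (open_edges (EB k) \<omega>) x)" ..
  have "clus (open_edges (EB k) \<omega>) x \<subseteq> clus (open_edges E \<omega>) x"
    by (intro clus_mono open_edges_EB_sub)
  then show "cluster_size E \<omega> x \<ge> enat n"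
    using k card_mono[of "clus (open_edges E \<omega>) x" "clus (open_edges (EB k) \<omega>) x"]
    by (auto simp: cluster_size_def cluster_eq)
qed

text \<open>Continuity from below along the exhaustion identifies \<open>supf\<close> with a
  probability.\<close>

lemma perc_increasing:
  assumes A: "\<And>F G. F \<in> fins \<Longrightarrow> G \<subseteq> F \<Longrightarrow> A G \<Longrightarrow> A F"
  shows "{\<omega> \<in> space (percolation E p). \<exists>k. A (open_edges (EB k) \<omega>)} \<in> sets (percolation E p)"
    and "measure (percolation E p) {\<omega> \<in> space (percolation E p). \<exists>k. A (open_edges (EB k) \<omega>)} = supf p (\<lambda>\<eta>. of_bool (A \<eta>))"
proof -
  interpret PP: prob_space "percolation E p" by (rule perc_prob_space)
  let ?M = "percolation E p"
  let ?A = "\<lambda>k. {\<omega> \<in> space ?M. A (open_edges (EB k) \<omega>)}"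
  have eq: "{\<omega> \<in> space ?M. \<exists>k. A (open_edges (EB k) \<omega>)} = (\<Union>k. ?A k)" by auto
  show "{\<omega> \<in> space ?M. \<exists>k. A (open_edges (EB k) \<omega>)} \<in> sets ?M"
    unfolding eq using perc_cylinder(1)[OF EB_fins] by auto
  have "good (\<lambda>\<eta>. of_bool (A \<eta>))" using A by (auto simp: good_def)
  then have "(\<lambda>k. fprob (EB k) (\<lambda>_. p) A) \<longlonglongrightarrow> supf p (\<lambda>\<eta>. of_bool (A \<eta>))"
    using supf_LIMSEQ by (simp add: fprob_def)
  moreover have "(\<lambda>k. measure ?M (?A k)) \<longlonglongrightarrow> measure ?M (\<Union>k. ?A k)"
  proof (rule PP.finite_Lim_measure_incseq)
    show "range ?A \<subseteq> sets ?M" using perc_cylinder(1)[OF EB_fins] by auto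
    show "incseq ?A"
      using A[OF open_edges_fins open_edges_EB_mono] by (auto simp: incseq_def)
  qed
  ultimately show "measure ?M {\<omega> \<in> space ?M. \<exists>k. A (open_edges (EB k) \<omega>)} = supf p (\<lambda>\<eta>. of_bool (A \<eta>))"
    unfolding eq perc_cylinder(2)[OF EB_fins] using LIMSEQ_unique by blast
qed

lemma conn_prob_tau: "conn_prob E p u v = tau p u v"
proof -
  have "conn_prob E p u v = tau p v u"
    unfolding conn_prob_def cluster_eq clus_def mem_Collect_eq conn_EB tau_def
    by (rule perc_increasing) (rule conn_mono)
  then show ?thesis using tau_sym by simp
qed

lemma perc_size:
  shows "{\<omega> \<in> space (percolation E p). cluster_size E \<omega> x \<ge> enat n} \<in> sets (percolation E p)"
    and "measure (percolation E p) {\<omega> \<in> space (percolation E p). cluster_size E \<omega> x \<ge> enat n} = tail p n x"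
  unfolding size_EB tail_def
  by (rule perc_increasing; use card_clus_mono order_trans in blast)+

end

lemma supf_mono_param:
  assumes "0 \<le> p" "p \<le> p'" "p' \<le> 1" "good Y"
  shows "supf p Y \<le> supf p' Y"
proof (rule supf_le)
  fix F assume F: "F \<in> fins"
  have "fexp F (\<lambda>_. p) Y \<le> fexp F (\<lambda>_. p') Y"
  proof (rule fexp_mono_param)
    fix \<omega> \<omega>' assume "\<omega> \<subseteq> \<omega>'" "\<omega>' \<subseteq> F"
    then show "Y \<omega> \<le> Y \<omega>'" using assms(4) fins_sub[OF F] by (auto simp: good_def)
  qed (use F assms in \<open>auto simp: fins_def probs_def\<close>)
  also have "\<dots> \<le> supf p' Y" using assms F by (intro supf_upper) auto
  finally show "fexp F (\<lambda>_. p) Y \<le> supf p' Y" .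
qed (use assms in auto)

lemma tau_mono_param: "0 \<le> p \<Longrightarrow> p \<le> p' \<Longrightarrow> p' \<le> 1 \<Longrightarrow> tau p x y \<le> tau p' x y"
  unfolding tau_def by (intro supf_mono_param good_conn)

section \<open>The triangle condition\<close>

definition tri where "tri p b x y = tau p b x * tau p x y * tau p y b"

context
  fixes p :: real
  assumes p: "0 \<le> p" "p \<le> 1" and nabla: "nabla V E p v0 < \<infinity>"
begin

lemma tri_nonneg: "0 \<le> tri p b x y"
  unfolding tri_def by (intro mult_nonneg_nonneg tau_bounds p)

text \<open>\<open>nabla\<close> is a sum in \<open>ennreal\<close>; its finiteness enters only
  through this real bound on the finite partial sums.\<close>

lemma tri_bounded:
  obtains B where "0 \<le> B" "\<And>Z. finite Z \<Longrightarrow> Z \<subseteq> V \<times> V \<Longrightarrow> (\<Sum>(x, y)\<in>Z. tri p v0 x y) \<le> B"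
proof -
  let ?f = "\<lambda>(u, w). ennreal (conn_prob E p v0 u * conn_prob E p u w * conn_prob E p w v0)"
  have f: "?f z = ennreal (tri p v0 (fst z) (snd z))" for z
    by (auto simp: tri_def conn_prob_tau[OF p] split: prod.splits)
  define I where "I = infsum ?f (V \<times> V)"
  have I: "I < \<infinity>" using nabla by (simp add: nabla_def I_def)
  have "(\<Sum>(x, y)\<in>Z. tri p v0 x y) \<le> enn2real I" if Z: "finite Z" "Z \<subseteq> V \<times> V" for Z
  proof -
    have "ennreal (\<Sum>(x, y)\<in>Z. tri p v0 x y) = sum ?f Z"
      unfolding f using tri_nonneg by (simp add: sum_ennreal case_prod_unfold)
    also have "\<dots> = infsum ?f Z" using Z by simp
    also have "\<dots> \<le> I" unfolding I_def
      by (intro infsum_mono_neutral nonneg_summable_on_complete) (use Z in auto)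
    finally have "enn2real (ennreal (\<Sum>(x, y)\<in>Z. tri p v0 x y)) \<le> enn2real I"
      using I by (intro enn2real_mono) auto
    moreover have "0 \<le> (\<Sum>(x, y)\<in>Z. tri p v0 x y)" using tri_nonneg by (auto intro!: sum_nonneg)
    ultimately show ?thesis by simp
  qed
  then show ?thesis using that[of "enn2real I"] by simp
qed

text \<open>A finite set \<open>W\<close> of pairs comes within \<open>\<epsilon>\<close> of the
  supremum of all finite sums, so a set disjoint from \<open>W\<close> has sum at most
  \<open>\<epsilon>\<close>. The radius is chosen so that the ball encloses
  \<open>W\<close>.\<close>

lemma tri_tail_v0:
  assumes "0 < \<epsilon>"
  obtains R where "\<And>Z. finite Z \<Longrightarrow> Z \<subseteq> V \<times> V \<Longrightarrow> (\<And>x y. (x, y) \<in> Z \<Longrightarrow> \<not> (x \<in> ball v0 R \<and> y \<in> ball v0 R))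
    \<Longrightarrow> (\<Sum>(x, y)\<in>Z. tri p v0 x y) \<le> \<epsilon>"
proof -
  define g where "g = (\<lambda>Z. \<Sum>(x, y)\<in>Z. tri p v0 x y)"
  define ZZ where "ZZ = {Z. finite Z \<and> Z \<subseteq> V \<times> V}"
  obtain B where B: "\<And>Z. Z \<in> ZZ \<Longrightarrow> g Z \<le> B"
  proof (rule tri_bounded)
    fix B assume "\<And>Z. finite Z \<Longrightarrow> Z \<subseteq> V \<times> V \<Longrightarrow> (\<Sum>(x, y)\<in>Z. tri p v0 x y) \<le> B"
    then show thesis by (intro that[of B]) (auto simp: g_def ZZ_def)
  qed
  have bdd: "bdd_above (g ` ZZ)" using B by (intro bdd_aboveI[of _ B]) auto
  have ne: "ZZ \<noteq> {}" by (auto simp: ZZ_def)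
  have "\<exists>W\<in>ZZ. (SUP Z\<in>ZZ. g Z) - \<epsilon> < g W"
    using assms by (subst less_cSUP_iff[OF ne bdd, symmetric]) simp
  then obtain W where W: "W \<in> ZZ" "(SUP Z\<in>ZZ. g Z) - \<epsilon> < g W" by blast
  have "finite (fst ` W \<union> snd ` W)" using W by (auto simp: ZZ_def)
  then have "finite (d v0 ` (fst ` W \<union> snd ` W))" by (rule finite_imageI)
  then obtain R where R: "\<forall>n \<in> d v0 ` (fst ` W \<union> snd ` W). n \<le> R"
    using finite_nat_set_iff_bounded_le by blast
  have WR: "x \<in> ball v0 R \<and> y \<in> ball v0 R" if "(x, y) \<in> W" for x y
  proof -
    have "x \<in> fst ` W" "y \<in> snd ` W" using that by force+
    then have "d v0 x \<le> R" "d v0 y \<le> R" using R by blast+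
    moreover have "x \<in> V" "y \<in> V" using that W(1) by (auto simp: ZZ_def)
    ultimately show ?thesis by (simp add: ball_def)
  qed
  show ?thesis
  proof (rule that[of R])
    fix Z assume Z: "finite Z" "Z \<subseteq> V \<times> V" "\<And>x y. (x, y) \<in> Z \<Longrightarrow> \<not> (x \<in> ball v0 R \<and> y \<in> ball v0 R)"
    have dj: "Z \<inter> W = {}" using Z(3) WR by auto
    have fW: "finite W" using W by (simp add: ZZ_def)
    have "Z \<union> W \<in> ZZ" using W Z by (auto simp: ZZ_def)
    then have "g (Z \<union> W) \<le> (SUP Z\<in>ZZ. g Z)" by (rule cSUP_upper[OF _ bdd])
    moreover have "g (Z \<union> W) = g Z + g W"
      unfolding g_def by (rule sum.union_disjoint[OF Z(1) fW dj])
    ultimately have "g Z \<le> \<epsilon>" using W(2) by simp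
    then show "(\<Sum>(x, y)\<in>Z. tri p v0 x y) \<le> \<epsilon>" by (simp add: g_def)
  qed
qed

text \<open>An automorphism taking \<open>b\<close> to \<open>v0\<close> preserves
  \<open>tau\<close> and distances, which makes the tail estimates uniform in the root.\<close>

lemma tri_transport:
  assumes "b \<in> V" "finite Z" "Z \<subseteq> V \<times> V"
  obtains Z' where "finite Z'" "Z' \<subseteq> V \<times> V" "(\<Sum>(x, y)\<in>Z. tri p b x y) = (\<Sum>(x, y)\<in>Z'. tri p v0 x y)"
    "\<And>R. (\<And>x y. (x, y) \<in> Z \<Longrightarrow> \<not> (x \<in> ball b R \<and> y \<in> ball b R)) \<Longrightarrow>
      (\<And>x y. (x, y) \<in> Z' \<Longrightarrow> \<not> (x \<in> ball v0 R \<and> y \<in> ball v0 R))"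
proof -
  obtain h where h: "h \<in> graph_aut V E" "h b = v0" using aut_ex[OF assms(1) v0] by auto
  note hp = aut_props[OF h(1)]
  let ?h = "map_prod h h"
  have inj: "inj_on ?h Z"
    using inj_on_subset[OF map_prod_inj_on[OF hp(1) hp(1)] assms(3)] .
  show ?thesis
  proof (rule that[of "?h ` Z"])
    show "finite (?h ` Z)" using assms by simp
    show "?h ` Z \<subseteq> V \<times> V" using assms(3) hp(2) by auto
    have "tri p v0 (h x) (h y) = tri p b x y" if "(x, y) \<in> Z" for x y
      using assms that tau_aut[OF p h(1)] unfolding tri_def h(2)[symmetric] by auto
    then show "(\<Sum>(x, y)\<in>Z. tri p b x y) = (\<Sum>(x, y)\<in>?h ` Z. tri p v0 x y)"
      by (subst sum.reindex[OF inj]) (auto intro!: sum.cong)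
    fix R x y
    assume R: "\<And>x y. (x, y) \<in> Z \<Longrightarrow> \<not> (x \<in> ball b R \<and> y \<in> ball b R)" and "(x, y) \<in> ?h ` Z"
    then obtain x' y' where xy: "(x', y') \<in> Z" "x = h x'" "y = h y'" by auto
    then have "x' \<in> V" "y' \<in> V" using assms by auto
    then have "d v0 x = d b x'" "d v0 y = d b y'"
      using aut_dist[OF h(1) assms(1)] h(2) xy by auto
    then show "\<not> (x \<in> ball v0 R \<and> y \<in> ball v0 R)"
      using R[OF xy(1)] \<open>x' \<in> V\<close> \<open>y' \<in> V\<close> by (auto simp: ball_def)
  qed
qed

lemma tri_tail:
  assumes "0 < \<epsilon>"
  obtains R where "\<And>b Z. b \<in> V \<Longrightarrow> finite Z \<Longrightarrow> Z \<subseteq> V \<times> V \<Longrightarrow>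
    (\<And>x y. (x, y) \<in> Z \<Longrightarrow> \<not> (x \<in> ball b R \<and> y \<in> ball b R)) \<Longrightarrow> (\<Sum>(x, y)\<in>Z. tri p b x y) \<le> \<epsilon>"
proof -
  obtain R where R: "\<And>Z. finite Z \<Longrightarrow> Z \<subseteq> V \<times> V \<Longrightarrow> (\<And>x y. (x, y) \<in> Z \<Longrightarrow> \<not> (x \<in> ball v0 R \<and> y \<in> ball v0 R))
    \<Longrightarrow> (\<Sum>(x, y)\<in>Z. tri p v0 x y) \<le> \<epsilon>" using tri_tail_v0[OF assms] by metis
  show ?thesis
  proof (rule that[of R])
    fix b Z assume b: "b \<in> V" and Z: "finite Z" "Z \<subseteq> V \<times> V" 
      and far: "\<And>x y. (x, y) \<in> Z \<Longrightarrow> \<not> (x \<in> ball b R \<and> y \<in> ball b R)"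
    show "(\<Sum>(x, y)\<in>Z. tri p b x y) \<le> \<epsilon>"
    proof (rule tri_transport[OF b Z])
      fix Z' assume Z': "finite Z'" "Z' \<subseteq> V \<times> V" "(\<Sum>(x, y)\<in>Z. tri p b x y) = (\<Sum>(x, y)\<in>Z'. tri p v0 x y)"
        "\<And>R x y. (\<And>x y. (x, y) \<in> Z \<Longrightarrow> \<not> (x \<in> ball b R \<and> y \<in> ball b R)) \<Longrightarrow>
          (x, y) \<in> Z' \<Longrightarrow> \<not> (x \<in> ball v0 R \<and> y \<in> ball v0 R)"
      show ?thesis
        unfolding Z'(3) by (rule R[OF Z'(1,2)]) (rule Z'(4)[OF far])
    qed
  qed
qed

lemma tri_bounded_all:
  obtains B where "0 \<le> B" "\<And>b Z. b \<in> V \<Longrightarrow> finite Z \<Longrightarrow> Z \<subseteq> V \<times> V \<Longrightarrow> (\<Sum>(x, y)\<in>Z. tri p b x y) \<le> B"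
proof -
  obtain B where B: "0 \<le> B" "\<And>Z. finite Z \<Longrightarrow> Z \<subseteq> V \<times> V \<Longrightarrow> (\<Sum>(x, y)\<in>Z. tri p v0 x y) \<le> B"
    using tri_bounded by metis
  show ?thesis
  proof (rule that[OF B(1)])
    fix b Z assume b: "b \<in> V" and Z: "finite Z" "Z \<subseteq> V \<times> V" 
    show "(\<Sum>(x, y)\<in>Z. tri p b x y) \<le> B"
    proof (rule tri_transport[OF b Z])
      fix Z' assume Z': "finite Z'" "Z' \<subseteq> V \<times> V" "(\<Sum>(x, y)\<in>Z. tri p b x y) = (\<Sum>(x, y)\<in>Z'. tri p v0 x y)"
      show ?thesis using Z'(3) B(2)[OF Z'(1,2)] by simp
    qed
  qed
qed

text \<open>The single degenerate pair \<open>(y, y)\<close> contributes the square of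
  \<open>tau p x y\<close> to the triangle sum at \<open>x\<close>, and it lies in the tail when
  \<open>y\<close> is far from \<open>x\<close>.\<close>

lemma tau_small:
  assumes "0 < \<epsilon>"
  obtains R where "\<And>x y. x \<in> V \<Longrightarrow> y \<in> V \<Longrightarrow> d x y > R \<Longrightarrow> tau p x y \<le> \<epsilon>"
proof -
  have "0 < \<epsilon>^2" using assms by simp
  then obtain R where R: "\<And>b Z. b \<in> V \<Longrightarrow> finite Z \<Longrightarrow> Z \<subseteq> V \<times> V \<Longrightarrow>
    (\<And>x y. (x, y) \<in> Z \<Longrightarrow> \<not> (x \<in> ball b R \<and> y \<in> ball b R)) \<Longrightarrow> (\<Sum>(x, y)\<in>Z. tri p b x y) \<le> \<epsilon>^2"
    using tri_tail by metis
  have "tau p x y \<le> \<epsilon>" if "x \<in> V" "y \<in> V" "d x y > R" for x y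
  proof -
    have "(\<Sum>(x', y')\<in>{(y, y)}. tri p x x' y') \<le> \<epsilon>^2"
      by (rule R) (use that in \<open>auto simp: ball_def\<close>)
    then have "(tau p x y)^2 \<le> \<epsilon>^2"
      by (simp add: tri_def tau_self[OF p] tau_sym[OF p, of y x] power2_eq_square)
    then show ?thesis using assms by (simp add: abs_le_square_iff[symmetric])
  qed
  then show ?thesis using that by blast
qed

text \<open>Connection is an equivalence relation, so for every configuration its indicator is a sum of squares.\<close>
lemma tau_psd:
  assumes "finite X"
  shows "0 \<le> (\<Sum>x\<in>X. \<Sum>y\<in>X. f x * f y * tau p x y)"
proof (rule LIMSEQ_le_const)
  show "(\<lambda>k. \<Sum>x\<in>X. \<Sum>y\<in>X. f x * f y * fexp (EB k) (\<lambda>_. p) (\<lambda>\<eta>. of_bool (conn \<eta> x y)))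
      \<longlonglongrightarrow> (\<Sum>x\<in>X. \<Sum>y\<in>X. f x * f y * tau p x y)"
    unfolding tau_def by (intro tendsto_sum tendsto_mult_left supf_LIMSEQ p good_conn)
  have "0 \<le> (\<Sum>x\<in>X. \<Sum>y\<in>X. f x * f y * fexp (EB k) (\<lambda>_. p) (\<lambda>\<eta>. of_bool (conn \<eta> x y)))" for k
  proof -
    have sq: "0 \<le> (\<Sum>x\<in>X. \<Sum>y\<in>X. f x * f y * of_bool (conn \<eta> x y))" for \<eta>
    proof -
      let ?c = "clus \<eta>"
      have cc: "of_bool (conn \<eta> x y) = (\<Sum>C\<in>?c ` X. of_bool (?c x = C) * of_bool (?c y = C) :: real)"
        if "x \<in> X" for x y
      proof -
        have "(\<Sum>C\<in>?c ` X. of_bool (?c x = C) * of_bool (?c y = C) :: real)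
            = (\<Sum>C\<in>?c ` X. if C = ?c x then of_bool (?c y = C) else 0)"
          by (intro sum.cong) auto
        also have "\<dots> = of_bool (?c y = ?c x)" using that assms by simp
        also have "?c y = ?c x \<longleftrightarrow> conn \<eta> x y"
        proof
          assume "?c y = ?c x"
          then have "y \<in> ?c x" using self_in_clus[of y \<eta>] by simp
          then show "conn \<eta> x y" by (simp add: clus_def)
        qed (simp add: clus_eq)
        finally show ?thesis by simp
      qed
      have "(\<Sum>x\<in>X. \<Sum>y\<in>X. f x * f y * of_bool (conn \<eta> x y))
          = (\<Sum>x\<in>X. \<Sum>y\<in>X. \<Sum>C\<in>?c ` X. (f x * of_bool (?c x = C)) * (f y * of_bool (?c y = C)))"
        using cc by (intro sum.cong refl) (simp add: sum_distrib_left mult_ac)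
      also have "\<dots> = (\<Sum>C\<in>?c ` X. \<Sum>x\<in>X. \<Sum>y\<in>X. (f x * of_bool (?c x = C)) * (f y * of_bool (?c y = C)))"
        by (subst sum.swap[of _ _ "?c ` X"], intro sum.cong refl, subst sum.swap[of _ _ "?c ` X"]) simp
      also have "\<dots> = (\<Sum>C\<in>?c ` X. (\<Sum>x\<in>X. f x * of_bool (?c x = C))^2)"
        by (simp add: power2_eq_square sum_product)
      also have "\<dots> \<ge> 0" by (intro sum_nonneg) simp
      finally show ?thesis .
    qed
    have "(\<Sum>x\<in>X. \<Sum>y\<in>X. f x * f y * fexp (EB k) (\<lambda>_. p) (\<lambda>\<eta>. of_bool (conn \<eta> x y)))
        = fexp (EB k) (\<lambda>_. p) (\<lambda>\<eta>. \<Sum>x\<in>X. \<Sum>y\<in>X. f x * f y * of_bool (conn \<eta> x y))"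
      by (simp add: fexp_sum fexp_cmult)
    also have "\<dots> \<ge> 0" by (intro fexp_nonneg probs_const p sq)
    finally show ?thesis .
  qed
  then show "\<exists>N. \<forall>n\<ge>N. 0 \<le> (\<Sum>x\<in>X. \<Sum>y\<in>X. f x * f y * fexp (EB n) (\<lambda>_. p) (\<lambda>\<eta>. of_bool (conn \<eta> x y)))"
    by blast
qed

text \<open>Positivity of the form at \<open>t * f - g\<close>. The weight \<open>t\<close> lets a
  small form in \<open>f\<close> compensate for a merely bounded one in \<open>g\<close>.\<close>

lemma tau_psd_amgm:
  assumes "finite X" "0 < t"
  shows "(\<Sum>x\<in>X. \<Sum>y\<in>X. f x * g y * tau p x y) \<le>
    (t * (\<Sum>x\<in>X. \<Sum>y\<in>X. f x * f y * tau p x y) + (\<Sum>x\<in>X. \<Sum>y\<in>X. g x * g y * tau p x y) / t) / 2"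
proof -
  define q where "q = (\<lambda>f g. \<Sum>x\<in>X. \<Sum>y\<in>X. f x * g y * tau p x y)"
  have sym: "q g f = q f g"
    unfolding q_def by (subst sum.swap) (simp add: tau_sym[OF p] mult_ac)
  have "0 \<le> q (\<lambda>x. t * f x - g x) (\<lambda>x. t * f x - g x)"
    unfolding q_def by (rule tau_psd[OF assms(1)])
  also have "\<dots> = t\<^sup>2 * q f f - t * q f g - t * q g f + q g g"
    unfolding q_def
    by (simp add: algebra_simps power2_eq_square sum.distrib sum_subtractf sum_distrib_left)
  finally have "2 * t * q f g \<le> t\<^sup>2 * q f f + q g g" by (simp add: sym)
  then have "q f g \<le> (t\<^sup>2 * q f f + q g g) / (2 * t)"
    using assms(2) by (simp add: field_simps)
  also have "\<dots> = (t * q f f + q g g / t) / 2"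
    using assms(2) by (simp add: field_simps power2_eq_square)
  finally show ?thesis by (simp add: q_def)
qed

text \<open>If \<open>x\<close> is within \<open>R\<close> of \<open>u\<close> and \<open>y\<close>
  within \<open>R\<close> of \<open>v\<close>, then \<open>x\<close> and \<open>y\<close> are far
  apart, \<open>tau p x y\<close> is small, and there are boundedly many such pairs. Otherwise one
  of them is outside its ball, and \<open>tau_psd_amgm\<close> compares the sum with two closed
  triangles: the tail of one at \<open>u\<close> and the whole of one at \<open>v\<close>, or
  conversely.\<close>

lemma open_triangle:
  assumes "0 < \<epsilon>"
  obtains K where "\<And>u v X. u \<in> V \<Longrightarrow> v \<in> V \<Longrightarrow> d u v \<ge> K \<Longrightarrow> finite X \<Longrightarrow> X \<subseteq> V \<Longrightarrow>
    (\<Sum>x\<in>X. \<Sum>y\<in>X. tau p u x * tau p x y * tau p y v) \<le> \<epsilon>"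
proof -
  obtain B where B: "0 \<le> B" "\<And>b Z. b \<in> V \<Longrightarrow> finite Z \<Longrightarrow> Z \<subseteq> V \<times> V \<Longrightarrow> (\<Sum>(x, y)\<in>Z. tri p b x y) \<le> B"
    using tri_bounded_all by metis
  \<comment> \<open>With \<open>t = 1 / \<eta>\<close> the two closed triangles give
    \<open>\<eta> * (1 + B) / 2 = \<epsilon> / 4\<close> in \<open>half\<close>, which is used
    twice.\<close>
  define \<eta> where "\<eta> = \<epsilon> / (2 * (1 + B))"
  have \<eta>: "0 < \<eta>" using assms B(1) by (simp add: \<eta>_def)
  then have "0 < \<eta>\<^sup>2" by simp
  then obtain R where R: "\<And>b Z. b \<in> V \<Longrightarrow> finite Z \<Longrightarrow> Z \<subseteq> V \<times> V \<Longrightarrow>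
    (\<And>x y. (x, y) \<in> Z \<Longrightarrow> \<not> (x \<in> ball b R \<and> y \<in> ball b R)) \<Longrightarrow> (\<Sum>(x, y)\<in>Z. tri p b x y) \<le> \<eta>\<^sup>2"
    using tri_tail by metis
  \<comment> \<open>The pairs inside both balls number at most \<open>(N R)^2\<close> and so
    contribute at most \<open>\<epsilon> / 2\<close>.\<close>
  define \<delta> where "\<delta> = \<epsilon> / (2 * (real (N R))\<^sup>2)"
  have NR: "1 \<le> real (N R)" using N_pos[of R] by simp
  have "0 < \<delta>" using assms NR by (simp add: \<delta>_def)
  then obtain R' where R': "\<And>x y. x \<in> V \<Longrightarrow> y \<in> V \<Longrightarrow> d x y > R' \<Longrightarrow> tau p x y \<le> \<delta>"
    using tau_small by metis
  have half: "(\<Sum>x\<in>X. \<Sum>y\<in>X. of_bool (x \<notin> ball u R) * tau p u x * tau p v y * tau p x y) \<le> \<epsilon> / 4"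
    if "u \<in> V" "v \<in> V" "finite X" "X \<subseteq> V" for u v X
  proof -
    let ?f = "\<lambda>x. of_bool (x \<notin> ball u R) * tau p u x" and ?g = "tau p v"
    have "(\<Sum>x\<in>X. \<Sum>y\<in>X. ?f x * ?f y * tau p x y) = (\<Sum>(x, y)\<in>X \<times> X. ?f x * ?f y * tau p x y)"
      by (simp add: sum.cartesian_product)
    also have "\<dots> = (\<Sum>(x, y)\<in>(X - ball u R) \<times> (X - ball u R). tri p u x y)"
      using that by (intro sum.mono_neutral_cong_right) (auto simp: tri_def tau_sym[OF p, of u])
    also have "\<dots> \<le> \<eta>\<^sup>2" by (rule R) (use that in auto)
    finally have ff: "(\<Sum>x\<in>X. \<Sum>y\<in>X. ?f x * ?f y * tau p x y) \<le> \<eta>\<^sup>2" .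
    have "(\<Sum>x\<in>X. \<Sum>y\<in>X. ?g x * ?g y * tau p x y) = (\<Sum>(x, y)\<in>X \<times> X. tri p v x y)"
      by (simp add: sum.cartesian_product tri_def tau_sym[OF p, of v] mult_ac)
    also have "\<dots> \<le> B" by (rule B(2)) (use that in auto)
    finally have gg: "(\<Sum>x\<in>X. \<Sum>y\<in>X. ?g x * ?g y * tau p x y) \<le> B" .
    have "(\<Sum>x\<in>X. \<Sum>y\<in>X. ?f x * ?g y * tau p x y) \<le>
      (1/\<eta> * (\<Sum>x\<in>X. \<Sum>y\<in>X. ?f x * ?f y * tau p x y) + (\<Sum>x\<in>X. \<Sum>y\<in>X. ?g x * ?g y * tau p x y) / (1/\<eta>)) / 2"
      using \<eta> that by (intro tau_psd_amgm) auto
    also have "\<dots> \<le> (1/\<eta> * \<eta>\<^sup>2 + B / (1/\<eta>)) / 2"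
      using ff gg \<eta> by (intro divide_right_mono add_mono mult_left_mono) auto
    also have "\<dots> = \<eta> * (1 + B) / 2" using \<eta> by (simp add: field_simps power2_eq_square)
    also have "\<eta> * (1 + B) = \<epsilon> / 2"
    proof -
      have "1 + B \<noteq> 0" using B(1) by simp
      then show ?thesis unfolding \<eta>_def by (metis divide_divide_eq_left nonzero_eq_divide_eq)
    qed
    also have "\<epsilon> / 2 / 2 = \<epsilon> / 4" by simp
    finally show ?thesis by simp
  qed
  show ?thesis
  \<comment> \<open>Removing two legs of length at most \<open>R\<close> leaves
    \<open>d x y > R'\<close>.\<close>
  proof (rule that[of "2 * R + R' + 1"])
    fix u v X assume uv: "u \<in> V" "v \<in> V" "d u v \<ge> 2 * R + R' + 1" and X: "finite X" "X \<subseteq> V"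
    have "tau p u x * tau p x y * tau p y v \<le>
        of_bool (x \<notin> ball u R) * tau p u x * tau p v y * tau p x y
      + of_bool (y \<notin> ball v R) * tau p v y * tau p u x * tau p y x
      + of_bool (x \<in> ball u R \<and> y \<in> ball v R) * \<delta>" if "x \<in> X" "y \<in> X" for x y
    proof (cases "x \<in> ball u R \<and> y \<in> ball v R")
      case True
      then have "d u v \<le> d u x + d x y + d y v"
        using dist_triangle[of u x v] dist_triangle[of x y v] uv by (force simp: ball_def)
      then have "d x y > R'" using True uv dist_sym[of v y] by (auto simp: ball_def)
      then have "tau p x y \<le> \<delta>" using R'[of x y] True by (auto simp: ball_def)
      moreover have "tau p u x * tau p x y * tau p y v \<le> 1 * tau p x y * 1"
        using tau_bounds[OF p] by (intro mult_mono) (auto intro!: mult_nonneg_nonneg)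
      ultimately show ?thesis using True by simp
    next
      case False
      then show ?thesis
        using tau_bounds[OF p] tau_sym[OF p, of y v] tau_sym[OF p, of y x] by (auto simp: mult_ac)
    qed
    then have "(\<Sum>x\<in>X. \<Sum>y\<in>X. tau p u x * tau p x y * tau p y v) \<le>
      (\<Sum>x\<in>X. \<Sum>y\<in>X. of_bool (x \<notin> ball u R) * tau p u x * tau p v y * tau p x y
      + of_bool (y \<notin> ball v R) * tau p v y * tau p u x * tau p y x
      + of_bool (x \<in> ball u R \<and> y \<in> ball v R) * \<delta>)" by (intro sum_mono) auto
    also have "\<dots> = (\<Sum>x\<in>X. \<Sum>y\<in>X. of_bool (x \<notin> ball u R) * tau p u x * tau p v y * tau p x y)
      + (\<Sum>x\<in>X. \<Sum>y\<in>X. of_bool (y \<notin> ball v R) * tau p v y * tau p u x * tau p y x)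
      + (\<Sum>x\<in>X. \<Sum>y\<in>X. of_bool (x \<in> ball u R \<and> y \<in> ball v R) * \<delta>)"
      by (simp only: sum.distrib)
    also have "(\<Sum>x\<in>X. \<Sum>y\<in>X. of_bool (y \<notin> ball v R) * tau p v y * tau p u x * tau p y x)
      = (\<Sum>y\<in>X. \<Sum>x\<in>X. of_bool (y \<notin> ball v R) * tau p v y * tau p u x * tau p y x)" by (rule sum.swap)
    also have "(\<Sum>x\<in>X. \<Sum>y\<in>X. of_bool (x \<in> ball u R \<and> y \<in> ball v R) * \<delta>)
        = (\<Sum>(x, y)\<in>X \<times> X. of_bool (x \<in> ball u R \<and> y \<in> ball v R) * \<delta>)"
      by (simp add: sum.cartesian_product)
    also have "\<dots> = (\<Sum>(x, y)\<in>(X \<times> X) \<inter> (ball u R \<times> ball v R). \<delta>)"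
      using X by (intro sum.mono_neutral_cong_right) auto
    also have "\<dots> \<le> (\<Sum>(x, y)\<in>ball u R \<times> ball v R. \<delta>)"
      using finite_ball uv \<open>0 < \<delta>\<close> by (intro sum_mono2) auto
    also have "\<dots> = \<epsilon> / 2"
      using uv NR by (simp add: card_ball card_cartesian_product \<delta>_def power2_eq_square)
    also note half[OF uv(1,2) X]
    also note half[OF uv(2,1) X]
    finally show "(\<Sum>x\<in>X. \<Sum>y\<in>X. tau p u x * tau p x y * tau p y v) \<le> \<epsilon>" by simp
  qed
qed

end

end

lemma fprob_disjoint:
  assumes "finite F" "Z \<subseteq> F"
  shows "fprob F r (\<lambda>\<omega>. Z \<inter> \<omega> = {}) = (\<Prod>c\<in>Z. 1 - r c)"
proof -
  have fZ: "finite Z" using assms finite_subset by blast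
  have "fprob F r (\<lambda>\<omega>. Z \<inter> \<omega> = {}) = fprob Z r (\<lambda>\<omega>. Z \<inter> \<omega> = {})"
    using assms by (intro fprob_restrict) auto
  also have "\<dots> = (\<Sum>\<omega>\<in>Pow Z. if \<omega> = {} then bern_weight Z r \<omega> else 0)"
    unfolding fprob_def fexp_def by (intro sum.cong) auto
  also have "\<dots> = (\<Prod>c\<in>Z. 1 - r c)"
    using fZ by (simp add: bern_weight_def)
  finally show ?thesis .
qed

lemma inc_diff: "inc A \<Longrightarrow> A (\<omega> - Z) \<Longrightarrow> A \<omega>"
  unfolding inc_def by (metis Diff_subset)

section \<open>Magnetization times susceptibility\<close>

text \<open>\<open>X\<close> may exceed the ends of the edges in \<open>F\<close>, so that a
  prescribed window or prescribed points can be included in it.\<close>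

locale finite_volume = pgraph V E v0 for V :: "'a set" and E v0 +
  fixes F :: "'a set set" and X :: "'a set" and I :: "nat set" and p :: real and qq :: "nat \<Rightarrow> real"
  assumes F: "F \<in> fins" and X: "finite X" "X \<subseteq> V" "\<Union>F \<subseteq> X" and I: "finite I"
    and p: "0 \<le> p" "p \<le> 1" and qq: "\<And>i. 0 \<le> qq i" "\<And>i. qq i \<le> 1"
begin

definition Om :: "'a coord set" where "Om = Inl ` F \<union> Inr ` (I \<times> X)"
definition rr :: "'a coord \<Rightarrow> real" where "rr = case_sum (\<lambda>_. p) (\<lambda>(i, x). qq i)"

lemma finite_F: "finite F" and F_sub: "F \<subseteq> E"
  using F by (auto simp: fins_def)

lemma eds_Om [simp]: "eds Om = F"
  by (auto simp: eds_def Om_def)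

lemma eds_sub: "\<omega> \<subseteq> Om \<Longrightarrow> eds \<omega> \<subseteq> F"
  using eds_mono[of \<omega> Om] by simp

sublocale fv: ghost_volume Om rr X
proof
  show "finite Om" using finite_F X I by (simp add: Om_def)
  show "probs rr" using p qq by (auto simp: probs_def rr_def split: sum.splits prod.splits)
qed (use X in auto)

lemma edge_event:
  "fv.EE (\<lambda>\<omega>. f (eds \<omega>)) = fexp F (\<lambda>_. p) f"
proof -
  have "fv.EE (\<lambda>\<omega>. f (eds \<omega>)) = fv.EE (\<lambda>\<omega>. f (eds \<omega> \<inter> F))"
    by (intro fexp_cong) (use eds_sub in \<open>auto simp: Int_absorb2\<close>)
  also have "\<dots> = fexp (Inl ` F) rr (\<lambda>\<omega>. f (eds \<omega> \<inter> F))"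
  proof (rule fexp_restrict[OF fv.fin])
    fix \<omega> :: "'a coord set"
    have "eds \<omega> \<inter> F = eds (\<omega> \<inter> Inl ` F) \<inter> F" by (auto simp: eds_def)
    then show "f (eds \<omega> \<inter> F) = f (eds (\<omega> \<inter> Inl ` F) \<inter> F)" by simp
  qed (simp add: Om_def)
  also have "\<dots> = fexp F (\<lambda>_. p) f"
    by (subst fexp_image[OF finite_F]) (auto simp: rr_def comp_def Int_absorb2 intro!: fexp_cong)
  finally show ?thesis .
qed

lemma T_eq: "fv.T x y = fprob F (\<lambda>_. p) (\<lambda>\<eta>. conn \<eta> x y)"
  unfolding fv.T_def fprob_def cn_def by (rule edge_event)

lemma T_le_tau: "fv.T x y \<le> tau p x y"
  unfolding T_eq by (rule tau_upper[OF p F])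

text \<open>Given the edges, the vertices of the cluster are coloured independently. The sum over
  the possible clusters \<open>A\<close> makes the vertex set deterministic, so that edges and
  colours separate as independent factors.\<close>

lemma nohit_eq:
  assumes "i \<in> I" "x \<in> X"
  shows "fv.EE (\<lambda>\<omega>. f (eds \<omega>) * of_bool (\<not> hit i x \<omega>)) = fexp F (\<lambda>_. p) (\<lambda>\<eta>. f \<eta> * (1 - qq i) ^ card (clus \<eta> x))"
proof -
  define SS where "SS = (\<lambda>\<eta>. clus \<eta> x) ` Pow F"
  have finSS: "finite SS" using finite_F by (simp add: SS_def)
  have SSX: "A \<subseteq> X" if A: "A \<in> SS" for A
  proof -
    obtain \<eta> where "\<eta> \<subseteq> F" "A = clus \<eta> x" using A by (auto simp: SS_def)
    then show ?thesis using clus_subset[of \<eta> x] X(3) assms(2) by blast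
  qed
  have split: "f \<eta> * h (clus \<eta> x) = (\<Sum>A\<in>SS. f \<eta> * of_bool (clus \<eta> x = A) * h A)"
    if "\<eta> \<subseteq> F" for \<eta> and h :: "'a set \<Rightarrow> real"
  proof -
    have "(\<Sum>A\<in>SS. f \<eta> * of_bool (clus \<eta> x = A) * h A) = (\<Sum>A\<in>SS. if A = clus \<eta> x then f \<eta> * h A else 0)"
      by (intro sum.cong) auto
    also have "\<dots> = f \<eta> * h (clus \<eta> x)" using that finSS by (simp add: SS_def)
    finally show ?thesis ..
  qed
  have "fv.EE (\<lambda>\<omega>. f (eds \<omega>) * of_bool (\<not> hit i x \<omega>))
      = fv.EE (\<lambda>\<omega>. \<Sum>A\<in>SS. f (eds \<omega>) * of_bool (clus (eds \<omega>) x = A) * of_bool (A \<inter> grn i \<omega> = {}))"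
  proof (intro fexp_cong)
    fix \<omega> assume "\<omega> \<subseteq> Om"
    then show "f (eds \<omega>) * of_bool (\<not> hit i x \<omega>)
        = (\<Sum>A\<in>SS. f (eds \<omega>) * of_bool (clus (eds \<omega>) x = A) * of_bool (A \<inter> grn i \<omega> = {}))"
      using split[OF eds_sub, of \<omega> "\<lambda>A. of_bool (A \<inter> grn i \<omega> = {})"] by (simp add: hit_iff)
  qed
  also have "\<dots> = (\<Sum>A\<in>SS. fv.EE (\<lambda>\<omega>. f (eds \<omega>) * of_bool (clus (eds \<omega>) x = A) * of_bool (A \<inter> grn i \<omega> = {})))"
    by (rule fexp_sum)
  also have "\<dots> = (\<Sum>A\<in>SS. fv.EE (\<lambda>\<omega>. f (eds \<omega>) * of_bool (clus (eds \<omega>) x = A)) * (1 - qq i) ^ card A)"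
  proof (intro sum.cong refl)
    fix A assume A: "A \<in> SS"
    have "fv.EE (\<lambda>\<omega>. f (eds \<omega>) * of_bool (clus (eds \<omega>) x = A) * of_bool (A \<inter> grn i \<omega> = {}))
        = fv.EE (\<lambda>\<omega>. f (eds \<omega>) * of_bool (clus (eds \<omega>) x = A)) * fv.EE (\<lambda>\<omega>. of_bool (A \<inter> grn i \<omega> = {}))"
    proof (rule fexp_indep[OF fv.fin, of _ "range Inl"])
      fix \<omega> :: "'a coord set"
      have "eds (\<omega> \<inter> range Inl) = eds \<omega>" "grn i (\<omega> - range Inl) = grn i \<omega>"
        by (auto simp: eds_def grn_def)
      then show "f (eds \<omega>) * of_bool (clus (eds \<omega>) x = A) = f (eds (\<omega> \<inter> range Inl)) * of_bool (clus (eds (\<omega> \<inter> range Inl)) x = A)"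
        "of_bool (A \<inter> grn i \<omega> = {}) = (of_bool (A \<inter> grn i (\<omega> - range Inl) = {}) :: real)" by simp_all
    qed
    also have "fv.EE (\<lambda>\<omega>. of_bool (A \<inter> grn i \<omega> = {})) = fprob Om rr (\<lambda>\<omega>. Inr ` ({i} \<times> A) \<inter> \<omega> = {})"
      unfolding fprob_def by (intro fexp_cong) (auto simp: grn_def)
    also have "\<dots> = (\<Prod>c\<in>Inr ` ({i} \<times> A). 1 - rr c)"
      by (rule fprob_disjoint[OF fv.fin]) (use SSX[OF A] assms in \<open>auto simp: Om_def\<close>)
    also have "\<dots> = (\<Prod>c\<in>{i} \<times> A. 1 - rr (Inr c))"
      by (subst prod.reindex) auto
    also have "\<dots> = (\<Prod>c\<in>{i} \<times> A. 1 - qq i)"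
      by (intro prod.cong refl) (auto simp: rr_def)
    also have "\<dots> = (1 - qq i) ^ card A" by (simp add: card_cartesian_product)
    finally show "fv.EE (\<lambda>\<omega>. f (eds \<omega>) * of_bool (clus (eds \<omega>) x = A) * of_bool (A \<inter> grn i \<omega> = {}))
      = fv.EE (\<lambda>\<omega>. f (eds \<omega>) * of_bool (clus (eds \<omega>) x = A)) * (1 - qq i) ^ card A" .
  qed
  also have "\<dots> = fv.EE (\<lambda>\<omega>. \<Sum>A\<in>SS. f (eds \<omega>) * of_bool (clus (eds \<omega>) x = A) * (1 - qq i) ^ card A)"
    by (simp add: fexp_sum fexp_cmult2)
  also have "\<dots> = fexp F (\<lambda>_. p) (\<lambda>\<eta>. \<Sum>A\<in>SS. f \<eta> * of_bool (clus \<eta> x = A) * (1 - qq i) ^ card A)"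
    by (rule edge_event)
  also have "\<dots> = fexp F (\<lambda>_. p) (\<lambda>\<eta>. f \<eta> * (1 - qq i) ^ card (clus \<eta> x))"
    by (intro fexp_cong split[symmetric])
  finally show ?thesis .
qed

lemma M_eq:
  assumes "i \<in> I" "x \<in> X"
  shows "fv.M i x = fexp F (\<lambda>_. p) (\<lambda>\<eta>. 1 - (1 - qq i) ^ card (clus \<eta> x))"
proof -
  have "fv.M i x = 1 - fv.EE (\<lambda>\<omega>. of_bool (\<not> hit i x \<omega>))"
    unfolding fv.M_def using fprob_neg[OF fv.fin, of rr "hit i x"] by (simp add: fprob_def)
  also have "fv.EE (\<lambda>\<omega>. of_bool (\<not> hit i x \<omega>)) = fexp F (\<lambda>_. p) (\<lambda>\<eta>. (1 - qq i) ^ card (clus \<eta> x))"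
    using nohit_eq[OF assms, of "\<lambda>_. 1"] by simp
  finally show ?thesis by (simp add: fexp_diff fexp_const[OF finite_F])
qed

lemma M_le_magn: "i \<in> I \<Longrightarrow> x \<in> X \<Longrightarrow> fv.M i x \<le> magn p (qq i) v0"
  using M_eq[of i x] magn_upper[OF p qq(1) qq(2) F, of i x] magn_eq[OF p qq(1) qq(2), of x i] X(2) by auto

text \<open>An open edge touching both clusters would join them, so exploring the cluster of
  \<open>v\<close> reveals no open edge of another cluster.\<close>

lemma clus_off:
  assumes "\<omega> \<subseteq> Om" "b \<notin> clus (eds \<omega>) v"
  shows "clus (eds (\<omega> - tch (clus (eds \<omega>) v))) b = clus (eds \<omega>) b"
proof (rule clus_local[OF subset_refl])
  fix e assume e: "e \<inter> clus (eds \<omega>) b \<noteq> {}"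
  have "e \<inter> clus (eds \<omega>) v = {}" if "e \<in> eds \<omega>"
  proof (rule ccontr)
    assume "e \<inter> clus (eds \<omega>) v \<noteq> {}"
    then obtain x y where x: "x \<in> e" "conn (eds \<omega>) v x" and y: "y \<in> e" "conn (eds \<omega>) b y"
      using e by (auto simp: clus_def)
    have "e \<in> E" using that eds_sub[OF assms(1)] F_sub by auto
    then have "conn (eds \<omega>) x y"
      using edge_card[of e] x y that by (auto simp: card_2_iff insert_commute intro: conn_edge)
    then show False using x y assms(2) conn_sym conn_trans unfolding clus_def by (metis mem_Collect_eq)
  qed
  then show "e \<in> eds \<omega> \<longleftrightarrow> e \<in> eds (\<omega> - tch (clus (eds \<omega>) v))"
    by (auto simp: off_def)
qed

lemma hit_off:
  assumes "\<omega> \<subseteq> Om" "b \<notin> clus (eds \<omega>) v"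
  shows "hit i b (\<omega> - tch (clus (eds \<omega>) v)) \<longleftrightarrow> hit i b \<omega>"
  using clus_off[OF assms] clus_disjoint_iff[of "eds \<omega>" v b] assms(2) unfolding hit_iff by auto

definition nbF :: "'a \<Rightarrow> 'a set" where "nbF s = {b. {s, b} \<in> F}"

lemma nbF: "finite (nbF s)" "nbF s \<subseteq> X" "s \<in> V \<Longrightarrow> card (nbF s) \<le> N 1"
proof -
  show *: "nbF s \<subseteq> X" using X(3) by (auto simp: nbF_def)
  then show "finite (nbF s)" using X(1) finite_subset by blast
  show "card (nbF s) \<le> N 1" if "s \<in> V"
    using card_mono[OF finite_nb[OF that], of "nbF s"] card_nb[OF that] F_sub
    by (auto simp: nbF_def nb_def intro: order_trans)
qed

lemma dec_nohit: "dec (\<lambda>\<omega>. \<not> hit i x \<omega>)"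
  using inc_hit unfolding inc_def dec_def by metis

lemma cn_iff: "cn v x \<omega> \<longleftrightarrow> x \<in> clus (eds \<omega>) v"
  by (simp add: cn_def clus_def)

text \<open>Once the cluster of \<open>v\<close> is explored and misses \<open>b\<close>, what
  happens at \<open>b\<close> is decided by the unexplored coordinates, and deleting the explored
  ones can only lower the probability of the increasing event \<open>B\<close>.\<close>

lemma explore_one:
  assumes "inc B" "\<And>\<omega>. \<omega> \<subseteq> Om \<Longrightarrow> b \<notin> clus (eds \<omega>) v \<Longrightarrow> B \<omega> \<Longrightarrow> B (\<omega> - tch (clus (eds \<omega>) v))"
    and "\<And>\<omega> \<omega>'. \<Phi> \<omega> \<Longrightarrow> \<omega> \<inter> tch (clus (eds \<omega>) v) = \<omega>' \<inter> tch (clus (eds \<omega>) v) \<Longrightarrow> \<Phi> \<omega>'"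
  shows "fv.P (\<lambda>\<omega>. \<Phi> \<omega> \<and> \<not> cn v b \<omega> \<and> B \<omega>) \<le> fv.P \<Phi> * fv.P B"
proof -
  let ?K = "\<lambda>\<omega>. clus (eds \<omega>) v"
  have "fv.P (\<lambda>\<omega>. \<Phi> \<omega> \<and> \<not> cn v b \<omega> \<and> B \<omega>) \<le> fv.P (\<lambda>\<omega>. \<Phi> \<omega> \<and> B (\<omega> - tch (?K \<omega>)))"
    using assms(2) by (intro fprob_mono fv.pr) (auto simp: cn_iff)
  also have "\<dots> = fv.EE (\<lambda>\<omega>. of_bool (\<Phi> \<omega>) * fv.P (\<lambda>\<omega>'. B (\<omega>' - tch (?K \<omega>))))"
  proof (rule fv.explore_prob[of \<Phi> ?K "\<lambda>A \<omega>. B (\<omega> - tch A)"])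
    fix \<omega> \<omega>' assume "\<Phi> \<omega>" and *: "\<omega> \<inter> tch (?K \<omega>) = \<omega>' \<inter> tch (?K \<omega>)"
    then show "\<Phi> \<omega>' \<and> ?K \<omega>' = ?K \<omega>" using assms(3)[OF _ *] clus_tch(1)[OF * subset_refl] by simp
  qed simp
  also have "\<dots> \<le> fv.EE (\<lambda>\<omega>. of_bool (\<Phi> \<omega>) * fv.P B)"
  proof (intro fexp_mono fv.pr mult_left_mono)
    fix \<omega>
    show "fv.P (\<lambda>\<omega>'. B (\<omega>' - tch (?K \<omega>))) \<le> fv.P B"
      by (intro fprob_mono fv.pr) (rule inc_diff[OF assms(1)])
  qed simp
  also have "\<dots> = fv.P \<Phi> * fv.P B" by (simp add: fexp_cmult2 fprob_def)
  finally show ?thesis .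
qed

section \<open>Green arms leaving the cluster of a vertex\<close>

context
  fixes v :: 'a and Mb :: real
  assumes v: "v \<in> X" and I0: "0 \<in> I" and Mb: "\<And>s. s \<in> X \<Longrightarrow> fv.M 0 s \<le> Mb"
begin

text \<open>The sum of \<open>g\<close> over the volume is the expected size on the green-free
  event. For an edge from \<open>a\<close> to \<open>b\<close>, \<open>f a b\<close> counts a place
  where a green cluster comes next to the cluster of \<open>v\<close>. In \<open>h3\<close> a second
  green cluster, distinct from the first, comes next to either of them at \<open>s\<close>; this is
  the configuration handed to the surgery.\<close>

definition g where "g x = fv.P (\<lambda>\<omega>. cn v x \<omega> \<and> \<not> hit 0 v \<omega>)"
definition g2 where "g2 x s = fv.P (\<lambda>\<omega>. cn v x \<omega> \<and> cn v s \<omega> \<and> \<not> hit 0 v \<omega>)"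
definition f where "f a b = fv.P (\<lambda>\<omega>. cn v a \<omega> \<and> \<not> hit 0 v \<omega> \<and> \<not> cn v b \<omega> \<and> hit 0 b \<omega>)"
definition h3 where "h3 a b s c = fv.P (\<lambda>\<omega>. cn v a \<omega> \<and> \<not> hit 0 v \<omega> \<and> \<not> cn v b \<omega> \<and> hit 0 b \<omega>
    \<and> (cn v s \<omega> \<or> cn b s \<omega>) \<and> \<not> cn v c \<omega> \<and> \<not> cn b c \<omega> \<and> hit 0 c \<omega>)"

lemma Mb_nonneg: "0 \<le> Mb"
  using Mb[OF v] fv.M_nonneg[of 0 v] by simp

lemma g_nonneg: "0 \<le> g x" and f_nonneg: "0 \<le> f a b" and g2_nonneg: "0 \<le> g2 x s" and h3_nonneg: "0 \<le> h3 a b s c"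
  by (simp_all add: g_def f_def g2_def h3_def fprob_nonneg fv.pr)

lemma g2_tree: "g2 x s \<le> (\<Sum>w\<in>X. g w * fv.T w x * fv.T w s)"
  unfolding g2_def g_def by (rule fv.tree_dec[OF v dec_nohit])

text \<open>Off the explored cluster the configuration is fresh, so \<open>hit_le_sum\<close>
  applies with that cluster as \<open>S\<close>. For \<open>s\<close> near \<open>x\<close> the
  factor \<open>T x s\<close> is dropped and the green arm is kept as a neighbour \<open>b\<close>
  of \<open>s\<close>. For \<open>s\<close> far from \<open>x\<close> the arm is estimated by
  \<open>Mb\<close>, and \<open>T x s\<close> is kept for the triangle condition.\<close>

lemma first_arm:
  assumes x: "x \<in> X"
  shows "g x * fv.M 0 x \<le> (\<Sum>s\<in>X. of_bool (d x s \<le> R) * (qq 0 * g s + (\<Sum>b\<in>nbF s. f s b)))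
    + (\<Sum>s\<in>X. of_bool (d x s > R) * (g2 x s * fv.T x s * Mb))"
proof -
  let ?K = "\<lambda>\<omega>. clus (eds \<omega>) v"
  let ?t = "\<lambda>s \<omega>. of_bool (cn v x \<omega> \<and> cn v s \<omega> \<and> \<not> hit 0 v \<omega>) * (fv.T x s * fv.Q 0 (?K \<omega>) s)"
  have "g x * fv.M 0 x = fv.EE (\<lambda>\<omega>. of_bool (cn v x \<omega> \<and> \<not> hit 0 v \<omega>) * fv.M 0 x)"
    by (simp add: g_def fprob_def fexp_cmult2)
  also have "\<dots> \<le> fv.EE (\<lambda>\<omega>. \<Sum>s\<in>X. ?t s \<omega>)"
  proof (intro fexp_mono fv.pr)
    fix \<omega> assume \<omega>: "\<omega> \<subseteq> Om"
    show "of_bool (cn v x \<omega> \<and> \<not> hit 0 v \<omega>) * fv.M 0 x \<le> (\<Sum>s\<in>X. ?t s \<omega>)"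
    proof (cases "cn v x \<omega> \<and> \<not> hit 0 v \<omega>")
      case True
      have KX: "?K \<omega> \<subseteq> X" by (rule fv.clus_in_X[OF \<omega> v])
      have "fv.M 0 x \<le> (\<Sum>s\<in>?K \<omega>. fv.T x s * fv.Q 0 (?K \<omega>) s)"
        using True KX X(1) by (intro fv.hit_le_sum) (auto simp: cn_iff finite_subset)
      also have "\<dots> = (\<Sum>s\<in>X. ?t s \<omega>)"
        using True KX X(1) by (intro sum.mono_neutral_cong_left) (auto simp: cn_iff)
      finally show ?thesis using True by simp
    qed (auto intro!: sum_nonneg mult_nonneg_nonneg fv.T_nonneg fv.Q_nonneg)
  qed
  also have "\<dots> = (\<Sum>s\<in>X. fv.EE (?t s))" by (rule fexp_sum)
  also have "\<dots> \<le> (\<Sum>s\<in>X. of_bool (d x s \<le> R) * (qq 0 * g s + (\<Sum>b\<in>nbF s. f s b))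
    + of_bool (d x s > R) * (g2 x s * fv.T x s * Mb))"
  proof (rule sum_mono)
    fix s assume s: "s \<in> X"
    show "fv.EE (?t s) \<le> of_bool (d x s \<le> R) * (qq 0 * g s + (\<Sum>b\<in>nbF s. f s b))
        + of_bool (d x s > R) * (g2 x s * fv.T x s * Mb)"
    proof (cases "d x s \<le> R")
      case False
      have "fv.EE (?t s) \<le> fv.EE (\<lambda>\<omega>. of_bool (cn v x \<omega> \<and> cn v s \<omega> \<and> \<not> hit 0 v \<omega>) * (fv.T x s * Mb))"
        using fv.Q_le_M[of 0 _ s] Mb[OF s]
        by (intro fexp_mono fv.pr mult_left_mono fv.T_nonneg) (auto intro: order_trans)
      also have "\<dots> = g2 x s * fv.T x s * Mb" by (simp add: fexp_cmult2 g2_def fprob_def)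
      finally show ?thesis using False by simp
    next
      case True
      have "fv.EE (?t s) \<le> fv.EE (\<lambda>\<omega>. of_bool (cn v s \<omega> \<and> \<not> hit 0 v \<omega>) * qq 0 +
         (\<Sum>b\<in>nbF s. of_bool (cn v s \<omega> \<and> \<not> hit 0 v \<omega> \<and> \<not> cn v b \<omega>) * fv.P (\<lambda>\<omega>'. hit 0 b (\<omega>' - tch (?K \<omega>)))))"
      proof (intro fexp_mono fv.pr)
        fix \<omega>
        let ?r = "of_bool (cn v s \<omega> \<and> \<not> hit 0 v \<omega>) * qq 0 +
         (\<Sum>b\<in>nbF s. of_bool (cn v s \<omega> \<and> \<not> hit 0 v \<omega> \<and> \<not> cn v b \<omega>) * fv.P (\<lambda>\<omega>'. hit 0 b (\<omega>' - tch (?K \<omega>))))"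
        show "?t s \<omega> \<le> ?r"
        proof (cases "cn v s \<omega> \<and> \<not> hit 0 v \<omega>")
          case True
          have "fv.T x s * fv.Q 0 (?K \<omega>) s \<le> 1 * fv.Q 0 (?K \<omega>) s"
            by (intro mult_right_mono fv.T_le_1 fv.Q_nonneg)
          also have "\<dots> \<le> qq 0 + (\<Sum>b\<in>nbF s - ?K \<omega>. fv.P (\<lambda>\<omega>'. hit 0 b (\<omega>' - tch (?K \<omega>))))"
            using fv.Q_le_sum[of s "?K \<omega>" 0] True s by (simp add: cn_iff rr_def nbF_def)
          also have "(\<Sum>b\<in>nbF s - ?K \<omega>. fv.P (\<lambda>\<omega>'. hit 0 b (\<omega>' - tch (?K \<omega>))))
              = (\<Sum>b\<in>nbF s. of_bool (cn v s \<omega> \<and> \<not> hit 0 v \<omega> \<and> \<not> cn v b \<omega>) * fv.P (\<lambda>\<omega>'. hit 0 b (\<omega>' - tch (?K \<omega>))))"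
            using True nbF(1) by (intro sum.mono_neutral_cong_left) (auto simp: cn_iff)
          finally have *: "fv.T x s * fv.Q 0 (?K \<omega>) s \<le> ?r" using True by simp
          have "?t s \<omega> \<le> 1 * (fv.T x s * fv.Q 0 (?K \<omega>) s)"
            by (intro mult_right_mono mult_nonneg_nonneg fv.T_nonneg fv.Q_nonneg) simp
          then show ?thesis using * by simp
        qed auto
      qed
      also have "\<dots> = qq 0 * g s + (\<Sum>b\<in>nbF s. fv.EE (\<lambda>\<omega>. of_bool (cn v s \<omega> \<and> \<not> hit 0 v \<omega> \<and> \<not> cn v b \<omega>) * fv.P (\<lambda>\<omega>'. hit 0 b (\<omega>' - tch (?K \<omega>)))))"
        by (simp add: fexp_add fexp_sum fexp_cmult2 g_def fprob_def)
      also have "\<dots> \<le> qq 0 * g s + (\<Sum>b\<in>nbF s. f s b)"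
      proof (intro add_left_mono sum_mono)
        fix b
        let ?\<Phi> = "\<lambda>\<omega>. cn v s \<omega> \<and> \<not> hit 0 v \<omega> \<and> \<not> cn v b \<omega>"
        have "fv.EE (\<lambda>\<omega>. of_bool (?\<Phi> \<omega>) * fv.P (\<lambda>\<omega>'. hit 0 b (\<omega>' - tch (?K \<omega>))))
            = fv.P (\<lambda>\<omega>. ?\<Phi> \<omega> \<and> hit 0 b (\<omega> - tch (?K \<omega>)))"
        proof (rule fv.explore_prob[symmetric, of ?\<Phi> ?K "\<lambda>A \<omega>. hit 0 b (\<omega> - tch A)"])
          fix \<omega> \<omega>' assume *: "?\<Phi> \<omega>" "\<omega> \<inter> tch (?K \<omega>) = \<omega>' \<inter> tch (?K \<omega>)"
          then show "?\<Phi> \<omega>' \<and> ?K \<omega>' = ?K \<omega>"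
            using clus_tch[OF *(2) subset_refl] unfolding cn_iff by simp
        qed simp
        also have "\<dots> \<le> f s b"
          unfolding f_def by (intro fprob_mono fv.pr) (auto intro: inc_diff[OF inc_hit])
        finally show "fv.EE (\<lambda>\<omega>. of_bool (?\<Phi> \<omega>) * fv.P (\<lambda>\<omega>'. hit 0 b (\<omega>' - tch (?K \<omega>)))) \<le> f s b" .
      qed
      finally show ?thesis using True by simp
    qed
  qed
  finally show ?thesis by (simp add: sum.distrib)
qed

text \<open>The argument of \<open>first_arm\<close> with the clusters of \<open>v\<close> and of
  \<open>b\<close> both explored. A far exit point \<open>s\<close> may lie in either; in the
  cluster of \<open>v\<close> it costs \<open>g2 a s * Mb\<close>, in that of \<open>b\<close> it
  costs \<open>g a\<close> times the probability that \<open>b\<close> is green and joined to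
  \<open>s\<close>.\<close>

lemma second_arm:
  assumes a: "a \<in> X" and b: "b \<in> X"
  shows "f a b * fv.M 0 a \<le> (\<Sum>s\<in>X. of_bool (d a s \<le> R) * (qq 0 * f a b + (\<Sum>c\<in>nbF s. h3 a b s c)))
    + (\<Sum>s\<in>X. of_bool (d a s > R) * ((g2 a s * Mb + g a * fv.P (\<lambda>\<omega>. cn b s \<omega> \<and> hit 0 b \<omega>)) * fv.T a s * Mb))"
proof -
  let ?S = "\<lambda>\<omega>. clus (eds \<omega>) v \<union> clus (eds \<omega>) b"
  let ?\<Phi> = "\<lambda>\<omega>. cn v a \<omega> \<and> \<not> hit 0 v \<omega> \<and> \<not> cn v b \<omega> \<and> hit 0 b \<omega>"
  let ?s = "\<lambda>s \<omega>. cn v s \<omega> \<or> cn b s \<omega>"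
  let ?t = "\<lambda>s \<omega>. of_bool (?\<Phi> \<omega> \<and> ?s s \<omega>) * (fv.T a s * fv.Q 0 (?S \<omega>) s)"
  have loc: "clus (eds \<omega>') v = clus (eds \<omega>) v \<and> clus (eds \<omega>') b = clus (eds \<omega>) b \<and>
      hit 0 v \<omega>' = hit 0 v \<omega> \<and> hit 0 b \<omega>' = hit 0 b \<omega>" if "\<omega> \<inter> tch (?S \<omega>) = \<omega>' \<inter> tch (?S \<omega>)" for \<omega> \<omega>'
    using clus_tch[OF that, of v] clus_tch[OF that, of b] by auto
  have "f a b * fv.M 0 a = fv.EE (\<lambda>\<omega>. of_bool (?\<Phi> \<omega>) * fv.M 0 a)"
    by (simp add: f_def fprob_def fexp_cmult2)
  also have "\<dots> \<le> fv.EE (\<lambda>\<omega>. \<Sum>s\<in>X. ?t s \<omega>)"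
  proof (intro fexp_mono fv.pr)
    fix \<omega> assume \<omega>: "\<omega> \<subseteq> Om"
    show "of_bool (?\<Phi> \<omega>) * fv.M 0 a \<le> (\<Sum>s\<in>X. ?t s \<omega>)"
    proof (cases "?\<Phi> \<omega>")
      case True
      have KX: "?S \<omega> \<subseteq> X" using fv.clus_in_X[OF \<omega> v] fv.clus_in_X[OF \<omega> b] by simp
      have "fv.M 0 a \<le> (\<Sum>s\<in>?S \<omega>. fv.T a s * fv.Q 0 (?S \<omega>) s)"
        using True finite_subset[OF KX X(1)] by (intro fv.hit_le_sum) (auto simp: cn_iff)
      also have "\<dots> = (\<Sum>s\<in>X. ?t s \<omega>)"
        using True KX X(1) by (intro sum.mono_neutral_cong_left) (auto simp: cn_iff)
      finally show ?thesis using True by simp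
    qed (auto intro!: sum_nonneg mult_nonneg_nonneg fv.T_nonneg fv.Q_nonneg)
  qed
  also have "\<dots> = (\<Sum>s\<in>X. fv.EE (?t s))" by (rule fexp_sum)
  also have "\<dots> \<le> (\<Sum>s\<in>X. of_bool (d a s \<le> R) * (qq 0 * f a b + (\<Sum>c\<in>nbF s. h3 a b s c))
    + of_bool (d a s > R) * ((g2 a s * Mb + g a * fv.P (\<lambda>\<omega>. cn b s \<omega> \<and> hit 0 b \<omega>)) * fv.T a s * Mb))"
  proof (rule sum_mono)
    fix s assume s: "s \<in> X"
    show "fv.EE (?t s) \<le> of_bool (d a s \<le> R) * (qq 0 * f a b + (\<Sum>c\<in>nbF s. h3 a b s c))
        + of_bool (d a s > R) * ((g2 a s * Mb + g a * fv.P (\<lambda>\<omega>. cn b s \<omega> \<and> hit 0 b \<omega>)) * fv.T a s * Mb)"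
    proof (cases "d a s \<le> R")
      case False
      have "fv.EE (?t s) \<le> fv.EE (\<lambda>\<omega>. of_bool (?\<Phi> \<omega> \<and> ?s s \<omega>) * (fv.T a s * Mb))"
        using fv.Q_le_M[of 0 _ s] Mb[OF s]
        by (intro fexp_mono fv.pr mult_left_mono fv.T_nonneg) (auto intro: order_trans)
      also have "\<dots> = fv.P (\<lambda>\<omega>. ?\<Phi> \<omega> \<and> ?s s \<omega>) * (fv.T a s * Mb)" by (simp add: fexp_cmult2 fprob_def)
      also have "\<dots> \<le> (g2 a s * Mb + g a * fv.P (\<lambda>\<omega>. cn b s \<omega> \<and> hit 0 b \<omega>)) * (fv.T a s * Mb)"
      proof (intro mult_right_mono mult_nonneg_nonneg fv.T_nonneg Mb_nonneg)
        \<comment> \<open>The two positions of \<open>s\<close> are separated first; in each,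
          \<open>explore_one\<close> decouples the cluster of \<open>b\<close> from that of
          \<open>v\<close>.\<close>
        have "fv.P (\<lambda>\<omega>. ?\<Phi> \<omega> \<and> ?s s \<omega>) \<le> (\<Sum>k\<in>{True, False}. fv.P (\<lambda>\<omega>. if k then
            (cn v a \<omega> \<and> cn v s \<omega> \<and> \<not> hit 0 v \<omega>) \<and> \<not> cn v b \<omega> \<and> hit 0 b \<omega>
            else (cn v a \<omega> \<and> \<not> hit 0 v \<omega>) \<and> \<not> cn v b \<omega> \<and> (cn b s \<omega> \<and> hit 0 b \<omega>)))"
          by (intro fprob_union_bound fv.pr) auto
        also have "\<dots> = fv.P (\<lambda>\<omega>. (cn v a \<omega> \<and> cn v s \<omega> \<and> \<not> hit 0 v \<omega>) \<and> \<not> cn v b \<omega> \<and> hit 0 b \<omega>)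
            + fv.P (\<lambda>\<omega>. (cn v a \<omega> \<and> \<not> hit 0 v \<omega>) \<and> \<not> cn v b \<omega> \<and> (cn b s \<omega> \<and> hit 0 b \<omega>))" by simp
        also have "\<dots> \<le> g2 a s * fv.P (hit 0 b) + g a * fv.P (\<lambda>\<omega>. cn b s \<omega> \<and> hit 0 b \<omega>)"
          unfolding g2_def g_def
        proof (intro add_mono explore_one inc_hit)
          show "inc (\<lambda>\<omega>. cn b s \<omega> \<and> hit 0 b \<omega>)"
            using inc_cn[of b s] inc_hit[of 0 b] unfolding inc_def by blast
        next
          fix \<omega> assume "\<omega> \<subseteq> Om" "b \<notin> clus (eds \<omega>) v" "hit 0 b \<omega>"
          then show "hit 0 b (\<omega> - tch (clus (eds \<omega>) v))" using hit_off by blast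
        next
          fix \<omega> assume "\<omega> \<subseteq> Om" "b \<notin> clus (eds \<omega>) v" "cn b s \<omega> \<and> hit 0 b \<omega>"
          then show "cn b s (\<omega> - tch (clus (eds \<omega>) v)) \<and> hit 0 b (\<omega> - tch (clus (eds \<omega>) v))"
            using hit_off clus_off unfolding cn_iff by metis
        next
          fix \<omega> \<omega>' assume *: "cn v a \<omega> \<and> cn v s \<omega> \<and> \<not> hit 0 v \<omega>" "\<omega> \<inter> tch (clus (eds \<omega>) v) = \<omega>' \<inter> tch (clus (eds \<omega>) v)"
          then show "cn v a \<omega>' \<and> cn v s \<omega>' \<and> \<not> hit 0 v \<omega>'"
            using clus_tch[OF *(2) subset_refl] unfolding cn_iff by simp
        next
          fix \<omega> \<omega>' assume *: "cn v a \<omega> \<and> \<not> hit 0 v \<omega>" "\<omega> \<inter> tch (clus (eds \<omega>) v) = \<omega>' \<inter> tch (clus (eds \<omega>) v)"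
          then show "cn v a \<omega>' \<and> \<not> hit 0 v \<omega>'"
            using clus_tch[OF *(2) subset_refl] unfolding cn_iff by simp
        qed
        also have "\<dots> \<le> g2 a s * Mb + g a * fv.P (\<lambda>\<omega>. cn b s \<omega> \<and> hit 0 b \<omega>)"
          using Mb[OF b] by (intro add_right_mono mult_left_mono g2_nonneg) (simp add: fv.M_def)
        finally show "fv.P (\<lambda>\<omega>. ?\<Phi> \<omega> \<and> ?s s \<omega>) \<le> g2 a s * Mb + g a * fv.P (\<lambda>\<omega>. cn b s \<omega> \<and> hit 0 b \<omega>)" .
      qed
      finally show ?thesis using False by (simp add: mult.assoc)
    next
      case True
      have "fv.EE (?t s) \<le> fv.EE (\<lambda>\<omega>. of_bool (?\<Phi> \<omega>) * qq 0 +
         (\<Sum>c\<in>nbF s. of_bool (?\<Phi> \<omega> \<and> ?s s \<omega> \<and> \<not> ?s c \<omega>) * fv.P (\<lambda>\<omega>'. hit 0 c (\<omega>' - tch (?S \<omega>)))))"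
      proof (intro fexp_mono fv.pr)
        fix \<omega>
        let ?r = "of_bool (?\<Phi> \<omega>) * qq 0 +
         (\<Sum>c\<in>nbF s. of_bool (?\<Phi> \<omega> \<and> ?s s \<omega> \<and> \<not> ?s c \<omega>) * fv.P (\<lambda>\<omega>'. hit 0 c (\<omega>' - tch (?S \<omega>))))"
        show "?t s \<omega> \<le> ?r"
        proof (cases "?\<Phi> \<omega> \<and> ?s s \<omega>")
          case True
          have "fv.T a s * fv.Q 0 (?S \<omega>) s \<le> 1 * fv.Q 0 (?S \<omega>) s"
            by (intro mult_right_mono fv.T_le_1 fv.Q_nonneg)
          also have "\<dots> \<le> qq 0 + (\<Sum>c\<in>nbF s - ?S \<omega>. fv.P (\<lambda>\<omega>'. hit 0 c (\<omega>' - tch (?S \<omega>))))"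
            using fv.Q_le_sum[of s "?S \<omega>" 0] True s by (simp add: cn_iff rr_def nbF_def)
          also have "(\<Sum>c\<in>nbF s - ?S \<omega>. fv.P (\<lambda>\<omega>'. hit 0 c (\<omega>' - tch (?S \<omega>))))
              = (\<Sum>c\<in>nbF s. of_bool (?\<Phi> \<omega> \<and> ?s s \<omega> \<and> \<not> ?s c \<omega>) * fv.P (\<lambda>\<omega>'. hit 0 c (\<omega>' - tch (?S \<omega>))))"
            using True nbF(1) by (intro sum.mono_neutral_cong_left) (auto simp: cn_iff)
          finally show ?thesis using True by simp
        qed (auto intro!: add_nonneg_nonneg sum_nonneg mult_nonneg_nonneg qq fprob_nonneg fv.pr)
      qed
      also have "\<dots> = qq 0 * f a b + (\<Sum>c\<in>nbF s. fv.EE (\<lambda>\<omega>. of_bool (?\<Phi> \<omega> \<and> ?s s \<omega> \<and> \<not> ?s c \<omega>) * fv.P (\<lambda>\<omega>'. hit 0 c (\<omega>' - tch (?S \<omega>)))))"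
        by (simp add: fexp_add fexp_sum fexp_cmult2 f_def fprob_def)
      also have "\<dots> \<le> qq 0 * f a b + (\<Sum>c\<in>nbF s. h3 a b s c)"
      proof (intro add_left_mono sum_mono)
        fix c
        let ?\<Psi> = "\<lambda>\<omega>. ?\<Phi> \<omega> \<and> ?s s \<omega> \<and> \<not> ?s c \<omega>"
        have "fv.EE (\<lambda>\<omega>. of_bool (?\<Psi> \<omega>) * fv.P (\<lambda>\<omega>'. hit 0 c (\<omega>' - tch (?S \<omega>))))
            = fv.P (\<lambda>\<omega>. ?\<Psi> \<omega> \<and> hit 0 c (\<omega> - tch (?S \<omega>)))"
        proof (rule fv.explore_prob[symmetric, of ?\<Psi> ?S "\<lambda>A \<omega>. hit 0 c (\<omega> - tch A)"])
          fix \<omega> \<omega>' assume *: "?\<Psi> \<omega>" "\<omega> \<inter> tch (?S \<omega>) = \<omega>' \<inter> tch (?S \<omega>)"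
          then show "?\<Psi> \<omega>' \<and> ?S \<omega>' = ?S \<omega>"
            using loc[OF *(2)] unfolding cn_iff by simp
        qed simp
        also have "\<dots> \<le> h3 a b s c"
          unfolding h3_def by (intro fprob_mono fv.pr) (auto intro: inc_diff[OF inc_hit])
        finally show "fv.EE (\<lambda>\<omega>. of_bool (?\<Psi> \<omega>) * fv.P (\<lambda>\<omega>'. hit 0 c (\<omega>' - tch (?S \<omega>)))) \<le> h3 a b s c" .
      qed
      finally show ?thesis using True by simp
    qed
  qed
  finally show ?thesis by (simp add: sum.distrib)
qed

end

end

section \<open>Surgery at places with three arms\<close>

lemma eds_Diff_Inl: "eds (\<omega> - Inl ` A) = eds \<omega> - A" and grn_Diff_Inl: "grn i (\<omega> - Inl ` A) = grn i \<omega>"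
  by (auto simp: eds_def grn_def)

text \<open>With the edge \<open>{a, b}\<close> open the points \<open>a\<close> and
  \<open>b\<close> are interchangeable, and forcing it open costs at most a factor
  \<open>p\<close>.\<close>

lemma (in pgraph) tau_neighbour:
  assumes p: "0 < p" "p \<le> 1" and e: "{a, b} \<in> E"
  shows "tau p a s \<le> tau p b s / p"
  unfolding tau_def[of p a s]
proof (rule supf_le)
  fix F assume F: "F \<in> fins"
  let ?e = "{a, b}" and ?F = "F - {{a, b}}"
  have fF: "finite ?F" "insert ?e ?F \<in> fins" using F e by (auto simp: fins_def)
  have pr: "probs (\<lambda>_. p)" using p by (intro probs_const) auto
  have ab: "conn (insert ?e \<eta>) a s \<Longrightarrow> conn (insert ?e \<eta>) b s" for \<eta>
    using conn_trans[OF conn_sym[OF conn_edge[of a b "insert ?e \<eta>"]]] by simp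
  have "fprob F (\<lambda>_. p) (\<lambda>\<eta>. conn \<eta> a s) \<le> fprob (insert ?e ?F) (\<lambda>_. p) (\<lambda>\<eta>. conn \<eta> a s)"
    by (intro fprob_mono_set pr) (use fF conn_mono in auto)
  also have "\<dots> = p * fprob ?F (\<lambda>_. p) (\<lambda>\<eta>. conn (insert ?e \<eta>) a s) + (1 - p) * fprob ?F (\<lambda>_. p) (\<lambda>\<eta>. conn \<eta> a s)"
    unfolding fprob_def by (rule fexp_insert[OF fF(1)]) simp
  also have "\<dots> \<le> p * fprob ?F (\<lambda>_. p) (\<lambda>\<eta>. conn (insert ?e \<eta>) a s) + (1 - p) * fprob ?F (\<lambda>_. p) (\<lambda>\<eta>. conn (insert ?e \<eta>) a s)"
    using p conn_mono[OF subset_insertI] by (intro add_left_mono mult_left_mono fprob_mono pr) auto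
  also have "\<dots> = fprob ?F (\<lambda>_. p) (\<lambda>\<eta>. conn (insert ?e \<eta>) a s)" by (simp add: algebra_simps)
  finally have 1: "fprob F (\<lambda>_. p) (\<lambda>\<eta>. conn \<eta> a s) \<le> fprob ?F (\<lambda>_. p) (\<lambda>\<eta>. conn (insert ?e \<eta>) a s)" .
  have "p * fprob ?F (\<lambda>_. p) (\<lambda>\<eta>. conn (insert ?e \<eta>) a s) \<le> p * fprob ?F (\<lambda>_. p) (\<lambda>\<eta>. conn (insert ?e \<eta>) b s)"
    using p ab by (intro mult_left_mono fprob_mono pr) auto
  also have "\<dots> \<le> p * fprob ?F (\<lambda>_. p) (\<lambda>\<eta>. conn (insert ?e \<eta>) b s) + (1 - p) * fprob ?F (\<lambda>_. p) (\<lambda>\<eta>. conn \<eta> b s)"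
    using p by (simp add: fprob_nonneg pr)
  also have "\<dots> = fprob (insert ?e ?F) (\<lambda>_. p) (\<lambda>\<eta>. conn \<eta> b s)"
    unfolding fprob_def by (rule fexp_insert[OF fF(1), symmetric]) simp
  also have "\<dots> \<le> tau p b s" using p fF by (intro tau_upper) auto
  finally have "fprob ?F (\<lambda>_. p) (\<lambda>\<eta>. conn (insert ?e \<eta>) a s) \<le> tau p b s / p"
    using p by (simp add: field_simps)
  then show "fexp F (\<lambda>_. p) (\<lambda>\<eta>. of_bool (conn \<eta> a s)) \<le> tau p b s / p"
    using 1 by (simp add: fprob_def)
qed (use p in auto)

text \<open>After its last visit \<open>y\<close> to the ball a path uses no edge inside the ball,
  because such an edge has an end in the ball other than \<open>y\<close>.\<close>

lemma (in pgraph) ball_exit: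
  assumes "u \<in> ball a \<rho>" "conn \<eta> u z"
  shows "\<exists>y\<in>ball a \<rho>. conn \<eta> u y \<and> conn (\<eta> - U a \<rho>) y z"
proof -
  obtain s I J where s: "s \<in> ball a \<rho>" "I \<subseteq> \<eta>" "J \<subseteq> \<eta>" "conn I u s" "conn (off J (ball a \<rho> - {s})) s z"
    using last_exit[OF assms(2), of "ball a \<rho>"] assms(1) by blast
  have "off J (ball a \<rho> - {s}) \<subseteq> \<eta> - U a \<rho>"
  proof
    fix e assume e: "e \<in> off J (ball a \<rho> - {s})"
    have "e \<notin> U a \<rho>"
    proof
      assume "e \<in> U a \<rho>"
      then have "card e = 2" "e \<subseteq> ball a \<rho>" using edge_card by (auto simp: U_def)
      then have "e \<inter> (ball a \<rho> - {s}) \<noteq> {}" by (auto simp: card_2_iff)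
      then show False using e by (simp add: off_def)
    qed
    then show "e \<in> \<eta> - U a \<rho>" using e s(3) by (auto simp: off_def)
  qed
  then show ?thesis using s conn_mono[OF _ s(5)] conn_mono[OF s(2,4)] by blast
qed

text \<open>The event is read off with the edges inside the ball removed, hence is independent of them.\<close>
definition (in pgraph) three_arms_at :: "'a \<Rightarrow> 'a \<Rightarrow> nat \<Rightarrow> 'a coord set \<Rightarrow> bool" where
  "three_arms_at v a \<rho> \<omega> \<longleftrightarrow> (\<exists>u\<in>ball a \<rho>. cn v u \<omega>) \<and> \<not> hit 0 v \<omega> \<and>
     (\<exists>y1\<in>ball a \<rho>. \<exists>y2\<in>ball a \<rho>. hit 0 y1 \<omega> \<and> hit 0 y2 \<omega> \<and> \<not> cn y1 y2 \<omega>)"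

text \<open>Each of the three paths is cut at its last visit to the ball, after which
  \<open>ball_exit\<close> keeps it off the edges inside. Deleting edges can neither make
  \<open>v\<close> green nor join the two green clusters.\<close>

lemma (in pgraph) three_arms:
  assumes "cn v a \<omega>" "\<not> hit 0 v \<omega>" "hit 0 b \<omega>" "hit 0 c \<omega>" "\<not> cn b c \<omega>"
    and "a \<in> ball a \<rho>" "b \<in> ball a \<rho>" "c \<in> ball a \<rho>"
  shows "three_arms_at v a \<rho> (\<omega> - Inl ` U a \<rho>)"
proof -
  let ?\<eta> = "eds \<omega> - U a \<rho>"
  have m: "conn ?\<eta> x y \<Longrightarrow> conn (eds \<omega>) x y" for x y by (rule conn_mono[rotated]) auto
  obtain u where u: "u \<in> ball a \<rho>" "conn ?\<eta> u v"
    using ball_exit[OF assms(6), of "eds \<omega>" v] conn_sym[OF assms(1)[unfolded cn_def]] by blast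
  have 1: "cn v u (\<omega> - Inl ` U a \<rho>)" using conn_sym[OF u(2)] by (simp add: cn_def eds_Diff_Inl)
  have 2: "\<not> hit 0 v (\<omega> - Inl ` U a \<rho>)" using assms(2) inc_diff[OF inc_hit] by metis
  obtain g1 where g1: "g1 \<in> grn 0 \<omega>" "conn (eds \<omega>) b g1" using assms(3) by (auto simp: hit_def)
  obtain y1 where y1: "y1 \<in> ball a \<rho>" "conn (eds \<omega>) b y1" "conn ?\<eta> y1 g1"
    using ball_exit[OF assms(7) g1(2)] by blast
  obtain g2 where g2: "g2 \<in> grn 0 \<omega>" "conn (eds \<omega>) c g2" using assms(4) by (auto simp: hit_def)
  obtain y2 where y2: "y2 \<in> ball a \<rho>" "conn (eds \<omega>) c y2" "conn ?\<eta> y2 g2"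
    using ball_exit[OF assms(8) g2(2)] by blast
  have "\<not> conn ?\<eta> y1 y2"
  proof
    assume "conn ?\<eta> y1 y2"
    then have "conn (eds \<omega>) b c" by (rule conn_trans[OF y1(2) conn_trans[OF m conn_sym[OF y2(2)]]])
    then show False using assms(5) by (simp add: cn_def)
  qed
  then have "\<not> cn y1 y2 (\<omega> - Inl ` U a \<rho>)" by (simp add: cn_def eds_Diff_Inl)
  moreover have "hit 0 y1 (\<omega> - Inl ` U a \<rho>)" "hit 0 y2 (\<omega> - Inl ` U a \<rho>)"
    using g1(1) g2(1) y1(3) y2(3) by (auto simp: hit_def eds_Diff_Inl grn_Diff_Inl)
  ultimately show ?thesis unfolding three_arms_at_def using 1 2 u(1) y1(1) y2(1) by blast
qed

lemma (in pgraph) three_arms_disconnect: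
  assumes aV: "a \<in> V" "a' \<in> V" and dj: "ball a \<rho> \<inter> ball a' \<rho> = {}"
    and U: "U a \<rho> \<subseteq> eds \<omega>" "U a' \<rho> \<subseteq> eds \<omega>"
    and 3: "three_arms_at v a \<rho> (\<omega> - Inl ` U a \<rho>)" "\<not> hit 0 v (\<omega> - Inl ` U a' \<rho>)"
    and s: "s \<in> ball a \<rho>" "conn (eds \<omega> - U a \<rho> - U a' \<rho>) s v"
  shows False
proof -
  let ?B = "ball a \<rho>" and ?B' = "ball a' \<rho>" and ?U = "U a \<rho>" and ?U' = "U a' \<rho>" and ?\<eta> = "eds \<omega>"
  have U'B: "e \<subseteq> ?B' \<and> e \<noteq> {}" if "e \<in> ?U'" for e
    using that edge_card[of e] by (auto simp: U_def)
  have djU: "?U \<inter> ?U' = {}" using U'B dj by (fastforce simp: U_def)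
  obtain y1 y2 where y: "y1 \<in> ?B" "y2 \<in> ?B" "hit 0 y1 (\<omega> - Inl ` ?U)" "hit 0 y2 (\<omega> - Inl ` ?U)" "\<not> conn (?\<eta> - ?U) y1 y2"
    using 3(1) by (auto simp: three_arms_at_def cn_def eds_Diff_Inl)
  \<comment> \<open>Two arms that both meet the second ball would be joined through its open edges,
    without using the edges of the first ball.\<close>
  have "clus (?\<eta> - ?U) y1 \<inter> ?B' = {} \<or> clus (?\<eta> - ?U) y2 \<inter> ?B' = {}"
  proof (rule ccontr)
    assume "\<not> ?thesis"
    then obtain z1 z2 where z: "z1 \<in> ?B'" "z2 \<in> ?B'" "conn (?\<eta> - ?U) y1 z1" "conn (?\<eta> - ?U) y2 z2"
      by (auto simp: clus_def)
    have "?U' \<subseteq> ?\<eta> - ?U" using U djU by auto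
    then have z': "conn (?\<eta> - ?U) a' z1" "conn (?\<eta> - ?U) a' z2"
      by (auto intro!: conn_mono[OF _ conn_U[OF aV(2)]] z(1,2))
    have "conn (?\<eta> - ?U) y1 y2"
      by (rule conn_trans[OF z(3) conn_trans[OF conn_sym[OF z'(1)] conn_trans[OF z'(2) conn_sym[OF z(4)]]]])
    then show False using y(5) by simp
  qed
  then obtain y where y: "y \<in> ?B" "hit 0 y (\<omega> - Inl ` ?U)" "clus (?\<eta> - ?U) y \<inter> ?B' = {}"
    using y(1-4) by auto
  obtain g where g: "g \<in> grn 0 \<omega>" "conn (?\<eta> - ?U) y g"
    using y(2) by (auto simp: hit_def eds_Diff_Inl grn_Diff_Inl)
  \<comment> \<open>The cluster of \<open>y\<close> misses the second ball, so deleting the edges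
    there does not change it.\<close>
  have "clus (?\<eta> - ?U - ?U') y = clus (?\<eta> - ?U) y"
    by (rule clus_local[OF subset_refl]) (use y(3) U'B in blast)
  then have "conn (?\<eta> - ?U - ?U') y g" using g(2) unfolding clus_def by blast
  then have yg: "conn (?\<eta> - ?U') y g" by (rule conn_mono[rotated]) auto
  have "?U \<subseteq> ?\<eta> - ?U'" using U djU by auto
  then have "conn (?\<eta> - ?U') a s" "conn (?\<eta> - ?U') a y"
    by (auto intro!: conn_mono[OF _ conn_U[OF aV(1)]] s(1) y(1))
  then have sy: "conn (?\<eta> - ?U') s y" by (rule conn_trans[OF conn_sym])
  have "conn (?\<eta> - ?U') s v" using s(2) by (rule conn_mono[rotated]) auto
  then have "conn (?\<eta> - ?U') v g" by (rule conn_trans[OF conn_sym conn_trans[OF sy yg]])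
  then show False using 3(2) g(1) by (auto simp: hit_def eds_Diff_Inl grn_Diff_Inl)
qed

text \<open>Exchanging the balls if needed, \<open>v\<close> is joined to the first ball outside the second one. One of the
  two green arms at the first ball avoids the second, so \<open>v\<close> is green even with the edges in the
  second ball removed.\<close>
lemma (in pgraph) three_arms_unique:
  assumes aV: "a \<in> V" "a' \<in> V" and dj: "ball a \<rho> \<inter> ball a' \<rho> = {}"
    and U: "U a \<rho> \<subseteq> eds \<omega>" "U a' \<rho> \<subseteq> eds \<omega>"
    and 3: "three_arms_at v a \<rho> (\<omega> - Inl ` U a \<rho>)" "three_arms_at v a' \<rho> (\<omega> - Inl ` U a' \<rho>)"
  shows False
proof -
  let ?S = "ball a \<rho> \<union> ball a' \<rho>" and ?\<eta> = "eds \<omega>"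
  obtain u where u: "u \<in> ball a \<rho>" "conn (?\<eta> - U a \<rho>) v u"
    using 3(1) by (auto simp: three_arms_at_def cn_def eds_Diff_Inl)
  have "conn ?\<eta> u v" using conn_sym[OF u(2)] by (rule conn_mono[rotated]) auto
  then obtain s I J where s: "s \<in> ?S" "J \<subseteq> ?\<eta>" "conn (off J (?S - {s})) s v"
    using last_exit[of ?\<eta> u v ?S] u(1) by auto
  have "off J (?S - {s}) \<subseteq> ?\<eta> - U a \<rho> - U a' \<rho>"
  proof
    fix e assume e: "e \<in> off J (?S - {s})"
    have "e \<notin> U c \<rho>" if "ball c \<rho> \<subseteq> ?S" for c
    proof
      assume "e \<in> U c \<rho>"
      then have "card e = 2" "e \<subseteq> ?S" using edge_card that by (auto simp: U_def)
      then have "e \<inter> (?S - {s}) \<noteq> {}" by (auto simp: card_2_iff)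
      then show False using e by (simp add: off_def)
    qed
    then show "e \<in> ?\<eta> - U a \<rho> - U a' \<rho>" using e s(2) by (auto simp: off_def)
  qed
  then have sv: "conn (?\<eta> - U a \<rho> - U a' \<rho>) s v" by (rule conn_mono[OF _ s(3)])
  show False
  proof (cases "s \<in> ball a \<rho>")
    case True
    show False by (rule three_arms_disconnect[OF aV dj U 3(1) _ True sv]) (use 3(2) in \<open>auto simp: three_arms_at_def\<close>)
  next
    case False
    then have s': "s \<in> ball a' \<rho>" using s(1) by simp
    have "conn (?\<eta> - U a' \<rho> - U a \<rho>) s v" using sv by (simp add: Diff_Diff_Int Diff_eq Int_ac)
    then show False
      by (intro three_arms_disconnect[OF aV(2,1) _ U(2,1) 3(2) _ s']) (use dj 3(1) in \<open>auto simp: three_arms_at_def\<close>)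
  qed
qed

context finite_volume begin

context
  fixes v :: 'a and Mb :: real
  assumes v: "v \<in> X" and I0: "0 \<in> I" and Mb: "\<And>s. s \<in> X \<Longrightarrow> fv.M 0 s \<le> Mb"
begin

text \<open>By \<open>three_arms_unique\<close> any two such centres have intersecting balls, so all
  of them lie within \<open>2 * \<rho>\<close> of one. If there is one, its open ball joins
  \<open>v\<close> to a green vertex, which supplies the factor \<open>hit 0 v\<close>.\<close>

lemma surgery_count:
  assumes V1: "finite V1" "V1 \<subseteq> V" and \<omega>: "\<omega> \<subseteq> Om"
  shows "(\<Sum>a\<in>V1. of_bool (U a \<rho> \<subseteq> eds \<omega> \<and> three_arms_at v a \<rho> (\<omega> - Inl ` U a \<rho>))) \<le> real (N (2 * \<rho>)) * of_bool (hit 0 v \<omega>)"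
proof -
  define A where "A = {a \<in> V1. U a \<rho> \<subseteq> eds \<omega> \<and> three_arms_at v a \<rho> (\<omega> - Inl ` U a \<rho>)}"
  have L: "(\<Sum>a\<in>V1. of_bool (U a \<rho> \<subseteq> eds \<omega> \<and> three_arms_at v a \<rho> (\<omega> - Inl ` U a \<rho>))) = real (card A)"
    unfolding A_def using V1(1) by (simp add: Int_def)
  show ?thesis
  proof (cases "A = {}")
    case False
    then obtain a0 where a0: "a0 \<in> A" by auto
    then have a0V: "a0 \<in> V" using V1 by (auto simp: A_def)
    have "A \<subseteq> ball a0 (2 * \<rho>)"
    proof
      fix a assume a: "a \<in> A"
      then have aV: "a \<in> V" using V1 by (auto simp: A_def)
      have "ball a0 \<rho> \<inter> ball a \<rho> \<noteq> {}"
        using three_arms_unique[OF a0V aV, of \<rho> \<omega> v] a a0 by (auto simp: A_def)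
      then obtain z where "z \<in> ball a0 \<rho>" "z \<in> ball a \<rho>" by auto
      then show "a \<in> ball a0 (2 * \<rho>)"
        using dist_triangle[OF a0V _ aV, of z] dist_sym[OF aV, of z] aV by (auto simp: ball_def)
    qed
    then have "card A \<le> N (2 * \<rho>)"
      using card_mono[OF finite_ball[OF a0V]] card_ball[OF a0V] by metis
    moreover have "hit 0 v \<omega>"
    proof -
      have U: "U a0 \<rho> \<subseteq> eds \<omega>" and "three_arms_at v a0 \<rho> (\<omega> - Inl ` U a0 \<rho>)" using a0 by (auto simp: A_def)
      then obtain u y where uy: "u \<in> ball a0 \<rho>" "conn (eds \<omega> - U a0 \<rho>) v u" "y \<in> ball a0 \<rho>" "hit 0 y (\<omega> - Inl ` U a0 \<rho>)"
        by (auto simp: three_arms_at_def cn_def eds_Diff_Inl)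
      obtain gr where gr: "gr \<in> grn 0 \<omega>" "conn (eds \<omega>) y gr"
        using inc_diff[OF inc_hit uy(4)] by (auto simp: hit_def)
      have "conn (eds \<omega>) v u" using uy(2) by (rule conn_mono[rotated]) auto
      moreover have "conn (eds \<omega>) a0 u" "conn (eds \<omega>) a0 y"
        by (auto intro!: conn_mono[OF U] conn_U[OF a0V] uy(1,3))
      then have "conn (eds \<omega>) u y" by (rule conn_trans[OF conn_sym])
      ultimately have "conn (eds \<omega>) v gr" using conn_trans[OF _ conn_trans[OF _ gr(2)]] by simp
      then show ?thesis using gr(1) by (auto simp: hit_def)
    qed
    ultimately show ?thesis unfolding L by simp
  qed (simp add: L)
qed

definition three_arm_prob where "three_arm_prob a \<rho> = fv.P (\<lambda>\<omega>. three_arms_at v a \<rho> (\<omega> - Inl ` U a \<rho>))"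

lemma three_arm_prob_nonneg: "0 \<le> three_arm_prob a \<rho>"
  unfolding three_arm_prob_def by (intro fprob_nonneg fv.pr)

text \<open>The three-arm event ignores the edges in the ball, so opening them is independent of it
  and costs \<open>p ^ card (U a \<rho>)\<close>. The sum over all centres is then at most a bounded
  count on the event that \<open>v\<close> is green, whence the single factor
  \<open>Mb\<close>.\<close>

lemma surgery:
  assumes V1: "finite V1" "V1 \<subseteq> V" "\<And>a. a \<in> V1 \<Longrightarrow> U a \<rho> \<subseteq> F"
  shows "p ^ (2 ^ N \<rho>) * (\<Sum>a\<in>V1. three_arm_prob a \<rho>) \<le> real (N (2 * \<rho>)) * Mb"
proof -
  have "p ^ (2 ^ N \<rho>) * three_arm_prob a \<rho> \<le> fv.P (\<lambda>\<omega>. U a \<rho> \<subseteq> eds \<omega> \<and> three_arms_at v a \<rho> (\<omega> - Inl ` U a \<rho>))"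
    if a: "a \<in> V1" for a
  proof -
    let ?Z = "Inl ` U a \<rho> :: 'a coord set"
    have "fv.P (\<lambda>\<omega>. U a \<rho> \<subseteq> eds \<omega> \<and> three_arms_at v a \<rho> (\<omega> - ?Z)) = fv.P (\<lambda>\<omega>. ?Z \<subseteq> \<omega> \<and> three_arms_at v a \<rho> (\<omega> - ?Z))"
      by (simp add: Inl_subset_iff)
    also have "\<dots> = fv.P (\<lambda>\<omega>. ?Z \<subseteq> \<omega>) * three_arm_prob a \<rho>"
      unfolding three_arm_prob_def by (rule fprob_indep[OF fv.fin, of _ ?Z]) auto
    also have "fv.P (\<lambda>\<omega>. ?Z \<subseteq> \<omega>) = (\<Prod>c\<in>?Z. rr c)"
      by (rule fprob_superset[OF fv.fin]) (use V1(3)[OF a] in \<open>auto simp: Om_def\<close>)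
    also have "\<dots> = p ^ card (U a \<rho>)"
      by (subst prod.reindex) (auto simp: rr_def)
    finally have "fv.P (\<lambda>\<omega>. U a \<rho> \<subseteq> eds \<omega> \<and> three_arms_at v a \<rho> (\<omega> - ?Z)) = p ^ card (U a \<rho>) * three_arm_prob a \<rho>" .
    moreover have "p ^ (2 ^ N \<rho>) \<le> p ^ card (U a \<rho>)"
      using p card_U[of a \<rho>] a V1(2) by (intro power_decreasing) auto
    ultimately show ?thesis by (simp add: mult_right_mono three_arm_prob_nonneg)
  qed
  then have "p ^ (2 ^ N \<rho>) * (\<Sum>a\<in>V1. three_arm_prob a \<rho>)
      \<le> (\<Sum>a\<in>V1. fv.P (\<lambda>\<omega>. U a \<rho> \<subseteq> eds \<omega> \<and> three_arms_at v a \<rho> (\<omega> - Inl ` U a \<rho>)))"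
    unfolding sum_distrib_left by (intro sum_mono)
  also have "\<dots> = fv.EE (\<lambda>\<omega>. \<Sum>a\<in>V1. of_bool (U a \<rho> \<subseteq> eds \<omega> \<and> three_arms_at v a \<rho> (\<omega> - Inl ` U a \<rho>)))"
    unfolding fprob_def by (rule fexp_sum[symmetric])
  also have "\<dots> \<le> fv.EE (\<lambda>\<omega>. real (N (2 * \<rho>)) * of_bool (hit 0 v \<omega>))"
    by (intro fexp_mono fv.pr surgery_count V1)
  also have "\<dots> = real (N (2 * \<rho>)) * fv.M 0 v" by (simp add: fexp_cmult fv.M_def fprob_def)
  also have "\<dots> \<le> real (N (2 * \<rho>)) * Mb" using Mb[OF v] by (intro mult_left_mono) auto
  finally show ?thesis .
qed

text \<open>The radius is \<open>R + 1\<close> because \<open>c\<close> is one edge beyond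
  \<open>s\<close>.\<close>

lemma h3_le_three_arm_prob:
  assumes "{a, b} \<in> F" "d a s \<le> R" "{s, c} \<in> F"
  shows "h3 v a b s c \<le> three_arm_prob a (R + 1)"
proof -
  have E: "{a, b} \<in> E" "{s, c} \<in> E" using assms F_sub by auto
  have in_V: "a \<in> V" "b \<in> V" "s \<in> V" "c \<in> V" using edge_V E by blast+
  have "a \<in> ball a (R + 1)" "b \<in> ball a (R + 1)" "c \<in> ball a (R + 1)"
    using in_V dist_edge[OF E(1)] dist_edge[OF E(2)] dist_triangle[of a s c] assms(2) by (auto simp: ball_def)
  note b = this
  have h3: "h3 v a b s c = fv.P (\<lambda>\<omega>. cn v a \<omega> \<and> \<not> hit 0 v \<omega> \<and> \<not> cn v b \<omega> \<and> hit 0 b \<omega>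
    \<and> (cn v s \<omega> \<or> cn b s \<omega>) \<and> \<not> cn v c \<omega> \<and> \<not> cn b c \<omega> \<and> hit 0 c \<omega>)"
    by (rule h3_def[OF v I0 Mb])
  show ?thesis
    unfolding h3 three_arm_prob_def
    by (intro fprob_mono fv.pr) (use three_arms[OF _ _ _ _ _ b] in blast)
qed

section \<open>Summation over a window with the triangle condition\<close>

definition chi where "chi = (\<Sum>x\<in>X. g v x)"

lemma arm_probs_nonneg: "0 \<le> g v x" "0 \<le> f v a b" "0 \<le> g2 v x s" "0 \<le> h3 v a b s c"
  using g_nonneg[OF v I0 Mb] f_nonneg[OF v I0 Mb] g2_nonneg[OF v I0 Mb] h3_nonneg[OF v I0 Mb] by auto

lemma chi_nonneg: "0 \<le> chi" unfolding chi_def by (intro sum_nonneg arm_probs_nonneg)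

lemma bound_nonneg: "0 \<le> Mb" by (rule Mb_nonneg[OF v I0 Mb])

text \<open>The tree bound on \<open>g2\<close> branches at some \<open>w\<close>, and
  \<open>T x s\<close> closes the two branches to a triangle at \<open>w\<close>. Over far pairs
  this is a triangle tail, and the remaining factor \<open>g v w\<close> sums to
  \<open>chi\<close>.\<close>

lemma far_pairs:
  assumes H: "\<And>w Z. w \<in> V \<Longrightarrow> Z \<subseteq> X \<times> X \<Longrightarrow> (\<And>x s. (x, s) \<in> Z \<Longrightarrow> d x s > R) \<Longrightarrow> (\<Sum>(x, s)\<in>Z. tri p w x s) \<le> e"
  shows "(\<Sum>x\<in>X. \<Sum>s\<in>X. of_bool (d x s > R) * (g2 v x s * fv.T x s)) \<le> e * chi"
proof -
  have "(\<Sum>x\<in>X. \<Sum>s\<in>X. of_bool (d x s > R) * (g2 v x s * fv.T x s))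
     \<le> (\<Sum>x\<in>X. \<Sum>s\<in>X. \<Sum>w\<in>X. g v w * (of_bool (d x s > R) * tri p w x s))"
  proof (intro sum_mono)
    fix x s
    have "g2 v x s * fv.T x s \<le> (\<Sum>w\<in>X. g v w * fv.T w x * fv.T w s) * fv.T x s"
      by (intro mult_right_mono g2_tree[OF v I0 Mb] fv.T_nonneg)
    also have "\<dots> = (\<Sum>w\<in>X. g v w * (fv.T w x * fv.T x s * fv.T s w))"
      unfolding sum_distrib_right by (intro sum.cong refl) (simp add: fv.T_sym[of s])
    also have "\<dots> \<le> (\<Sum>w\<in>X. g v w * tri p w x s)"
      unfolding tri_def
      by (intro sum_mono mult_left_mono arm_probs_nonneg mult_mono T_le_tau mult_nonneg_nonneg fv.T_nonneg tau_bounds p)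
    finally have "g2 v x s * fv.T x s \<le> (\<Sum>w\<in>X. g v w * tri p w x s)" .
    then show "of_bool (d x s > R) * (g2 v x s * fv.T x s) \<le> (\<Sum>w\<in>X. g v w * (of_bool (d x s > R) * tri p w x s))"
      by (cases "d x s > R") auto
  qed
  also have "\<dots> = (\<Sum>x\<in>X. \<Sum>w\<in>X. \<Sum>s\<in>X. g v w * (of_bool (d x s > R) * tri p w x s))"
    by (rule sum.cong[OF refl], rule sum.swap)
  also have "\<dots> = (\<Sum>w\<in>X. \<Sum>x\<in>X. \<Sum>s\<in>X. g v w * (of_bool (d x s > R) * tri p w x s))"
    by (rule sum.swap)
  also have "\<dots> = (\<Sum>w\<in>X. g v w * (\<Sum>(x, s)\<in>X \<times> X. of_bool (d x s > R) * tri p w x s))"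
    by (simp add: sum_distrib_left sum.cartesian_product case_prod_unfold)
  also have "\<dots> \<le> (\<Sum>w\<in>X. g v w * e)"
  proof (intro sum_mono mult_left_mono arm_probs_nonneg)
    fix w assume w: "w \<in> X"
    have "(\<Sum>(x, s)\<in>X \<times> X. of_bool (d x s > R) * tri p w x s) = (\<Sum>(x, s)\<in>{z \<in> X \<times> X. d (fst z) (snd z) > R}. tri p w x s)"
      using X(1) by (intro sum.mono_neutral_cong_right) auto
    also have "\<dots> \<le> e" by (rule H) (use w X(2) in auto)
    finally show "(\<Sum>(x, s)\<in>X \<times> X. of_bool (d x s > R) * tri p w x s) \<le> e" .
  qed
  also have "\<dots> = e * chi" by (simp add: chi_def sum_distrib_left mult.commute)
  finally show ?thesis .
qed

lemma count_near: "a \<in> V \<Longrightarrow> (\<Sum>s\<in>X. of_bool (d a s \<le> R)) \<le> real (N R)"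
proof -
  assume a: "a \<in> V"
  have "(\<Sum>s\<in>X. of_bool (d a s \<le> R)) = real (card {s \<in> X. d a s \<le> R})"
    using X(1) by (simp add: Int_def)
  also have "card {s \<in> X. d a s \<le> R} \<le> card (ball a R)"
    using X(2) by (intro card_mono finite_ball a) (auto simp: ball_def)
  finally show ?thesis using card_ball[OF a] by simp
qed

text \<open>After exchanging the sums, each \<open>s\<close> is near at most \<open>N R\<close>
  points \<open>x\<close>. The window grows from \<open>V0\<close> to \<open>V1\<close> because exit
  points near it have to be covered.\<close>

lemma near_sum:
  assumes V0: "V0 \<subseteq> X" and V1: "V1 \<subseteq> X" "\<And>x. x \<in> V0 \<Longrightarrow> ball x R \<subseteq> V1" and \<phi>: "\<And>s. 0 \<le> \<phi> s"
  shows "(\<Sum>x\<in>V0. \<Sum>s\<in>X. of_bool (d x s \<le> R) * \<phi> s) \<le> real (N R) * (\<Sum>s\<in>V1. \<phi> s)"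
proof -
  have "(\<Sum>x\<in>V0. \<Sum>s\<in>X. of_bool (d x s \<le> R) * \<phi> s) = (\<Sum>x\<in>V0. \<Sum>s\<in>V1. of_bool (d x s \<le> R) * \<phi> s)"
  proof (rule sum.cong[OF refl], rule sum.mono_neutral_right)
    fix x assume "x \<in> V0"
    then show "\<forall>s\<in>X - V1. of_bool (d x s \<le> R) * \<phi> s = 0"
      using V1(2) X(2) by (fastforce simp: ball_def)
  qed (use V1 X in auto)
  also have "\<dots> = (\<Sum>s\<in>V1. \<phi> s * (\<Sum>x\<in>V0. of_bool (d x s \<le> R)))"
    by (subst sum.swap) (simp add: sum_distrib_left mult.commute)
  also have "\<dots> \<le> (\<Sum>s\<in>V1. \<phi> s * real (N R))"
  proof (intro sum_mono mult_left_mono \<phi>)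
    fix s assume "s \<in> V1"
    then have s: "s \<in> V" using V1 X by auto
    have "(\<Sum>x\<in>V0. of_bool (d x s \<le> R)) \<le> (\<Sum>x\<in>X. of_bool (d x s \<le> R) :: real)"
      using V0 X(1) by (intro sum_mono2) auto
    also have "\<dots> = (\<Sum>x\<in>X. of_bool (d s x \<le> R))"
      using X(2) s dist_sym by (intro sum.cong refl) (metis subsetD)
    also have "\<dots> \<le> real (N R)" by (rule count_near[OF s])
    finally show "(\<Sum>x\<in>V0. of_bool (d x s \<le> R)) \<le> real (N R)" .
  qed
  also have "\<dots> = real (N R) * (\<Sum>s\<in>V1. \<phi> s)" by (simp add: sum_distrib_right mult.commute)
  finally show ?thesis .
qed

text \<open>The factor 1/4 is made of two halves: the window \<open>V0\<close> carries half of
  \<open>chi\<close>, and on it \<open>fv.M 0\<close> is at least half of \<open>Mb\<close>.\<close>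

lemma first_bound:
  assumes V0: "V0 \<subseteq> X" "chi / 2 \<le> (\<Sum>x\<in>V0. g v x)" and V1: "V1 \<subseteq> X" "\<And>x. x \<in> V0 \<Longrightarrow> ball x R \<subseteq> V1"
    and M: "\<And>a. a \<in> V0 \<Longrightarrow> Mb / 2 \<le> fv.M 0 a"
    and H: "\<And>w Z. w \<in> V \<Longrightarrow> Z \<subseteq> X \<times> X \<Longrightarrow> (\<And>x s. (x, s) \<in> Z \<Longrightarrow> d x s > R) \<Longrightarrow> (\<Sum>(x, s)\<in>Z. tri p w x s) \<le> e"
  shows "Mb * chi / 4 \<le> real (N R) * (qq 0 * chi + (\<Sum>s\<in>V1. \<Sum>b\<in>nbF s. f v s b)) + e * chi * Mb"
proof -
  have "Mb * chi / 4 = (chi / 2) * (Mb / 2)" by simp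
  also have "\<dots> \<le> (\<Sum>x\<in>V0. g v x) * (Mb / 2)" using V0(2) bound_nonneg by (intro mult_right_mono) auto
  also have "\<dots> \<le> (\<Sum>x\<in>V0. g v x * fv.M 0 x)"
    unfolding sum_distrib_right by (intro sum_mono mult_left_mono M arm_probs_nonneg)
  also have "\<dots> \<le> (\<Sum>x\<in>V0. (\<Sum>s\<in>X. of_bool (d x s \<le> R) * (qq 0 * g v s + (\<Sum>b\<in>nbF s. f v s b)))
    + (\<Sum>s\<in>X. of_bool (d x s > R) * (g2 v x s * fv.T x s * Mb)))"
    using V0(1) by (intro sum_mono first_arm[OF v I0 Mb]) auto
  also have "\<dots> = (\<Sum>x\<in>V0. \<Sum>s\<in>X. of_bool (d x s \<le> R) * (qq 0 * g v s + (\<Sum>b\<in>nbF s. f v s b)))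
    + (\<Sum>x\<in>V0. \<Sum>s\<in>X. of_bool (d x s > R) * (g2 v x s * fv.T x s * Mb))" by (rule sum.distrib)
  also have "\<dots> \<le> real (N R) * (\<Sum>s\<in>V1. qq 0 * g v s + (\<Sum>b\<in>nbF s. f v s b)) + e * chi * Mb"
  proof (rule add_mono)
    show "(\<Sum>x\<in>V0. \<Sum>s\<in>X. of_bool (d x s \<le> R) * (qq 0 * g v s + (\<Sum>b\<in>nbF s. f v s b)))
      \<le> real (N R) * (\<Sum>s\<in>V1. qq 0 * g v s + (\<Sum>b\<in>nbF s. f v s b))"
      by (intro near_sum V0 V1 add_nonneg_nonneg mult_nonneg_nonneg qq arm_probs_nonneg sum_nonneg)
    have "(\<Sum>x\<in>V0. \<Sum>s\<in>X. of_bool (d x s > R) * (g2 v x s * fv.T x s * Mb))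
        \<le> (\<Sum>x\<in>X. \<Sum>s\<in>X. of_bool (d x s > R) * (g2 v x s * fv.T x s * Mb))"
      using V0 X(1) by (intro sum_mono2 sum_nonneg mult_nonneg_nonneg arm_probs_nonneg fv.T_nonneg bound_nonneg) auto
    also have "\<dots> = (\<Sum>x\<in>X. \<Sum>s\<in>X. of_bool (d x s > R) * (g2 v x s * fv.T x s)) * Mb"
      by (simp add: sum_distrib_right mult.assoc)
    also have "\<dots> \<le> e * chi * Mb" by (intro mult_right_mono far_pairs H bound_nonneg)
    finally show "(\<Sum>x\<in>V0. \<Sum>s\<in>X. of_bool (d x s > R) * (g2 v x s * fv.T x s * Mb)) \<le> e * chi * Mb" .
  qed
  also have "(\<Sum>s\<in>V1. qq 0 * g v s + (\<Sum>b\<in>nbF s. f v s b)) \<le> qq 0 * chi + (\<Sum>s\<in>V1. \<Sum>b\<in>nbF s. f v s b)"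
    unfolding sum.distrib chi_def sum_distrib_left[symmetric] using V1(1) X(1)
    by (intro add_right_mono mult_left_mono sum_mono2 qq arm_probs_nonneg) auto
  finally show ?thesis by (simp add: mult_left_mono)
qed

text \<open>For exit points in the cluster of \<open>b\<close> the triangle is rooted at
  \<open>b\<close> instead of \<open>a\<close>. Moving the last leg from \<open>a\<close> to
  \<open>b\<close> by \<open>tau_neighbour\<close> costs \<open>1 / p\<close>, and the distance to
  \<open>s\<close> may drop by one, whence the alternative \<open>d w s \<ge> R\<close> in the
  hypothesis.\<close>

lemma second_bound:
  assumes p0: "0 < p" and V1: "V1 \<subseteq> X"
    and M: "\<And>a. a \<in> V1 \<Longrightarrow> Mb / 2 \<le> fv.M 0 a"
    and H: "\<And>w Z. w \<in> V \<Longrightarrow> Z \<subseteq> X \<times> X \<Longrightarrow> (\<And>x s. (x, s) \<in> Z \<Longrightarrow> d x s > R \<or> d w s \<ge> R) \<Longrightarrow> (\<Sum>(x, s)\<in>Z. tri p w x s) \<le> e"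
    and e: "0 \<le> e"
  shows "Mb / 2 * (\<Sum>a\<in>V1. \<Sum>b\<in>nbF a. f v a b) \<le>
    real (N R) * qq 0 * (\<Sum>a\<in>V1. \<Sum>b\<in>nbF a. f v a b) + real (N 1)^2 * real (N R) * (\<Sum>a\<in>V1. three_arm_prob a (R + 1))
    + real (N 1) * Mb\<^sup>2 * chi * e * (1 + 1 / p)"
proof -
  have VV: "a \<in> V" if "a \<in> V1" for a using that V1 X by auto
  have near: "(\<Sum>s\<in>X. of_bool (d a s \<le> R) * (qq 0 * f v a b + (\<Sum>c\<in>nbF s. h3 v a b s c)))
      \<le> real (N R) * (qq 0 * f v a b + real (N 1) * three_arm_prob a (R + 1))" if "a \<in> V1" "b \<in> nbF a" for a b
  proof -
    have "(\<Sum>c\<in>nbF s. h3 v a b s c) \<le> real (N 1) * three_arm_prob a (R + 1)" if "s \<in> X" "d a s \<le> R" for s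
    proof -
      have "(\<Sum>c\<in>nbF s. h3 v a b s c) \<le> (\<Sum>c\<in>nbF s. three_arm_prob a (R + 1))"
        using \<open>b \<in> nbF a\<close> that by (intro sum_mono h3_le_three_arm_prob) (auto simp: nbF_def)
      also have "\<dots> \<le> real (N 1) * three_arm_prob a (R + 1)"
        using nbF(3)[of s] that X(2) by (auto intro!: mult_right_mono three_arm_prob_nonneg)
      finally show ?thesis .
    qed
    then have "(\<Sum>s\<in>X. of_bool (d a s \<le> R) * (qq 0 * f v a b + (\<Sum>c\<in>nbF s. h3 v a b s c)))
        \<le> (\<Sum>s\<in>X. of_bool (d a s \<le> R) * (qq 0 * f v a b + real (N 1) * three_arm_prob a (R + 1)))"
      by (intro sum_mono) auto
    also have "\<dots> = (\<Sum>s\<in>X. of_bool (d a s \<le> R)) * (qq 0 * f v a b + real (N 1) * three_arm_prob a (R + 1))"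
      by (simp add: sum_distrib_right)
    also have "\<dots> \<le> real (N R) * (qq 0 * f v a b + real (N 1) * three_arm_prob a (R + 1))"
      by (intro mult_right_mono count_near VV that add_nonneg_nonneg mult_nonneg_nonneg qq arm_probs_nonneg three_arm_prob_nonneg) simp
    finally show ?thesis .
  qed
  have far: "(\<Sum>s\<in>X. of_bool (d a s > R) * (fv.P (\<lambda>\<omega>. cn b s \<omega> \<and> hit 0 b \<omega>) * fv.T a s)) \<le> Mb * e / p"
    if "a \<in> V1" "b \<in> nbF a" for a b
  proof -
    have ab: "{a, b} \<in> E" "b \<in> X" "b \<in> V" using that F_sub nbF(2) X(2) by (auto simp: nbF_def)
    have "(\<Sum>s\<in>X. of_bool (d a s > R) * (fv.P (\<lambda>\<omega>. cn b s \<omega> \<and> hit 0 b \<omega>) * fv.T a s))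
        \<le> (\<Sum>s\<in>X. \<Sum>w\<in>X. Mb / p * (of_bool (d a s > R) * tri p b w s))"
    proof (rule sum_mono)
      fix s
      have "fv.P (\<lambda>\<omega>. cn b s \<omega> \<and> hit 0 b \<omega>) * fv.T a s \<le> (\<Sum>w\<in>X. fv.T b w * fv.T w s * fv.M 0 w) * (tau p b s / p)"
      proof (intro mult_mono fv.tree_hit ab)
        show "fv.T a s \<le> tau p b s / p"
          using T_le_tau[of a s] tau_neighbour[OF p0 p(2) ab(1), of s] by simp
      qed (auto intro!: sum_nonneg mult_nonneg_nonneg fv.T_nonneg fv.M_nonneg)
      also have "\<dots> = (\<Sum>w\<in>X. fv.T b w * fv.T w s * fv.M 0 w * (tau p b s / p))" by (rule sum_distrib_right)
      also have "\<dots> \<le> (\<Sum>w\<in>X. tau p b w * tau p w s * Mb * (tau p b s / p))"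
        using p0 by (intro sum_mono mult_mono T_le_tau Mb mult_nonneg_nonneg fv.T_nonneg fv.M_nonneg tau_bounds p bound_nonneg divide_nonneg_pos) auto
      also have "\<dots> = (\<Sum>w\<in>X. Mb / p * tri p b w s)"
        by (intro sum.cong refl) (simp add: tri_def tau_sym[OF p, of s b])
      finally have "fv.P (\<lambda>\<omega>. cn b s \<omega> \<and> hit 0 b \<omega>) * fv.T a s \<le> (\<Sum>w\<in>X. Mb / p * tri p b w s)" .
      then show "of_bool (d a s > R) * (fv.P (\<lambda>\<omega>. cn b s \<omega> \<and> hit 0 b \<omega>) * fv.T a s)
        \<le> (\<Sum>w\<in>X. Mb / p * (of_bool (d a s > R) * tri p b w s))"
        by (cases "d a s > R") auto
    qed
    also have "\<dots> = Mb / p * (\<Sum>(w, s)\<in>X \<times> X. of_bool (d a s > R) * tri p b w s)"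
      by (subst sum.swap) (simp add: sum_distrib_left sum.cartesian_product case_prod_unfold)
    also have "(\<Sum>(w, s)\<in>X \<times> X. of_bool (d a s > R) * tri p b w s) = (\<Sum>(w, s)\<in>{z \<in> X \<times> X. d a (snd z) > R}. tri p b w s)"
      using X(1) by (intro sum.mono_neutral_cong_right) auto
    also have "Mb / p * \<dots> \<le> Mb / p * e"
    proof (intro mult_left_mono H ab)
      fix w s assume ws: "(w, s) \<in> {z \<in> X \<times> X. d a (snd z) > R}"
      then have "d a s \<le> d a b + d b s" using dist_triangle[of a b s] VV that ab X(2) by auto
      then show "d w s > R \<or> d b s \<ge> R" using ws dist_edge[OF ab(1)] by auto
    qed (use bound_nonneg p0 in auto)
    finally show ?thesis by simp
  qed
  have "Mb / 2 * (\<Sum>a\<in>V1. \<Sum>b\<in>nbF a. f v a b) = (\<Sum>a\<in>V1. \<Sum>b\<in>nbF a. f v a b * (Mb / 2))"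
    by (simp add: sum_distrib_left mult.commute)
  also have "\<dots> \<le> (\<Sum>a\<in>V1. \<Sum>b\<in>nbF a. f v a b * fv.M 0 a)"
    by (intro sum_mono mult_left_mono M arm_probs_nonneg)
  also have "\<dots> \<le> (\<Sum>a\<in>V1. \<Sum>b\<in>nbF a. real (N R) * (qq 0 * f v a b + real (N 1) * three_arm_prob a (R + 1))
      + (Mb\<^sup>2 * (\<Sum>s\<in>X. of_bool (d a s > R) * (g2 v a s * fv.T a s)) + g v a * Mb * (Mb * e / p)))"
  proof (intro sum_mono)
    fix a b assume ab: "a \<in> V1" "b \<in> nbF a"
    have "f v a b * fv.M 0 a \<le> (\<Sum>s\<in>X. of_bool (d a s \<le> R) * (qq 0 * f v a b + (\<Sum>c\<in>nbF s. h3 v a b s c)))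
      + (\<Sum>s\<in>X. of_bool (d a s > R) * ((g2 v a s * Mb + g v a * fv.P (\<lambda>\<omega>. cn b s \<omega> \<and> hit 0 b \<omega>)) * fv.T a s * Mb))"
      using ab V1 nbF(2) by (intro second_arm[OF v I0 Mb]) auto
    also have "(\<Sum>s\<in>X. of_bool (d a s > R) * ((g2 v a s * Mb + g v a * fv.P (\<lambda>\<omega>. cn b s \<omega> \<and> hit 0 b \<omega>)) * fv.T a s * Mb))
        = Mb\<^sup>2 * (\<Sum>s\<in>X. of_bool (d a s > R) * (g2 v a s * fv.T a s))
        + g v a * Mb * (\<Sum>s\<in>X. of_bool (d a s > R) * (fv.P (\<lambda>\<omega>. cn b s \<omega> \<and> hit 0 b \<omega>) * fv.T a s))"
      unfolding sum_distrib_left sum.distrib[symmetric]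
      by (intro sum.cong refl) (simp add: algebra_simps power2_eq_square)
    also have "\<dots> \<le> Mb\<^sup>2 * (\<Sum>s\<in>X. of_bool (d a s > R) * (g2 v a s * fv.T a s)) + g v a * Mb * (Mb * e / p)"
      using far[OF ab] arm_probs_nonneg bound_nonneg by (intro add_left_mono mult_left_mono) auto
    finally show "f v a b * fv.M 0 a \<le> real (N R) * (qq 0 * f v a b + real (N 1) * three_arm_prob a (R + 1))
      + (Mb\<^sup>2 * (\<Sum>s\<in>X. of_bool (d a s > R) * (g2 v a s * fv.T a s)) + g v a * Mb * (Mb * e / p))"
      using near[OF ab] by linarith
  qed
  also have "\<dots> = real (N R) * qq 0 * (\<Sum>a\<in>V1. \<Sum>b\<in>nbF a. f v a b) +
      (\<Sum>a\<in>V1. real (card (nbF a)) * (real (N R) * real (N 1) * three_arm_prob a (R + 1)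
       + (Mb\<^sup>2 * (\<Sum>s\<in>X. of_bool (d a s > R) * (g2 v a s * fv.T a s)) + g v a * Mb * (Mb * e / p))))"
    by (simp add: sum.distrib sum_distrib_left algebra_simps)
  also have "\<dots> \<le> real (N R) * qq 0 * (\<Sum>a\<in>V1. \<Sum>b\<in>nbF a. f v a b) +
      (\<Sum>a\<in>V1. real (N 1) * (real (N R) * real (N 1) * three_arm_prob a (R + 1)
       + (Mb\<^sup>2 * (\<Sum>s\<in>X. of_bool (d a s > R) * (g2 v a s * fv.T a s)) + g v a * Mb * (Mb * e / p))))"
    using nbF(3)[OF VV] p0 e
    by (intro add_left_mono sum_mono mult_right_mono add_nonneg_nonneg mult_nonneg_nonneg sum_nonneg three_arm_prob_nonneg arm_probs_nonneg fv.T_nonneg bound_nonneg divide_nonneg_pos) auto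
  also have "\<dots> = real (N R) * qq 0 * (\<Sum>a\<in>V1. \<Sum>b\<in>nbF a. f v a b) +
      real (N 1)^2 * real (N R) * (\<Sum>a\<in>V1. three_arm_prob a (R + 1))
      + real (N 1) * Mb\<^sup>2 * (\<Sum>a\<in>V1. \<Sum>s\<in>X. of_bool (d a s > R) * (g2 v a s * fv.T a s))
      + real (N 1) * Mb\<^sup>2 * (\<Sum>a\<in>V1. g v a) * (e / p)"
    by (simp add: sum.distrib sum_distrib_left sum_distrib_right algebra_simps power2_eq_square)
  also have "\<dots> \<le> real (N R) * qq 0 * (\<Sum>a\<in>V1. \<Sum>b\<in>nbF a. f v a b) +
      real (N 1)^2 * real (N R) * (\<Sum>a\<in>V1. three_arm_prob a (R + 1))
      + real (N 1) * Mb\<^sup>2 * (e * chi)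
      + real (N 1) * Mb\<^sup>2 * chi * (e / p)"
  proof (intro add_mono order_refl mult_left_mono mult_right_mono)
    have "(\<Sum>a\<in>V1. \<Sum>s\<in>X. of_bool (d a s > R) * (g2 v a s * fv.T a s))
        \<le> (\<Sum>a\<in>X. \<Sum>s\<in>X. of_bool (d a s > R) * (g2 v a s * fv.T a s))"
      using V1 X(1) by (intro sum_mono2 sum_nonneg mult_nonneg_nonneg arm_probs_nonneg fv.T_nonneg) auto
    also have "\<dots> \<le> e * chi" by (intro far_pairs H) auto
    finally show "(\<Sum>a\<in>V1. \<Sum>s\<in>X. of_bool (d a s > R) * (g2 v a s * fv.T a s)) \<le> e * chi" .
    show "(\<Sum>a\<in>V1. g v a) \<le> chi"
      unfolding chi_def using V1 X(1) by (intro sum_mono2 arm_probs_nonneg) auto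
  qed (use p0 e in auto)
  finally show ?thesis by (simp add: algebra_simps add_divide_distrib)
qed

text \<open>Three inequalities are chained: \<open>Mb * chi\<close> is at most a multiple of
  \<open>ff\<close>, \<open>Mb * ff\<close> at most a multiple of \<open>S\<close> plus a small
  multiple of \<open>Mb^2 * chi\<close>, and \<open>S\<close> at most a multiple of
  \<open>Mb\<close>. Eliminating \<open>ff\<close> and \<open>S\<close> leaves one factor
  \<open>Mb\<close> to cancel.\<close>

lemma magn_susc_finite:
  assumes p0: "0 < p" and V0: "V0 \<subseteq> X" "chi / 2 \<le> (\<Sum>x\<in>V0. g v x)"
    and V1: "V1 \<subseteq> X" "\<And>x. x \<in> V0 \<Longrightarrow> ball x R1 \<subseteq> V1" and UF: "\<And>a. a \<in> V1 \<Longrightarrow> U a (R2 + 1) \<subseteq> F"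
    and M: "\<And>a. a \<in> V1 \<Longrightarrow> Mb / 2 \<le> fv.M 0 a"
    and H1: "\<And>w Z. w \<in> V \<Longrightarrow> Z \<subseteq> X \<times> X \<Longrightarrow> (\<And>x s. (x, s) \<in> Z \<Longrightarrow> d x s > R1) \<Longrightarrow> (\<Sum>(x, s)\<in>Z. tri p w x s) \<le> 1/16"
    and H2: "\<And>w Z. w \<in> V \<Longrightarrow> Z \<subseteq> X \<times> X \<Longrightarrow> (\<And>x s. (x, s) \<in> Z \<Longrightarrow> d x s > R2 \<or> d w s \<ge> R2) \<Longrightarrow> (\<Sum>(x, s)\<in>Z. tri p w x s) \<le> e"
    and e: "0 \<le> e" "real (N 1) * e * (1 + 1 / p) \<le> 1 / (64 * real (N R1))"
    and q: "real (N R1) * qq 0 \<le> Mb / 16" "real (N R2) * qq 0 \<le> Mb / 4"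
  shows "Mb * chi \<le> 64 * real (N R1) * real (N 1)^2 * real (N R2) * real (N (2 * (R2 + 1))) / p ^ (2 ^ N (R2 + 1))"
proof -
  define ff where "ff = (\<Sum>a\<in>V1. \<Sum>b\<in>nbF a. f v a b)"
  define n where "n = real (N R1)"
  have n: "1 \<le> n" using N_pos[of R1] by (simp add: n_def)
  have ff: "0 \<le> ff" unfolding ff_def by (intro sum_nonneg arm_probs_nonneg)
  have V0V1: "a \<in> V1" if "a \<in> V0" for a using V1(2)[OF that] ball_self[of a R1] V0(1) X(2) that by auto
  have "Mb * chi / 4 \<le> n * (qq 0 * chi + ff) + 1/16 * chi * Mb"
    unfolding ff_def n_def using V0V1 by (intro first_bound[OF V0 V1 M H1]) auto
  also have "n * (qq 0 * chi + ff) = (n * qq 0) * chi + n * ff" by (simp add: algebra_simps)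
  also have "(n * qq 0) * chi \<le> Mb / 16 * chi" using q(1) chi_nonneg by (intro mult_right_mono) (simp_all add: n_def)
  \<comment> \<open>The two error terms take one sixteenth each out of the quarter on the
    left.\<close>
  finally have 1: "Mb * chi / 8 \<le> n * ff" by simp
  define S where "S = (\<Sum>a\<in>V1. three_arm_prob a (R2 + 1))"
  define c1 where "c1 = real (N 1)^2 * real (N R2)"
  have c1: "0 \<le> c1" by (simp add: c1_def)
  have "Mb / 2 * ff \<le> real (N R2) * qq 0 * ff + c1 * S + real (N 1) * Mb\<^sup>2 * chi * e * (1 + 1 / p)"
    unfolding ff_def S_def c1_def by (rule second_bound[OF p0 V1(1) M H2 e(1)])
  also have "real (N R2) * qq 0 * ff \<le> Mb / 4 * ff" using q(2) ff by (intro mult_right_mono)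
  also have "real (N 1) * Mb\<^sup>2 * chi * e * (1 + 1 / p) = Mb\<^sup>2 * chi * (real (N 1) * e * (1 + 1 / p))" by (simp add: mult_ac)
  also have "\<dots> \<le> Mb\<^sup>2 * chi * (1 / (64 * n))"
    using e(2) chi_nonneg by (intro mult_left_mono) (auto simp: n_def)
  finally have 2: "Mb / 4 * ff \<le> c1 * S + Mb\<^sup>2 * chi / (64 * n)" by simp
  \<comment> \<open>Inserting \<open>1\<close> into \<open>2\<close>: the error term of
    \<open>2\<close> absorbs half of the left side, which is what the condition on \<open>e\<close>
    with the constant 64 was made for.\<close>
  have "Mb\<^sup>2 * chi / (32 * n) = Mb / (4 * n) * (Mb * chi / 8)" by (simp add: power2_eq_square)
  also have "\<dots> \<le> Mb / (4 * n) * (n * ff)" using 1 bound_nonneg n by (intro mult_left_mono) auto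
  also have "\<dots> = Mb / 4 * ff" using n by simp
  also note 2
  finally have 3: "Mb\<^sup>2 * chi / (64 * n) \<le> c1 * S" by (simp add: field_simps)
  let ?P = "p ^ (2 ^ N (R2 + 1))"
  have P: "0 < ?P" using p0 by simp
  have "?P * S \<le> real (N (2 * (R2 + 1))) * Mb"
    unfolding S_def using V1(1) X UF finite_subset by (intro surgery) auto
  then have "S \<le> real (N (2 * (R2 + 1))) * Mb / ?P" using P by (simp add: field_simps)
  then have "c1 * S \<le> c1 * (real (N (2 * (R2 + 1))) * Mb / ?P)" using c1 by (intro mult_left_mono)
  with 3 have "Mb\<^sup>2 * chi / (64 * n) \<le> Mb * (c1 * real (N (2 * (R2 + 1))) / ?P)" by (simp add: mult_ac)
  then have 4: "Mb * (Mb * chi) \<le> Mb * (64 * n * c1 * real (N (2 * (R2 + 1))) / ?P)"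
    using n by (simp add: field_simps power2_eq_square)
  have "Mb * chi \<le> 64 * n * c1 * real (N (2 * (R2 + 1))) / ?P" if "0 < Mb"
    using mult_le_cancel_left_pos[OF that] 4 by blast
  moreover have "Mb * chi \<le> 64 * n * c1 * real (N (2 * (R2 + 1))) / ?P" if "Mb = 0"
    using that n c1 P by simp
  ultimately show ?thesis using bound_nonneg by (cases "Mb = 0") (auto simp: n_def c1_def mult.assoc)
qed

end

end

section \<open>The critical point\<close>

text \<open>\<open>n \<le> card\<close> alone would not be increasing, because infinite sets have
  cardinality 0 and \<open>inc\<close> ranges over all configurations. A finite subset as witness
  avoids this.\<close>

definition big_clus :: "nat \<Rightarrow> 'a \<Rightarrow> 'a coord set \<Rightarrow> bool" where
  "big_clus n v \<omega> \<longleftrightarrow> (\<exists>B. finite B \<and> card B = n \<and> B \<subseteq> clus (eds \<omega>) v)"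

lemma inc_big_clus: "inc (big_clus n v)"
  unfolding inc_def
proof (intro allI impI)
  fix \<omega> \<omega>' :: "'a coord set" assume "\<omega> \<subseteq> \<omega>'" and b: "big_clus n v \<omega>"
  then have "clus (eds \<omega>) v \<subseteq> clus (eds \<omega>') v" by (intro clus_mono eds_mono)
  then show "big_clus n v \<omega>'" using b unfolding big_clus_def by (elim exE conjE) (intro exI conjI, assumption+, rule subset_trans)
qed

lemma big_clus_res: "big_clus n v (res (clus (eds \<omega>) v) \<omega>) = big_clus n v \<omega>"
  by (simp add: big_clus_def clus_res)

lemma big_clus_iff: "finite (clus (eds \<omega>) v) \<Longrightarrow> big_clus n v \<omega> \<longleftrightarrow> n \<le> card (clus (eds \<omega>) v)"
  unfolding big_clus_def by (metis card_mono obtain_subset_with_card_n)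

lemma (in finite_volume) big_clus_Om: "\<omega> \<subseteq> Om \<Longrightarrow> big_clus n v \<omega> \<longleftrightarrow> n \<le> card (clus (eds \<omega>) v)"
  by (rule big_clus_iff, rule finite_clus, rule fins_sub[OF F eds_sub])

lemma (in finite_volume) big_clus_prob: "fv.P (big_clus n v) = fprob F (\<lambda>_. p) (\<lambda>\<eta>. n \<le> card (clus \<eta> v))"
  unfolding fprob_def edge_event[symmetric] by (intro fexp_cong) (simp add: big_clus_Om)

lemma fexp_zero: "finite F \<Longrightarrow> fexp F (\<lambda>_. 0) Y = Y {}"
  by (induction F arbitrary: Y rule: finite_induct) (auto simp: fexp_insert)

context pgraph begin

section \<open>From positive probability to almost sure percolation\<close>

lemma V_countable: "countable V"
proof -
  have "V = (\<Union>n. ball v0 n)" by (auto simp: ball_def)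
  then show ?thesis using finite_ball[OF v0] by (metis countable_UN countable_finite countableI_type)
qed

context
  fixes p :: real assumes p: "0 \<le> p" "p \<le> 1"
begin

lemma infinite_cluster_iff: "infinite (cluster E \<omega> x) \<longleftrightarrow> (\<forall>n. cluster_size E \<omega> x \<ge> enat n)"
proof
  assume "\<forall>n. cluster_size E \<omega> x \<ge> enat n"
  then have "cluster_size E \<omega> x \<ge> enat (Suc (card (cluster E \<omega> x)))" by blast
  then show "infinite (cluster E \<omega> x)" by (auto simp: cluster_size_def split: if_splits)
qed (simp add: cluster_size_def)

lemma infinite_cluster_prob:
  shows "{\<omega> \<in> space (percolation E p). infinite (cluster E \<omega> x)} \<in> sets (percolation E p)"
    and "(\<lambda>n. tail p n x) \<longlonglongrightarrow> measure (percolation E p) {\<omega> \<in> space (percolation E p). infinite (cluster E \<omega> x)}"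
proof -
  interpret PP: prob_space "percolation E p" by (rule perc_prob_space[OF p])
  let ?A = "\<lambda>n. {\<omega> \<in> space (percolation E p). cluster_size E \<omega> x \<ge> enat n}"
  have eq: "{\<omega> \<in> space (percolation E p). infinite (cluster E \<omega> x)} = (\<Inter>n. ?A n)"
    by (auto simp: infinite_cluster_iff)
  show "{\<omega> \<in> space (percolation E p). infinite (cluster E \<omega> x)} \<in> sets (percolation E p)"
    unfolding eq using perc_size(1)[OF p] by (intro sets.countable_INT) auto
  have "(\<lambda>n. measure (percolation E p) (?A n)) \<longlonglongrightarrow> measure (percolation E p) (\<Inter>n. ?A n)"
  proof (rule PP.finite_Lim_measure_decseq)
    show "decseq ?A" by (auto simp: decseq_def intro: order_trans[of "enat _" "enat _"])
  qed (use perc_size(1)[OF p] in auto)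
  then show "(\<lambda>n. tail p n x) \<longlonglongrightarrow> measure (percolation E p) {\<omega> \<in> space (percolation E p). infinite (cluster E \<omega> x)}"
    unfolding perc_size(2)[OF p] eq .
qed

lemma no_infinite:
  assumes "(\<lambda>n. tail p n v0) \<longlonglongrightarrow> 0"
  shows "\<not> (AE \<omega> in percolation E p. \<exists>v\<in>V. infinite (cluster E \<omega> v))"
proof
  interpret PP: prob_space "percolation E p" by (rule perc_prob_space[OF p])
  assume ae: "AE \<omega> in percolation E p. \<exists>v\<in>V. infinite (cluster E \<omega> v)"
  have "AE \<omega> in percolation E p. \<forall>v\<in>V. \<not> infinite (cluster E \<omega> v)"
  proof (rule AE_ball_countable[THEN iffD2, OF V_countable], rule ballI)
    fix v assume v: "v \<in> V"
    have "tail p n v = tail p n v0" for n by (rule tail_eq[OF p v])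
    then have "measure (percolation E p) {\<omega> \<in> space (percolation E p). infinite (cluster E \<omega> v)} = 0"
      using infinite_cluster_prob(2)[of v] assms by (intro LIMSEQ_unique) auto
    then show "AE \<omega> in percolation E p. \<not> infinite (cluster E \<omega> v)"
      using PP.prob_eq_0[OF infinite_cluster_prob(1)[of v]] by auto
  qed
  with ae have "AE \<omega> in percolation E p. False" by eventually_elim auto
  then show False by (simp add: PP.AE_False)
qed

text \<open>If \<open>x\<close> and \<open>y\<close> are not connected, their clusters are disjoint
  witnesses and BK gives the product. This is the upper bound on correlations that the second moment
  argument needs.\<close>

lemma two_big_clusters:
  assumes x: "x \<in> V" and y: "y \<in> V"
  shows "measure (percolation E p) {\<omega> \<in> space (percolation E p). cluster_size E \<omega> x \<ge> enat n \<and> cluster_size E \<omega> y \<ge> enat n}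
    \<le> tau p x y + tail p n x * tail p n y"
proof -
  let ?A = "\<lambda>\<eta>. n \<le> card (clus \<eta> x) \<and> n \<le> card (clus \<eta> y)"
  have "(cluster_size E \<omega> x \<ge> enat n \<and> cluster_size E \<omega> y \<ge> enat n) \<longleftrightarrow> (\<exists>k. ?A (open_edges (EB k) \<omega>))" for \<omega>
  proof
    assume "cluster_size E \<omega> x \<ge> enat n \<and> cluster_size E \<omega> y \<ge> enat n"
    then obtain j k where "n \<le> card (clus (open_edges (EB j) \<omega>) x)" "n \<le> card (clus (open_edges (EB k) \<omega>) y)"
      unfolding size_EB[OF p] by blast
    then have "?A (open_edges (EB (max j k)) \<omega>)"
      using card_clus_mono[OF open_edges_fins[OF p] open_edges_EB_mono[OF p], of j "max j k" \<omega> x]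
        card_clus_mono[OF open_edges_fins[OF p] open_edges_EB_mono[OF p], of k "max j k" \<omega> y] by simp
    then show "\<exists>k. ?A (open_edges (EB k) \<omega>)" ..
  qed (use size_EB[OF p] in blast)
  then have "measure (percolation E p) {\<omega> \<in> space (percolation E p). cluster_size E \<omega> x \<ge> enat n \<and> cluster_size E \<omega> y \<ge> enat n}
      = measure (percolation E p) {\<omega> \<in> space (percolation E p). \<exists>k. ?A (open_edges (EB k) \<omega>)}"
    by simp
  also have "\<dots> = supf p (\<lambda>\<eta>. of_bool (?A \<eta>))"
  proof (rule perc_increasing[OF p])
    fix F G assume "F \<in> fins" "G \<subseteq> F" "?A G"
    then show "?A F" using card_clus_mono[of F G x] card_clus_mono[of F G y] by simp
  qed
  also have "\<dots> \<le> tau p x y + tail p n x * tail p n y"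
  proof (rule supf_le[OF p])
    fix F assume F: "F \<in> fins"
    interpret finite_volume V E v0 F "insert x (insert y (\<Union>F))" "{}" p "\<lambda>_. 0"
      using F p x y fins_finite_UN[OF F] edge_sub by unfold_locales (auto simp: fins_def)
    have "fexp F (\<lambda>_. p) (\<lambda>\<eta>. of_bool (?A \<eta>)) = fv.P (\<lambda>\<omega>. ?A (eds \<omega>))"
      unfolding fprob_def by (rule edge_event[symmetric])
    also have "\<dots> \<le> (\<Sum>b\<in>{True, False}. fv.P (if b then cn x y else circ (big_clus n x) (big_clus n y)))"
    proof (intro fprob_union_bound fv.pr)
      fix \<omega> assume \<omega>: "\<omega> \<subseteq> Om" and A: "?A (eds \<omega>)"
      have "circ (big_clus n x) (big_clus n y) \<omega>" if "\<not> cn x y \<omega>"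
      proof (rule circI[of "res (clus (eds \<omega>) x) \<omega>" _ "res (clus (eds \<omega>) y) \<omega>"])
        have "clus (eds \<omega>) x \<inter> clus (eds \<omega>) y = {}"
          using that clus_disjoint_iff[of "eds \<omega>" x y] by (simp add: cn_def clus_def)
        then show "res (clus (eds \<omega>) x) \<omega> \<inter> res (clus (eds \<omega>) y) \<omega> = {}" by (rule res_disjoint)
      qed (use A big_clus_Om[OF \<omega>] in \<open>auto simp: res_subset big_clus_res\<close>)
      then show "\<exists>b\<in>{True, False}. (if b then cn x y else circ (big_clus n x) (big_clus n y)) \<omega>" by auto
    qed simp
    also have "\<dots> = fv.T x y + fv.P (circ (big_clus n x) (big_clus n y))" by (simp add: fv.T_def)
    also have "\<dots> \<le> tau p x y + fv.P (big_clus n x) * fv.P (big_clus n y)"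
      by (intro add_mono T_le_tau bk_simple fv.fin fv.pr inc_big_clus)
    also have "\<dots> \<le> tau p x y + tail p n x * tail p n y"
      unfolding big_clus_prob using F
      by (intro add_left_mono mult_mono tail_upper p tail_bounds fprob_nonneg probs_const)
    finally show "fexp F (\<lambda>_. p) (\<lambda>\<eta>. of_bool (?A \<eta>)) \<le> tau p x y + tail p n x * tail p n y" .
  qed
  finally show ?thesis .
qed

text \<open>A second moment argument replaces ergodicity: far away vertices lie in infinite clusters almost
  independently.\<close>
lemma infinite_cluster_01:
  assumes inf: "infinite V" and T: "\<And>\<delta>. 0 < \<delta> \<Longrightarrow> \<exists>R. \<forall>x\<in>V. \<forall>y\<in>V. d x y > R \<longrightarrow> tau p x y \<le> \<delta>"
    and ntail: "\<not> (\<lambda>n. tail p n v0) \<longlonglongrightarrow> 0"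
  shows "AE \<omega> in percolation E p. \<exists>v\<in>V. infinite (cluster E \<omega> v)"
proof -
  interpret PP: prob_space "percolation E p" by (rule perc_prob_space[OF p])
  let ?M = "percolation E p"
  let ?A = "\<lambda>x. {\<omega> \<in> space ?M. infinite (cluster E \<omega> x)}"
  define \<theta> where "\<theta> = measure ?M (?A v0)"
  have \<theta>v: "measure ?M (?A x) = \<theta>" if "x \<in> V" for x
    using infinite_cluster_prob(2)[of x] infinite_cluster_prob(2)[of v0] tail_eq[OF p that] unfolding \<theta>_def
    by (intro LIMSEQ_unique) auto
  have "\<theta> \<noteq> 0" using ntail infinite_cluster_prob(2)[of v0] by (auto simp: \<theta>_def)
  moreover have "0 \<le> \<theta>" by (simp add: \<theta>_def)
  ultimately have \<theta>: "0 < \<theta>" by simp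
  have pair: "measure ?M (?A x \<inter> ?A y) \<le> tau p x y + \<theta>\<^sup>2" if "x \<in> V" "y \<in> V" for x y
  proof (rule LIMSEQ_le_const)
    show "(\<lambda>n. tau p x y + tail p n x * tail p n y) \<longlonglongrightarrow> tau p x y + \<theta>\<^sup>2"
      using infinite_cluster_prob(2)[of x] infinite_cluster_prob(2)[of y] unfolding \<theta>v[OF that(1)] \<theta>v[OF that(2)] power2_eq_square
      by (intro tendsto_add tendsto_const tendsto_mult)
    have "measure ?M (?A x \<inter> ?A y) \<le> tau p x y + tail p n x * tail p n y" for n
    proof -
      have s: "{\<omega> \<in> space ?M. cluster_size E \<omega> x \<ge> enat n \<and> cluster_size E \<omega> y \<ge> enat n} \<in> sets ?M"
        using sets.Int[OF perc_size(1)[OF p, of n x] perc_size(1)[OF p, of n y]] by (simp add: Int_def conj_ac)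
      have "measure ?M (?A x \<inter> ?A y) \<le> measure ?M {\<omega> \<in> space ?M. cluster_size E \<omega> x \<ge> enat n \<and> cluster_size E \<omega> y \<ge> enat n}"
        by (intro PP.finite_measure_mono s) (auto simp: infinite_cluster_iff)
      also note two_big_clusters[OF that]
      finally show ?thesis .
    qed
    then show "\<exists>N. \<forall>n\<ge>N. measure ?M (?A x \<inter> ?A y) \<le> tau p x y + tail p n x * tail p n y" by blast
  qed
  let ?B = "{\<omega> \<in> space ?M. \<exists>v\<in>V. infinite (cluster E \<omega> v)}"
  have B: "?B \<in> sets ?M"
  proof -
    have "?B = (\<Union>v\<in>V. ?A v)" by auto
    then show ?thesis using infinite_cluster_prob(1) V_countable by (auto intro!: sets.countable_UN')
  qed
  \<comment> \<open>Chebyshev's inequality for the number of vertices of \<open>W\<close> in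
    infinite clusters, where \<open>W\<close> consists of \<open>m\<close> vertices with pairwise
    small \<open>tau\<close>. Its mean is \<open>m * \<theta>\<close>, its variance at most
    \<open>m * m * \<delta> + m * \<theta>\<close>, and it is 0 off \<open>?B\<close>.\<close>
  have bound: "measure ?M (space ?M - ?B) \<le> 1 / (real m * \<theta>) + \<delta> / \<theta>\<^sup>2" if m: "0 < m" and \<delta>: "0 < \<delta>" for m :: nat and \<delta>
  proof -
    obtain R where R: "\<forall>x\<in>V. \<forall>y\<in>V. d x y > R \<longrightarrow> tau p x y \<le> \<delta>" using T[OF \<delta>] by blast
    have exW: "\<exists>W. finite W \<and> W \<subseteq> V \<and> card W = m \<and> (\<forall>x\<in>W. \<forall>y\<in>W. x \<noteq> y \<longrightarrow> d x y > R)" for m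
    proof (induction m)
      case (Suc m)
      then obtain W where W: "finite W" "W \<subseteq> V" "card W = m" "\<forall>x\<in>W. \<forall>y\<in>W. x \<noteq> y \<longrightarrow> d x y > R" by blast
      obtain y where y: "y \<in> V" "\<forall>w\<in>W. d w y \<ge> Suc R" using far_vertex[OF inf W(1,2)] by blast
      have "y \<notin> W" using y(2) dist_self by (metis not_less_eq_eq le0)
      moreover have "d y w > R" if "w \<in> W" for w
        using y that W(2) dist_sym[of y w] by (auto simp: Suc_le_eq subset_iff)
      moreover have "d w y > R" if "w \<in> W" for w using y(2) that by (simp add: Suc_le_eq)
      ultimately have "finite (insert y W) \<and> insert y W \<subseteq> V \<and> card (insert y W) = Suc m \<and>
          (\<forall>x\<in>insert y W. \<forall>z\<in>insert y W. x \<noteq> z \<longrightarrow> d x z > R)"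
        using W y by auto
      then show ?case by (rule exI)
    qed (rule exI[of _ "{}"], simp)
    then obtain W where W: "finite W" "W \<subseteq> V" "card W = m" "\<forall>x\<in>W. \<forall>y\<in>W. x \<noteq> y \<longrightarrow> d x y > R"
      using exW[of m] by (elim exE conjE)
    let ?i = "\<lambda>x \<omega>. indicator (?A x) \<omega> :: real"
    let ?S = "\<lambda>\<omega>. \<Sum>x\<in>W. ?i x \<omega>"
    have int1: "integrable ?M (?i x)" for x using infinite_cluster_prob(1)[of x] by (simp add: PP.emeasure_eq_measure)
    have int2: "integrable ?M (\<lambda>\<omega>. ?i x \<omega> * ?i y \<omega>)" for x y
      unfolding indicator_inter_arith[symmetric]
      using infinite_cluster_prob(1)[of x] infinite_cluster_prob(1)[of y] by (simp add: PP.emeasure_eq_measure sets.Int)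
    have sq: "(?S \<omega> - m * \<theta>)\<^sup>2 = (\<Sum>x\<in>W. \<Sum>y\<in>W. ?i x \<omega> * ?i y \<omega>) - 2 * (m * \<theta>) * ?S \<omega> + (m * \<theta>)\<^sup>2" for \<omega>
      by (simp add: power2_diff sum_product power2_eq_square[of "?S \<omega>"])
    have "(m * \<theta>)\<^sup>2 * measure ?M (space ?M - ?B) = (\<integral>\<omega>. (m * \<theta>)\<^sup>2 * indicator (space ?M - ?B) \<omega> \<partial>?M)"
      using B by simp
    also have "\<dots> \<le> (\<integral>\<omega>. (\<Sum>x\<in>W. \<Sum>y\<in>W. ?i x \<omega> * ?i y \<omega>) - 2 * (m * \<theta>) * ?S \<omega> + (m * \<theta>)\<^sup>2 \<partial>?M)"
    proof (rule integral_mono)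
      show "integrable ?M (\<lambda>\<omega>. (\<Sum>x\<in>W. \<Sum>y\<in>W. ?i x \<omega> * ?i y \<omega>) - 2 * (m * \<theta>) * ?S \<omega> + (m * \<theta>)\<^sup>2)"
        using int1 int2 by auto
      fix \<omega> assume \<omega>: "\<omega> \<in> space ?M"
      show "(m * \<theta>)\<^sup>2 * indicator (space ?M - ?B) \<omega> \<le> (\<Sum>x\<in>W. \<Sum>y\<in>W. ?i x \<omega> * ?i y \<omega>) - 2 * (m * \<theta>) * ?S \<omega> + (m * \<theta>)\<^sup>2"
      proof (cases "\<omega> \<in> ?B")
        case False
        then have "?S \<omega> = 0" using W(2) \<omega> by (intro sum.neutral) (auto simp: indicator_def)
        then show ?thesis unfolding sq[symmetric] using False \<omega> by simp
      next
        case True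
        then show ?thesis unfolding sq[symmetric] by simp
      qed
    qed (use B in \<open>simp add: PP.emeasure_eq_measure\<close>)
    also have "\<dots> = (\<Sum>x\<in>W. \<Sum>y\<in>W. measure ?M (?A x \<inter> ?A y)) - 2 * (m * \<theta>) * (\<Sum>x\<in>W. measure ?M (?A x)) + (m * \<theta>)\<^sup>2"
      using int1 int2 infinite_cluster_prob(1)
      by (simp add: indicator_inter_arith[symmetric] PP.prob_space sets.Int)
    also have "(\<Sum>x\<in>W. measure ?M (?A x)) = m * \<theta>"
      using \<theta>v W by (simp add: subset_iff)
    also have "(\<Sum>x\<in>W. \<Sum>y\<in>W. measure ?M (?A x \<inter> ?A y)) \<le> (\<Sum>x\<in>W. \<Sum>y\<in>W. (\<delta> + \<theta>\<^sup>2) + of_bool (x = y) * \<theta>)"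
    proof (intro sum_mono)
      fix x y assume xy: "x \<in> W" "y \<in> W"
      show "measure ?M (?A x \<inter> ?A y) \<le> (\<delta> + \<theta>\<^sup>2) + of_bool (x = y) * \<theta>"
      proof (cases "x = y")
        case True
        then have "measure ?M (?A x \<inter> ?A y) = \<theta>" using \<theta>v xy W(2) by auto
        then show ?thesis using True \<delta> by simp
      next
        case False
        then have "tau p x y \<le> \<delta>" using R W xy by blast
        moreover have "measure ?M (?A x \<inter> ?A y) \<le> tau p x y + \<theta>\<^sup>2"
          using pair[of x y] xy W(2) by blast
        ultimately show ?thesis using False by simp
      qed
    qed
    also have "\<dots> = (\<Sum>x\<in>W. m * (\<delta> + \<theta>\<^sup>2) + \<theta>)"
    proof (rule sum.cong[OF refl])
      fix x assume x: "x \<in> W"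
      have "(\<Sum>y\<in>W. of_bool (x = y) * \<theta>) = (\<Sum>y\<in>W. if x = y then \<theta> else 0)"
        by (intro sum.cong) auto
      also have "\<dots> = \<theta>" using W(1) x by simp
      finally show "(\<Sum>y\<in>W. (\<delta> + \<theta>\<^sup>2) + of_bool (x = y) * \<theta>) = m * (\<delta> + \<theta>\<^sup>2) + \<theta>"
        using W(3) by (simp only: sum.distrib sum_constant distrib_left)
    qed
    also have "\<dots> = m * m * (\<delta> + \<theta>\<^sup>2) + m * \<theta>"
      using W(3) by (simp add: algebra_simps)
    finally have "(m * \<theta>)\<^sup>2 * measure ?M (space ?M - ?B) \<le> m * m * \<delta> + m * \<theta>"
      by (simp add: power2_eq_square algebra_simps)
    then have "measure ?M (space ?M - ?B) \<le> (m * m * \<delta> + m * \<theta>) / (m * \<theta>)\<^sup>2"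
      using m \<theta> by (simp add: field_simps)
    also have "\<dots> = 1 / (real m * \<theta>) + \<delta> / \<theta>\<^sup>2"
      using m \<theta> by (simp add: field_simps power2_eq_square)
    finally show ?thesis .
  qed
  have "measure ?M (space ?M - ?B) \<le> 0"
  proof (rule LIMSEQ_le_const)
    \<comment> \<open>With \<open>\<delta> = 1 / Suc m\<close> both error terms vanish as the number
      of vertices grows.\<close>
    have "(\<lambda>m. 1 / (real (Suc m) * \<theta>) + 1 / real (Suc m) / \<theta>\<^sup>2) \<longlonglongrightarrow> 0 * (1 / \<theta>) + 0 * (1 / \<theta>\<^sup>2)"
    proof -
      have eq: "(\<lambda>m. 1 / (real (Suc m) * \<theta>) + 1 / real (Suc m) / \<theta>\<^sup>2) = (\<lambda>m. 1 / real (Suc m) * (1 / \<theta>) + 1 / real (Suc m) * (1 / \<theta>\<^sup>2))"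
        by simp
      have "(\<lambda>m. 1 / real (Suc m)) \<longlonglongrightarrow> 0" using LIMSEQ_inverse_real_of_nat by (simp add: inverse_eq_divide)
      then show ?thesis unfolding eq by (intro tendsto_intros)
    qed
    then show "(\<lambda>m. 1 / (real (Suc m) * \<theta>) + 1 / real (Suc m) / \<theta>\<^sup>2) \<longlonglongrightarrow> 0" by simp
    have b: "measure ?M (space ?M - ?B) \<le> 1 / (real (Suc m) * \<theta>) + 1 / real (Suc m) / \<theta>\<^sup>2" for m
      by (rule bound) auto
    show "\<exists>N. \<forall>m\<ge>N. measure ?M (space ?M - ?B) \<le> 1 / (real (Suc m) * \<theta>) + 1 / real (Suc m) / \<theta>\<^sup>2"
      by (rule exI[of _ 0]) (use b in blast)
  qed
  then have "measure ?M (space ?M - ?B) = 0" using measure_nonneg[of ?M "space ?M - ?B"] by (intro antisym) auto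
  then have "measure ?M ?B = 1" using PP.prob_compl[OF B] by simp
  then show ?thesis using PP.prob_eq_1[OF B] by simp
qed

end

section \<open>Finite susceptibility is an open condition\<close>

lemma card_clus_eq_sum:
  assumes "finite W" "clus \<eta> v \<subseteq> W"
  shows "real (card (clus \<eta> v)) = (\<Sum>x\<in>W. of_bool (conn \<eta> v x))"
proof -
  have "W \<inter> {x. conn \<eta> v x} = clus \<eta> v" using assms(2) by (auto simp: clus_def)
  then show ?thesis using assms(1) by simp
qed

definition sphere :: "'a \<Rightarrow> nat \<Rightarrow> 'a set" where "sphere v r = {y \<in> V. d v y = r}"

lemma sphere_ball: "sphere v r \<subseteq> ball v r"
  by (auto simp: sphere_def ball_def)

lemma finite_sphere: "v \<in> V \<Longrightarrow> finite (sphere v r)"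
  using finite_subset[OF sphere_ball finite_ball] .

text \<open>Unlike the sum of \<open>tau\<close> over the sphere, this depends on finitely many
  edges and is a polynomial in \<open>p\<close>. It is the quantity of the Hammersley-Simon
  finite-size criterion.\<close>

definition inball where "inball p v r = (\<Sum>y\<in>sphere v r. fprob (U v r) (\<lambda>_. p) (\<lambda>\<eta>. conn \<eta> v y))"

lemma inball_le:
  assumes v: "v \<in> V" and p: "0 \<le> p" "p \<le> 1"
  shows "inball p v r \<le> inball p v0 r"
proof -
  obtain h where h: "h \<in> graph_aut V E" "h v = v0" using aut_ex[OF v v0] by auto
  note hp = aut_props[OF h(1)]
  have inj: "inj_on h (sphere v r)" using hp(1) by (rule inj_on_subset) (auto simp: sphere_def)
  have hU: "(`) h ` U v r \<subseteq> U v0 r"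
  proof
    fix e assume "e \<in> (`) h ` U v r"
    then obtain e' where e': "e' \<in> E" "e' \<subseteq> ball v r" "e = h ` e'" by (auto simp: U_def)
    have "h ` e' \<subseteq> ball v0 r"
      using e'(2) aut_dist[OF h(1) v] h(2) hp(2) by (auto simp: ball_def)
    then show "e \<in> U v0 r" using aut_edge[OF h(1) e'(1)] e'(3) by (simp add: U_def)
  qed
  have "fprob (U v r) (\<lambda>_. p) (\<lambda>\<eta>. conn \<eta> v y) \<le> fprob (U v0 r) (\<lambda>_. p) (\<lambda>\<eta>. conn \<eta> v0 (h y))"
    if y: "y \<in> sphere v r" for y
  proof -
    have yV: "y \<in> V" using y by (simp add: sphere_def)
    have "fprob (U v r) (\<lambda>_. p) (\<lambda>\<eta>. conn \<eta> v y) = fprob (U v r) (\<lambda>_. p) (\<lambda>\<eta>. conn ((`) h ` \<eta>) (h v) (h y))"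
      using aut_conn[OF h(1) _ v yV] U_sub by (intro fprob_cong) (metis subset_trans)
    also have "\<dots> = fprob ((`) h ` U v r) (\<lambda>_. p) (\<lambda>\<eta>. conn \<eta> v0 (h y))"
      unfolding fprob_def h(2)[symmetric] using aut_fexp[OF h(1) fins_U[OF v]] by simp
    also have "\<dots> \<le> fprob (U v0 r) (\<lambda>_. p) (\<lambda>\<eta>. conn \<eta> v0 (h y))"
      by (rule fprob_mono_set[OF finite_U[OF v0] hU probs_const[OF p]]) (rule conn_mono)
    finally show ?thesis .
  qed
  then have "inball p v r \<le> (\<Sum>y\<in>sphere v r. fprob (U v0 r) (\<lambda>_. p) (\<lambda>\<eta>. conn \<eta> v0 (h y)))"
    unfolding inball_def by (rule sum_mono)
  also have "\<dots> = (\<Sum>y\<in>h ` sphere v r. fprob (U v0 r) (\<lambda>_. p) (\<lambda>\<eta>. conn \<eta> v0 y))"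
    using inj by (simp add: sum.reindex)
  also have "\<dots> \<le> inball p v0 r"
    unfolding inball_def
  proof (rule sum_mono2[OF finite_sphere[OF v0]])
    show "h ` sphere v r \<subseteq> sphere v0 r"
      using aut_dist[OF h(1) v] h(2) hp(2) by (auto simp: sphere_def)
  qed (intro fprob_nonneg probs_const p)
  finally show ?thesis .
qed

text \<open>\<open>last_exit\<close> is applied to the reversed path with the vertices at distance
  at least \<open>r\<close>, so \<open>s\<close> is the first entrance as seen from
  \<open>v\<close>. All other vertices of the piece between \<open>v\<close> and \<open>s\<close>
  are at distance less than \<open>r\<close>, hence its edges lie in the ball.\<close>

lemma sphere_exit:
  assumes \<eta>: "\<eta> \<subseteq> E" and r: "1 \<le> r" and c: "conn \<eta> v x" and v: "v \<in> V" and x: "x \<in> V" "d v x \<ge> r"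
  shows "\<exists>s\<in>sphere v r. \<exists>I J. I \<subseteq> \<eta> \<and> J \<subseteq> \<eta> \<inter> U v r \<and> I \<inter> J = {} \<and> conn I s x \<and> conn J v s"
proof -
  let ?S = "{u. r \<le> d v u}"
  obtain s I J where s: "s \<in> ?S" "I \<subseteq> \<eta>" "J \<subseteq> \<eta>" "I \<inter> J = {}" "conn I x s" "conn (off J (?S - {s})) s v"
    using last_exit[OF conn_sym[OF c], of ?S] x(2) by auto
  let ?J = "off J (?S - {s})"
  have JE: "?J \<subseteq> E" using s(3) \<eta> off_subset by blast
  have "s \<noteq> v" using s(1) r by auto
  then obtain w where w: "{s, w} \<in> ?J"
    using s(6) unfolding conn_def by (metis adj_iff converse_rtranclE)
  have "w \<noteq> s"
  proof
    assume "w = s"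
    then have "{s} \<in> E" using w JE by auto
    then show False using edge_card[of "{s}"] by simp
  qed
  then have dw: "d v w < r" using w by (auto simp: off_def)
  have sE: "{w, s} \<in> E" using w JE by (auto simp: insert_commute)
  have sV: "w \<in> V" "s \<in> V" using edge_V[OF sE] by auto
  \<comment> \<open>The inner piece contains an edge from \<open>s\<close> to a vertex at distance
    less than \<open>r\<close>, so \<open>s\<close> is not beyond the sphere.\<close>
  have ds: "d v s = r"
    using dist_triangle[OF v sV] dist_edge[OF sE] dw s(1) by simp
  have "?J \<subseteq> \<eta> \<inter> U v r"
  proof
    fix e assume e: "e \<in> ?J"
    have "e \<in> E" using e JE by auto
    moreover have "e \<subseteq> ball v r"
    proof
      fix u assume u: "u \<in> e"
      then have "u \<in> V" using edge_sub[OF \<open>e \<in> E\<close>] by auto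
      moreover have "u = s \<or> d v u < r" using e u by (auto simp: off_def)
      ultimately show "u \<in> ball v r" using ds by (auto simp: ball_def)
    qed
    ultimately show "e \<in> \<eta> \<inter> U v r" using subsetD[OF off_subset e] s(3) by (auto simp: U_def)
  qed
  moreover have "I \<inter> ?J = {}" using s(4) off_subset by blast
  ultimately show ?thesis
    using s(2) conn_sym[OF s(5)] conn_sym[OF s(6)] ds sV(2) by (auto simp: sphere_def)
qed

text \<open>The largest susceptibility \<open>m\<close> in the volume satisfies
  \<open>m \<le> N r + 3/4 * m\<close>: a vertex outside the ball is reached through a point of the
  sphere, and BK separates the inner piece, summed by \<open>inball\<close>, from the outer one,
  summed by \<open>m\<close>. As the volume is finite, so is \<open>m\<close>, and it can be
  absorbed.\<close>

lemma susc_bounded_from_inball: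
  assumes p: "0 \<le> p" "p \<le> 1" and r: "1 \<le> r" and ib: "inball p v0 r \<le> 3/4" and F: "F \<in> fins"
  shows "fexp F (\<lambda>_. p) (\<lambda>\<eta>. real (card (clus \<eta> v0))) \<le> 4 * real (N r)"
proof -
  define X where "X = insert v0 (\<Union>F)"
  have X: "finite X" "X \<subseteq> V" "\<Union>F \<subseteq> X"
    using fins_finite_UN[OF F] v0 F edge_sub by (auto simp: X_def fins_def)
  interpret finite_volume V E v0 F X "{}" p "\<lambda>_. 0"
    using F p X by unfold_locales auto
  define sz where "sz = (\<lambda>v. \<Sum>x\<in>X. fv.T v x)"
  define m where "m = Max (sz ` X)"
  have mX: "sz v \<le> m" if "v \<in> X" for v unfolding m_def using X(1) that by (intro Max_ge) auto
  have m0: "0 \<le> m"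
    using mX[of v0] sum_nonneg[of X "fv.T v0"] fv.T_nonneg by (auto simp: sz_def X_def)
  have bound: "sz v \<le> real (N r) + 3/4 * m" if v: "v \<in> X" for v
  proof -
    have vV: "v \<in> V" using v X by auto
    let ?B = "\<lambda>s. \<lambda>\<omega>. conn (eds \<omega> \<inter> U v r) v s"
    have incB: "inc (?B s)" for s
      unfolding inc_def
    proof (intro allI impI)
      fix \<omega> \<omega>' :: "'a coord set" assume "\<omega> \<subseteq> \<omega>'" and c: "?B s \<omega>"
      then have "eds \<omega> \<inter> U v r \<subseteq> eds \<omega>' \<inter> U v r" using eds_mono by blast
      then show "?B s \<omega>'" using c by (rule conn_mono)
    qed
    have far: "fv.T v x \<le> (\<Sum>s\<in>sphere v r \<inter> X. fv.T s x * fv.P (?B s))" if x: "x \<in> X" "x \<notin> ball v r" for x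
    proof -
      have xV: "x \<in> V" using x X by auto
      have "fv.T v x \<le> (\<Sum>s\<in>sphere v r \<inter> X. fv.P (circ (cn s x) (?B s)))"
        unfolding fv.T_def
      proof (intro fprob_union_bound fv.pr)
        show "finite (sphere v r \<inter> X)" using X(1) by simp
        fix \<omega> assume \<omega>: "\<omega> \<subseteq> Om" and c: "cn v x \<omega>"
        have "eds \<omega> \<subseteq> E" using eds_sub[OF \<omega>] F_sub by auto
        then obtain s I J where s: "s \<in> sphere v r" "I \<subseteq> eds \<omega>" "J \<subseteq> eds \<omega> \<inter> U v r" "I \<inter> J = {}" "conn I s x" "conn J v s"
          using sphere_exit[OF _ r c[unfolded cn_def] vV xV] x(2) xV by (auto simp: ball_def)
        have "conn (eds \<omega>) v s" using s(3,6) by (intro conn_mono[OF _ s(6)]) auto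
        then have "s \<in> X" using fv.clus_in_X[OF \<omega> v] by (auto simp: clus_def)
        moreover have "circ (cn s x) (?B s) \<omega>"
        proof (rule circI[of "Inl ` I" _ "Inl ` J"])
          have "J \<inter> U v r = J" using s(3) by auto
          then show "conn (eds (Inl ` J) \<inter> U v r) v s" using s(6) by simp
        qed (use s in \<open>auto simp: Inl_subset_iff cn_def\<close>)
        ultimately show "\<exists>s\<in>sphere v r \<inter> X. circ (cn s x) (?B s) \<omega>" using s(1) by blast
      qed
      also have "\<dots> \<le> (\<Sum>s\<in>sphere v r \<inter> X. fv.T s x * fv.P (?B s))"
        unfolding fv.T_def by (intro sum_mono bk_simple fv.fin fv.pr inc_cn incB)
      finally show ?thesis .
    qed
    have PB: "fv.P (?B s) \<le> fprob (U v r) (\<lambda>_. p) (\<lambda>\<eta>. conn \<eta> v s)" for s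
    proof -
      have "fv.P (?B s) = fprob F (\<lambda>_. p) (\<lambda>\<eta>. conn (\<eta> \<inter> U v r) v s)"
        unfolding fprob_def by (rule edge_event)
      also have "\<dots> = fprob F (\<lambda>_. p) (\<lambda>\<eta>. conn (\<eta> \<inter> (F \<inter> U v r)) v s)"
        by (intro fprob_cong) (metis Int_absorb2 inf_assoc)
      also have "\<dots> = fprob (F \<inter> U v r) (\<lambda>_. p) (\<lambda>\<eta>. conn (\<eta> \<inter> (F \<inter> U v r)) v s)"
        by (rule fprob_restrict[OF finite_F]) auto
      also have "\<dots> = fprob (F \<inter> U v r) (\<lambda>_. p) (\<lambda>\<eta>. conn \<eta> v s)"
        by (intro fprob_cong) (simp add: Int_absorb2)
      also have "\<dots> \<le> fprob (U v r) (\<lambda>_. p) (\<lambda>\<eta>. conn \<eta> v s)"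
        by (rule fprob_mono_set[OF finite_U[OF vV] _ probs_const[OF p]]) (auto intro: conn_mono)
      finally show ?thesis .
    qed
    have "sz v \<le> (\<Sum>x\<in>X. of_bool (x \<in> ball v r) + (\<Sum>s\<in>sphere v r \<inter> X. fv.T s x * fv.P (?B s)))"
      unfolding sz_def
    proof (rule sum_mono)
      fix x assume x: "x \<in> X"
      have nn: "0 \<le> (\<Sum>s\<in>sphere v r \<inter> X. fv.T s x * fv.P (?B s))"
        by (intro sum_nonneg mult_nonneg_nonneg fv.T_nonneg fprob_nonneg fv.pr)
      show "fv.T v x \<le> of_bool (x \<in> ball v r) + (\<Sum>s\<in>sphere v r \<inter> X. fv.T s x * fv.P (?B s))"
      proof (cases "x \<in> ball v r")
        case True
        then show ?thesis using nn fv.T_le_1[of v x] by simp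
      next
        case False
        then show ?thesis using far[OF x] by simp
      qed
    qed
    also have "\<dots> = real (card (X \<inter> ball v r)) + (\<Sum>s\<in>sphere v r \<inter> X. \<Sum>x\<in>X. fv.T s x * fv.P (?B s))"
      using X(1) by (simp add: sum.distrib Int_def sum.swap[of _ X])
    also have "real (card (X \<inter> ball v r)) \<le> real (N r)"
      using card_mono[OF finite_ball[OF vV, of r], of "X \<inter> ball v r"] card_ball[OF vV] by simp
    also have "(\<Sum>s\<in>sphere v r \<inter> X. \<Sum>x\<in>X. fv.T s x * fv.P (?B s)) \<le> (\<Sum>s\<in>sphere v r \<inter> X. m * fprob (U v r) (\<lambda>_. p) (\<lambda>\<eta>. conn \<eta> v s))"
    proof (rule sum_mono)
      fix s assume s: "s \<in> sphere v r \<inter> X"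
      have "(\<Sum>x\<in>X. fv.T s x * fv.P (?B s)) = sz s * fv.P (?B s)" by (simp add: sz_def sum_distrib_right)
      also have "\<dots> \<le> m * fprob (U v r) (\<lambda>_. p) (\<lambda>\<eta>. conn \<eta> v s)"
        using s m0 by (intro mult_mono mX PB fprob_nonneg fv.pr) auto
      finally show "(\<Sum>x\<in>X. fv.T s x * fv.P (?B s)) \<le> m * fprob (U v r) (\<lambda>_. p) (\<lambda>\<eta>. conn \<eta> v s)" .
    qed
    also have "\<dots> \<le> m * inball p v r"
      unfolding inball_def sum_distrib_left[symmetric]
      by (intro mult_left_mono m0 sum_mono2 finite_sphere vV fprob_nonneg probs_const p) auto
    also have "\<dots> \<le> m * (3/4)"
      using inball_le[OF vV p, of r] ib m0 by (intro mult_left_mono) auto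
    finally show ?thesis by simp
  qed
  have "m \<in> sz ` X" unfolding m_def using X(1) by (intro Max_in) (auto simp: X_def)
  then have "m \<le> real (N r) + 3/4 * m" using bound by auto
  then have m4: "m \<le> 4 * real (N r)" by simp
  have "fexp F (\<lambda>_. p) (\<lambda>\<eta>. real (card (clus \<eta> v0))) = fexp F (\<lambda>_. p) (\<lambda>\<eta>. \<Sum>x\<in>X. of_bool (conn \<eta> v0 x))"
  proof (intro fexp_cong card_clus_eq_sum X(1))
    fix \<eta> assume "\<eta> \<subseteq> F"
    then show "clus \<eta> v0 \<subseteq> X" using clus_subset[of \<eta> v0] by (auto simp: X_def)
  qed
  also have "\<dots> = sz v0" by (simp add: fexp_sum sz_def T_eq fprob_def)
  also have "\<dots> \<le> m" by (intro mX) (simp add: X_def)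
  finally show ?thesis using m4 by simp
qed

lemma tail_markov:
  assumes p: "0 \<le> p" "p \<le> 1" and B: "\<And>F. F \<in> fins \<Longrightarrow> fexp F (\<lambda>_. p) (\<lambda>\<eta>. real (card (clus \<eta> v0))) \<le> B"
  shows "(\<lambda>n. tail p n v0) \<longlonglongrightarrow> 0"
proof (rule tendsto_sandwich[where f = "\<lambda>_. 0" and h = "\<lambda>n. B / real n"])
  have "tail p n v0 \<le> B / real n" if n: "0 < n" for n
    unfolding tail_def
  proof (rule supf_le[OF p])
    fix F assume F: "F \<in> fins"
    have "real n * fexp F (\<lambda>_. p) (\<lambda>\<eta>. of_bool (n \<le> card (clus \<eta> v0))) \<le> fexp F (\<lambda>_. p) (\<lambda>\<eta>. real (card (clus \<eta> v0)))"
      unfolding fexp_cmult[symmetric] by (intro fexp_mono probs_const p) auto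
    also have "\<dots> \<le> B" by (rule B[OF F])
    finally show "fexp F (\<lambda>_. p) (\<lambda>\<eta>. of_bool (n \<le> card (clus \<eta> v0))) \<le> B / real n"
      using n by (simp add: field_simps)
  qed
  then show "\<forall>\<^sub>F n in sequentially. tail p n v0 \<le> B / real n"
    by (intro eventually_sequentiallyI[of 1]) auto
  show "(\<lambda>n. B / real n) \<longlonglongrightarrow> 0" by (rule lim_const_over_n)
qed (use tail_bounds[OF p] in auto)

text \<open>If the susceptibility is finite, some sphere has expected number of vertices reached inside the ball
  below 1, a condition that is open in \<open>p\<close> and, by BK, bounds the susceptibility in turn.\<close>
lemma subcritical_open:
  assumes p: "0 \<le> p" "p \<le> 1" and B: "\<And>F. F \<in> fins \<Longrightarrow> fexp F (\<lambda>_. p) (\<lambda>\<eta>. real (card (clus \<eta> v0))) \<le> B"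
  obtains \<epsilon> where "0 < \<epsilon>" "\<And>p'. p \<le> p' \<Longrightarrow> p' < p + \<epsilon> \<Longrightarrow> p' \<le> 1 \<Longrightarrow> (\<lambda>n. tail p' n v0) \<longlonglongrightarrow> 0"
proof -
  have tauB: "(\<Sum>x\<in>W. tau p v0 x) \<le> B" if W: "finite W" for W
  proof (rule LIMSEQ_le_const2)
    show "(\<lambda>k. \<Sum>x\<in>W. fexp (EB k) (\<lambda>_. p) (\<lambda>\<eta>. of_bool (conn \<eta> v0 x))) \<longlonglongrightarrow> (\<Sum>x\<in>W. tau p v0 x)"
      unfolding tau_def by (intro tendsto_sum supf_LIMSEQ p good_conn)
    have "(\<Sum>x\<in>W. fexp (EB k) (\<lambda>_. p) (\<lambda>\<eta>. of_bool (conn \<eta> v0 x))) \<le> B" for k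
    proof -
      have "(\<Sum>x\<in>W. fexp (EB k) (\<lambda>_. p) (\<lambda>\<eta>. of_bool (conn \<eta> v0 x))) = fexp (EB k) (\<lambda>_. p) (\<lambda>\<eta>. \<Sum>x\<in>W. of_bool (conn \<eta> v0 x))"
        by (rule fexp_sum[symmetric])
      also have "\<dots> \<le> fexp (EB k) (\<lambda>_. p) (\<lambda>\<eta>. real (card (clus \<eta> v0)))"
      proof (intro fexp_mono probs_const p)
        fix \<eta> assume "\<eta> \<subseteq> EB k"
        then have "finite (clus \<eta> v0)" using EB_fins[OF p] fins_sub finite_clus by blast
        then show "(\<Sum>x\<in>W. of_bool (conn \<eta> v0 x)) \<le> real (card (clus \<eta> v0))"
          using W by (auto simp: clus_def intro!: card_mono)
      qed
      also have "\<dots> \<le> B" by (rule B[OF EB_fins[OF p]])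
      finally show ?thesis .
    qed
    then show "\<exists>N. \<forall>n\<ge>N. (\<Sum>x\<in>W. fexp (EB n) (\<lambda>_. p) (\<lambda>\<eta>. of_bool (conn \<eta> v0 x))) \<le> B" by blast
  qed
  \<comment> \<open>The spheres are disjoint, so if each had sum at least 1/2, the total would
    exceed \<open>B\<close>.\<close>
  have "\<exists>r\<ge>1. (\<Sum>x\<in>sphere v0 r. tau p v0 x) < 1/2"
  proof (rule ccontr)
    assume "\<not> ?thesis"
    then have big: "1/2 \<le> (\<Sum>x\<in>sphere v0 r. tau p v0 x)" if "1 \<le> r" for r using that by force
    obtain n :: nat where n: "2 * B < real n" using reals_Archimedean2 by blast
    let ?W = "\<Union>r\<in>{1..n}. sphere v0 r"
    have "real n * (1/2) \<le> (\<Sum>r\<in>{1..n}. \<Sum>x\<in>sphere v0 r. tau p v0 x)"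
      using sum_bounded_below[of "{1..n}" "1/2" "\<lambda>r. \<Sum>x\<in>sphere v0 r. tau p v0 x"] big by simp
    also have "\<dots> = (\<Sum>x\<in>?W. tau p v0 x)"
      by (subst sum.UNION_disjoint) (auto simp: finite_sphere v0, auto simp: sphere_def)
    also have "\<dots> \<le> B" by (rule tauB) (use finite_sphere[OF v0] in auto)
    finally show False using n by simp
  qed
  then obtain r where r: "1 \<le> r" "(\<Sum>x\<in>sphere v0 r. tau p v0 x) < 1/2" by blast
  have "inball p v0 r \<le> (\<Sum>x\<in>sphere v0 r. tau p v0 x)"
    unfolding inball_def by (intro sum_mono tau_upper p fins_U v0)
  then have ib: "inball p v0 r < 3/4" using r(2) by simp
  have cont: "continuous_on UNIV (\<lambda>p. inball p v0 r)"
    unfolding inball_def fprob_def by (intro continuous_on_sum continuous_on_fexp)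
  then have "isCont (\<lambda>p. inball p v0 r) p" by (simp add: continuous_on_eq_continuous_at)
  then have "\<forall>\<^sub>F p' in at p. inball p' v0 r < 3/4"
    using ib by (intro order_tendstoD(2)[of _ "inball p v0 r"]) (simp_all add: isCont_def)
  then obtain \<epsilon> where \<epsilon>: "0 < \<epsilon>" "\<And>p'. p' \<noteq> p \<Longrightarrow> dist p' p < \<epsilon> \<Longrightarrow> inball p' v0 r < 3/4"
    unfolding eventually_at by blast
  show ?thesis
  proof (rule that[OF \<epsilon>(1)])
    fix p' assume p': "p \<le> p'" "p' < p + \<epsilon>" "p' \<le> 1"
    have "inball p' v0 r \<le> 3/4"
      using \<epsilon>(2)[of p'] ib p' by (cases "p' = p") (auto simp: dist_real_def)
    then show "(\<lambda>n. tail p' n v0) \<longlonglongrightarrow> 0"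
      using p' p by (intro tail_markov[of _ "4 * real (N r)"] susc_bounded_from_inball[OF _ _ r(1)]) auto
  qed
qed

section \<open>Behaviour below and at the critical point\<close>

definition perc_set where "perc_set = {p \<in> {0..1}. AE \<omega> in percolation E p. \<exists>v\<in>V. infinite (cluster E \<omega> v)}"

abbreviation "pc \<equiv> p_crit V E"

lemma pc_def: "pc = Inf perc_set"
  by (simp add: p_crit_def perc_set_def)

text \<open>At \<open>p = 1\<close> every edge is open, so the cluster of \<open>v0\<close> contains
  all balls, and these grow without bound.\<close>

lemma perc_set_nonempty: assumes "infinite V" shows "1 \<in> perc_set"
proof -
  have one: "tail 1 n v0 = 1" for n
  proof -
    have "\<exists>k. n \<le> card (ball v0 k)"
    proof -
      obtain B where B: "B \<subseteq> V" "finite B" "card B = n" using infinite_arbitrarily_large[OF assms] by blast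
      obtain k where "\<forall>m\<in>d v0 ` B. m \<le> k" using finite_nat_set_iff_bounded_le[of "d v0 ` B"] B(2) by blast
      then have "B \<subseteq> ball v0 k" using B(1) by (auto simp: ball_def)
      then show ?thesis using card_mono[OF finite_ball[OF v0]] B(3) by blast
    qed
    then obtain k where k: "n \<le> card (ball v0 k)" ..
    have big: "n \<le> card (clus (U v0 k) v0)"
    proof -
      have "ball v0 k \<subseteq> clus (U v0 k) v0" using conn_U[OF v0] by (auto simp: clus_def)
      then show ?thesis using k card_mono[OF finite_clus[OF fins_U[OF v0]]] by (meson order_trans)
    qed
    have "1 = fprob (U v0 k) (\<lambda>_. 1) (\<lambda>\<omega>. U v0 k \<subseteq> \<omega>)"
      by (subst fprob_superset) (auto simp: finite_U v0)
    also have "\<dots> \<le> fprob (U v0 k) (\<lambda>_. 1) (\<lambda>\<eta>. n \<le> card (clus \<eta> v0))"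
      using big by (intro fprob_mono probs_const) (auto dest: equalityI)
    also have "\<dots> \<le> tail 1 n v0" by (intro tail_upper fins_U v0) auto
    finally show ?thesis using tail_bounds(2)[of 1 n v0] by simp
  qed
  interpret PP: prob_space "percolation E 1" by (rule perc_prob_space) auto
  have "(\<lambda>n. tail 1 n v0) \<longlonglongrightarrow> 1" by (simp add: one)
  then have "PP.prob {\<omega> \<in> space (percolation E 1). infinite (cluster E \<omega> v0)} = 1"
    using infinite_cluster_prob(2)[of 1 v0] by (intro LIMSEQ_unique) auto
  then have "AE \<omega> in percolation E 1. infinite (cluster E \<omega> v0)"
    using PP.prob_eq_1[OF infinite_cluster_prob(1)[of 1 v0]] by auto
  then have "AE \<omega> in percolation E 1. \<exists>v\<in>V. infinite (cluster E \<omega> v)"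
    by eventually_elim (use v0 in blast)
  then show ?thesis by (simp add: perc_set_def)
qed

lemma perc_set_bdd: "bdd_below perc_set"
  by (rule bdd_belowI[of _ 0]) (auto simp: perc_set_def)

lemma pc_bounds: assumes "infinite V" shows "0 \<le> pc" "pc \<le> 1"
  unfolding pc_def using perc_set_nonempty[OF assms] perc_set_bdd
  by (auto intro!: cInf_greatest cInf_lower) (auto simp: perc_set_def)

lemma perc_set_tail: "p \<in> perc_set \<Longrightarrow> \<not> (\<lambda>n. tail p n v0) \<longlonglongrightarrow> 0"
  using no_infinite[of p] by (auto simp: perc_set_def)

text \<open>At \<open>p = 0\<close> every cluster is a single vertex, and
  \<open>subcritical_open\<close> extends the absence of infinite clusters to an interval.\<close>

lemma pc_pos: assumes "infinite V" shows "0 < pc"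
proof -
  have "clus {} v0 = {v0}" using clus_subset[of "{}" v0] self_in_clus[of v0 "{}"] by auto
  then have "fexp F (\<lambda>_. 0) (\<lambda>\<eta>. real (card (clus \<eta> v0))) \<le> 1" if "F \<in> fins" for F
    using that by (simp add: fexp_zero fins_def)
  then obtain \<epsilon> where \<epsilon>: "0 < \<epsilon>" "\<And>p'. 0 \<le> p' \<Longrightarrow> p' < 0 + \<epsilon> \<Longrightarrow> p' \<le> 1 \<Longrightarrow> (\<lambda>n. tail p' n v0) \<longlonglongrightarrow> 0"
    using subcritical_open[of 0 1] by (metis order_refl zero_le_one)
  have "\<epsilon> \<le> pc" unfolding pc_def
  proof (rule cInf_greatest)
    fix p assume p: "p \<in> perc_set"
    then show "\<epsilon> \<le> p" using \<epsilon>(2)[of p] perc_set_tail[OF p] by (force simp: perc_set_def)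
  qed (use perc_set_nonempty[OF assms] in auto)
  then show ?thesis using \<epsilon>(1) by simp
qed

text \<open>Were it bounded at \<open>pc\<close>, \<open>subcritical_open\<close> would exclude
  percolation slightly above \<open>pc\<close>, against the definition of \<open>pc\<close> as an
  infimum.\<close>

lemma susceptibility_unbounded:
  assumes "infinite V"
  shows "\<exists>F\<in>fins. B < fexp F (\<lambda>_. pc) (\<lambda>\<eta>. real (card (clus \<eta> v0)))"
proof (rule ccontr)
  assume "\<not> ?thesis"
  then have B: "fexp F (\<lambda>_. pc) (\<lambda>\<eta>. real (card (clus \<eta> v0))) \<le> B" if "F \<in> fins" for F using that by force
  show False
  proof (rule subcritical_open[OF pc_bounds[OF assms] B])
    fix \<epsilon> :: real assume \<epsilon>: "0 < \<epsilon>" "\<And>p'. pc \<le> p' \<Longrightarrow> p' < pc + \<epsilon> \<Longrightarrow> p' \<le> 1 \<Longrightarrow> (\<lambda>n. tail p' n v0) \<longlonglongrightarrow> 0"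
    have "\<exists>p\<in>perc_set. p < pc + \<epsilon>"
      using \<epsilon>(1) perc_set_nonempty[OF assms] perc_set_bdd unfolding pc_def by (subst cInf_less_iff[symmetric]) auto
    then obtain p where p: "p \<in> perc_set" "p < pc + \<epsilon>" ..
    moreover have "pc \<le> p" unfolding pc_def using p(1) perc_set_bdd by (rule cInf_lower)
    ultimately show False using \<epsilon>(2)[of p] perc_set_tail[of p] by (auto simp: perc_set_def)
  qed
qed

text \<open>Below \<open>pc\<close> percolation is not almost sure, and by
  \<open>infinite_cluster_01\<close> it then has probability 0. The decay of \<open>tau\<close>
  needed for this is inherited from \<open>pc\<close> by monotonicity.\<close>

lemma theta_zero:
  assumes "infinite V" "nabla V E pc v0 < \<infinity>" "0 \<le> p" "p < pc"
  shows "(\<lambda>n. tail p n v0) \<longlonglongrightarrow> 0"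
proof (rule ccontr)
  assume nt: "\<not> ?thesis"
  note pcb = pc_bounds[OF assms(1)]
  have p1: "p \<le> 1" using assms(4) pcb by simp
  have "AE \<omega> in percolation E p. \<exists>v\<in>V. infinite (cluster E \<omega> v)"
  proof (rule infinite_cluster_01[OF assms(3) p1 assms(1) _ nt])
    fix \<delta> :: real assume "0 < \<delta>"
    then obtain R where R: "\<And>x y. x \<in> V \<Longrightarrow> y \<in> V \<Longrightarrow> d x y > R \<Longrightarrow> tau pc x y \<le> \<delta>"
      using tau_small[OF pcb assms(2)] by metis
    have "tau p x y \<le> tau pc x y" for x y using assms pcb by (intro tau_mono_param) auto
    then show "\<exists>R. \<forall>x\<in>V. \<forall>y\<in>V. d x y > R \<longrightarrow> tau p x y \<le> \<delta>" using R by (meson order_trans)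
  qed
  then have "p \<in> perc_set" using assms(3) p1 by (simp add: perc_set_def)
  then have "pc \<le> p" unfolding pc_def using perc_set_bdd by (rule cInf_lower)
  then show False using assms(4) by simp
qed

end

section \<open>The upper bound on the tail\<close>

text \<open>It yields \<open>q * \<chi> \<le> 1\<close>, the elementary bound used when
  \<open>q\<close> is not small compared with \<open>M\<close>.\<close>

lemma mult_power_le_1:
  fixes q :: real assumes "0 \<le> q" "q \<le> 1" shows "q * (real k * (1 - q) ^ k) \<le> 1"
proof -
  \<comment> \<open>The induction runs with this sharper bound; the increments of its right side are
    exactly \<open>q * (1 - q) ^ k\<close>.\<close>
  have "q * (real k * (1 - q) ^ k) \<le> 1 - (1 - q) ^ k"
  proof (induction k)
    case (Suc k)
    have pd: "(1 - q) ^ Suc k \<le> (1 - q) ^ k" using assms by (intro power_decreasing) auto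
    have 1: "q * (1 - q) ^ Suc k \<le> q * (1 - q) ^ k"
      using assms(1) by (rule mult_left_mono[OF pd])
    have "q * (real k * (1 - q) ^ Suc k) \<le> q * (real k * (1 - q) ^ k)"
      using assms(1) by (intro mult_left_mono pd) auto
    also note Suc.IH
    finally have 2: "q * (real k * (1 - q) ^ Suc k) \<le> 1 - (1 - q) ^ k" .
    have "q * (real (Suc k) * (1 - q) ^ Suc k) = q * (real k * (1 - q) ^ Suc k) + q * (1 - q) ^ Suc k"
      by (simp add: algebra_simps)
    also have "\<dots> \<le> (1 - (1 - q) ^ k) + q * (1 - q) ^ k" using 1 2 by (rule add_mono[rotated])
    also have "\<dots> = 1 - (1 - q) ^ Suc k" by (simp add: algebra_simps)
    finally show ?case .
  qed simp
  then show ?thesis using assms by (smt (verit) zero_le_power)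
qed

context pgraph begin

lemma fins_UN_V: "F \<in> fins \<Longrightarrow> \<Union>F \<subseteq> V"
  unfolding fins_def using edge_sub by blast

text \<open>Along an edge the distance from \<open>v0\<close> grows by at most one, so the cluster
  contains a vertex at every smaller distance. Thus a cluster that leaves a large ball is
  large.\<close>

lemma dist_less_card:
  assumes \<eta>: "\<eta> \<in> fins" and c: "conn \<eta> v0 x"
  shows "d v0 x < card (clus \<eta> v0)"
proof -
  have "\<forall>j\<le>d v0 x. \<exists>z\<in>clus \<eta> v0. d v0 z = j"
    using c
  proof (induction rule: conn_induct)
    case refl
    then show ?case by (auto intro!: bexI[of _ v0])
  next
    case (step y z)
    have e: "{y, z} \<in> E" using step(2) \<eta> by (auto simp: fins_def)
    have zc: "z \<in> clus \<eta> v0" using conn_trans[OF step(1) conn_edge[OF step(2)]] by (simp add: clus_def)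
    have "d v0 z \<le> d v0 y + 1"
      using dist_triangle[OF v0, of y z] edge_V[OF e] dist_edge[OF e] by simp
    show ?case
    proof (intro allI impI)
      fix j assume j: "j \<le> d v0 z"
      show "\<exists>z\<in>clus \<eta> v0. d v0 z = j"
      proof (cases "j \<le> d v0 y")
        case False
        then have "j = d v0 z" using j \<open>d v0 z \<le> d v0 y + 1\<close> by simp
        then show ?thesis using zc by blast
      qed (use step(3) in blast)
    qed
  qed
  then have "{..d v0 x} \<subseteq> d v0 ` clus \<eta> v0" by (auto simp: image_iff)
  then have "card {..d v0 x} \<le> card (d v0 ` clus \<eta> v0)"
    by (intro card_mono finite_imageI finite_clus \<eta>)
  also have "\<dots> \<le> card (clus \<eta> v0)" by (intro card_image_le finite_clus \<eta>)
  finally show ?thesis by simp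
qed

definition ghost_susc where "ghost_susc p q F = fexp F (\<lambda>_. p) (\<lambda>\<eta>. real (card (clus \<eta> v0)) * (1 - q) ^ card (clus \<eta> v0))"

text \<open>This stands in for transitivity, which \<open>F\<close> lacks: in a large enough volume
  the finite-volume value is nearly the common infinite-volume one at every point of a finite
  window.\<close>

lemma magn_approx:
  assumes p: "0 \<le> p" "p \<le> 1" and q: "0 < q" "q \<le> 1" and W: "finite W" "W \<subseteq> V"
    and k: "0 \<le> k" "k < 1"
  shows "\<exists>F0\<in>fins. \<forall>F\<in>fins. F0 \<subseteq> F \<longrightarrow> (\<forall>x\<in>W. k * magn p q v0 \<le> fexp F (\<lambda>_. p) (\<lambda>\<eta>. 1 - (1 - q) ^ card (clus \<eta> x)))"
  using W
proof (induction W rule: finite_induct)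
  case empty
  then show ?case using fins_empty by auto
next
  case (insert x W)
  obtain F1 where F1: "F1 \<in> fins" "\<forall>F\<in>fins. F1 \<subseteq> F \<longrightarrow> (\<forall>x\<in>W. k * magn p q v0 \<le> fexp F (\<lambda>_. p) (\<lambda>\<eta>. 1 - (1 - q) ^ card (clus \<eta> x)))"
    using insert by auto
  have x: "x \<in> V" using insert.prems by auto
  have m: "0 < magn p q v0" using magn_ge_q[OF p, of q v0] q by simp
  then have "0 < (1 - k) * magn p q v0" using k by simp
  then obtain F2 where F2: "F2 \<in> fins" "\<forall>F\<in>fins. F2 \<subseteq> F \<longrightarrow>
      fexp F (\<lambda>_. p) (\<lambda>\<eta>. 1 - (1 - q) ^ card (clus \<eta> x)) \<ge> magn p q x - (1 - k) * magn p q v0"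
    using supf_approx[OF p good_magn[of q x]] q unfolding magn_def by force
  have "magn p q x = magn p q v0" using magn_eq[OF p _ _ x] q by simp
  then have "magn p q x - (1 - k) * magn p q v0 = k * magn p q v0" by (simp add: algebra_simps)
  then show ?case using F1 F2 by (intro bexI[OF _ fins_Un[OF F1(1) F2(1)]]) auto
qed

text \<open>The radii come from triangle tails at \<open>pc\<close>, and the powers of
  \<open>p\<close> are estimated by those of \<open>pc / 2\<close>; so \<open>C\<close> is uniform
  in \<open>p\<close> and \<open>q\<close>. Only the window and \<open>F0\<close> depend on
  them.\<close>

lemma magn_susc:
  assumes infV: "infinite V" and nabla: "nabla V E pc v0 < \<infinity>"
  obtains C where "0 < C" "\<And>p q. pc / 2 \<le> p \<Longrightarrow> p \<le> pc \<Longrightarrow> 0 < q \<Longrightarrow> q \<le> 1/2 \<Longrightarrow>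
    \<exists>F0\<in>fins. \<forall>F\<in>fins. F0 \<subseteq> F \<longrightarrow> magn p q v0 * ghost_susc p q F \<le> C"
proof -
  note pcb = pc_bounds[OF infV] and pcpos = pc_pos[OF infV]
  have "(0::real) < 1/16" by simp
  then obtain R where R: "\<And>b Z. b \<in> V \<Longrightarrow> finite Z \<Longrightarrow> Z \<subseteq> V \<times> V \<Longrightarrow>
    (\<And>x y. (x, y) \<in> Z \<Longrightarrow> \<not> (x \<in> ball b R \<and> y \<in> ball b R)) \<Longrightarrow> (\<Sum>(x, y)\<in>Z. tri pc b x y) \<le> 1/16"
    using tri_tail[OF pcb nabla] by metis
  \<comment> \<open>Vertices at distance more than \<open>2 * R\<close> are not both within
    \<open>R\<close> of a common \<open>w\<close>.\<close>
  define R1 where "R1 = 2 * R"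
  \<comment> \<open>With \<open>1 / p \<le> 2 / pc\<close> this meets the condition on
    \<open>e\<close> in \<open>magn_susc_finite\<close>.\<close>
  define e where "e = 1 / (64 * real (N R1) * real (N 1) * (1 + 2 / pc))"
  have N1: "1 \<le> real (N R1)" "1 \<le> real (N 1)" using N_pos[of R1] N_pos[of 1] by auto
  have e0: "0 < e" unfolding e_def using N1 pcpos by (intro divide_pos_pos mult_pos_pos add_pos_pos) auto
  then obtain R' where R': "\<And>b Z. b \<in> V \<Longrightarrow> finite Z \<Longrightarrow> Z \<subseteq> V \<times> V \<Longrightarrow>
    (\<And>x y. (x, y) \<in> Z \<Longrightarrow> \<not> (x \<in> ball b R' \<and> y \<in> ball b R')) \<Longrightarrow> (\<Sum>(x, y)\<in>Z. tri pc b x y) \<le> e"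
    using tri_tail[OF pcb nabla] by metis
  \<comment> \<open>The extra 1 gives \<open>R' < R2\<close>, so the alternative
    \<open>d w s \<ge> R2\<close> also puts \<open>s\<close> outside the ball about
    \<open>w\<close>.\<close>
  define R2 where "R2 = 2 * R' + 1"
  define C0 where "C0 = 64 * real (N R1) * real (N 1)^2 * real (N R2) * real (N (2 * (R2 + 1))) / (pc/2) ^ (2 ^ N (R2 + 1))"
  define C where "C = C0 + 16 * real (N R1) + 4 * real (N R2) + 1"
  have C0: "0 \<le> C0" unfolding C0_def using pcpos by (intro divide_nonneg_pos) auto
  show ?thesis
  proof (rule that[of C])
    show "0 < C" using C0 by (simp add: C_def)
    fix p q :: real assume pr: "pc / 2 \<le> p" "p \<le> pc" and q: "0 < q" "q \<le> 1/2"
    have p: "0 \<le> p" "p \<le> 1" and p0: "0 < p" using pr pcpos pcb by auto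
    define Mb where "Mb = magn p q v0"
    have Mb: "0 < Mb" "Mb \<le> 1" using magn_ge_q[OF p(1,2), of q v0] magn_bounds(2)[OF p(1,2), of q v0] q by (auto simp: Mb_def)
    \<comment> \<open>A cluster that leaves \<open>V0\<close> has at least \<open>r\<close> vertices
      and so contributes less than 1/2 to the expected green-free size. In the main case that size
      exceeds 1, and \<open>V0\<close> carries at least half of it.\<close>
    have "(\<lambda>k. real k * (1 - q) ^ k) \<longlonglongrightarrow> 0"
      using q by (intro powser_times_n_limit_0) auto
    then have "\<forall>\<^sub>F k in sequentially. real k * (1 - q) ^ k < 1/2" by (intro order_tendstoD(2)) auto
    then obtain r where r: "\<And>k. k \<ge> r \<Longrightarrow> real k * (1 - q) ^ k < 1/2" unfolding eventually_sequentially by blast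
    define V0 where "V0 = ball v0 r"
    define V1 where "V1 = ball v0 (r + R1)"
    obtain F1 where F1: "F1 \<in> fins" "\<forall>F\<in>fins. F1 \<subseteq> F \<longrightarrow> (\<forall>x\<in>V1. 1/2 * magn p q v0 \<le> fexp F (\<lambda>_. p) (\<lambda>\<eta>. 1 - (1 - q) ^ card (clus \<eta> x)))"
    proof -
      have "\<exists>F0\<in>fins. \<forall>F\<in>fins. F0 \<subseteq> F \<longrightarrow> (\<forall>x\<in>V1. 1/2 * magn p q v0 \<le> fexp F (\<lambda>_. p) (\<lambda>\<eta>. 1 - (1 - q) ^ card (clus \<eta> x)))"
        unfolding V1_def using q by (intro magn_approx p finite_ball v0 ball_sub) auto
      then show thesis using that by blast
    qed
    define F0 where "F0 = F1 \<union> U v0 (r + R1 + (R2 + 1))"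
    have F0: "F0 \<in> fins" unfolding F0_def by (intro fins_Un F1 fins_U v0)
    have "magn p q v0 * ghost_susc p q F \<le> C" if F: "F \<in> fins" and F0F: "F0 \<subseteq> F" for F
    proof -
      define X where "X = V1 \<union> \<Union>F"
      have X: "finite X" "X \<subseteq> V" "\<Union>F \<subseteq> X"
        using fins_finite_UN[OF F] finite_ball[OF v0] ball_sub fins_UN_V[OF F] by (auto simp: X_def V1_def)
      have v0X: "v0 \<in> X" using ball_self[OF v0] by (auto simp: X_def V1_def)
      interpret finite_volume V E v0 F X "{0}" p "\<lambda>_. q"
        using F p X q by unfold_locales auto
      have I0: "0 \<in> {0::nat}" by simp
      have MMb: "fv.M 0 s \<le> Mb" if "s \<in> X" for s
        unfolding Mb_def by (rule M_le_magn[OF I0 that])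
      have g_eq: "g v0 x = fexp F (\<lambda>_. p) (\<lambda>\<eta>. of_bool (conn \<eta> v0 x) * (1 - q) ^ card (clus \<eta> v0))" for x
      proof -
        have "g v0 x = fv.P (\<lambda>\<omega>. cn v0 x \<omega> \<and> \<not> hit 0 v0 \<omega>)" by (rule g_def[OF v0X I0 MMb])
        also have "\<dots> = fv.EE (\<lambda>\<omega>. of_bool (conn (eds \<omega>) v0 x) * of_bool (\<not> hit 0 v0 \<omega>))"
          unfolding fprob_def cn_def by (simp only: of_bool_conj)
        finally show ?thesis using nohit_eq[OF I0 v0X, of "\<lambda>\<eta>. of_bool (conn \<eta> v0 x)"] by simp
      qed
      have clusX: "clus \<eta> v0 \<subseteq> X" if "\<eta> \<subseteq> F" for \<eta> using clus_subset[of \<eta> v0] that X(3) v0X by blast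
      have chi_eq: "chi v0 = ghost_susc p q F"
      proof -
        have "chi v0 = (\<Sum>x\<in>X. g v0 x)" by (rule chi_def[OF v0X I0 MMb])
        also have "\<dots> = fexp F (\<lambda>_. p) (\<lambda>\<eta>. \<Sum>x\<in>X. of_bool (conn \<eta> v0 x) * (1 - q) ^ card (clus \<eta> v0))"
          unfolding g_eq by (rule fexp_sum[symmetric])
        also have "\<dots> = ghost_susc p q F"
          unfolding ghost_susc_def sum_distrib_right[symmetric]
          by (intro fexp_cong) (use card_clus_eq_sum[OF X(1) clusX] in simp)
        finally show ?thesis .
      qed
      have chi0: "0 \<le> ghost_susc p q F"
        unfolding ghost_susc_def using q by (intro fexp_nonneg probs_const p) auto
      have qchi: "q * ghost_susc p q F \<le> 1"
      proof -
        have "q * ghost_susc p q F \<le> fexp F (\<lambda>_. p) (\<lambda>_. 1)"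
          unfolding ghost_susc_def fexp_cmult[symmetric] using q by (intro fexp_mono probs_const p mult_power_le_1) auto
        then show ?thesis by (simp add: fexp_const finite_F)
      qed
      have V01: "V0 \<subseteq> V1" "V1 \<subseteq> X" using ball_mono[of r "r + R1" v0] by (auto simp: V0_def V1_def X_def)
      \<comment> \<open>If \<open>q\<close> is not small compared with \<open>Mb\<close>, then
        \<open>Mb\<close> may be replaced by a multiple of \<open>q\<close>, and \<open>qchi\<close>
        concludes. Case \<open>d\<close> is the only one that uses the geometry.\<close>
      consider (a) "real (N R1) * q > Mb / 16" | (b) "real (N R2) * q > Mb / 4" | (c) "ghost_susc p q F \<le> 1"
        | (d) "real (N R1) * q \<le> Mb / 16" "real (N R2) * q \<le> Mb / 4" "1 < ghost_susc p q F" by linarith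
      then have "Mb * ghost_susc p q F \<le> C"
      proof cases
        case a
        then have "Mb * ghost_susc p q F \<le> (16 * real (N R1) * q) * ghost_susc p q F" using chi0 by (intro mult_right_mono) auto
        also have "\<dots> = 16 * real (N R1) * (q * ghost_susc p q F)" by simp
        also have "\<dots> \<le> 16 * real (N R1) * 1" using qchi by (intro mult_left_mono) auto
        finally show ?thesis using C0 by (simp add: C_def)
      next
        case b
        then have "Mb * ghost_susc p q F \<le> (4 * real (N R2) * q) * ghost_susc p q F" using chi0 by (intro mult_right_mono) auto
        also have "\<dots> = 4 * real (N R2) * (q * ghost_susc p q F)" by simp
        also have "\<dots> \<le> 4 * real (N R2) * 1" using qchi by (intro mult_left_mono) auto
        finally show ?thesis using C0 by (simp add: C_def)
      next
        case c
        then have "Mb * ghost_susc p q F \<le> 1 * 1" using Mb chi0 by (intro mult_mono) auto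
        then show ?thesis using C0 by (simp add: C_def)
      next
        case d
        have "(\<Sum>x\<in>X - V0. g v0 x) \<le> 1/2"
        proof -
          have "(\<Sum>x\<in>X - V0. g v0 x) = fexp F (\<lambda>_. p) (\<lambda>\<eta>. \<Sum>x\<in>X - V0. of_bool (conn \<eta> v0 x) * (1 - q) ^ card (clus \<eta> v0))"
            unfolding g_eq by (rule fexp_sum[symmetric])
          also have "\<dots> \<le> fexp F (\<lambda>_. p) (\<lambda>_. 1/2)"
          proof (intro fexp_mono probs_const p)
            fix \<eta> assume \<eta>: "\<eta> \<subseteq> F"
            have \<eta>f: "\<eta> \<in> fins" using fins_sub[OF F \<eta>] .
            show "(\<Sum>x\<in>X - V0. of_bool (conn \<eta> v0 x) * (1 - q) ^ card (clus \<eta> v0)) \<le> 1/2"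
            proof (cases "\<exists>x\<in>X - V0. conn \<eta> v0 x")
              case True
              then obtain x where x: "x \<in> X - V0" "conn \<eta> v0 x" by blast
              then have "r < d v0 x" using X(2) by (auto simp: V0_def ball_def)
              then have "r \<le> card (clus \<eta> v0)" using dist_less_card[OF \<eta>f x(2)] by simp
              then have "real (card (clus \<eta> v0)) * (1 - q) ^ card (clus \<eta> v0) < 1/2" by (rule r)
              moreover have "(\<Sum>x\<in>X - V0. of_bool (conn \<eta> v0 x)) \<le> (\<Sum>x\<in>X. of_bool (conn \<eta> v0 x) :: real)"
                using X(1) by (intro sum_mono2) auto
              then have "(\<Sum>x\<in>X - V0. of_bool (conn \<eta> v0 x)) * (1 - q) ^ card (clus \<eta> v0)
                \<le> real (card (clus \<eta> v0)) * (1 - q) ^ card (clus \<eta> v0)"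
                unfolding card_clus_eq_sum[OF X(1) clusX[OF \<eta>]] using q by (intro mult_right_mono) auto
              ultimately show ?thesis unfolding sum_distrib_right[symmetric] by linarith
            next
              case False
              then have "(\<Sum>x\<in>X - V0. of_bool (conn \<eta> v0 x) * (1 - q) ^ card (clus \<eta> v0)) = 0"
                by (intro sum.neutral) auto
              then show ?thesis by simp
            qed
          qed
          finally show ?thesis by (simp add: fexp_const finite_F)
        qed
        moreover have "chi v0 = (\<Sum>x\<in>X - V0. g v0 x) + (\<Sum>x\<in>V0. g v0 x)"
        proof -
          have "chi v0 = (\<Sum>x\<in>X. g v0 x)" by (rule chi_def[OF v0X I0 MMb])
          also have "\<dots> = (\<Sum>x\<in>X - V0. g v0 x) + (\<Sum>x\<in>V0. g v0 x)"
            using X(1) V01 by (intro sum.subset_diff) auto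
          finally show ?thesis .
        qed
        ultimately have half: "chi v0 / 2 \<le> (\<Sum>x\<in>V0. g v0 x)" using d(3) chi_eq by simp
        have tri_mono: "(\<Sum>(x, s)\<in>Z. tri p w x s) \<le> (\<Sum>(x, s)\<in>Z. tri pc w x s)" for Z w
          unfolding tri_def using pr pcb p
          by (intro sum_mono) (auto intro!: mult_mono tau_mono_param mult_nonneg_nonneg tau_bounds)
        have "Mb * chi v0 \<le> 64 * real (N R1) * real (N 1)^2 * real (N R2) * real (N (2 * (R2 + 1))) / p ^ (2 ^ N (R2 + 1))"
        proof (rule magn_susc_finite[OF v0X I0 MMb p0 _ half V01(2), where ?R1.0 = R1 and e = e])
          show "V0 \<subseteq> X" using V01 by blast
          show "ball x R1 \<subseteq> V1" if "x \<in> V0" for x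
            using that unfolding V0_def V1_def by (intro ball_subset v0) (auto simp: ball_def)
          show "U a (R2 + 1) \<subseteq> F" if a: "a \<in> V1" for a
          proof -
            have "ball a (R2 + 1) \<subseteq> ball v0 (r + R1 + (R2 + 1))"
              using a unfolding V1_def by (intro ball_subset v0) (auto simp: ball_def)
            then have "U a (R2 + 1) \<subseteq> U v0 (r + R1 + (R2 + 1))" unfolding U_def by blast
            then show ?thesis using F0F by (auto simp: F0_def)
          qed
          show "Mb / 2 \<le> fv.M 0 a" if a: "a \<in> V1" for a
          proof -
            have "a \<in> X" using a V01 by blast
            have "F1 \<subseteq> F" using F0F by (simp add: F0_def)
            then have "1/2 * magn p q v0 \<le> fexp F (\<lambda>_. p) (\<lambda>\<eta>. 1 - (1 - q) ^ card (clus \<eta> a))"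
              using F1(2) F a by blast
            then show ?thesis using M_eq[OF I0 \<open>a \<in> X\<close>] by (simp add: Mb_def)
          qed
          fix w Z assume w: "w \<in> V" and Z: "Z \<subseteq> X \<times> X"
          have finZ: "finite Z" "Z \<subseteq> V \<times> V" using Z X by (auto intro: finite_subset)
          {
            assume far: "\<And>x s. (x, s) \<in> Z \<Longrightarrow> d x s > R1"
            have "(\<Sum>(x, s)\<in>Z. tri pc w x s) \<le> 1/16"
            proof (rule R[OF w finZ])
              fix x y assume xy: "(x, y) \<in> Z"
              then have "x \<in> V" "y \<in> V" using finZ by auto
              then show "\<not> (x \<in> ball w R \<and> y \<in> ball w R)"
                using far[OF xy] dist_triangle[of x w y] w dist_sym[of x w] by (auto simp: ball_def R1_def)
            qed
            then show "(\<Sum>(x, s)\<in>Z. tri p w x s) \<le> 1/16" using tri_mono[of w Z] by simp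
          }
          {
            assume far: "\<And>x s. (x, s) \<in> Z \<Longrightarrow> d x s > R2 \<or> d w s \<ge> R2"
            have "(\<Sum>(x, s)\<in>Z. tri pc w x s) \<le> e"
            proof (rule R'[OF w finZ])
              fix x y assume xy: "(x, y) \<in> Z"
              then have "x \<in> V" "y \<in> V" using finZ by auto
              then show "\<not> (x \<in> ball w R' \<and> y \<in> ball w R')"
                using far[OF xy] dist_triangle[of x w y] w dist_sym[of x w] by (auto simp: ball_def R2_def)
            qed
            then show "(\<Sum>(x, s)\<in>Z. tri p w x s) \<le> e" using tri_mono[of w Z] by simp
          }
        next
          have "1 / p \<le> 2 / pc" using pr pcpos p by (simp add: field_simps)
          then have "real (N 1) * e * (1 + 1 / p) \<le> real (N 1) * e * (1 + 2 / pc)"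
            using e0 by (intro mult_left_mono) auto
          also have "\<dots> = 1 / (64 * real (N R1))"
          proof -
            have "1 + 2 / pc \<noteq> 0" using pcpos by (simp add: add_pos_pos less_imp_neq[symmetric])
            moreover have "b * (1 / (64 * a * b * k)) * k = 1 / (64 * a)" if "b \<noteq> 0" "k \<noteq> 0" for a b k :: real
              using that by simp
            moreover have "real (N 1) \<noteq> 0" using N1 by linarith
            ultimately show ?thesis unfolding e_def by blast
          qed
          finally show "real (N 1) * e * (1 + 1 / p) \<le> 1 / (64 * real (N R1))" .
        qed (use e0 d in auto)
        also have "\<dots> \<le> C0"
        proof -
          have "(pc/2) ^ (2 ^ N (R2 + 1)) \<le> p ^ (2 ^ N (R2 + 1))" using pr pcpos by (intro power_mono) auto
          then show ?thesis unfolding C0_def using pcpos p0 by (intro divide_left_mono) (auto intro!: mult_pos_pos)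
        qed
        finally show ?thesis unfolding chi_eq by (simp add: C_def)
      qed
      then show ?thesis by (simp add: Mb_def)
    qed
    then show "\<exists>F0\<in>fins. \<forall>F\<in>fins. F0 \<subseteq> F \<longrightarrow> magn p q v0 * ghost_susc p q F \<le> C" using F0 by blast
  qed
qed

text \<open>A discrete form of differentiating \<open>M^2\<close>. Since the increment of
  \<open>M\<close> from \<open>q\<close> to \<open>2 * q\<close> is at most
  \<open>2 * q * \<chi>\<close>, it is at most \<open>2 * q * C / M\<close>; and
  \<open>M (2 * q) + M q \<le> 3 * M q\<close> cancels the denominator and gives the constant
  6.\<close>

lemma magn_double:
  assumes p: "0 \<le> p" "p \<le> 1" and q: "0 < q" "q \<le> 1/2" and C: "0 \<le> C"
    and F0: "F0 \<in> fins" "\<forall>F\<in>fins. F0 \<subseteq> F \<longrightarrow> magn p q v0 * ghost_susc p q F \<le> C"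
  shows "(magn p (2 * q) v0)\<^sup>2 \<le> (magn p q v0)\<^sup>2 + 6 * C * q"
proof -
  define M where "M = magn p q v0"
  have M: "0 < M" using magn_ge_q[OF p, of q v0] q by (simp add: M_def)
  have k1: "(1 - q) ^ k - (1 - 2 * q) ^ k \<le> 2 * q * (real k * (1 - q) ^ k)" for k
  proof (induction k)
    case (Suc k)
    let ?a = "1 - q" and ?b = "1 - 2 * q"
    have b: "0 \<le> ?b" "?b ^ k \<le> ?a ^ k" using q by (auto intro: power_mono)
    have "?a ^ Suc k - ?b ^ Suc k = ?a * (?a ^ k - ?b ^ k) + q * ?b ^ k" by (simp add: algebra_simps)
    also have "\<dots> \<le> ?a * (2 * q * (real k * ?a ^ k)) + q * ?a ^ k"
      using q b Suc.IH by (intro add_mono mult_left_mono) auto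
    also have "q * ?a ^ k \<le> 2 * q * ?a * ?a ^ k" using q by (intro mult_right_mono) auto
    also have "?a * (2 * q * (real k * ?a ^ k)) + 2 * q * ?a * ?a ^ k = 2 * q * (real (Suc k) * ?a ^ Suc k)"
      by (simp add: algebra_simps)
    finally show ?case by simp
  qed simp
  have k2: "1 - (1 - 2 * q) ^ k \<le> 2 * (1 - (1 - q) ^ k)" for k
  proof (induction k)
    case (Suc k)
    let ?a = "1 - q" and ?b = "1 - 2 * q"
    have a1: "?a ^ k \<le> 1" using q by (intro power_le_one) auto
    have "?b * (2 * ?a ^ k - 1) \<le> ?b * ?b ^ k" using q Suc.IH by (intro mult_left_mono) auto
    moreover have "2 * ?a ^ Suc k - 1 \<le> ?b * (2 * ?a ^ k - 1)"
    proof -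
      have "2 * q * ?a ^ k \<le> 2 * q * 1" using q a1 by (intro mult_left_mono) auto
      then show ?thesis by (simp add: algebra_simps)
    qed
    ultimately show ?case by simp
  qed simp
  have up: "magn p (2 * q) v0 \<le> M + 2 * q * (C / M)" unfolding magn_def
  proof (rule supf_le[OF p])
    fix F assume F: "F \<in> fins"
    let ?F = "F \<union> F0"
    have F': "?F \<in> fins" using fins_Un F F0 by blast
    have "fexp F (\<lambda>_. p) (\<lambda>\<eta>. 1 - (1 - 2 * q) ^ card (clus \<eta> v0)) \<le> fexp ?F (\<lambda>_. p) (\<lambda>\<eta>. 1 - (1 - 2 * q) ^ card (clus \<eta> v0))"
      using q by (intro fexp_good_mono[OF p] good_magn F') auto
    also have "\<dots> \<le> fexp ?F (\<lambda>_. p) (\<lambda>\<eta>. (1 - (1 - q) ^ card (clus \<eta> v0)) + 2 * q * (real (card (clus \<eta> v0)) * (1 - q) ^ card (clus \<eta> v0)))"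
    proof (intro fexp_mono probs_const p)
      fix \<eta>
      show "1 - (1 - 2 * q) ^ card (clus \<eta> v0) \<le> (1 - (1 - q) ^ card (clus \<eta> v0)) + 2 * q * (real (card (clus \<eta> v0)) * (1 - q) ^ card (clus \<eta> v0))"
        using k1[of "card (clus \<eta> v0)"] by linarith
    qed
    also have "\<dots> = fexp ?F (\<lambda>_. p) (\<lambda>\<eta>. 1 - (1 - q) ^ card (clus \<eta> v0)) + 2 * q * ghost_susc p q ?F"
      by (simp add: fexp_add fexp_cmult ghost_susc_def)
    also have "\<dots> \<le> M + 2 * q * (C / M)"
    proof (intro add_mono mult_left_mono)
      show "fexp ?F (\<lambda>_. p) (\<lambda>\<eta>. 1 - (1 - q) ^ card (clus \<eta> v0)) \<le> M"
        unfolding M_def using q by (intro magn_upper p F') auto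
      have "M * ghost_susc p q ?F \<le> C" unfolding M_def using F0(2) F' by blast
      then show "ghost_susc p q ?F \<le> C / M" using M by (simp add: field_simps)
    qed (use q in auto)
    finally show "fexp F (\<lambda>_. p) (\<lambda>\<eta>. 1 - (1 - 2 * q) ^ card (clus \<eta> v0)) \<le> M + 2 * q * (C / M)" .
  qed
  have dbl: "magn p (2 * q) v0 \<le> 2 * M" unfolding magn_def[of p "2 * q"]
  proof (rule supf_le[OF p])
    fix F assume F: "F \<in> fins"
    have "fexp F (\<lambda>_. p) (\<lambda>\<eta>. 1 - (1 - 2 * q) ^ card (clus \<eta> v0)) \<le> 2 * fexp F (\<lambda>_. p) (\<lambda>\<eta>. 1 - (1 - q) ^ card (clus \<eta> v0))"
      unfolding fexp_cmult[symmetric] by (intro fexp_mono probs_const p k2)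
    also have "\<dots> \<le> 2 * M" unfolding M_def using q by (intro mult_left_mono magn_upper p F) auto
    finally show "fexp F (\<lambda>_. p) (\<lambda>\<eta>. 1 - (1 - 2 * q) ^ card (clus \<eta> v0)) \<le> 2 * M" .
  qed
  have pos: "0 \<le> magn p (2 * q) v0" using q by (intro magn_bounds p) auto
  have "(magn p (2 * q) v0)\<^sup>2 - M\<^sup>2 = (magn p (2 * q) v0 - M) * (magn p (2 * q) v0 + M)"
    by (simp add: power2_eq_square algebra_simps)
  also have "\<dots> \<le> (2 * q * (C / M)) * (magn p (2 * q) v0 + M)"
    using up pos M by (intro mult_right_mono) auto
  also have "\<dots> \<le> (2 * q * (C / M)) * (3 * M)"
    using dbl M C q by (intro mult_left_mono) auto
  also have "\<dots> = 6 * C * q" using M by simp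
  finally show ?thesis by (simp add: M_def)
qed

text \<open>Clusters with fewer than \<open>n\<close> vertices are green with probability at most
  \<open>n * q\<close>. Letting \<open>q\<close> tend to 0 and then \<open>n\<close> to infinity
  shows that \<open>magn\<close> vanishes in the limit when there is no percolation.\<close>

lemma magn_le_tail:
  assumes p: "0 \<le> p" "p \<le> 1" and q: "0 \<le> q" "q \<le> 1"
  shows "magn p q v0 \<le> tail p n v0 + real n * q"
  unfolding magn_def
proof (rule supf_le[OF p])
  fix F assume F: "F \<in> fins"
  have "fexp F (\<lambda>_. p) (\<lambda>\<eta>. 1 - (1 - q) ^ card (clus \<eta> v0)) \<le> fexp F (\<lambda>_. p) (\<lambda>\<eta>. of_bool (n \<le> card (clus \<eta> v0)) + real n * q)"
  proof (intro fexp_mono probs_const p)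
    fix \<eta>
    have "1 - (1 - q) ^ k \<le> of_bool (n \<le> k) + real n * q" for k
    proof (cases "n \<le> k")
      case False
      have "1 + real k * (- q) \<le> (1 + (- q)) ^ k" using q by (intro Bernoulli_inequality) auto
      moreover have "real k * q \<le> real n * q" using False q by (intro mult_right_mono) auto
      ultimately show ?thesis using False by simp
    next
      case True
      have "0 \<le> (1 - q) ^ k" "0 \<le> real n * q" using q by auto
      then have "1 - (1 - q) ^ k \<le> 1 + real n * q" by linarith
      then show ?thesis using True by simp
    qed
    then show "1 - (1 - q) ^ card (clus \<eta> v0) \<le> of_bool (n \<le> card (clus \<eta> v0)) + real n * q" .
  qed
  also have "\<dots> = fprob F (\<lambda>_. p) (\<lambda>\<eta>. n \<le> card (clus \<eta> v0)) + real n * q"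
    using F by (simp add: fexp_add fexp_const fprob_def fins_def)
  also have "\<dots> \<le> tail p n v0 + real n * q" by (intro add_right_mono tail_upper p F)
  finally show "fexp F (\<lambda>_. p) (\<lambda>\<eta>. 1 - (1 - q) ^ card (clus \<eta> v0)) \<le> tail p n v0 + real n * q" .
qed

text \<open>For \<open>p < pc\<close> the errors of repeated halving form a geometric series and the
  remaining term vanishes by \<open>theta_zero\<close>. The limit \<open>p \<rightarrow> pc\<close>
  is taken separately for each finite \<open>F\<close>.\<close>

lemma magn_sqrt:
  assumes infV: "infinite V" and nabla: "nabla V E pc v0 < \<infinity>"
  obtains C where "0 < C" "\<And>q. 0 < q \<Longrightarrow> q \<le> 1 \<Longrightarrow> magn pc q v0 \<le> sqrt (C * q)"
proof -
  note pcb = pc_bounds[OF infV] and pcpos = pc_pos[OF infV]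
  obtain C where C: "0 < C" "\<And>p q. pc / 2 \<le> p \<Longrightarrow> p \<le> pc \<Longrightarrow> 0 < q \<Longrightarrow> q \<le> 1/2 \<Longrightarrow>
    \<exists>F0\<in>fins. \<forall>F\<in>fins. F0 \<subseteq> F \<longrightarrow> magn p q v0 * ghost_susc p q F \<le> C"
    using magn_susc[OF infV nabla] by metis
  have sub: "(magn p q v0)\<^sup>2 \<le> 6 * C * q" if p: "pc / 2 \<le> p" "p < pc" and q: "0 < q" "q \<le> 1" for p q
  proof -
    have p01: "0 \<le> p" "p \<le> 1" using p pcpos pcb by auto
    have step: "(magn p (q / 2 ^ j) v0)\<^sup>2 \<le> (magn p (q / 2 ^ Suc j) v0)\<^sup>2 + 6 * C * (q / 2 ^ Suc j)" for j
    proof -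
      have q': "0 < q / 2 ^ Suc j" "q / 2 ^ Suc j \<le> 1/2"
      proof -
        have "q \<le> 2 ^ j" by (rule order_trans[OF q(2)]) simp
        then show "q / 2 ^ Suc j \<le> 1/2" using q by (simp add: field_simps)
      qed (use q in simp)
      obtain F0 where F0: "F0 \<in> fins" "\<forall>F\<in>fins. F0 \<subseteq> F \<longrightarrow> magn p (q / 2 ^ Suc j) v0 * ghost_susc p (q / 2 ^ Suc j) F \<le> C"
        using C(2)[of p "q / 2 ^ Suc j"] p q' by auto
      have "2 * (q / 2 ^ Suc j) = q / 2 ^ j" by simp
      then show ?thesis using magn_double[OF p01 q' _ F0] C(1) by simp
    qed
    have it: "(magn p q v0)\<^sup>2 \<le> (magn p (q / 2 ^ j) v0)\<^sup>2 + 6 * C * q * (1 - 1 / 2 ^ j)" for j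
    proof (induction j)
      case (Suc j)
      have "6 * C * q * (1 - 1 / 2 ^ j) + 6 * C * (q / 2 ^ Suc j) = 6 * C * q * (1 - 1 / 2 ^ Suc j)"
        by (simp add: field_simps)
      then show ?case using Suc step[of j] by linarith
    qed simp
    have n: "(magn p q v0)\<^sup>2 \<le> (tail p n v0)\<^sup>2 + 6 * C * q" for n
    proof (rule LIMSEQ_le_const)
      have "(\<lambda>j. q / 2 ^ j) \<longlonglongrightarrow> 0" using LIMSEQ_divide_realpow_zero[of 2 q] by simp
      then have "(\<lambda>j. (tail p n v0 + real n * (q / 2 ^ j))\<^sup>2 + 6 * C * q) \<longlonglongrightarrow> (tail p n v0 + real n * 0)\<^sup>2 + 6 * C * q"
        by (intro tendsto_intros)
      then show "(\<lambda>j. (tail p n v0 + real n * (q / 2 ^ j))\<^sup>2 + 6 * C * q) \<longlonglongrightarrow> (tail p n v0)\<^sup>2 + 6 * C * q" by simp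
      have "(magn p q v0)\<^sup>2 \<le> (tail p n v0 + real n * (q / 2 ^ j))\<^sup>2 + 6 * C * q" for j
      proof -
        have qj: "0 \<le> q / 2 ^ j" "q / 2 ^ j \<le> 1"
        proof -
          have "q \<le> 2 ^ j" by (rule order_trans[OF q(2)]) simp
          then show "q / 2 ^ j \<le> 1" using q by (simp add: divide_le_eq)
        qed (use q in simp)
        have "(magn p (q / 2 ^ j) v0)\<^sup>2 \<le> (tail p n v0 + real n * (q / 2 ^ j))\<^sup>2"
          by (intro power_mono magn_le_tail magn_bounds p01 qj)
        moreover have "6 * C * q * (1 - 1 / 2 ^ j) \<le> 6 * C * q * 1" using C(1) q by (intro mult_left_mono) auto
        ultimately show ?thesis using it[of j] by simp
      qed
      then show "\<exists>N. \<forall>j\<ge>N. (magn p q v0)\<^sup>2 \<le> (tail p n v0 + real n * (q / 2 ^ j))\<^sup>2 + 6 * C * q" by blast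
    qed
    show ?thesis
    proof (rule LIMSEQ_le_const)
      have "(\<lambda>n. (tail p n v0)\<^sup>2 + 6 * C * q) \<longlonglongrightarrow> 0\<^sup>2 + 6 * C * q"
        by (intro tendsto_intros theta_zero infV nabla p01 p)
      then show "(\<lambda>n. (tail p n v0)\<^sup>2 + 6 * C * q) \<longlonglongrightarrow> 6 * C * q" by simp
    qed (use n in blast)
  qed
  have "magn pc q v0 \<le> sqrt (6 * C * q)" if q: "0 < q" "q \<le> 1" for q
    unfolding magn_def
  proof (rule supf_le[OF pcb])
    fix F assume F: "F \<in> fins"
    let ?Y = "\<lambda>\<eta>. 1 - (1 - q) ^ card (clus \<eta> v0)"
    \<comment> \<open>A sequence in \<open>[pc / 2, pc)\<close> with limit
      \<open>pc\<close>.\<close>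
    let ?s = "\<lambda>n. pc - (pc / 2) * (1 / real (Suc n))"
    show "fexp F (\<lambda>_. pc) ?Y \<le> sqrt (6 * C * q)"
    proof (rule LIMSEQ_le_const2)
      have "(\<lambda>n. 1 / real (Suc n)) \<longlonglongrightarrow> 0" using LIMSEQ_inverse_real_of_nat by (simp add: inverse_eq_divide)
      then have "?s \<longlonglongrightarrow> pc - (pc / 2) * 0" by (intro tendsto_intros)
      then have s: "?s \<longlonglongrightarrow> pc" by simp
      have "continuous_on UNIV (\<lambda>p. fexp F (\<lambda>_. p) ?Y)" by (rule continuous_on_fexp)
      then show "(\<lambda>n. fexp F (\<lambda>_. ?s n) ?Y) \<longlonglongrightarrow> fexp F (\<lambda>_. pc) ?Y"
        by (rule continuous_on_tendsto_compose[OF _ s]) auto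
      have "fexp F (\<lambda>_. ?s n) ?Y \<le> sqrt (6 * C * q)" for n
      proof -
        have "1 / real (Suc n) \<le> 1" "0 < 1 / real (Suc n)" by auto
        then have sn: "pc / 2 \<le> ?s n" "?s n < pc"
          using pcpos mult_left_mono[of "1 / real (Suc n)" 1 "pc / 2"] by auto
        then have s01: "0 \<le> ?s n" "?s n \<le> 1" using pcpos pcb by linarith+
        have "fexp F (\<lambda>_. ?s n) ?Y \<le> magn (?s n) q v0" using q by (intro magn_upper s01 F) auto
        also have "\<dots> \<le> sqrt (6 * C * q)" by (intro real_le_rsqrt sub sn q)
        finally show ?thesis .
      qed
      then show "\<exists>N. \<forall>n\<ge>N. fexp F (\<lambda>_. ?s n) ?Y \<le> sqrt (6 * C * q)" by blast
    qed
  qed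
  then show ?thesis using that[of "6 * C"] C(1) by simp
qed

text \<open>With \<open>q = 1 / n\<close> a cluster of at least \<open>n\<close> vertices is green
  with probability at least \<open>1 - exp (-1)\<close>, hence at least 1/2.\<close>

lemma tail_le_magn:
  assumes p: "0 \<le> p" "p \<le> 1" and n: "1 \<le> n"
  shows "tail p n v0 \<le> 2 * magn p (1 / real n) v0"
  unfolding tail_def
proof (rule supf_le[OF p])
  fix F assume F: "F \<in> fins"
  let ?q = "1 / real n"
  have q: "0 \<le> ?q" "?q \<le> 1" using n by auto
  have "(1 - ?q) ^ n \<le> exp (- ?q) ^ n" using q exp_ge_add_one_self[of "- ?q"] by (intro power_mono) auto
  also have "\<dots> = exp (-1)" using n by (simp add: exp_of_nat_mult[symmetric])
  also have "\<dots> \<le> 1/2"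
    using exp_ge_add_one_self[of "1::real"] by (simp add: exp_minus field_simps)
  finally have half: "(1 - ?q) ^ n \<le> 1/2" .
  have "fexp F (\<lambda>_. p) (\<lambda>\<eta>. of_bool (n \<le> card (clus \<eta> v0))) \<le> fexp F (\<lambda>_. p) (\<lambda>\<eta>. 2 * (1 - (1 - ?q) ^ card (clus \<eta> v0)))"
  proof (intro fexp_mono probs_const p)
    fix \<eta>
    have "of_bool (n \<le> k) \<le> 2 * (1 - (1 - ?q) ^ k)" for k
    proof (cases "n \<le> k")
      case True
      then have "(1 - ?q) ^ k \<le> (1 - ?q) ^ n" using q by (intro power_decreasing) auto
      then show ?thesis using half True by simp
    qed (use q in \<open>auto intro: power_le_one\<close>)
    then show "of_bool (n \<le> card (clus \<eta> v0)) \<le> 2 * (1 - (1 - ?q) ^ card (clus \<eta> v0))" .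
  qed
  also have "\<dots> \<le> 2 * magn p ?q v0"
    unfolding fexp_cmult by (intro mult_left_mono magn_upper p q F) auto
  finally show "fexp F (\<lambda>_. p) (\<lambda>\<eta>. of_bool (n \<le> card (clus \<eta> v0))) \<le> 2 * magn p ?q v0" .
qed

lemma tail_upper_sqrt:
  assumes infV: "infinite V" and nabla: "nabla V E pc v0 < \<infinity>"
  obtains C where "1 \<le> C" "\<And>n x. 1 \<le> n \<Longrightarrow> x \<in> V \<Longrightarrow> tail pc n x \<le> C / sqrt (real n)"
proof -
  obtain C where C: "0 < C" "\<And>q. 0 < q \<Longrightarrow> q \<le> 1 \<Longrightarrow> magn pc q v0 \<le> sqrt (C * q)"
    using magn_sqrt[OF infV nabla] by metis
  show ?thesis
  proof (rule that[of "2 * sqrt C + 1"])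
    fix n :: nat and x assume n: "1 \<le> n" and x: "x \<in> V"
    have "tail pc n x = tail pc n v0" by (rule tail_eq[OF pc_bounds[OF infV] x])
    also have "\<dots> \<le> 2 * magn pc (1 / real n) v0" by (rule tail_le_magn[OF pc_bounds[OF infV] n])
    also have "\<dots> \<le> 2 * sqrt (C * (1 / real n))" using C(2)[of "1 / real n"] n by simp
    also have "\<dots> = 2 * sqrt C / sqrt (real n)" by (simp add: real_sqrt_divide)
    also have "\<dots> \<le> (2 * sqrt C + 1) / sqrt (real n)" by (intro divide_right_mono) auto
    finally show "tail pc n x \<le> (2 * sqrt C + 1) / sqrt (real n)" .
  qed (use C in simp)
qed

end

section \<open>The lower bound on the tail\<close>

lemma sum_inverse_sqrt: "(\<Sum>j=1..n. 1 / sqrt (real j)) \<le> 2 * sqrt (real n)"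
proof (induction n)
  case (Suc n)
  let ?a = "sqrt (real n)" and ?b = "sqrt (real (Suc n))"
  have ab: "0 \<le> ?a" "?a \<le> ?b" "0 < ?b" by auto
  have sq: "?b * ?b - ?a * ?a = 1" by simp
  have "1 / ?b \<le> 2 * (?b - ?a)"
  proof -
    have "1 = (?b - ?a) * (?b + ?a)" using sq by (simp add: algebra_simps)
    also have "\<dots> \<le> (?b - ?a) * (2 * ?b)" using ab by (intro mult_left_mono) auto
    finally show ?thesis using ab by (simp add: field_simps)
  qed
  then show ?case using Suc.IH by simp
qed simp

lemma clus_isolated: "v \<notin> \<Union>\<eta> \<Longrightarrow> clus \<eta> v = {v}"
proof (intro equalityI subsetI)
  fix u assume v: "v \<notin> \<Union>\<eta>" and "u \<in> clus \<eta> v"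
  then have "conn \<eta> v u" by (simp add: clus_def)
  then have "u = v"
  proof (induction rule: conn_induct)
    case (step y z)
    then show ?case using v by auto
  qed simp
  then show "u \<in> {v}" by simp
qed simp

lemma clus_insert_edge: "clus (insert {a, b} \<eta>) v \<subseteq> clus \<eta> v \<union> clus \<eta> a \<union> clus \<eta> b"
proof
  fix u assume "u \<in> clus (insert {a, b} \<eta>) v"
  then have "conn (insert {a, b} \<eta>) v u" by (simp add: clus_def)
  then show "u \<in> clus \<eta> v \<union> clus \<eta> a \<union> clus \<eta> b"
  proof (induction rule: conn_induct)
    case (step y z)
    show ?case
    proof (cases "{y, z} = {a, b}")
      case True
      then have "z = a \<or> z = b" by (auto simp: doubleton_eq_iff)
      then show ?thesis by auto
    next
      case False
      then have "conn \<eta> y z" using step(2) by (intro conn_edge) simp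
      then have "x \<in> {v, a, b} \<Longrightarrow> conn \<eta> x y \<Longrightarrow> conn \<eta> x z" for x by (metis conn_trans)
      then show ?thesis using step(3) by (auto simp: clus_def)
    qed
  qed simp
qed

context pgraph begin

context
  fixes Ct :: real
  assumes infV: "infinite V" and Ct: "1 \<le> Ct" "\<And>n x. 1 \<le> n \<Longrightarrow> x \<in> V \<Longrightarrow> tail pc n x \<le> Ct / sqrt (real n)"
begin

text \<open>A mean is a sum of tails, and each tail is at most \<open>Ct / sqrt j\<close>; so
  clusters smaller than \<open>n\<close> contribute only order \<open>sqrt n\<close>.\<close>

lemma trunc_mean:
  assumes F: "F \<in> fins" and x: "x \<in> V"
  shows "fexp F (\<lambda>_. pc) (\<lambda>\<eta>. real (card (clus \<eta> x)) * of_bool (card (clus \<eta> x) < n)) \<le> 2 * Ct * sqrt (real n)"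
proof -
  note pcb = pc_bounds[OF infV]
  have "fexp F (\<lambda>_. pc) (\<lambda>\<eta>. real (card (clus \<eta> x)) * of_bool (card (clus \<eta> x) < n))
      \<le> fexp F (\<lambda>_. pc) (\<lambda>\<eta>. \<Sum>j=1..n. of_bool (j \<le> card (clus \<eta> x)))"
  proof (intro fexp_mono probs_const pcb)
    fix \<eta>
    have "real k * of_bool (k < n) \<le> (\<Sum>j=1..n. of_bool (j \<le> k))" for k
    proof (cases "k < n")
      case True
      have "(\<Sum>j=1..n. of_bool (j \<le> k)) = (\<Sum>j\<in>{1..k}. 1 :: real)"
        using True by (intro sum.mono_neutral_cong_right) auto
      then show ?thesis using True by simp
    qed (auto intro: sum_nonneg)
    then show "real (card (clus \<eta> x)) * of_bool (card (clus \<eta> x) < n) \<le> (\<Sum>j=1..n. of_bool (j \<le> card (clus \<eta> x)))" .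
  qed
  also have "\<dots> = (\<Sum>j=1..n. fprob F (\<lambda>_. pc) (\<lambda>\<eta>. j \<le> card (clus \<eta> x)))"
    by (simp only: fexp_sum fprob_def)
  also have "\<dots> \<le> (\<Sum>j=1..n. Ct * (1 / sqrt (real j)))"
  proof (rule sum_mono)
    fix j assume "j \<in> {1..n}"
    then have "tail pc j x \<le> Ct / sqrt (real j)" using x by (intro Ct) auto
    then show "fprob F (\<lambda>_. pc) (\<lambda>\<eta>. j \<le> card (clus \<eta> x)) \<le> Ct * (1 / sqrt (real j))"
      using tail_upper[OF pcb F, of j x] by simp
  qed
  also have "\<dots> \<le> Ct * (2 * sqrt (real n))"
    unfolding sum_distrib_left[symmetric] using Ct(1) by (intro mult_left_mono sum_inverse_sqrt) auto
  finally show ?thesis by simp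
qed

definition susc where "susc F v = fexp F (\<lambda>_. pc) (\<lambda>\<eta>. real (card (clus \<eta> v)))"

text \<open>The maximum over the vertices replaces transitivity, which the finite subgraph lacks.\<close>
definition max_susc where "max_susc F = Max (susc F ` insert v0 (\<Union>F))"

lemma susc_ge_1: assumes "F \<in> fins" shows "1 \<le> susc F v"
proof -
  have "1 = fexp F (\<lambda>_. pc) (\<lambda>_. 1)" using assms by (simp add: fexp_const fins_def)
  also have "\<dots> \<le> susc F v" unfolding susc_def
  proof (intro fexp_mono probs_const pc_bounds infV)
    fix \<eta> assume "\<eta> \<subseteq> F"
    then have "finite (clus \<eta> v)" using assms fins_sub finite_clus by blast
    then have "1 \<le> card (clus \<eta> v)" using self_in_clus[of v \<eta>] by (metis One_nat_def Suc_leI card_gt_0_iff empty_iff)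
    then show "1 \<le> real (card (clus \<eta> v))" by simp
  qed
  finally show ?thesis .
qed

lemma susc_le_max: assumes F: "F \<in> fins" and v: "v \<in> V" shows "susc F v \<le> max_susc F"
proof (cases "v \<in> insert v0 (\<Union>F)")
  case True
  then show ?thesis unfolding max_susc_def using fins_finite_UN[OF F] by (intro Max_ge) auto
next
  case False
  have "susc F v = fexp F (\<lambda>_. pc) (\<lambda>_. 1)"
    unfolding susc_def by (intro fexp_cong, subst clus_isolated) (use False in auto)
  also have "\<dots> = 1" using F by (simp add: fexp_const fins_def)
  also have "1 \<le> susc F v0" by (rule susc_ge_1[OF F])
  also have "\<dots> \<le> max_susc F" unfolding max_susc_def using fins_finite_UN[OF F] by (intro Max_ge) auto
  finally show ?thesis .
qed

lemma max_susc_attained: assumes F: "F \<in> fins" shows "\<exists>v\<in>V. susc F v = max_susc F"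
proof -
  have "max_susc F \<in> susc F ` insert v0 (\<Union>F)"
    unfolding max_susc_def using fins_finite_UN[OF F] by (intro Max_in) auto
  then obtain v where "v \<in> insert v0 (\<Union>F)" "max_susc F = susc F v" by (rule imageE)
  then show ?thesis using fins_UN_V[OF F] v0 by (intro bexI[of _ v]) auto
qed

lemma max_susc_insert:
  assumes F: "insert e F \<in> fins" shows "max_susc (insert e F) \<le> 3 * max_susc F"
proof (cases "e \<in> F")
  case True
  have "F \<in> fins" using F by (rule fins_sub) auto
  then have "1 \<le> max_susc F" using susc_ge_1[of F v0] susc_le_max[OF _ v0] by force
  then show ?thesis using True by (simp add: insert_absorb)
next
  case False
  have F': "F \<in> fins" "finite F" using F by (auto simp: fins_def)
  have eE: "e \<in> E" using F by (simp add: fins_def)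
  obtain a b where ab: "e = {a, b}" using edge_card[OF eE] by (auto simp: card_2_iff)
  have abV: "a \<in> V" "b \<in> V" using edge_V eE ab by blast+
  note pcb = pc_bounds[OF infV]
  obtain v where v: "v \<in> V" "susc (insert e F) v = max_susc (insert e F)" using max_susc_attained[OF F] by blast
  let ?k = "\<lambda>\<eta> x. real (card (clus \<eta> x))"
  have pt: "?k (insert e \<eta>) v \<le> ?k \<eta> v + ?k \<eta> a + ?k \<eta> b" if "\<eta> \<subseteq> F" for \<eta>
  proof -
    have \<eta>: "\<eta> \<in> fins" using fins_sub[OF F'(1) that] .
    have "card (clus (insert e \<eta>) v) \<le> card (clus \<eta> v \<union> clus \<eta> a \<union> clus \<eta> b)"
      unfolding ab by (intro card_mono clus_insert_edge) (auto intro: finite_clus[OF \<eta>])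
    also have "\<dots> \<le> card (clus \<eta> v) + card (clus \<eta> a) + card (clus \<eta> b)"
      using card_Un_le[of "clus \<eta> v \<union> clus \<eta> a" "clus \<eta> b"] card_Un_le[of "clus \<eta> v" "clus \<eta> a"] by linarith
    finally show ?thesis by linarith
  qed
  have "susc (insert e F) v = pc * fexp F (\<lambda>_. pc) (\<lambda>\<eta>. ?k (insert e \<eta>) v) + (1 - pc) * fexp F (\<lambda>_. pc) (\<lambda>\<eta>. ?k \<eta> v)"
    unfolding susc_def using False F' by (intro fexp_insert) auto
  also have "\<dots> \<le> pc * fexp F (\<lambda>_. pc) (\<lambda>\<eta>. ?k \<eta> v + ?k \<eta> a + ?k \<eta> b) + (1 - pc) * fexp F (\<lambda>_. pc) (\<lambda>\<eta>. ?k \<eta> v + ?k \<eta> a + ?k \<eta> b)"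
    using pt pcb by (intro add_mono mult_left_mono fexp_mono probs_const) auto
  also have "\<dots> = susc F v + susc F a + susc F b" by (simp add: fexp_add susc_def algebra_simps)
  also have "\<dots> \<le> 3 * max_susc F" using susc_le_max[OF F'(1) v(1)] susc_le_max[OF F'(1) abV(1)] susc_le_max[OF F'(1) abV(2)] by linarith
  finally show ?thesis using v(2) by simp
qed

lemma max_susc_between:
  assumes t: "1 \<le> t"
  shows "\<exists>F\<in>fins. t \<le> max_susc F \<and> max_susc F \<le> 3 * t"
proof -
  obtain F where F: "F \<in> fins" "t < susc F v0" using susceptibility_unbounded[OF infV, of t] by (auto simp: susc_def)
  then have big: "t \<le> max_susc F" using susc_le_max[OF F(1) v0] by simp
  have "finite F" "F \<in> fins" using F by (auto simp: fins_def)
  then show ?thesis using big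
  proof (induction F rule: finite_induct)
    case empty
    have "max_susc {} = 1" unfolding max_susc_def susc_def by (simp add: clus_isolated)
    then show ?case using empty t by (intro bexI[of _ "{}"]) auto
  next
    case (insert e F)
    have "F \<in> fins" using insert.prems(1) by (rule fins_sub) auto
    show ?case
    proof (cases "t \<le> max_susc F")
      case False
      then have "max_susc (insert e F) \<le> 3 * t" using max_susc_insert[OF insert.prems(1)] by simp
      then show ?thesis using insert.prems by blast
    qed (use insert \<open>F \<in> fins\<close> in blast)
  qed
qed

lemma second_moment_le:
  assumes F: "F \<in> fins" and v: "v \<in> V"
  shows "fexp F (\<lambda>_. pc) (\<lambda>\<eta>. (real (card (clus \<eta> v)))\<^sup>2) \<le> max_susc F ^ 3"
proof -
  note pcb = pc_bounds[OF infV]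
  define X where "X = insert v (\<Union>F)"
  interpret finite_volume V E v0 F X "{}" pc "\<lambda>_. 0"
    using F v pcb fins_finite_UN[OF F] fins_UN_V[OF F] by unfold_locales (auto simp: X_def)
  have vX: "v \<in> X" by (simp add: X_def)
  have clusX: "clus \<eta> w \<subseteq> X" if "\<eta> \<subseteq> F" "w \<in> X" for \<eta> w using clus_subset[of \<eta> w] that by (auto simp: X_def)
  have Tsum: "(\<Sum>x\<in>X. fv.T w x) \<le> max_susc F" if w: "w \<in> X" for w
  proof -
    have "(\<Sum>x\<in>X. fv.T w x) = fexp F (\<lambda>_. pc) (\<lambda>\<eta>. \<Sum>x\<in>X. of_bool (conn \<eta> w x))"
      by (simp add: T_eq fprob_def fexp_sum)
    also have "\<dots> = susc F w"
      unfolding susc_def by (intro fexp_cong card_clus_eq_sum[symmetric] X(1) clusX w)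
    also have "\<dots> \<le> max_susc F" using w X(2) by (intro susc_le_max F) auto
    finally show ?thesis .
  qed
  have Ts0: "0 \<le> (\<Sum>x\<in>X. fv.T w x)" for w by (intro sum_nonneg fv.T_nonneg)
  have "fexp F (\<lambda>_. pc) (\<lambda>\<eta>. (real (card (clus \<eta> v)))\<^sup>2) = fexp F (\<lambda>_. pc) (\<lambda>\<eta>. \<Sum>x\<in>X. \<Sum>y\<in>X. of_bool (conn \<eta> v x \<and> conn \<eta> v y))"
  proof (rule fexp_cong)
    fix \<eta> assume "\<eta> \<subseteq> F"
    then have "(real (card (clus \<eta> v)))\<^sup>2 = (\<Sum>x\<in>X. of_bool (conn \<eta> v x)) * (\<Sum>y\<in>X. of_bool (conn \<eta> v y))"
      using card_clus_eq_sum[OF X(1) clusX[OF _ vX]] by (simp add: power2_eq_square)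
    then show "(real (card (clus \<eta> v)))\<^sup>2 = (\<Sum>x\<in>X. \<Sum>y\<in>X. of_bool (conn \<eta> v x \<and> conn \<eta> v y))"
      by (simp only: sum_product of_bool_conj)
  qed
  also have "\<dots> = (\<Sum>x\<in>X. \<Sum>y\<in>X. fexp F (\<lambda>_. pc) (\<lambda>\<eta>. of_bool (conn \<eta> v x \<and> conn \<eta> v y)))"
    by (simp only: fexp_sum)
  also have "\<dots> = (\<Sum>x\<in>X. \<Sum>y\<in>X. fv.P (\<lambda>\<omega>. cn v x \<omega> \<and> cn v y \<omega> \<and> True))"
    unfolding fprob_def cn_def edge_event[symmetric] by simp
  also have "\<dots> \<le> (\<Sum>x\<in>X. \<Sum>y\<in>X. \<Sum>w\<in>X. fv.P (\<lambda>\<omega>. cn v w \<omega> \<and> True) * fv.T w x * fv.T w y)"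
    by (intro sum_mono fv.tree_dec vX) (simp add: dec_def)
  also have "\<dots> = (\<Sum>x\<in>X. \<Sum>w\<in>X. \<Sum>y\<in>X. fv.T v w * fv.T w x * fv.T w y)"
    unfolding fv.T_def[of v] by (rule sum.cong[OF refl], subst sum.swap) simp
  also have "\<dots> = (\<Sum>w\<in>X. \<Sum>x\<in>X. \<Sum>y\<in>X. fv.T v w * fv.T w x * fv.T w y)"
    by (rule sum.swap)
  also have "\<dots> = (\<Sum>w\<in>X. fv.T v w * ((\<Sum>x\<in>X. fv.T w x) * (\<Sum>y\<in>X. fv.T w y)))"
    by (simp only: sum_distrib_left[symmetric] sum_distrib_right[symmetric] mult.assoc)
  also have "\<dots> \<le> (\<Sum>w\<in>X. fv.T v w * (max_susc F * max_susc F))"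
    by (intro sum_mono mult_left_mono mult_mono Tsum Ts0 fv.T_nonneg order_trans[OF Ts0 Tsum])
  also have "\<dots> = (\<Sum>w\<in>X. fv.T v w) * (max_susc F * max_susc F)" by (simp add: sum_distrib_right)
  also have "\<dots> \<le> max_susc F * (max_susc F * max_susc F)"
    by (intro mult_right_mono Tsum vX) simp
  finally show ?thesis by (simp add: power3_eq_cube mult.assoc)
qed

lemma tail_lower:
  assumes n: "1 \<le> n" and x: "x \<in> V"
  shows "1 / (48 * Ct) / sqrt (real n) \<le> tail pc n x"
proof -
  note pcb = pc_bounds[OF infV]
  \<comment> \<open>By \<open>trunc_mean\<close>, clusters smaller than \<open>n\<close> contribute
    at most \<open>t / 2\<close> to the mean size, so at least half of \<open>m\<close> comes from
    larger ones.\<close>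
  define t where "t = 4 * Ct * sqrt (real n)"
  have sn: "1 \<le> sqrt (real n)" using n by simp
  have t1: "1 \<le> t" using mult_mono[of 1 Ct 1 "sqrt (real n)"] sn Ct(1) by (simp add: t_def)
  obtain F where F: "F \<in> fins" "t \<le> max_susc F" "max_susc F \<le> 3 * t" using max_susc_between[OF t1] by blast
  obtain v where v: "v \<in> V" "susc F v = max_susc F" using max_susc_attained[OF F(1)] by blast
  define m where "m = max_susc F"
  have m: "0 < m" using F(2) t1 by (simp add: m_def)
  let ?k = "\<lambda>\<eta>. real (card (clus \<eta> v))"
  \<comment> \<open>This weight in \<open>k \<le> s / 2 * k^2 + 1 / (2 * s)\<close> turns the second
    moment bound \<open>m ^ 3\<close> into \<open>m / 4\<close>.\<close>
  define s where "s = 1 / (2 * m\<^sup>2)"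
  have l: "0 < s" using m by (simp add: s_def)
  have "m = fexp F (\<lambda>_. pc) ?k" using v(2) by (simp add: m_def susc_def)
  also have "\<dots> \<le> fexp F (\<lambda>_. pc) (\<lambda>\<eta>. ?k \<eta> * of_bool (card (clus \<eta> v) < n) + (s / 2 * (?k \<eta>)\<^sup>2 + 1 / (2 * s) * of_bool (n \<le> card (clus \<eta> v))))"
  proof (intro fexp_mono probs_const pcb)
    fix \<eta>
    show "?k \<eta> \<le> ?k \<eta> * of_bool (card (clus \<eta> v) < n) + (s / 2 * (?k \<eta>)\<^sup>2 + 1 / (2 * s) * of_bool (n \<le> card (clus \<eta> v)))"
    proof (cases "card (clus \<eta> v) < n")
      case False
      have "0 \<le> (s * ?k \<eta> - 1)\<^sup>2" by simp
      then have "2 * s * ?k \<eta> \<le> s\<^sup>2 * (?k \<eta>)\<^sup>2 + 1" by (simp add: power2_eq_square algebra_simps)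
      then have "?k \<eta> \<le> (s\<^sup>2 * (?k \<eta>)\<^sup>2 + 1) / (2 * s)" using l by (simp add: field_simps)
      also have "\<dots> = s / 2 * (?k \<eta>)\<^sup>2 + 1 / (2 * s)" using l by (simp add: field_simps power2_eq_square)
      finally show ?thesis using False by simp
    qed (use l in simp)
  qed
  also have "\<dots> = fexp F (\<lambda>_. pc) (\<lambda>\<eta>. ?k \<eta> * of_bool (card (clus \<eta> v) < n))
      + (s / 2 * fexp F (\<lambda>_. pc) (\<lambda>\<eta>. (?k \<eta>)\<^sup>2) + 1 / (2 * s) * fprob F (\<lambda>_. pc) (\<lambda>\<eta>. n \<le> card (clus \<eta> v)))"
    by (simp only: fexp_add fexp_cmult fprob_def)
  also have "\<dots> \<le> 2 * Ct * sqrt (real n) + (s / 2 * m ^ 3 + 1 / (2 * s) * tail pc n v)"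
    unfolding m_def using l
    by (intro add_mono mult_left_mono trunc_mean second_moment_le tail_upper F v pcb) auto
  also have "2 * Ct * sqrt (real n) \<le> m / 2" using F(2) by (simp add: t_def m_def)
  also have "s / 2 * m ^ 3 = m / 4" using m by (simp add: s_def power3_eq_cube power2_eq_square field_simps)
  also have "1 / (2 * s) = m\<^sup>2" using m by (simp add: s_def)
  finally have "m / 4 \<le> m\<^sup>2 * tail pc n v" by simp
  then have "1 / (4 * m) \<le> tail pc n v" using m by (simp add: field_simps power2_eq_square)
  \<comment> \<open>From \<open>m \<le> 3 * t\<close> and \<open>t = 4 * Ct * sqrt n\<close> comes
    the constant 48.\<close>
  moreover have "1 / (12 * t) \<le> 1 / (4 * m)" using F(3) m t1 by (intro divide_left_mono) (auto simp: m_def)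
  moreover have "1 / (48 * Ct) / sqrt (real n) = 1 / (12 * t)" by (simp add: t_def)
  moreover have "tail pc n v = tail pc n x" using tail_eq[OF pcb v(1)] tail_eq[OF pcb x] by simp
  ultimately show ?thesis by linarith
qed

text \<open>With \<open>n\<close> the ceiling of \<open>1 / q\<close>, a cluster of \<open>n\<close>
  vertices is green with probability at least 1/2. The constant 192 is 48 times 2 for this half and
  2 for \<open>sqrt n \<le> 2 / sqrt q\<close>.\<close>

lemma magn_lower:
  assumes q: "0 < q" "q \<le> 1"
  shows "1 / (192 * Ct) * sqrt q \<le> magn pc q v0"
proof -
  note pcb = pc_bounds[OF infV]
  define n where "n = nat \<lceil>1 / q\<rceil>"
  have n: "1 / q \<le> real n" "real n < 1 / q + 1" "1 \<le> n"
  proof -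
    have "1 \<le> 1 / q" using q by simp
    then show "1 / q \<le> real n" "real n < 1 / q + 1" "1 \<le> n" unfolding n_def by linarith+
  qed
  have "(1 - q) ^ n \<le> exp (- q) ^ n" using q exp_ge_add_one_self[of "- q"] by (intro power_mono) auto
  also have "\<dots> = exp (- (real n * q))" by (simp add: exp_of_nat_mult[symmetric])
  also have "\<dots> \<le> exp (-1)" using n(1) q by (simp add: field_simps)
  also have "\<dots> \<le> 1/2"
    using exp_ge_add_one_self[of "1::real"] by (simp add: exp_minus field_simps)
  finally have half: "(1 - q) ^ n \<le> 1/2" .
  have "tail pc n v0 \<le> 2 * magn pc q v0"
    unfolding tail_def
  proof (rule supf_le[OF pcb])
    fix F assume F: "F \<in> fins"
    have "fexp F (\<lambda>_. pc) (\<lambda>\<eta>. of_bool (n \<le> card (clus \<eta> v0))) \<le> fexp F (\<lambda>_. pc) (\<lambda>\<eta>. 2 * (1 - (1 - q) ^ card (clus \<eta> v0)))"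
    proof (intro fexp_mono probs_const pcb)
      fix \<eta>
      have "of_bool (n \<le> k) \<le> 2 * (1 - (1 - q) ^ k)" for k
      proof (cases "n \<le> k")
        case True
        then have "(1 - q) ^ k \<le> (1 - q) ^ n" using q by (intro power_decreasing) auto
        then show ?thesis using half True by simp
      qed (use q in \<open>auto intro: power_le_one\<close>)
      then show "of_bool (n \<le> card (clus \<eta> v0)) \<le> 2 * (1 - (1 - q) ^ card (clus \<eta> v0))" .
    qed
    also have "\<dots> \<le> 2 * magn pc q v0"
      unfolding fexp_cmult using q by (intro mult_left_mono magn_upper pcb F) auto
    finally show "fexp F (\<lambda>_. pc) (\<lambda>\<eta>. of_bool (n \<le> card (clus \<eta> v0))) \<le> 2 * magn pc q v0" .
  qed
  moreover have "1 / (48 * Ct) / sqrt (real n) \<le> tail pc n v0" by (rule tail_lower[OF n(3) v0])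
  moreover have "1 / (48 * Ct) * (sqrt q / 2) \<le> 1 / (48 * Ct) / sqrt (real n)"
  proof -
    have "real n \<le> 4 / q"
    proof -
      have "1 \<le> 1 / q" using q by simp
      then show ?thesis using n(2) by simp
    qed
    then have "sqrt (real n) \<le> sqrt (4 / q)" by (rule real_sqrt_le_mono)
    also have "\<dots> = 2 / sqrt q" by (simp add: real_sqrt_divide)
    finally have "sqrt q / 2 \<le> 1 / sqrt (real n)" using n(3) q by (simp add: field_simps)
    then have "1 / (48 * Ct) * (sqrt q / 2) \<le> 1 / (48 * Ct) * (1 / sqrt (real n))"
      using Ct(1) by (intro mult_left_mono) auto
    then show ?thesis by simp
  qed
  ultimately show ?thesis by simp
qed

end

end

section \<open>Several disjoint clusters\<close>

definition disjoint_large :: "(nat \<Rightarrow> 'a) \<Rightarrow> (nat \<Rightarrow> nat) \<Rightarrow> nat \<Rightarrow> 'a set set \<Rightarrow> bool" where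
  "disjoint_large vv nn l \<eta> \<longleftrightarrow> disjoint_family_on (\<lambda>i. clus \<eta> (vv i)) {1..l} \<and> (\<forall>i\<in>{1..l}. nn i \<le> card (clus \<eta> (vv i)))"

context finite_volume begin

text \<open>Large clusters are first replaced by clusters meeting a colour. A path to a coloured
  vertex can be cut at an intermediate point and BK applied to both pieces; the size of a cluster
  has no such path as witness.\<close>

definition disjoint_hit :: "(nat \<Rightarrow> 'a) \<Rightarrow> nat \<Rightarrow> 'a coord set \<Rightarrow> bool" where
  "disjoint_hit vv k \<omega> \<longleftrightarrow> (\<forall>i\<in>{1..k}. hit i (vv i) \<omega>) \<and> disjoint_family_on (\<lambda>i. clus (eds \<omega>) (vv i)) {1..k}"

text \<open>The connection to \<open>a\<close> takes place inside the cluster of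
  \<open>vv j\<close>, so it is charged to that factor alone, where the tree bound applies with
  branch point \<open>w\<close>.\<close>

lemma disjoint_hit_conn:
  assumes j: "j \<in> {1..k}" and vX: "vv j \<in> X"
  shows "fv.P (\<lambda>\<omega>. disjoint_hit vv k \<omega> \<and> cn (vv j) a \<omega>)
    \<le> (\<Sum>w\<in>X. fv.T (vv j) w * fv.T w a * fv.M j w) * (\<Prod>i\<in>{1..k}-{j}. fv.M i (vv i))"
proof -
  define W where "W = (\<lambda>i. if i = j then (\<lambda>\<omega>. cn (vv j) a \<omega> \<and> hit j (vv j) \<omega>) else hit i (vv i))"
  have incW: "inc (W i)" for i
  proof (cases "i = j")
    case True
    have "inc (\<lambda>\<omega>. cn (vv j) a \<omega> \<and> hit j (vv j) \<omega>)"
      using inc_cn[of "vv j" a] inc_hit[of j "vv j"] unfolding inc_def by blast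
    then show ?thesis using True by (simp add: W_def)
  qed (simp add: W_def inc_hit)
  have "fv.P (\<lambda>\<omega>. disjoint_hit vv k \<omega> \<and> cn (vv j) a \<omega>) \<le> fv.P (disj_occ W {1..k})"
  proof (intro fprob_mono fv.pr)
    fix \<omega> assume *: "disjoint_hit vv k \<omega> \<and> cn (vv j) a \<omega>"
    show "disj_occ W {1..k} \<omega>"
    proof (rule disj_occ_clusters)
      show "disjoint_family_on (\<lambda>i. clus (eds \<omega>) (vv i)) {1..k}" using * by (simp add: disjoint_hit_def)
      show "W i (res (clus (eds \<omega>) (vv i)) \<omega>)" if "i \<in> {1..k}" for i
        using * that by (auto simp: W_def disjoint_hit_def hit_res cn_iff clus_res)
    qed
  qed
  also have "\<dots> \<le> (\<Prod>i\<in>{1..k}. fv.P (W i))" by (intro bk_family fv.fin fv.pr incW) auto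
  also have "\<dots> = fv.P (W j) * (\<Prod>i\<in>{1..k}-{j}. fv.P (W i))" using j by (intro prod.remove) auto
  also have "(\<Prod>i\<in>{1..k}-{j}. fv.P (W i)) = (\<Prod>i\<in>{1..k}-{j}. fv.M i (vv i))"
    by (intro prod.cong) (auto simp: W_def fv.M_def)
  also have "fv.P (W j) = fv.P (\<lambda>\<omega>. cn (vv j) a \<omega> \<and> hit j (vv j) \<omega>)" by (simp add: W_def)
  also have "\<dots> * (\<Prod>i\<in>{1..k}-{j}. fv.M i (vv i)) \<le> (\<Sum>w\<in>X. fv.T (vv j) w * fv.T w a * fv.M j w) * (\<Prod>i\<in>{1..k}-{j}. fv.M i (vv i))"
    by (intro mult_right_mono fv.tree_hit vX prod_nonneg) (auto simp: fv.M_nonneg)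
  finally show ?thesis .
qed

text \<open>The first \<open>k\<close> clusters are explored. What the next point loses by avoiding
  them passes through a vertex \<open>a\<close> of some \<open>j\<close>-th cluster. The path from
  \<open>vv j\<close> to the branch point \<open>w\<close>, the one from \<open>w\<close> to
  \<open>a\<close>, and the one from \<open>a\<close> to the new point are the three sides of an
  open triangle.\<close>

lemma disjoint_hit_step:
  assumes vX: "\<And>i. i \<in> {1..Suc k} \<Longrightarrow> vv i \<in> X"
    and Mb: "\<And>i s. i \<in> {1..Suc k} \<Longrightarrow> s \<in> X \<Longrightarrow> fv.M i s \<le> Mb i"
    and \<epsilon>: "\<And>j. j \<in> {1..k} \<Longrightarrow> (\<Sum>x\<in>X. \<Sum>y\<in>X. tau p (vv j) x * tau p x y * tau p y (vv (Suc k))) \<le> \<epsilon>"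
  shows "fv.P (disjoint_hit vv (Suc k)) \<ge> fv.M (Suc k) (vv (Suc k)) * fv.P (disjoint_hit vv k) - real k * \<epsilon> * (\<Prod>i\<in>{1..Suc k}. Mb i)"
proof -
  let ?v = "vv (Suc k)" and ?m = "Suc k"
  let ?S = "\<lambda>\<omega>. \<Union>i\<in>{1..k}. clus (eds \<omega>) (vv i)"
  let ?R = "\<lambda>A \<omega>. ?v \<notin> A \<and> hit ?m ?v (\<omega> - tch A)"
  have bound_nonneg: "0 \<le> Mb i" if "i \<in> {1..Suc k}" for i
    using Mb[OF that vX[OF that]] fv.M_nonneg[of i "vv i"] by simp
  have loc: "disjoint_hit vv k \<omega>' \<and> ?S \<omega>' = ?S \<omega>" if D: "disjoint_hit vv k \<omega>" and a: "\<omega> \<inter> tch (?S \<omega>) = \<omega>' \<inter> tch (?S \<omega>)" for \<omega> \<omega>'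
  proof -
    have c: "clus (eds \<omega>') (vv i) = clus (eds \<omega>) (vv i)" "hit i (vv i) \<omega>' = hit i (vv i) \<omega>" if "i \<in> {1..k}" for i
    proof -
      have "clus (eds \<omega>) (vv i) \<subseteq> ?S \<omega>" using that by blast
      then show "clus (eds \<omega>') (vv i) = clus (eds \<omega>) (vv i)" "hit i (vv i) \<omega>' = hit i (vv i) \<omega>"
        using clus_tch[OF a] by auto
    qed
    then have "?S \<omega>' = ?S \<omega>" by simp
    moreover have "disjoint_hit vv k \<omega>'"
      using D c unfolding disjoint_hit_def disjoint_family_on_def by simp
    ultimately show ?thesis by blast
  qed
  have SX: "?S \<omega> \<subseteq> X" if "\<omega> \<subseteq> Om" for \<omega>
    using fv.clus_in_X[OF that] vX by fastforce
  have "fv.M ?m ?v * fv.P (disjoint_hit vv k) - fv.EE (\<lambda>\<omega>. of_bool (disjoint_hit vv k \<omega>) * (\<Sum>a\<in>X. of_bool (a \<in> ?S \<omega>) * (fv.T ?v a * Mb ?m)))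
      = fv.EE (\<lambda>\<omega>. of_bool (disjoint_hit vv k \<omega>) * (fv.M ?m ?v - (\<Sum>a\<in>X. of_bool (a \<in> ?S \<omega>) * (fv.T ?v a * Mb ?m))))"
    by (simp add: fprob_def fexp_cmult2 right_diff_distrib fexp_diff mult.commute)
  also have "\<dots> \<le> fv.EE (\<lambda>\<omega>. of_bool (disjoint_hit vv k \<omega>) * fv.P (?R (?S \<omega>)))"
  proof (intro fexp_mono fv.pr mult_left_mono)
    fix \<omega> assume \<omega>: "\<omega> \<subseteq> Om"
    have fS: "finite (?S \<omega>)" using SX[OF \<omega>] X(1) finite_subset by blast
    have "fv.M ?m ?v \<le> fv.P (?R (?S \<omega>)) + (\<Sum>a\<in>?S \<omega>. fv.T ?v a * fv.M ?m a)"
      by (rule fv.hit_through_bound[OF fS])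
    also have "(\<Sum>a\<in>?S \<omega>. fv.T ?v a * fv.M ?m a) \<le> (\<Sum>a\<in>?S \<omega>. fv.T ?v a * Mb ?m)"
      using SX[OF \<omega>] by (intro sum_mono mult_left_mono Mb fv.T_nonneg) auto
    also have "\<dots> = (\<Sum>a\<in>X. of_bool (a \<in> ?S \<omega>) * (fv.T ?v a * Mb ?m))"
      using SX[OF \<omega>] X(1) by (intro sum.mono_neutral_cong_left) auto
    finally show "fv.M ?m ?v - (\<Sum>a\<in>X. of_bool (a \<in> ?S \<omega>) * (fv.T ?v a * Mb ?m)) \<le> fv.P (?R (?S \<omega>))" by simp
  qed simp
  also have "\<dots> = fv.P (\<lambda>\<omega>. disjoint_hit vv k \<omega> \<and> ?R (?S \<omega>) \<omega>)"
  proof (rule fv.explore_prob[symmetric, of "disjoint_hit vv k" ?S ?R])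
    fix \<omega> \<omega>' assume "disjoint_hit vv k \<omega>" "\<omega> \<inter> tch (?S \<omega>) = \<omega>' \<inter> tch (?S \<omega>)"
    then show "disjoint_hit vv k \<omega>' \<and> ?S \<omega>' = ?S \<omega>" by (rule loc)
  qed simp
  also have "\<dots> \<le> fv.P (disjoint_hit vv (Suc k))"
  proof (intro fprob_mono fv.pr)
    fix \<omega> assume *: "disjoint_hit vv k \<omega> \<and> ?R (?S \<omega>) \<omega>"
    have h: "hit ?m ?v \<omega>" using * inc_diff[OF inc_hit] by metis
    have dj: "clus (eds \<omega>) (vv i) \<inter> clus (eds \<omega>) ?v = {}" if "i \<in> {1..k}" for i
      using * that clus_disjoint_iff[of "eds \<omega>" "vv i" ?v] by blast
    have set: "{1..Suc k} = insert ?m {1..k}" by auto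
    show "disjoint_hit vv (Suc k) \<omega>"
      unfolding disjoint_hit_def set
    proof
      show "\<forall>i\<in>insert ?m {1..k}. hit i (vv i) \<omega>" using h * by (auto simp: disjoint_hit_def)
      show "disjoint_family_on (\<lambda>i. clus (eds \<omega>) (vv i)) (insert ?m {1..k})"
      proof -
        have nm: "?m \<notin> {1..k}" by simp
        have "clus (eds \<omega>) ?v \<inter> (\<Union>i\<in>{1..k}. clus (eds \<omega>) (vv i)) = {}" using dj by blast
        then show ?thesis using * disjoint_family_on_insert[OF nm] unfolding disjoint_hit_def by blast
      qed
    qed
  qed
  finally have main: "fv.M ?m ?v * fv.P (disjoint_hit vv k) - fv.EE (\<lambda>\<omega>. of_bool (disjoint_hit vv k \<omega>) * (\<Sum>a\<in>X. of_bool (a \<in> ?S \<omega>) * (fv.T ?v a * Mb ?m)))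
      \<le> fv.P (disjoint_hit vv (Suc k))" .
  have "fv.EE (\<lambda>\<omega>. of_bool (disjoint_hit vv k \<omega>) * (\<Sum>a\<in>X. of_bool (a \<in> ?S \<omega>) * (fv.T ?v a * Mb ?m)))
      = (\<Sum>a\<in>X. fv.P (\<lambda>\<omega>. disjoint_hit vv k \<omega> \<and> a \<in> ?S \<omega>) * (fv.T ?v a * Mb ?m))"
    by (simp add: fprob_def sum_distrib_left fexp_sum mult.assoc[symmetric] fexp_cmult2 of_bool_conj)
  also have "\<dots> \<le> (\<Sum>a\<in>X. (\<Sum>j\<in>{1..k}. fv.P (\<lambda>\<omega>. disjoint_hit vv k \<omega> \<and> cn (vv j) a \<omega>)) * (fv.T ?v a * Mb ?m))"
  proof (intro sum_mono mult_right_mono mult_nonneg_nonneg fv.T_nonneg bound_nonneg)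
    fix a
    show "fv.P (\<lambda>\<omega>. disjoint_hit vv k \<omega> \<and> a \<in> ?S \<omega>) \<le> (\<Sum>j\<in>{1..k}. fv.P (\<lambda>\<omega>. disjoint_hit vv k \<omega> \<and> cn (vv j) a \<omega>))"
      by (intro fprob_union_bound fv.pr) (auto simp: cn_iff)
  qed auto
  also have "\<dots> \<le> (\<Sum>a\<in>X. (\<Sum>j\<in>{1..k}. (\<Sum>w\<in>X. tau p (vv j) w * tau p w a) * (\<Prod>i\<in>{1..k}. Mb i)) * (tau p a ?v * Mb ?m))"
  proof (intro sum_mono mult_mono)
    fix a j assume aj: "a \<in> X" "j \<in> {1..k}"
    have "fv.P (\<lambda>\<omega>. disjoint_hit vv k \<omega> \<and> cn (vv j) a \<omega>) \<le> (\<Sum>w\<in>X. fv.T (vv j) w * fv.T w a * fv.M j w) * (\<Prod>i\<in>{1..k}-{j}. fv.M i (vv i))"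
      using aj vX by (intro disjoint_hit_conn) auto
    also have "\<dots> \<le> (\<Sum>w\<in>X. tau p (vv j) w * tau p w a * Mb j) * (\<Prod>i\<in>{1..k}-{j}. Mb i)"
    proof (rule mult_mono)
      show "(\<Sum>w\<in>X. fv.T (vv j) w * fv.T w a * fv.M j w) \<le> (\<Sum>w\<in>X. tau p (vv j) w * tau p w a * Mb j)"
        using aj by (intro sum_mono mult_mono T_le_tau Mb mult_nonneg_nonneg fv.T_nonneg fv.M_nonneg tau_bounds p) auto
      show "(\<Prod>i\<in>{1..k}-{j}. fv.M i (vv i)) \<le> (\<Prod>i\<in>{1..k}-{j}. Mb i)"
        using vX by (intro prod_mono conjI fv.M_nonneg Mb) auto
      show "0 \<le> (\<Sum>w\<in>X. tau p (vv j) w * tau p w a * Mb j)"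
        using aj by (intro sum_nonneg mult_nonneg_nonneg tau_bounds p bound_nonneg) auto
      show "0 \<le> (\<Prod>i\<in>{1..k}-{j}. fv.M i (vv i))" by (intro prod_nonneg) (auto simp: fv.M_nonneg)
    qed
    also have "\<dots> = (\<Sum>w\<in>X. tau p (vv j) w * tau p w a) * (Mb j * (\<Prod>i\<in>{1..k}-{j}. Mb i))"
      by (simp add: sum_distrib_right mult.assoc)
    also have "Mb j * (\<Prod>i\<in>{1..k}-{j}. Mb i) = (\<Prod>i\<in>{1..k}. Mb i)"
      using aj by (intro prod.remove[symmetric]) auto
    finally show "fv.P (\<lambda>\<omega>. disjoint_hit vv k \<omega> \<and> cn (vv j) a \<omega>) \<le> (\<Sum>w\<in>X. tau p (vv j) w * tau p w a) * (\<Prod>i\<in>{1..k}. Mb i)" .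
  next
    fix a show "fv.T ?v a \<le> tau p a ?v" using T_le_tau[of ?v a] tau_sym[OF p, of a ?v] by simp
  qed (auto intro!: sum_nonneg mult_nonneg_nonneg prod_nonneg tau_bounds p bound_nonneg fv.T_nonneg)
  also have "\<dots> = (\<Sum>a\<in>X. \<Sum>j\<in>{1..k}. (\<Sum>w\<in>X. tau p (vv j) w * tau p w a * tau p a ?v) * (\<Prod>i\<in>{1..Suc k}. Mb i))"
    unfolding sum_distrib_right[of _ "{1..k}"] sum_distrib_right[of _ X, symmetric]
    by (intro sum.cong refl) (simp add: mult_ac)
  also have "\<dots> = (\<Sum>j\<in>{1..k}. (\<Sum>a\<in>X. \<Sum>w\<in>X. tau p (vv j) w * tau p w a * tau p a ?v) * (\<Prod>i\<in>{1..Suc k}. Mb i))"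
    by (subst sum.swap) (simp only: sum_distrib_right)
  also have "\<dots> \<le> (\<Sum>j\<in>{1..k}. \<epsilon> * (\<Prod>i\<in>{1..Suc k}. Mb i))"
  proof (intro sum_mono mult_right_mono)
    fix j assume "j \<in> {1..k}"
    then have "(\<Sum>w\<in>X. \<Sum>a\<in>X. tau p (vv j) w * tau p w a * tau p a ?v) \<le> \<epsilon>" by (rule \<epsilon>)
    then show "(\<Sum>a\<in>X. \<Sum>w\<in>X. tau p (vv j) w * tau p w a * tau p a ?v) \<le> \<epsilon>" by (subst sum.swap)
    show "0 \<le> (\<Prod>i\<in>{1..Suc k}. Mb i)" by (intro prod_nonneg) (use bound_nonneg in auto)
  qed
  also have "\<dots> = real k * \<epsilon> * (\<Prod>i\<in>{1..Suc k}. Mb i)" by simp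
  finally show ?thesis using main by linarith
qed

text \<open>Each cluster contributes a factor \<open>\<kappa>\<close> and an additive loss of at
  most \<open>k * \<epsilon>\<close> relative to the product of the \<open>Mb\<close>. The loss is
  rounded up to \<open>l * \<epsilon>\<close>, and earlier losses do not grow since
  \<open>\<kappa> \<le> 1\<close>, so losses add up linearly.\<close>

lemma disjoint_hit_lower:
  assumes vX: "\<And>i. i \<in> {1..l} \<Longrightarrow> vv i \<in> X"
    and Mb: "\<And>i s. i \<in> {1..l} \<Longrightarrow> s \<in> X \<Longrightarrow> fv.M i s \<le> Mb i"
    and \<kappa>: "0 \<le> \<kappa>" "\<kappa> \<le> 1" "\<And>i. i \<in> {1..l} \<Longrightarrow> \<kappa> * Mb i \<le> fv.M i (vv i)"
    and \<epsilon>: "0 \<le> \<epsilon>" "\<And>i j. i \<in> {1..l} \<Longrightarrow> j \<in> {1..l} \<Longrightarrow> i < j \<Longrightarrow> (\<Sum>x\<in>X. \<Sum>y\<in>X. tau p (vv i) x * tau p x y * tau p y (vv j)) \<le> \<epsilon>"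
    and k: "k \<le> l"
  shows "(\<kappa> ^ k - real k * real l * \<epsilon>) * (\<Prod>i\<in>{1..k}. Mb i) \<le> fv.P (disjoint_hit vv k)"
  using k
proof (induction k)
  case 0
  have "fv.P (disjoint_hit vv 0) = fv.P (\<lambda>_. True)" by (intro fprob_cong) (simp add: disjoint_hit_def disjoint_family_on_def)
  then show ?case by (simp add: fprob_True fv.fin)
next
  case (Suc k)
  let ?\<Pi> = "\<Prod>i\<in>{1..k}. Mb i"
  have bound_nonneg: "0 \<le> Mb i" if "i \<in> {1..l}" for i
    using Mb[OF that vX[OF that]] fv.M_nonneg[of i "vv i"] by simp
  have \<Pi>0: "0 \<le> ?\<Pi>" using Suc.prems by (intro prod_nonneg) (auto intro: bound_nonneg)
  have m: "0 \<le> Mb (Suc k)" "Suc k \<in> {1..l}" using Suc.prems bound_nonneg[of "Suc k"] by auto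
  have IH: "(\<kappa> ^ k - real k * real l * \<epsilon>) * ?\<Pi> \<le> fv.P (disjoint_hit vv k)" using Suc by simp
  have ps: "(\<Prod>i\<in>{1..Suc k}. Mb i) = ?\<Pi> * Mb (Suc k)" by simp
  have PD: "0 \<le> fv.P (disjoint_hit vv k)" by (intro fprob_nonneg fv.pr)
  have st: "fv.P (disjoint_hit vv (Suc k)) \<ge> fv.M (Suc k) (vv (Suc k)) * fv.P (disjoint_hit vv k) - real k * \<epsilon> * (\<Prod>i\<in>{1..Suc k}. Mb i)"
    by (rule disjoint_hit_step) (use Suc.prems vX Mb \<epsilon>(2) in auto)
  have "\<kappa> * Mb (Suc k) * ((\<kappa> ^ k - real k * real l * \<epsilon>) * ?\<Pi>) \<le> \<kappa> * Mb (Suc k) * fv.P (disjoint_hit vv k)"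
    using IH \<kappa>(1) m by (intro mult_left_mono) auto
  also have "\<dots> \<le> fv.M (Suc k) (vv (Suc k)) * fv.P (disjoint_hit vv k)"
    using \<kappa>(3)[OF m(2)] PD by (intro mult_right_mono) auto
  finally have 1: "\<kappa> * Mb (Suc k) * ((\<kappa> ^ k - real k * real l * \<epsilon>) * ?\<Pi>) \<le> fv.M (Suc k) (vv (Suc k)) * fv.P (disjoint_hit vv k)" .
  have "(\<kappa> ^ Suc k - real (Suc k) * real l * \<epsilon>) * (?\<Pi> * Mb (Suc k))
     = \<kappa> * Mb (Suc k) * (\<kappa> ^ k * ?\<Pi>) - (real k * real l * \<epsilon>) * (?\<Pi> * Mb (Suc k)) - real l * \<epsilon> * (?\<Pi> * Mb (Suc k))"
    by (simp add: algebra_simps)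
  also have "\<dots> \<le> \<kappa> * Mb (Suc k) * (\<kappa> ^ k * ?\<Pi>) - \<kappa> * ((real k * real l * \<epsilon>) * (?\<Pi> * Mb (Suc k))) - real k * \<epsilon> * (?\<Pi> * Mb (Suc k))"
  proof (intro diff_mono)
    have "\<kappa> * ((real k * real l * \<epsilon>) * (?\<Pi> * Mb (Suc k))) \<le> 1 * ((real k * real l * \<epsilon>) * (?\<Pi> * Mb (Suc k)))"
      using \<kappa> \<epsilon>(1) \<Pi>0 m by (intro mult_right_mono mult_nonneg_nonneg) auto
    then show "\<kappa> * ((real k * real l * \<epsilon>) * (?\<Pi> * Mb (Suc k))) \<le> (real k * real l * \<epsilon>) * (?\<Pi> * Mb (Suc k))" by simp
    show "real k * \<epsilon> * (?\<Pi> * Mb (Suc k)) \<le> real l * \<epsilon> * (?\<Pi> * Mb (Suc k))"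
      using Suc.prems \<epsilon>(1) \<Pi>0 m by (intro mult_right_mono mult_nonneg_nonneg) auto
  qed simp
  also have "\<dots> = \<kappa> * Mb (Suc k) * ((\<kappa> ^ k - real k * real l * \<epsilon>) * ?\<Pi>) - real k * \<epsilon> * (?\<Pi> * Mb (Suc k))"
    by (simp add: algebra_simps)
  also have "\<dots> \<le> fv.P (disjoint_hit vv (Suc k))" using 1 st unfolding ps by linarith
  finally show ?case unfolding ps .
qed

text \<open>Given the edges, Bernoulli's inequality bounds the chance of a green vertex in a cluster
  by \<open>qq i\<close> times its size.\<close>

lemma hit_small:
  assumes i: "i \<in> I" and v: "v \<in> X"
  shows "fv.P (\<lambda>\<omega>. hit i v \<omega> \<and> \<not> big_clus n v \<omega>) \<le> qq i * fexp F (\<lambda>_. p) (\<lambda>\<eta>. real (card (clus \<eta> v)) * of_bool (card (clus \<eta> v) < n))"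
proof -
  let ?f = "\<lambda>\<eta>. of_bool (card (clus \<eta> v) < n) :: real"
  have "fv.P (\<lambda>\<omega>. hit i v \<omega> \<and> \<not> big_clus n v \<omega>) = fv.EE (\<lambda>\<omega>. ?f (eds \<omega>) - ?f (eds \<omega>) * of_bool (\<not> hit i v \<omega>))"
    unfolding fprob_def by (intro fexp_cong) (auto simp: big_clus_Om not_le)
  also have "\<dots> = fexp F (\<lambda>_. p) ?f - fexp F (\<lambda>_. p) (\<lambda>\<eta>. ?f \<eta> * (1 - qq i) ^ card (clus \<eta> v))"
    using nohit_eq[OF i v, of ?f] edge_event[of ?f] by (simp add: fexp_diff)
  also have "\<dots> = fexp F (\<lambda>_. p) (\<lambda>\<eta>. ?f \<eta> - ?f \<eta> * (1 - qq i) ^ card (clus \<eta> v))" by (simp add: fexp_diff)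
  also have "\<dots> \<le> fexp F (\<lambda>_. p) (\<lambda>\<eta>. qq i * (real (card (clus \<eta> v)) * ?f \<eta>))"
  proof (intro fexp_mono probs_const p)
    fix \<eta>
    have "1 + real (card (clus \<eta> v)) * (- qq i) \<le> (1 + (- qq i)) ^ card (clus \<eta> v)"
      using qq(2)[of i] by (intro Bernoulli_inequality) simp
    then show "?f \<eta> - ?f \<eta> * (1 - qq i) ^ card (clus \<eta> v) \<le> qq i * (real (card (clus \<eta> v)) * ?f \<eta>)"
      by (simp add: mult.commute)
  qed
  finally show ?thesis by (simp add: fexp_cmult)
qed

lemma disjoint_large_upper: "fprob F (\<lambda>_. p) (disjoint_large vv nn l) \<le> (\<Prod>i\<in>{1..l}. tail p (nn i) (vv i))"
proof -
  have "fprob F (\<lambda>_. p) (disjoint_large vv nn l) = fv.P (\<lambda>\<omega>. disjoint_large vv nn l (eds \<omega>))"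
    unfolding fprob_def by (rule edge_event[symmetric])
  also have "\<dots> \<le> fv.P (disj_occ (\<lambda>i. big_clus (nn i) (vv i)) {1..l})"
  proof (intro fprob_mono fv.pr disj_occ_clusters)
    fix \<omega> assume "\<omega> \<subseteq> Om" "disjoint_large vv nn l (eds \<omega>)"
    then show "disjoint_family_on (\<lambda>i. clus (eds \<omega>) (vv i)) {1..l}"
      "\<And>i. i \<in> {1..l} \<Longrightarrow> big_clus (nn i) (vv i) (res (clus (eds \<omega>) (vv i)) \<omega>)"
      by (auto simp: disjoint_large_def big_clus_res big_clus_Om)
  qed
  also have "\<dots> \<le> (\<Prod>i\<in>{1..l}. fv.P (big_clus (nn i) (vv i)))"
    by (intro bk_family fv.fin fv.pr inc_big_clus) auto
  also have "\<dots> \<le> (\<Prod>i\<in>{1..l}. tail p (nn i) (vv i))"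
    unfolding big_clus_prob using F by (intro prod_mono conjI fprob_nonneg probs_const p tail_upper) auto
  finally show ?thesis .
qed

text \<open>Green but small clusters are subtracted. Being small is decreasing, so
  \<open>bk_family_dec\<close> keeps it with the factor of its own cluster. Each of the
  \<open>l\<close> indices costs at most \<open>1 / (4 * l)\<close> of the product, and 1/2 - 1/4
  remains.\<close>

lemma disjoint_large_lower:
  assumes vX: "\<And>i. i \<in> {1..l} \<Longrightarrow> vv i \<in> X" and I: "{1..l} \<subseteq> I"
    and Mb: "\<And>i. i \<in> {1..l} \<Longrightarrow> fv.M i (vv i) \<le> Mb i"
    and D: "1/2 * (\<Prod>i\<in>{1..l}. Mb i) \<le> fv.P (disjoint_hit vv l)"
    and small: "\<And>i. i \<in> {1..l} \<Longrightarrow> real l * (qq i * fexp F (\<lambda>_. p) (\<lambda>\<eta>. real (card (clus \<eta> (vv i))) * of_bool (card (clus \<eta> (vv i)) < nn i))) \<le> Mb i / 4"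
    and l: "1 \<le> l"
  shows "1/4 * (\<Prod>i\<in>{1..l}. Mb i) \<le> fprob F (\<lambda>_. p) (disjoint_large vv nn l)"
proof -
  let ?\<Pi> = "\<Prod>i\<in>{1..l}. Mb i"
  have bound_nonneg: "0 \<le> Mb i" if "i \<in> {1..l}" for i
    using Mb[OF that] fv.M_nonneg[of i "vv i"] by simp
  have each: "fv.P (\<lambda>\<omega>. disjoint_hit vv l \<omega> \<and> \<not> big_clus (nn i) (vv i) \<omega>) \<le> ?\<Pi> / (4 * real l)" if i: "i \<in> {1..l}" for i
  proof -
    have "fv.P (\<lambda>\<omega>. disjoint_hit vv l \<omega> \<and> \<not> big_clus (nn i) (vv i) \<omega>) \<le> fv.P (\<lambda>\<omega>. disj_occ (\<lambda>i. hit i (vv i)) {1..l} \<omega> \<and> \<not> big_clus (nn i) (vv i) \<omega>)"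
      by (intro fprob_mono fv.pr) (auto simp: disjoint_hit_def hit_res intro!: disj_occ_clusters)
    also have "\<dots> \<le> fv.P (\<lambda>\<omega>. hit i (vv i) \<omega> \<and> \<not> big_clus (nn i) (vv i) \<omega>) * (\<Prod>j\<in>{1..l}-{i}. fv.P (hit j (vv j)))"
    proof (rule bk_family_dec[OF fv.fin fv.pr _ inc_hit i])
      show "dec (\<lambda>\<omega>. \<not> big_clus (nn i) (vv i) \<omega>)" using inc_big_clus unfolding inc_def dec_def by metis
    qed simp
    also have "\<dots> \<le> (Mb i / (4 * real l)) * (\<Prod>j\<in>{1..l}-{i}. Mb j)"
    proof (rule mult_mono)
      have "fv.P (\<lambda>\<omega>. hit i (vv i) \<omega> \<and> \<not> big_clus (nn i) (vv i) \<omega>) \<le> qq i * fexp F (\<lambda>_. p) (\<lambda>\<eta>. real (card (clus \<eta> (vv i))) * of_bool (card (clus \<eta> (vv i)) < nn i))"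
        using I i vX[OF i] by (intro hit_small) auto
      also have "\<dots> \<le> Mb i / (4 * real l)" using small[OF i] l by (simp add: field_simps)
      finally show "fv.P (\<lambda>\<omega>. hit i (vv i) \<omega> \<and> \<not> big_clus (nn i) (vv i) \<omega>) \<le> Mb i / (4 * real l)" .
      show "(\<Prod>j\<in>{1..l}-{i}. fv.P (hit j (vv j))) \<le> (\<Prod>j\<in>{1..l}-{i}. Mb j)"
        using Mb by (intro prod_mono) (auto simp: fv.M_def fprob_nonneg fv.pr)
      show "0 \<le> Mb i / (4 * real l)" using bound_nonneg[OF i] by simp
      show "0 \<le> (\<Prod>j\<in>{1..l}-{i}. fv.P (hit j (vv j)))" by (intro prod_nonneg) (auto simp: fprob_nonneg fv.pr)
    qed
    also have "\<dots> = (Mb i * (\<Prod>j\<in>{1..l}-{i}. Mb j)) / (4 * real l)" by simp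
    also have "Mb i * (\<Prod>j\<in>{1..l}-{i}. Mb j) = ?\<Pi>" using i by (intro prod.remove[symmetric]) auto
    finally show ?thesis .
  qed
  have "fv.P (disjoint_hit vv l) \<le> (\<Sum>c\<in>insert 0 {1..l}. fv.P (if c = 0 then (\<lambda>\<omega>. disjoint_large vv nn l (eds \<omega>)) else (\<lambda>\<omega>. disjoint_hit vv l \<omega> \<and> \<not> big_clus (nn c) (vv c) \<omega>)))"
  proof (intro fprob_union_bound fv.pr)
    fix \<omega> assume \<omega>: "\<omega> \<subseteq> Om" and D: "disjoint_hit vv l \<omega>"
    show "\<exists>c\<in>insert 0 {1..l}. (if c = 0 then (\<lambda>\<omega>. disjoint_large vv nn l (eds \<omega>)) else (\<lambda>\<omega>. disjoint_hit vv l \<omega> \<and> \<not> big_clus (nn c) (vv c) \<omega>)) \<omega>"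
    proof (cases "\<exists>i\<in>{1..l}. \<not> big_clus (nn i) (vv i) \<omega>")
      case True
      then obtain i where "i \<in> {1..l}" "\<not> big_clus (nn i) (vv i) \<omega>" by blast
      then show ?thesis using D by (intro bexI[of _ i]) auto
    next
      case False
      then have "disjoint_large vv nn l (eds \<omega>)" using D \<omega> by (auto simp: disjoint_large_def disjoint_hit_def big_clus_Om)
      then show ?thesis by (intro bexI[of _ 0]) auto
    qed
  qed auto
  also have "\<dots> = fv.P (\<lambda>\<omega>. disjoint_large vv nn l (eds \<omega>)) + (\<Sum>c\<in>{1..l}. fv.P (\<lambda>\<omega>. disjoint_hit vv l \<omega> \<and> \<not> big_clus (nn c) (vv c) \<omega>))"
    by (subst sum.insert) (auto intro!: sum.cong)
  also have "(\<Sum>c\<in>{1..l}. fv.P (\<lambda>\<omega>. disjoint_hit vv l \<omega> \<and> \<not> big_clus (nn c) (vv c) \<omega>)) \<le> (\<Sum>c\<in>{1..l}. ?\<Pi> / (4 * real l))"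
    by (intro sum_mono each)
  also have "\<dots> = ?\<Pi> / 4" using l by simp
  also have "fv.P (\<lambda>\<omega>. disjoint_large vv nn l (eds \<omega>)) = fprob F (\<lambda>_. p) (disjoint_large vv nn l)"
    unfolding fprob_def by (rule edge_event)
  finally show ?thesis using D by linarith
qed

end

lemma (in pgraph) disjoint_large_bounds:
  assumes infV: "infinite V" and nabla: "nabla V E pc v0 < \<infinity>" and l: "1 \<le> l"
  shows "\<exists>K c C. 0 < c \<and> c \<le> C \<and> (\<forall>nn vv. (\<forall>i\<in>{1..l}. 1 \<le> nn i) \<longrightarrow> (\<forall>i\<in>{1..l}. vv i \<in> V) \<longrightarrow>
      (\<forall>i\<in>{1..l}. \<forall>j\<in>{1..l}. i < j \<longrightarrow> K \<le> d (vv i) (vv j)) \<longrightarrow>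
      (\<exists>F0\<in>fins. \<forall>F\<in>fins. F0 \<subseteq> F \<longrightarrow>
        c * (\<Prod>i=1..l. 1 / sqrt (real (nn i))) \<le> fprob F (\<lambda>_. pc) (disjoint_large vv nn l) \<and>
        fprob F (\<lambda>_. pc) (disjoint_large vv nn l) \<le> C * (\<Prod>i=1..l. 1 / sqrt (real (nn i)))))"
proof -
  note pcb = pc_bounds[OF infV]
  obtain Ct where Ct: "1 \<le> Ct" "\<And>n x. 1 \<le> n \<Longrightarrow> x \<in> V \<Longrightarrow> tail pc n x \<le> Ct / sqrt (real n)"
    using tail_upper_sqrt[OF infV nabla] by metis
  define c2 where "c2 = 1 / (192 * Ct)"
  have c2: "0 < c2" "c2 \<le> 1" using Ct(1) by (auto simp: c2_def)
  have ml: "c2 * sqrt q \<le> magn pc q v0" if "0 < q" "q \<le> 1" for q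
    unfolding c2_def by (rule magn_lower[OF infV Ct that])
  \<comment> \<open>Bernoulli's inequality gives \<open>\<kappa> ^ l \<ge> 3/4\<close>.\<close>
  define \<kappa> :: real where "\<kappa> = 1 - 1 / (4 * real l)"
  have \<kappa>: "0 \<le> \<kappa>" "\<kappa> < 1" using l by (auto simp: \<kappa>_def)
  have \<kappa>l: "3/4 \<le> \<kappa> ^ l"
  proof -
    have "- 1 \<le> - (1 / (4 * real l))" using l by simp
    then have "1 + real l * (- (1 / (4 * real l))) \<le> (1 + (- (1 / (4 * real l)))) ^ l"
      by (rule Bernoulli_inequality)
    then show ?thesis using l by (simp add: \<kappa>_def)
  qed
  \<comment> \<open>The total loss \<open>l * l * \<epsilon>\<close> is 1/4, which leaves
    1/2.\<close>
  define \<epsilon> where "\<epsilon> = 1 / (4 * (real l)\<^sup>2)"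
  have \<epsilon>: "0 < \<epsilon>" using l by (simp add: \<epsilon>_def)
  obtain K where K: "\<And>u v X. u \<in> V \<Longrightarrow> v \<in> V \<Longrightarrow> d u v \<ge> K \<Longrightarrow> finite X \<Longrightarrow> X \<subseteq> V \<Longrightarrow>
    (\<Sum>x\<in>X. \<Sum>y\<in>X. tau pc u x * tau pc x y * tau pc y v) \<le> \<epsilon>"
    by (rule open_triangle[OF pcb nabla \<epsilon>]) (rule that)
  \<comment> \<open>With intensity \<open>s^2 / n\<close>, colour is met with probability at least
    \<open>c2 * s / sqrt n\<close> up to \<open>\<kappa>\<close>, while a cluster smaller than
    \<open>n\<close> is coloured with probability at most \<open>2 * Ct * s^2 / sqrt n\<close>. The
    extra factor \<open>s\<close> makes the second a small part of the first, even after
    multiplication by \<open>l\<close>.\<close>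
  define s where "s = c2 / (8 * Ct * real l)"
  have s: "0 < s" "s \<le> 1"
  proof -
    show "0 < s" using c2 Ct(1) l by (simp add: s_def)
    have "1 \<le> 8 * Ct * real l" using mult_mono[of 1 "8 * Ct" 1 "real l"] Ct(1) l by simp
    then show "s \<le> 1" using c2 by (simp add: s_def divide_le_eq_1)
  qed
  define c where "c = 1/4 * (c2 * s) ^ l"
  have c0: "0 < c" using c2 s by (simp add: c_def)
  define C where "C = max c (Ct ^ l)"
  show ?thesis
  proof (rule exI[of _ K], rule exI[of _ c], rule exI[of _ C], intro conjI c0 allI impI)
    show "c \<le> C" by (simp add: C_def)
    fix nn :: "nat \<Rightarrow> nat" and vv :: "nat \<Rightarrow> 'a"
    assume nn': "\<forall>i\<in>{1..l}. 1 \<le> nn i" and vv': "\<forall>i\<in>{1..l}. vv i \<in> V"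
      and sep': "\<forall>i\<in>{1..l}. \<forall>j\<in>{1..l}. i < j \<longrightarrow> K \<le> d (vv i) (vv j)"
    have nn: "1 \<le> nn i" and vv: "vv i \<in> V" if "i \<in> {1..l}" for i using nn' vv' that by auto
    have sep: "K \<le> d (vv i) (vv j)" if "i \<in> {1..l}" "j \<in> {1..l}" "i < j" for i j using sep' that by blast
    \<comment> \<open>The maximum keeps \<open>qq i\<close> in the unit interval for indices outside
      \<open>{1..l}\<close>, where \<open>nn i\<close> may be 0.\<close>
    define qq where "qq i = s\<^sup>2 / real (max 1 (nn i))" for i
    have qb: "0 < qq i" "qq i \<le> 1" for i
    proof -
      have "1 \<le> real (max 1 (nn i))" by simp
      moreover have "s\<^sup>2 \<le> 1" using s by (simp add: power_le_one)
      ultimately show "qq i \<le> 1" unfolding qq_def by (subst divide_le_eq_1) linarith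
      show "0 < qq i" using s by (simp add: qq_def)
    qed
    have sqq: "sqrt (qq i) = s / sqrt (real (nn i))" if "i \<in> {1..l}" for i
      using nn[OF that] s by (simp add: qq_def real_sqrt_divide max_def)
    define Mb where "Mb i = magn pc (qq i) v0" for i
    define R where "R = (\<Prod>i=1..l. 1 / sqrt (real (nn i)))"
    have R0: "0 \<le> R" unfolding R_def by (intro prod_nonneg) auto
    have Mbl: "c2 * s * (1 / sqrt (real (nn i))) \<le> Mb i" if "i \<in> {1..l}" for i
      using ml[OF qb, of i] sqq[OF that] by (simp add: Mb_def)
    define W where "W = vv ` {1..l}"
    have W: "finite W" "W \<subseteq> V" using vv by (auto simp: W_def)
    \<comment> \<open>How large \<open>F\<close> has to be depends on the thresholds and the points;
      \<open>K\<close>, \<open>c\<close> and \<open>C\<close> are already fixed.\<close>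
    have "\<forall>i. \<exists>F0. F0 \<in> fins \<and> (\<forall>F\<in>fins. F0 \<subseteq> F \<longrightarrow> (\<forall>x\<in>W. \<kappa> * magn pc (qq i) v0 \<le> fexp F (\<lambda>_. pc) (\<lambda>\<eta>. 1 - (1 - qq i) ^ card (clus \<eta> x))))"
      using magn_approx[OF pcb qb W \<kappa>] by blast
    from choice[OF this] obtain G where G: "\<forall>i. G i \<in> fins \<and> (\<forall>F\<in>fins. G i \<subseteq> F \<longrightarrow> (\<forall>x\<in>W. \<kappa> * magn pc (qq i) v0 \<le> fexp F (\<lambda>_. pc) (\<lambda>\<eta>. 1 - (1 - qq i) ^ card (clus \<eta> x))))"
      by blast
    define F0 where "F0 = (\<Union>i\<in>{1..l}. G i)"
    have F0: "F0 \<in> fins" using G by (auto simp: F0_def fins_def)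
    have "c * R \<le> fprob F (\<lambda>_. pc) (disjoint_large vv nn l) \<and> fprob F (\<lambda>_. pc) (disjoint_large vv nn l) \<le> C * R"
      if F: "F \<in> fins" and F0F: "F0 \<subseteq> F" for F
    proof -
      define X where "X = W \<union> \<Union>F"
      have XX: "finite X" "X \<subseteq> V" "\<Union>F \<subseteq> X"
        using fins_finite_UN[OF F] fins_UN_V[OF F] W by (auto simp: X_def)
      interpret finite_volume V E v0 F X "{1..l}" pc qq
        using F pcb XX qb by unfold_locales (auto intro: less_imp_le)
      have vX: "vv i \<in> X" if "i \<in> {1..l}" for i using that by (auto simp: X_def W_def)
      have MM: "fv.M i x \<le> Mb i" if "i \<in> {1..l}" "x \<in> X" for i x
        unfolding Mb_def by (rule M_le_magn[OF that])
      have D: "1/2 * (\<Prod>i\<in>{1..l}. Mb i) \<le> fv.P (disjoint_hit vv l)"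
      proof -
        have "(\<kappa> ^ l - real l * real l * \<epsilon>) * (\<Prod>i\<in>{1..l}. Mb i) \<le> fv.P (disjoint_hit vv l)"
        proof (rule disjoint_hit_lower[OF vX MM \<kappa>(1) less_imp_le[OF \<kappa>(2)] _ less_imp_le[OF \<epsilon>]])
          fix i assume i: "i \<in> {1..l}"
          have "G i \<subseteq> F" using F0F i by (metis F0_def SUP_le_iff)
          moreover have "vv i \<in> W" using i by (simp add: W_def)
          ultimately have "\<kappa> * magn pc (qq i) v0 \<le> fexp F (\<lambda>_. pc) (\<lambda>\<eta>. 1 - (1 - qq i) ^ card (clus \<eta> (vv i)))"
            using G F by blast
          then show "\<kappa> * Mb i \<le> fv.M i (vv i)" using M_eq[OF i vX[OF i]] by (simp add: Mb_def)
        next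
          fix i j assume "i \<in> {1..l}" "j \<in> {1..l}" "i < j"
          then show "(\<Sum>x\<in>X. \<Sum>y\<in>X. tau pc (vv i) x * tau pc x y * tau pc y (vv j)) \<le> \<epsilon>"
            using XX by (intro K vv sep) auto
        qed auto
        moreover have "1/2 \<le> \<kappa> ^ l - real l * real l * \<epsilon>"
        proof -
          have "real l * real l * \<epsilon> = 1/4" using l by (simp add: \<epsilon>_def power2_eq_square)
          then show ?thesis using \<kappa>l by simp
        qed
        moreover have "0 \<le> (\<Prod>i\<in>{1..l}. Mb i)"
          using MM vX fv.M_nonneg by (intro prod_nonneg) (meson order_trans)
        ultimately show ?thesis by (meson mult_right_mono order_trans)
      qed
      have small: "real l * (qq i * fexp F (\<lambda>_. pc) (\<lambda>\<eta>. real (card (clus \<eta> (vv i))) * of_bool (card (clus \<eta> (vv i)) < nn i))) \<le> Mb i / 4"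
        if i: "i \<in> {1..l}" for i
      proof -
        have n1: "1 \<le> nn i" by (rule nn[OF i])
        have "fexp F (\<lambda>_. pc) (\<lambda>\<eta>. real (card (clus \<eta> (vv i))) * of_bool (card (clus \<eta> (vv i)) < nn i)) \<le> 2 * Ct * sqrt (real (nn i))"
          by (rule trunc_mean[OF infV Ct F vv[OF i]])
        then have "real l * (qq i * fexp F (\<lambda>_. pc) (\<lambda>\<eta>. real (card (clus \<eta> (vv i))) * of_bool (card (clus \<eta> (vv i)) < nn i)))
            \<le> real l * (qq i * (2 * Ct * sqrt (real (nn i))))"
          using less_imp_le[OF qb(1)] by (intro mult_left_mono) auto
        also have "\<dots> = (2 * Ct * real l * s) * s * (1 / sqrt (real (nn i)))"
        proof -
          have "qq i * sqrt (real (nn i)) = s\<^sup>2 * (1 / sqrt (real (nn i)))"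
            using n1 by (simp add: qq_def max_def field_simps)
          then have "real l * (2 * Ct) * (qq i * sqrt (real (nn i))) = real l * (2 * Ct) * (s\<^sup>2 * (1 / sqrt (real (nn i))))"
            by (rule arg_cong)
          then show ?thesis by (simp add: power2_eq_square mult_ac)
        qed
        also have "2 * Ct * real l * s = c2 / 4" using Ct(1) l by (simp add: s_def)
        also have "c2 / 4 * s * (1 / sqrt (real (nn i))) \<le> Mb i / 4" using Mbl[OF i] by simp
        finally show ?thesis .
      qed
      have lower: "1/4 * (\<Prod>i\<in>{1..l}. Mb i) \<le> fprob F (\<lambda>_. pc) (disjoint_large vv nn l)"
        by (rule disjoint_large_lower[OF vX subset_refl MM D small l]) (use vX in auto)
      have "c * R = 1/4 * (\<Prod>i\<in>{1..l}. c2 * s * (1 / sqrt (real (nn i))))"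
        by (simp add: c_def R_def prod.distrib prod_dividef)
      also have "\<dots> \<le> 1/4 * (\<Prod>i\<in>{1..l}. Mb i)"
        using Mbl c2 s by (intro mult_left_mono prod_mono) auto
      finally have 1: "c * R \<le> fprob F (\<lambda>_. pc) (disjoint_large vv nn l)" using lower by simp
      have "fprob F (\<lambda>_. pc) (disjoint_large vv nn l) \<le> (\<Prod>i\<in>{1..l}. tail pc (nn i) (vv i))" by (rule disjoint_large_upper)
      also have "\<dots> \<le> (\<Prod>i\<in>{1..l}. Ct * (1 / sqrt (real (nn i))))"
      proof (intro prod_mono conjI tail_bounds pcb)
        fix i assume i: "i \<in> {1..l}"
        show "tail pc (nn i) (vv i) \<le> Ct * (1 / sqrt (real (nn i)))" using Ct(2)[OF nn[OF i] vv[OF i]] by simp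
      qed
      also have "\<dots> = Ct ^ l * R" by (simp add: R_def prod.distrib prod_dividef)
      also have "\<dots> \<le> C * R" using R0 by (intro mult_right_mono) (auto simp: C_def)
      finally show ?thesis using 1 by simp
    qed
    then show "\<exists>F0\<in>fins. \<forall>F\<in>fins. F0 \<subseteq> F \<longrightarrow>
        c * (\<Prod>i=1..l. 1 / sqrt (real (nn i))) \<le> fprob F (\<lambda>_. pc) (disjoint_large vv nn l) \<and>
        fprob F (\<lambda>_. pc) (disjoint_large vv nn l) \<le> C * (\<Prod>i=1..l. 1 / sqrt (real (nn i)))"
      using F0 unfolding R_def by blast
  qed
qed

text \<open>Having large clusters is increasing in the volume and being disjoint is decreasing, so
  their conjunction is monotone in neither direction. It is squeezed instead: replacing
  \<open>A k\<close> by its limit costs at most the measure still missing from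
  \<open>A k\<close>.\<close>

lemma (in finite_measure) LIMSEQ_measure_incseq_Int_decseq:
  fixes A B :: "nat \<Rightarrow> 'a set"
  assumes sets: "\<And>k. A k \<in> sets M" "\<And>k. B k \<in> sets M"
    and A: "\<And>j k. j \<le> k \<Longrightarrow> A j \<subseteq> A k" and B: "\<And>j k. j \<le> k \<Longrightarrow> B k \<subseteq> B j"
  shows "(\<lambda>k. measure M (A k \<inter> B k)) \<longlonglongrightarrow> measure M ((\<Union>k. A k) \<inter> (\<Inter>k. B k))"
proof -
  have "(\<lambda>k. measure M (A k)) \<longlonglongrightarrow> measure M (\<Union>k. A k)"
    using sets A by (intro finite_Lim_measure_incseq) (auto simp: incseq_def)
  then have lA: "(\<lambda>k. measure M (\<Union>k. A k) - measure M (A k)) \<longlonglongrightarrow> 0"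
    using tendsto_diff[OF tendsto_const, where a = "measure M (\<Union>k. A k)"] by fastforce
  have "(\<lambda>k. measure M ((\<Union>k. A k) \<inter> B k)) \<longlonglongrightarrow> measure M (\<Inter>k. (\<Union>k. A k) \<inter> B k)"
    using sets B by (intro finite_Lim_measure_decseq) (auto simp: decseq_def dest: subsetD[OF B])
  moreover have "(\<Inter>k. (\<Union>k. A k) \<inter> B k) = (\<Union>k. A k) \<inter> (\<Inter>k. B k)" by simp
  ultimately have lB: "(\<lambda>k. measure M ((\<Union>k. A k) \<inter> B k)) \<longlonglongrightarrow> measure M ((\<Union>k. A k) \<inter> (\<Inter>k. B k))"
    by simp
  have UA: "(\<Union>k. A k) \<in> sets M" using sets by auto
  show ?thesis
  proof (rule tendsto_sandwich[OF _ _ _ lB])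
    show "(\<lambda>k. measure M ((\<Union>k. A k) \<inter> B k) - (measure M (\<Union>k. A k) - measure M (A k)))
        \<longlonglongrightarrow> measure M ((\<Union>k. A k) \<inter> (\<Inter>k. B k))"
      using tendsto_diff[OF lB lA] by simp
    show "\<forall>\<^sub>F k in sequentially. measure M ((\<Union>k. A k) \<inter> B k) - (measure M (\<Union>k. A k) - measure M (A k))
        \<le> measure M (A k \<inter> B k)"
    proof (rule always_eventually, rule allI)
      fix k
      have "measure M ((\<Union>k. A k) \<inter> B k) \<le> measure M (A k \<inter> B k \<union> ((\<Union>k. A k) - A k))"
        using sets UA by (intro finite_measure_mono) auto
      also have "\<dots> \<le> measure M (A k \<inter> B k) + measure M ((\<Union>k. A k) - A k)"
        using sets UA by (intro measure_Un_le) auto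
      also have "measure M ((\<Union>k. A k) - A k) = measure M (\<Union>k. A k) - measure M (A k)"
        using sets UA by (intro finite_measure_Diff) auto
      finally show "measure M ((\<Union>k. A k) \<inter> B k) - (measure M (\<Union>k. A k) - measure M (A k))
        \<le> measure M (A k \<inter> B k)" by simp
    qed
    show "\<forall>\<^sub>F k in sequentially. measure M (A k \<inter> B k) \<le> measure M ((\<Union>k. A k) \<inter> B k)"
      using sets UA by (intro always_eventually allI finite_measure_mono) auto
  qed
qed

lemma (in pgraph) disjoint_large_LIMSEQ:
  assumes p: "0 \<le> p" "p \<le> 1"
  shows "(\<lambda>k. fprob (EB k) (\<lambda>_. p) (disjoint_large vv nn l)) \<longlonglongrightarrow> measure (percolation E p)
    {\<omega> \<in> space (percolation E p). disjoint_family_on (\<lambda>i. cluster E \<omega> (vv i)) {1..l} \<and>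
      (\<forall>i\<in>{1..l}. cluster_size E \<omega> (vv i) \<ge> enat (nn i))}"
proof -
  interpret PP: prob_space "percolation E p" by (rule perc_prob_space[OF p])
  let ?M = "percolation E p"
  let ?S = "{\<omega> \<in> space ?M. disjoint_family_on (\<lambda>i. cluster E \<omega> (vv i)) {1..l} \<and>
      (\<forall>i\<in>{1..l}. cluster_size E \<omega> (vv i) \<ge> enat (nn i))}"
  let ?c = "\<lambda>k \<omega> i. clus (open_edges (EB k) \<omega>) (vv i)"
  let ?A = "\<lambda>k. {\<omega> \<in> space ?M. \<forall>i\<in>{1..l}. nn i \<le> card (?c k \<omega> i)}"
  let ?B = "\<lambda>k. {\<omega> \<in> space ?M. disjoint_family_on (?c k \<omega>) {1..l}}"
  let ?D = "\<lambda>k. {\<omega> \<in> space ?M. disjoint_large vv nn l (open_edges (EB k) \<omega>)}"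
  have cyl: "?A k \<in> sets ?M" "?B k \<in> sets ?M" "?D k \<in> sets ?M" for k
    by (rule perc_cylinder(1)[OF p EB_fins[OF p], of "\<lambda>\<eta>. \<forall>i\<in>{1..l}. nn i \<le> card (clus \<eta> (vv i))" k]
        perc_cylinder(1)[OF p EB_fins[OF p], of "\<lambda>\<eta>. disjoint_family_on (\<lambda>i. clus \<eta> (vv i)) {1..l}" k]
        perc_cylinder(1)[OF p EB_fins[OF p], of "disjoint_large vv nn l" k])+
  have DAB: "?D k = ?A k \<inter> ?B k" for k by (auto simp: disjoint_large_def)
  have Amono: "?A j \<subseteq> ?A k" if "j \<le> k" for j k
    using card_clus_mono[OF open_edges_fins[OF p] open_edges_EB_mono[OF p that]] by (auto intro: order_trans)
  have Banti: "?B k \<subseteq> ?B j" if "j \<le> k" for j k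
    using clus_mono[OF open_edges_EB_mono[OF p that]] by (fastforce simp: disjoint_family_on_def)
  have size: "(\<forall>i\<in>{1..l}. cluster_size E \<omega> (vv i) \<ge> enat (nn i)) \<longleftrightarrow> (\<exists>k. \<omega> \<in> ?A k)" if \<omega>: "\<omega> \<in> space ?M" for \<omega>
  proof
    assume "\<forall>i\<in>{1..l}. cluster_size E \<omega> (vv i) \<ge> enat (nn i)"
    then have "\<forall>i\<in>{1..l}. \<exists>k. nn i \<le> card (?c k \<omega> i)" unfolding size_EB[OF p] .
    then obtain kk where kk: "\<forall>i\<in>{1..l}. nn i \<le> card (?c (kk i) \<omega> i)" by metis
    obtain k where k: "\<forall>m\<in>kk ` {1..l}. m \<le> k" using finite_nat_set_iff_bounded_le[of "kk ` {1..l}"] by auto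
    have "nn i \<le> card (?c k \<omega> i)" if i: "i \<in> {1..l}" for i
    proof -
      have "card (?c (kk i) \<omega> i) \<le> card (?c k \<omega> i)"
        using k i by (intro card_clus_mono open_edges_fins[OF p] open_edges_EB_mono[OF p]) auto
      then show ?thesis using kk i by force
    qed
    then show "\<exists>k. \<omega> \<in> ?A k" using \<omega> by blast
  next
    assume "\<exists>k. \<omega> \<in> ?A k"
    then show "\<forall>i\<in>{1..l}. cluster_size E \<omega> (vv i) \<ge> enat (nn i)" unfolding size_EB[OF p] by blast
  qed
  have disj: "disjoint_family_on (\<lambda>i. cluster E \<omega> (vv i)) {1..l} \<longleftrightarrow> (\<forall>k. \<omega> \<in> ?B k)" if \<omega>: "\<omega> \<in> space ?M" for \<omega>
  proof
    assume "disjoint_family_on (\<lambda>i. cluster E \<omega> (vv i)) {1..l}"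
    then show "\<forall>k. \<omega> \<in> ?B k"
      using clus_mono[OF open_edges_EB_sub[OF p]] \<omega> unfolding disjoint_family_on_def cluster_eq by blast
  next
    assume B: "\<forall>k. \<omega> \<in> ?B k"
    show "disjoint_family_on (\<lambda>i. cluster E \<omega> (vv i)) {1..l}"
      unfolding disjoint_family_on_def cluster_eq
    proof (intro ballI impI)
      fix i j assume ij: "i \<in> {1..l}" "j \<in> {1..l}" "i \<noteq> j"
      show "clus (open_edges E \<omega>) (vv i) \<inter> clus (open_edges E \<omega>) (vv j) = {}"
      proof (rule ccontr)
        assume "\<not> ?thesis"
        then obtain u where "conn (open_edges E \<omega>) (vv i) u" "conn (open_edges E \<omega>) (vv j) u" by (auto simp: clus_def)
        then obtain k1 k2 where k: "conn (open_edges (EB k1) \<omega>) (vv i) u" "conn (open_edges (EB k2) \<omega>) (vv j) u"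
          unfolding conn_EB[OF p] by blast
        have "u \<in> ?c (max k1 k2) \<omega> i \<inter> ?c (max k1 k2) \<omega> j"
          using conn_mono[OF open_edges_EB_mono[OF p] k(1), of "max k1 k2"]
            conn_mono[OF open_edges_EB_mono[OF p] k(2), of "max k1 k2"] by (simp add: clus_def)
        moreover have "?c (max k1 k2) \<omega> i \<inter> ?c (max k1 k2) \<omega> j = {}"
          using B ij unfolding disjoint_family_on_def by blast
        ultimately show False by blast
      qed
    qed
  qed
  have memS: "\<omega> \<in> ?S \<longleftrightarrow> (\<exists>k. \<omega> \<in> ?A k) \<and> (\<forall>k. \<omega> \<in> ?B k)" if "\<omega> \<in> space ?M" for \<omega>
    unfolding size[OF that, symmetric] disj[OF that, symmetric] using that by (simp add: conj_commute)
  have Seq: "?S = (\<Union>k. ?A k) \<inter> (\<Inter>k. ?B k)"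
  proof (rule set_eqI)
    fix \<omega>
    show "\<omega> \<in> ?S \<longleftrightarrow> \<omega> \<in> (\<Union>k. ?A k) \<inter> (\<Inter>k. ?B k)"
    proof (cases "\<omega> \<in> space ?M")
      case True
      show ?thesis unfolding memS[OF True] by (simp only: Int_iff UN_iff INT_iff) simp
    qed simp
  qed
  have "(\<lambda>k. measure ?M (?A k \<inter> ?B k)) \<longlonglongrightarrow> measure ?M ((\<Union>k. ?A k) \<inter> (\<Inter>k. ?B k))"
    by (rule PP.LIMSEQ_measure_incseq_Int_decseq[OF cyl(1,2) Amono Banti])
  then show ?thesis
    unfolding Seq[symmetric] DAB[symmetric] perc_cylinder(2)[OF p EB_fins[OF p], of "disjoint_large vv nn l"] .
qed

theorem theorem5p1:
  fixes V :: "'a set" and E :: "'a set set" and v0 :: 'a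
  assumes "simple_graph V E"
    and "connected_graph V E"
    and "locally_finite_graph V E"
    and "transitive_graph V E"
    and "v0 \<in> V"
    and "nabla V E (p_crit V E) v0 < \<infinity>"
  shows "\<forall>l::nat. l \<ge> 2 \<longrightarrow>
    (\<exists>K::nat. \<exists>c C :: real. 0 < c \<and> c \<le> C \<and>
      (\<forall>(n :: nat \<Rightarrow> nat) (v :: nat \<Rightarrow> 'a).
         (\<forall>i\<in>{1..l}. n i \<ge> 1) \<longrightarrow>
         (\<forall>i\<in>{1..l}. v i \<in> V) \<longrightarrow>
         (\<forall>i\<in>{1..l}. \<forall>j\<in>{1..l}. i < j \<longrightarrow> graph_dist E (v i) (v j) \<ge> K) \<longrightarrow>
         (let P = measure (percolation E (p_crit V E))
                    {\<omega> \<in> space (percolation E (p_crit V E)).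
                       disjoint_family_on (\<lambda>i. cluster E \<omega> (v i)) {1..l} \<and>
                       (\<forall>i\<in>{1..l}. cluster_size E \<omega> (v i) \<ge> enat (n i))};
              R = (\<Prod>i=1..l. real (n i) powr (-1/2))
          in c * R \<le> P \<and> P \<le> C * R)))"
proof (intro allI impI)
  fix l :: nat assume l: "2 \<le> l"
  interpret pgraph V E v0 using assms by unfold_locales
  show "\<exists>K::nat. \<exists>c C :: real. 0 < c \<and> c \<le> C \<and>
      (\<forall>(n :: nat \<Rightarrow> nat) (v :: nat \<Rightarrow> 'a).
         (\<forall>i\<in>{1..l}. n i \<ge> 1) \<longrightarrow>
         (\<forall>i\<in>{1..l}. v i \<in> V) \<longrightarrow>
         (\<forall>i\<in>{1..l}. \<forall>j\<in>{1..l}. i < j \<longrightarrow> graph_dist E (v i) (v j) \<ge> K) \<longrightarrow>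
         (let P = measure (percolation E (p_crit V E))
                    {\<omega> \<in> space (percolation E (p_crit V E)).
                       disjoint_family_on (\<lambda>i. cluster E \<omega> (v i)) {1..l} \<and>
                       (\<forall>i\<in>{1..l}. cluster_size E \<omega> (v i) \<ge> enat (n i))};
              R = (\<Prod>i=1..l. real (n i) powr (-1/2))
          in c * R \<le> P \<and> P \<le> C * R))"
  proof (cases "finite V")
    case True
    \<comment> \<open>For finite \<open>V\<close> the value of \<open>p_crit\<close> is unspecified.
      \<open>K\<close> exceeds the diameter, and as \<open>l \<ge> 2\<close> there are two points
      that would have to be that far apart, so the claim is vacuous.\<close>
    define K where "K = Suc (Max ((\<lambda>(x, y). d x y) ` (V \<times> V)))"
    have far: "d x y < K" if "x \<in> V" "y \<in> V" for x y
      unfolding K_def less_Suc_eq_le using True that by (intro Max_ge) auto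
    have no: False if *: "\<forall>i\<in>{1..l}. v i \<in> V" "\<forall>i\<in>{1..l}. \<forall>j\<in>{1..l}. i < j \<longrightarrow> K \<le> d (v i) (v j)" for v :: "nat \<Rightarrow> 'a"
    proof -
      have "(1::nat) \<in> {1..l}" "2 \<in> {1..l}" using l by auto
      then have "v 1 \<in> V" "v 2 \<in> V" "K \<le> d (v 1) (v 2)" using * by auto
      then show False using far[of "v 1" "v 2"] by simp
    qed
    show ?thesis
    proof (intro exI[of _ K] exI[of _ "1::real"] conjI allI impI, goal_cases)
      case (3 n v)
      show ?case by (rule FalseE, rule no[of v], rule 3(2), rule 3(3))
    qed (simp, simp)
  next
    case False
    note pcb = pc_bounds[OF False]
    have "1 \<le> l" using l by simp
    from disjoint_large_bounds[OF False assms(6) this] obtain K c C where cC: "0 < c" "c \<le> C"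
      and est: "\<forall>nn vv. (\<forall>i\<in>{1..l}. 1 \<le> nn i) \<longrightarrow> (\<forall>i\<in>{1..l}. vv i \<in> V) \<longrightarrow>
      (\<forall>i\<in>{1..l}. \<forall>j\<in>{1..l}. i < j \<longrightarrow> K \<le> d (vv i) (vv j)) \<longrightarrow>
      (\<exists>F0\<in>fins. \<forall>F\<in>fins. F0 \<subseteq> F \<longrightarrow>
        c * (\<Prod>i=1..l. 1 / sqrt (real (nn i))) \<le> fprob F (\<lambda>_. pc) (disjoint_large vv nn l) \<and>
        fprob F (\<lambda>_. pc) (disjoint_large vv nn l) \<le> C * (\<Prod>i=1..l. 1 / sqrt (real (nn i))))"
      by (elim exE conjE)
    show ?thesis
    proof (rule exI[of _ K], rule exI[of _ c], rule exI[of _ C], intro conjI cC allI impI)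
      fix n :: "nat \<Rightarrow> nat" and v :: "nat \<Rightarrow> 'a"
      assume n: "\<forall>i\<in>{1..l}. 1 \<le> n i" and v: "\<forall>i\<in>{1..l}. v i \<in> V"
        and sep: "\<forall>i\<in>{1..l}. \<forall>j\<in>{1..l}. i < j \<longrightarrow> K \<le> d (v i) (v j)"
      define R where "R = (\<Prod>i=1..l. 1 / sqrt (real (n i)))"
      define P where "P = measure (percolation E pc) {\<omega> \<in> space (percolation E pc).
         disjoint_family_on (\<lambda>i. cluster E \<omega> (v i)) {1..l} \<and> (\<forall>i\<in>{1..l}. cluster_size E \<omega> (v i) \<ge> enat (n i))}"
      have R: "(\<Prod>i=1..l. real (n i) powr (-1/2)) = R"
        unfolding R_def
      proof (intro prod.cong refl)
        fix i assume "i \<in> {1..l}"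
        have "real (n i) powr (-1/2) = inverse (real (n i) powr (1/2))"
          using powr_minus[of "real (n i)" "1/2"] by simp
        then show "real (n i) powr (-1/2) = 1 / sqrt (real (n i))"
          by (simp add: powr_half_sqrt inverse_eq_divide)
      qed
      obtain F0 where F0: "F0 \<in> fins" "\<forall>F\<in>fins. F0 \<subseteq> F \<longrightarrow> c * R \<le> fprob F (\<lambda>_. pc) (disjoint_large v n l) \<and> fprob F (\<lambda>_. pc) (disjoint_large v n l) \<le> C * R"
        unfolding R_def using est[rule_format, of n v] n v sep by metis
      obtain k0 where k0: "F0 \<subseteq> EB k0" using EB_cover[OF pcb F0(1)] by blast
      have ev: "c * R \<le> fprob (EB k) (\<lambda>_. pc) (disjoint_large v n l) \<and> fprob (EB k) (\<lambda>_. pc) (disjoint_large v n l) \<le> C * R" if "k \<ge> k0" for k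
      proof -
        have "F0 \<subseteq> EB k" using k0 EB_mono[OF pcb that] by (rule subset_trans)
        then show ?thesis using F0(2) EB_fins[OF pcb] by blast
      qed
      have lim: "(\<lambda>k. fprob (EB k) (\<lambda>_. pc) (disjoint_large v n l)) \<longlonglongrightarrow> P"
        unfolding P_def by (rule disjoint_large_LIMSEQ[OF pcb])
      have "c * R \<le> P" by (rule LIMSEQ_le_const[OF lim]) (use ev in blast)
      moreover have "P \<le> C * R" by (rule LIMSEQ_le_const2[OF lim]) (use ev in blast)
      ultimately show "let P = measure (percolation E pc) {\<omega> \<in> space (percolation E pc).
           disjoint_family_on (\<lambda>i. cluster E \<omega> (v i)) {1..l} \<and> (\<forall>i\<in>{1..l}. cluster_size E \<omega> (v i) \<ge> enat (n i))};
         R = (\<Prod>i=1..l. real (n i) powr (-1/2)) in c * R \<le> P \<and> P \<le> C * R"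
        unfolding Let_def R P_def by blast
    qed
  qed
qed

end
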